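(* Consider a projective variety $X\subset\mathbb P^n$ of dimension $m$ intersecting the dense torus non-trivially. Let $\mathcal G(X)\subset\operatorname{Gr}(m+1,n+1)$ be the closure of the image of the Gauss map. Let $J\subset\{0,\dots,n\}$ with $|J|=m+1$. Then the $J$th Plücker coordinate $p_J$ vanishes on $\mathcal G(X)$ if and only if for every maximal cell $E$ of $\operatorname{Trop}(X)$, $\langle E\rangle\cap\langle\overline J\rangle\neq\{0\}$. In particular, if $X$ is a curve, $p_J$ vanishes on $\mathcal G(X)$ if and only if $\langle\operatorname{Trop}(X)\rangle\subseteq\langle\overline J\rangle$.
   Context: $\mathbb K$ is an algebraically closed field of characteristic zero with a nontrivial non-Archimedean valuation $\operatorname{val}:\mathbb K\to\mathbb R\cup\{\infty\}$, $\operatorname{val}(0)=\infty$, with $\operatorname{val}(m)=0$ for nonzero integers $m$. The dense torus of $\mathbb P^n$ is the open set $T$ where all homogeneous coordinates are nonzero. $\mathbb T^n=\mathbb R^{n+1}/\mathbb R(1,\dots,1)$, with $e_0,\dots,e_n$ the images of the standard basis vectors. $\operatorname{Trop}(X)\subset\mathbb T^n$ is the closure of the set of coordinatewise valuations of points of $X\cap T$, with the structure of a finite polyhedral complex. $\overline J=\{0,\dots,n\}\setminus J$; $\langle\overline J\rangle=\operatorname{span}\{e_i:i\in\overline J\}$; for a subset $S\subset\mathbb T^n$ (such as $E$ or $\operatorname{Trop}(X)$), $\langle S\rangle$ is the linear span of all differences of elements of $S$. The Gauss map $\mathcal G_X:X\dashrightarrow\operatorname{Gr}(m+1,n+1)$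 sends a smooth point $P$ to its (projective) tangent space $T_PX$. For an $(m+1)$-dimensional subspace of $\mathbb K^{n+1}$ given as the row span of a matrix, $p_J$ is the minor with columns indexed by $J$. *)

theory Defs
  imports "HOL-Analysis.Analysis" "HOL-Library.Poly_Mapping" "HOL-Library.Extended_Nat"
    "Jordan_Normal_Form.Determinant"
begin

no_notation Matrix.vec_index (infixl "$" 100)

text \<open>
  The coordinates of $K^{n+1}$ are indexed by a finite linearly ordered type \<open>'n\<close> with
  \<open>CARD('n) = n + 1\<close>, playing the role of $\{0, \dots, n\}$. The order is only used to arrange the
  columns of a minor.
\<close>

section \<open>Multivariate polynomials\<close>

text \<open>
  A polynomial in variables indexed by \<open>'v\<close> maps finitely many exponent vectors to nonzero
  coefficients.
\<close>

type_synonym ('v, 'k) mvpoly = "('v \<Rightarrow>\<^sub>0 nat) \<Rightarrow>\<^sub>0 'k"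

definition mv_eval :: "('v::finite, 'k::comm_ring_1) mvpoly \<Rightarrow> 'k ^ 'v \<Rightarrow> 'k" where
  "mv_eval f x = (\<Sum>a\<in>Poly_Mapping.keys f.
     Poly_Mapping.lookup f a * (\<Prod>i\<in>UNIV. (x $ i) ^ Poly_Mapping.lookup a i))"

definition homogeneous :: "nat \<Rightarrow> ('v::finite, 'k::comm_ring_1) mvpoly \<Rightarrow> bool" where
  "homogeneous d f \<longleftrightarrow> (\<forall>a\<in>Poly_Mapping.keys f. (\<Sum>i\<in>UNIV. Poly_Mapping.lookup a i) = d)"

text \<open>
  The truncated subtraction of exponents is harmless: if the variable \<open>i\<close> does not occur in the
  monomial \<open>a\<close>, then the coefficient is zero.
\<close>

definition mv_deriv ::
  "'v::finite \<Rightarrow> ('v, 'k::comm_ring_1) mvpoly \<Rightarrow> ('v, 'k) mvpoly" where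
  "mv_deriv i f = (\<Sum>a\<in>Poly_Mapping.keys f.
     Poly_Mapping.single (a - Poly_Mapping.single i 1)
       (of_nat (Poly_Mapping.lookup a i) * Poly_Mapping.lookup f a))"

section \<open>Grassmannians and projective space\<close>

definition grassmannian :: "nat \<Rightarrow> ('k::field ^ 'v::finite) set set" where
  "grassmannian r = {W. vec.subspace W \<and> vec.dim W = r}"

text \<open>A point of $\mathbb P^n$ is a line through the origin of $K^{n+1}$.\<close>

abbreviation proj_space :: "('k::field ^ 'v::finite) set set" where
  "proj_space \<equiv> grassmannian 1"

definition proj_closed :: "('k::field ^ 'v::finite) set set \<Rightarrow> bool" where
  "proj_closed X \<longleftrightarrow> (\<exists>S. (\<forall>f\<in>S. \<exists>d. homogeneous d f) \<and>
     X = {P \<in> proj_space. \<forall>f\<in>S. \<forall>x\<in>P. mv_eval f x = 0})"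

definition proj_variety :: "('k::field ^ 'v::finite) set set \<Rightarrow> bool" where
  "proj_variety X \<longleftrightarrow> proj_closed X \<and> X \<noteq> {} \<and>
     (\<forall>Y Z. proj_closed Y \<and> proj_closed Z \<and> X = Y \<union> Z \<longrightarrow> X = Y \<or> X = Z)"

text \<open>Krull dimension: the supremum of the lengths of chains of irreducible closed subsets.\<close>

definition proj_dim :: "('k::field ^ 'v::finite) set set \<Rightarrow> enat" where
  "proj_dim X = Sup {enat d | d. \<exists>Z :: nat \<Rightarrow> ('k ^ 'v) set set.
     (\<forall>i\<le>d. proj_variety (Z i) \<and> Z i \<subseteq> X) \<and> (\<forall>i<d. Z i \<subset> Z (Suc i))}"

definition dense_torus :: "('k::field ^ 'v::finite) set set" where
  "dense_torus = {P \<in> proj_space. \<forall>x\<in>P - {0}. \<forall>i. x $ i \<noteq> 0}"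

section \<open>Pluecker coordinates and the Zariski topology of the Grassmannian\<close>

text \<open>
  A matrix is given as the list of its rows. For \<open>card J = length A\<close> the following is the minor
  of \<open>A\<close> with columns \<open>J\<close>; the value zero for all other \<open>J\<close> allows all subsets as indices.
\<close>

definition pluecker :: "('k::field ^ 'n::{finite,linorder}) list \<Rightarrow> 'n set \<Rightarrow> 'k" where
  "pluecker A J = (if card J = length A
     then Determinant.det (Matrix.mat (length A) (length A)
            (\<lambda>(i, j). (A ! i) $ (sorted_list_of_set J ! j)))
     else 0)"

definition row_span :: "('k::field ^ 'n::finite) list \<Rightarrow> ('k ^ 'n) set" where
  "row_span A = vec.span (set A)"

text \<open>
  The Pluecker embedding. The Pluecker vectors of any two matrices of full rank with the same row
  span are proportional, so this is a line.
\<close>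

definition pluecker_point ::
  "nat \<Rightarrow> ('k::field ^ 'n::{finite,linorder}) set \<Rightarrow> ('k ^ ('n set)) set" where
  "pluecker_point r W = vec.span {\<chi> J. pluecker A J | A. length A = r \<and> row_span A = W}"

definition grass_closed :: "nat \<Rightarrow> ('k::field ^ 'n::{finite,linorder}) set set \<Rightarrow> bool" where
  "grass_closed r Z \<longleftrightarrow>
     (\<exists>Y. proj_closed Y \<and> Z = {W \<in> grassmannian r. pluecker_point r W \<in> Y})"

definition pluecker_vanishes_on ::
  "nat \<Rightarrow> 'n set \<Rightarrow> ('k::field ^ 'n::{finite,linorder}) set set \<Rightarrow> bool" where
  "pluecker_vanishes_on r J Z \<longleftrightarrow>
     (\<forall>W\<in>Z. \<forall>A. length A = r \<and> row_span A = W \<longrightarrow> pluecker A J = 0)"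

section \<open>Gauss map\<close>

definition vanishing_forms :: "('k::field ^ 'v::finite) set set \<Rightarrow> ('v, 'k) mvpoly set" where
  "vanishing_forms X = {f. (\<exists>d. homogeneous d f) \<and> (\<forall>P\<in>X. \<forall>x\<in>P. mv_eval f x = 0)}"

text \<open>The projective tangent space, as the linear subspace of $K^{n+1}$ lying over it.\<close>

definition tangent_space ::
  "('k::field ^ 'v::finite) set set \<Rightarrow> ('k ^ 'v) set \<Rightarrow> ('k ^ 'v) set" where
  "tangent_space X P = {v. \<forall>f\<in>vanishing_forms X. \<forall>x\<in>P - {0}.
     (\<Sum>i\<in>UNIV. mv_eval (mv_deriv i f) x * v $ i) = 0}"

definition smooth_points :: "('k::field ^ 'v::finite) set set \<Rightarrow> ('k ^ 'v) set set" where
  "smooth_points X = {P \<in> X. enat (vec.dim (tangent_space X P)) = proj_dim X + 1}"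

definition gauss_image ::
  "nat \<Rightarrow> ('k::field ^ 'n::{finite,linorder}) set set \<Rightarrow>
     ('k ^ 'n::{finite,linorder}) set set" where
  "gauss_image m X = grass_closed (m + 1) hull (tangent_space X ` smooth_points X)"

section \<open>The tropical torus\<close>

text \<open>The quotient $\mathbb R^{n+1} / \mathbb R (1, \dots, 1)$; note that \<open>1 :: real ^ 'n\<close> is the
  all-ones vector.\<close>

definition ttorus_rel :: "real ^ 'n::finite \<Rightarrow> real ^ 'n \<Rightarrow> bool" where
  "ttorus_rel x y \<longleftrightarrow> (\<exists>c. x - y = c *\<^sub>R 1)"

lemma equivp_ttorus_rel: "equivp ttorus_rel"
proof (rule equivpI)
  show "reflp ttorus_rel"
    by (auto simp: reflp_def ttorus_rel_def intro: exI[of _ 0])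
  show "symp ttorus_rel"
  proof (rule sympI)
    fix x y :: "real ^ 'n" assume "ttorus_rel x y"
    then obtain c where "x - y = c *\<^sub>R 1" by (auto simp: ttorus_rel_def)
    then have "y - x = (- c) *\<^sub>R 1" by (simp add: algebra_simps)
    then show "ttorus_rel y x" unfolding ttorus_rel_def by blast
  qed
  show "transp ttorus_rel"
  proof (rule transpI)
    fix x y z :: "real ^ 'n" assume "ttorus_rel x y" "ttorus_rel y z"
    then obtain c d where "x - y = c *\<^sub>R 1" "y - z = d *\<^sub>R 1"
      by (auto simp: ttorus_rel_def)
    then have "x - z = (c + d) *\<^sub>R 1" by (simp add: algebra_simps)
    then show "ttorus_rel x z" unfolding ttorus_rel_def by blast
  qed
qed

quotient_type (overloaded) 'n ttorus = "real ^ 'n::finite" / ttorus_rel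
  morphisms rep_ttorus to_ttorus
  by (rule equivp_ttorus_rel)

instantiation ttorus :: (finite) real_vector
begin

lift_definition zero_ttorus :: "'a ttorus" is 0 .

lift_definition plus_ttorus :: "'a ttorus \<Rightarrow> 'a ttorus \<Rightarrow> 'a ttorus" is "(+)"
proof -
  fix x y x' y' :: "real ^ 'a" assume "ttorus_rel x y" "ttorus_rel x' y'"
  then obtain c d where "x - y = c *\<^sub>R 1" "x' - y' = d *\<^sub>R 1"
    by (auto simp: ttorus_rel_def)
  then have "(x + x') - (y + y') = (c + d) *\<^sub>R 1" by (simp add: algebra_simps)
  then show "ttorus_rel (x + x') (y + y')" unfolding ttorus_rel_def by blast
qed

lift_definition minus_ttorus :: "'a ttorus \<Rightarrow> 'a ttorus \<Rightarrow> 'a ttorus" is "(-)"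
proof -
  fix x y x' y' :: "real ^ 'a" assume "ttorus_rel x y" "ttorus_rel x' y'"
  then obtain c d where "x - y = c *\<^sub>R 1" "x' - y' = d *\<^sub>R 1"
    by (auto simp: ttorus_rel_def)
  then have "(x - x') - (y - y') = (c - d) *\<^sub>R 1" by (simp add: algebra_simps)
  then show "ttorus_rel (x - x') (y - y')" unfolding ttorus_rel_def by blast
qed

lift_definition uminus_ttorus :: "'a ttorus \<Rightarrow> 'a ttorus" is uminus
proof -
  fix x y :: "real ^ 'a" assume "ttorus_rel x y"
  then obtain c where "x - y = c *\<^sub>R 1" by (auto simp: ttorus_rel_def)
  then have "- x - - y = (- c) *\<^sub>R 1" by (simp add: algebra_simps)
  then show "ttorus_rel (- x) (- y)" unfolding ttorus_rel_def by blast
qed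

lift_definition scaleR_ttorus :: "real \<Rightarrow> 'a ttorus \<Rightarrow> 'a ttorus" is "(*\<^sub>R)"
proof -
  fix r and x y :: "real ^ 'a" assume "ttorus_rel x y"
  then obtain c where "x - y = c *\<^sub>R 1" by (auto simp: ttorus_rel_def)
  then have "r *\<^sub>R x - r *\<^sub>R y = (r * c) *\<^sub>R 1"
    by (metis scaleR_right_diff_distrib scaleR_scaleR)
  then show "ttorus_rel (r *\<^sub>R x) (r *\<^sub>R y)" unfolding ttorus_rel_def by blast
qed

instance
proof
  have refl: "ttorus_rel x x" for x :: "real ^ 'a"
    using equivp_ttorus_rel by (rule equivp_reflp)
  fix a b c :: "'a ttorus" and r s :: real
  show "a + b + c = a + (b + c)" by transfer (simp add: refl add.assoc)
  show "a + b = b + a" by transfer (simp add: refl add.commute)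
  show "0 + a = a" by transfer (simp add: refl)
  show "- a + a = 0" by transfer (simp add: refl)
  show "a - b = a + - b" by transfer (simp add: refl)
  show "r *\<^sub>R (a + b) = r *\<^sub>R a + r *\<^sub>R b" by transfer (simp add: refl scaleR_add_right)
  show "(r + s) *\<^sub>R a = r *\<^sub>R a + s *\<^sub>R a" by transfer (simp add: refl scaleR_add_left)
  show "r *\<^sub>R s *\<^sub>R a = (r * s) *\<^sub>R a" by transfer (simp add: refl)
  show "1 *\<^sub>R a = a" by transfer (simp add: refl)
qed

end

instantiation ttorus :: (finite) topological_space
begin

definition open_ttorus :: "'a ttorus set \<Rightarrow> bool" where
  "open_ttorus U \<longleftrightarrow> open (to_ttorus -` U)"

instance
  by standard (auto simp: open_ttorus_def vimage_Union)

end

definition coord_span :: "'n set \<Rightarrow> 'n::finite ttorus set" where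
  "coord_span I = span ((\<lambda>i. to_ttorus (axis i 1)) ` I)"

definition diff_span :: "'a::real_vector set \<Rightarrow> 'a set" where
  "diff_span S = span {x - y | x y. x \<in> S \<and> y \<in> S}"

section \<open>Polyhedral complexes\<close>

text \<open>
  The library's \<open>polyhedron\<close> and its half-spaces rely on an inner product, which the quotient
  does not carry.
\<close>

definition is_polyhedron :: "'a::real_vector set \<Rightarrow> bool" where
  "is_polyhedron P \<longleftrightarrow> (\<exists>H. finite H \<and> P = \<Inter>H \<and>
     (\<forall>h\<in>H. \<exists>(l :: 'a \<Rightarrow> real) b. linear l \<and> h = {x. l x \<le> b}))"

text \<open>The empty set may, but need not, be a cell; it is a face of every set for \<open>face_of\<close>.\<close>

definition polyhedral_complex :: "'a::real_vector set set \<Rightarrow> bool" where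
  "polyhedral_complex C \<longleftrightarrow> finite C \<and> (\<forall>E\<in>C. is_polyhedron E) \<and>
     (\<forall>E\<in>C. \<forall>F. F face_of E \<and> F \<noteq> {} \<longrightarrow> F \<in> C) \<and>
     (\<forall>E\<in>C. \<forall>F\<in>C. (E \<inter> F) face_of E \<and> (E \<inter> F) face_of F)"

definition maximal_cells :: "'a set set \<Rightarrow> 'a set set" where
  "maximal_cells C = {E \<in> C. \<forall>F\<in>C. E \<subseteq> F \<longrightarrow> F = E}"

section \<open>Valuations and tropicalization\<close>

definition nonarch_valuation :: "('k::field \<Rightarrow> ereal) \<Rightarrow> bool" where
  "nonarch_valuation val \<longleftrightarrow>
     (\<forall>x. val x \<noteq> - \<infinity>) \<and> (\<forall>x. val x = \<infinity> \<longleftrightarrow> x = 0) \<and>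
     (\<forall>x y. val (x * y) = val x + val y) \<and>
     (\<forall>x y. min (val x) (val y) \<le> val (x + y))"

definition nontrivial_valuation :: "('k::field \<Rightarrow> ereal) \<Rightarrow> bool" where
  "nontrivial_valuation val \<longleftrightarrow> (\<exists>x. x \<noteq> 0 \<and> val x \<noteq> 0)"

text \<open>Choosing another vector of the line \<open>P\<close> shifts the valuations by a multiple of the
  all-ones vector.\<close>

definition Trop ::
  "('k::field \<Rightarrow> ereal) \<Rightarrow> ('k ^ 'n::finite) set set \<Rightarrow> 'n ttorus set" where
  "Trop val X = closure {to_ttorus (\<chi> i. real_of_ereal (val (x $ i))) | x P.
     P \<in> X \<inter> dense_torus \<and> x \<in> P - {0}}"

end

theory Submission
 imports Defs "HOL-Library.Function_Algebras"
begin

text \<open>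
 Both sides of the equivalence say that the coordinates in \<open>J\<close> are algebraically dependent on the
 affine cone over \<open>X\<close>. At a generic point of the cone, a transcendence basis of coordinates gives
 coordinates of the tangent space. A relation between the coordinates in \<open>J\<close> therefore yields a
 tangent vector \<open>v\<close> with \<open>v\<^sub>J = 0\<close> generically, and then at all smooth points, because generic
 points are dense and injectivity of the projection to \<open>J\<close> is an open condition.

 On the tropical side, let \<open>L\<close> be the span of a maximal cell. If the coordinates in \<open>J\<close> are free on
 \<open>L\<close>, then the terms of a polynomial in them have distinct valuations at some point over the cell,
 so there is no relation. Conversely, if \<open>J\<close> is a transcendence basis, then generic values of these
 coordinates lift to the cone, so not all cells can have degenerate projections to \<open>J\<close>. The dimension
 of \<open>L\<close> is the transcendence degree: otherwise the coordinates free on \<open>L\<close> would locally determine the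
 valuation of a further basis coordinate, whereas the number of points of a fibre with a given
 valuation is the logarithm of a continuous function along a line.

 Polynomials enter as functions: \<open>pf S\<close> consists of the polynomial functions in the coordinates \<open>S\<close>.
\<close>

section \<open>Polynomial functions\<close>

text \<open>The field is not assumed complete, so neither power series nor an implicit function
  theorem produces points of the cone near a given one. They are found by counting: a primitive
  element \<open>te\<close> over a transcendence basis satisfies a relation that factors over the
  fibre, and if the product of the differences \<open>te x - te z\<close> is small, so is one
  factor. A single linear form can still be small on a large difference. A polynomial, however, has
  coefficients bounded by its value at a suitable natural number, because nonzero integers have norm
  1. Linear forms depending polynomially on a parameter are therefore used at many integers at once.

  Two uses go beyond generic points. Arbitrary points of the cone are approximated through a finite
  projection, whose relations become monic because the polynomial ring is normal. Torus points with
  valuations close to those of a given point are handled by adjoining the reciprocals of the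
  coordinates, which turns all conditions on valuations into one condition on the maximum
  norm.\<close>

lemmas cart_eq_iff = Finite_Cartesian_Product.vec_eq_iff

inductive_set pf :: "'v set => ('k::comm_ring_1 ^ 'v::finite => 'k) set" for S where
 pf_const: "(\<lambda>_. c) \<in> pf S"
| pf_coord: "i \<in> S ==> (\<lambda>x. x $ i) \<in> pf S"
| pf_add: "f \<in> pf S ==> g \<in> pf S ==> f + g \<in> pf S"
| pf_mult: "f \<in> pf S ==> g \<in> pf S ==> f * g \<in> pf S"

lemma pf_zero [simp]: "0 \<in> pf S"
 using pf_const[of 0 S] by (simp add: zero_fun_def)

lemma pf_one [simp]: "1 \<in> pf S"
 using pf_const[of 1 S] by (simp add: one_fun_def)

lemma pf_uminus: "f \<in> pf S ==> - f \<in> pf S"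
 using pf_mult[OF pf_const[of "-1" S], of f] by (simp add: times_fun_def fun_Compl_def)

lemma pf_diff: "f \<in> pf S ==> g \<in> pf S ==> f - g \<in> pf S"
 using pf_add[of f S "- g"] pf_uminus[of g S] by simp

lemma pf_power: "f \<in> pf S ==> f ^ n \<in> pf S"
 by (induction n) (auto intro: pf_mult)

lemma pf_sum: "(!!i. i \<in> A ==> f i \<in> pf S) ==> sum f A \<in> pf S"
 by (induction A rule: infinite_finite_induct) (auto intro: pf_add)

lemma pf_prod: "(!!i. i \<in> A ==> f i \<in> pf S) ==> prod f A \<in> pf S"
 by (induction A rule: infinite_finite_induct) (auto intro: pf_mult)

lemma pf_mono: "f \<in> pf S ==> S \<subseteq> T ==> f \<in> pf T"
 by (induction rule: pf.induct) (auto intro: pf.intros)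

lemma pf_UNIV: "f \<in> pf S ==> f \<in> pf UNIV"
 by (erule pf_mono) simp

lemma pf_lambda:
 "f \<in> pf S ==> g \<in> pf S ==> (\<lambda>x. f x + g x) \<in> pf S"
 "f \<in> pf S ==> g \<in> pf S ==> (\<lambda>x. f x * g x) \<in> pf S"
 "f \<in> pf S ==> g \<in> pf S ==> (\<lambda>x. f x - g x) \<in> pf S"
 "f \<in> pf S ==> (\<lambda>x. - f x) \<in> pf S"
 "f \<in> pf S ==> (\<lambda>x. f x ^ n) \<in> pf S"
proof -
 assume f: "f \<in> pf S"
 show "(\<lambda>x. - f x) \<in> pf S"
  using pf_uminus[OF f] by (simp add: fun_Compl_def)
 have "f ^ n = (\<lambda>x. f x ^ n)" by (induction n) (auto simp: fun_eq_iff)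
 with pf_power[OF f, of n] show "(\<lambda>x. f x ^ n) \<in> pf S" by simp
 assume g: "g \<in> pf S"
 show "(\<lambda>x. f x + g x) \<in> pf S" using pf_add[OF f g] by (simp add: plus_fun_def)
 show "(\<lambda>x. f x * g x) \<in> pf S" using pf_mult[OF f g] by (simp add: times_fun_def)
 show "(\<lambda>x. f x - g x) \<in> pf S" using pf_diff[OF f g] by (simp add: fun_diff_def)
qed

lemma sum_fun_apply [simp]: "(sum f A :: 'a => 'b::comm_monoid_add) x = (\<Sum>i\<in>A. f i x)"
 by (induction A rule: infinite_finite_induct) auto

lemma prod_fun_apply [simp]: "(prod f A :: 'a => 'b::comm_monoid_mult) x = (\<Prod>i\<in>A. f i x)"
 by (induction A rule: infinite_finite_induct) auto

lemma power_fun_apply [simp]: "((f :: 'a => 'b::comm_monoid_mult) ^ n) x = f x ^ n"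
 by (induction n) auto

lemma pf_lambda_sum:
 "(!!i. i \<in> A ==> f i \<in> pf S) ==> (\<lambda>x. \<Sum>i\<in>A. f i x) \<in> pf S"
 "(!!i. i \<in> A ==> f i \<in> pf S) ==> (\<lambda>x. \<Prod>i\<in>A. f i x) \<in> pf S"
 using pf_sum[of A f S] pf_prod[of A f S] by (simp_all add: sum_fun_apply[abs_def] prod_fun_apply[abs_def])

lemma pf_cong_coords:
 assumes "f \<in> pf S" "!!i. i \<in> S ==> x $ i = y $ i"
 shows "f x = f y"
 using assms by (induction rule: pf.induct) auto

lemma pf_compose:
 assumes "f \<in> pf S" "!!i. i \<in> S ==> (\<lambda>x. h x $ i) \<in> pf T"
 shows "(\<lambda>x. f (h x)) \<in> pf T"
 using assms by (induction rule: pf.induct) (auto intro: pf.intros pf_lambda)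

subsection \<open>Polynomials with polynomial functions as coefficients\<close>

text \<open>Since the coefficients are functions, such a polynomial can be evaluated at a function
  \<open>h\<close>, giving an expression in \<open>h\<close> over \<open>pf S\<close>, or at a
  constant function \<open>\<lambda>_. s\<close> and then at a point, giving an ordinary polynomial
  in \<open>s\<close>. The ring of all functions has zero divisors; domain properties are later
  supplied by prime ideals.\<close>

definition pfpoly :: "'v set => ('k::comm_ring_1 ^ 'v::finite => 'k) poly set" where
 "pfpoly S = {P. \<forall>j. coeff P j \<in> pf S}"

lemma pfpolyI: "(!!j. coeff P j \<in> pf S) ==> P \<in> pfpoly S" by (simp add: pfpoly_def)
lemma pfpolyD: "P \<in> pfpoly S ==> coeff P j \<in> pf S" by (simp add: pfpoly_def)

lemma pfpoly_zero [simp]: "0 \<in> pfpoly S" by (auto intro: pfpolyI)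

lemma pfpoly_add: "P \<in> pfpoly S ==> Q \<in> pfpoly S ==> P + Q \<in> pfpoly S"
 by (auto simp: pfpoly_def intro: pf_add)

lemma pfpoly_uminus: "P \<in> pfpoly S ==> - P \<in> pfpoly S"
 by (auto simp: pfpoly_def intro: pf_uminus)

lemma pfpoly_diff: "P \<in> pfpoly S ==> Q \<in> pfpoly S ==> P - Q \<in> pfpoly S"
 by (auto simp: pfpoly_def intro: pf_diff)

lemma pfpoly_mult: "P \<in> pfpoly S ==> Q \<in> pfpoly S ==> P * Q \<in> pfpoly S"
 by (auto simp: pfpoly_def coeff_mult intro!: pf_sum pf_mult)

lemma pfpoly_pCons: "a \<in> pf S ==> P \<in> pfpoly S ==> pCons a P \<in> pfpoly S"
 by (auto simp: pfpoly_def coeff_pCons split: nat.split)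

lemma pfpoly_pConsD: "pCons a P \<in> pfpoly S ==> a \<in> pf S \<and> P \<in> pfpoly S"
 unfolding pfpoly_def mem_Collect_eq by (metis coeff_pCons_0 coeff_pCons_Suc)

lemma pfpoly_smult: "a \<in> pf S ==> P \<in> pfpoly S ==> Polynomial.smult a P \<in> pfpoly S"
 by (auto simp: pfpoly_def intro: pf_mult)

lemma pfpoly_monom: "a \<in> pf S ==> monom a n \<in> pfpoly S"
 by (auto simp: pfpoly_def coeff_monom)

lemma pfpoly_one [simp]: "1 \<in> pfpoly S"
 using pfpoly_monom[of 1 S 0] by (simp add: monom_0 one_pCons)

lemma pfpoly_const: "a \<in> pf S ==> [:a:] \<in> pfpoly S" by (simp add: pfpoly_pCons)

lemma pfpoly_sum: "(!!i. i \<in> A ==> f i \<in> pfpoly S) ==> sum f A \<in> pfpoly S"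
 by (induction A rule: infinite_finite_induct) (auto intro: pfpoly_add)

lemma pfpoly_power: "P \<in> pfpoly S ==> P ^ n \<in> pfpoly S"
 by (induction n) (auto intro: pfpoly_mult)

lemma pfpoly_mono: "P \<in> pfpoly S ==> S \<subseteq> T ==> P \<in> pfpoly T"
 by (auto simp: pfpoly_def intro: pf_mono)

text \<open>The formal derivative, in a form that makes sense over a coefficient ring with zero
  divisors such as the ring of all functions.\<close>

definition zderiv :: "('a => 'k::comm_ring_1) poly => ('a => 'k) poly" where
 "zderiv P = (\<Sum>j\<le>degree P. monom (of_nat (Suc j) * coeff P (Suc j)) j)"

lemma coeff_zderiv: "coeff (zderiv P) j = of_nat (Suc j) * coeff P (Suc j)"
 unfolding zderiv_def by (auto simp: coeff_sum coeff_monom coeff_eq_0 if_distrib cong: if_cong)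

lemma of_nat_fun_apply: "(of_nat n :: 'a => 'b::comm_ring_1) y = of_nat n"
 by (induction n) auto

lemma pfpoly_zderiv: "P \<in> pfpoly S ==> zderiv P \<in> pfpoly S"
proof (rule pfpolyI)
 fix j assume P: "P \<in> pfpoly S"
 have c: "of_nat n \<in> pf S" for n
  using pf_const[of "of_nat n" S] by (simp add: of_nat_fun_apply[abs_def])
 show "coeff (zderiv P) j \<in> pf S"
  unfolding coeff_zderiv by (intro pf_mult c pfpolyD[OF P])
qed

lemma pfpoly_poly: "P \<in> pfpoly S ==> h \<in> pf S ==> poly P h \<in> pf S"
 by (induction P) (auto dest!: pfpoly_pConsD intro!: pf_add pf_mult)

lemma pfpoly_pcompose: "P \<in> pfpoly S ==> Q \<in> pfpoly S ==> pcompose P Q \<in> pfpoly S"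
 by (induction P) (auto dest!: pfpoly_pConsD simp: pcompose_pCons intro!: pfpoly_add pfpoly_mult pfpoly_const)

lemma poly_fun_apply: "poly P th y = poly P (\<lambda>_. th y) y"
 for th :: "'a => 'k::comm_ring_1"
 by (induction P) auto

definition at_pt :: "'a => ('a => 'k::comm_ring_1) poly => 'k poly" where
 "at_pt y P = map_poly (\<lambda>f. f y) P"

lemma coeff_at_pt [simp]: "coeff (at_pt y P) j = coeff P j y"
 by (simp add: at_pt_def coeff_map_poly)

lemma at_pt_pCons: "at_pt y (pCons a P) = pCons (a y) (at_pt y P)"
 by (rule poly_eqI) (auto simp: coeff_pCons split: nat.split)

lemma at_pt_0 [simp]: "at_pt y 0 = 0" by (rule poly_eqI) simp

lemma poly_at_pt: "poly (at_pt y P) z = poly P (\<lambda>_. z) y"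
 by (induction P) (auto simp: at_pt_pCons)

lemma degree_at_pt: "degree (at_pt y P) <= degree P"
 by (rule degree_le) (auto simp: coeff_eq_0)

lemma pderiv_at_pt: "pderiv (at_pt y P) = at_pt y (zderiv P)"
 for P :: "('a => 'k::idom) poly"
 by (intro poly_eqI) (simp add: coeff_pderiv coeff_zderiv of_nat_fun_apply)

text \<open>Covers lines with a moving base point, lines with a moving direction and, later, curves
  in the space of linear forms. In each case a statement about infinitely many parameters
  \<open>s\<close> becomes one about the coefficients of \<open>P\<close>.\<close>

lemma pf_subst_poly:
 assumes "f \<in> pf S"
  and "!!i. i \<in> S ==> \<exists>Q\<in>pfpoly T. \<forall>y s. h y s $ i = poly Q (\<lambda>_. s) y"
 shows "\<exists>P\<in>pfpoly T. \<forall>y s. f (h y s) = poly P (\<lambda>_. s) y"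
 using assms
proof (induction rule: pf.induct)
 case (pf_const c)
 then show ?case by (intro bexI[of _ "[:\<lambda>_. c:]"]) (auto intro: pfpoly_const pf.pf_const)
next
 case (pf_coord i)
 then show ?case by auto
next
 case (pf_add f g)
 then obtain P Q where "P \<in> pfpoly T" "\<forall>y s. f (h y s) = poly P (\<lambda>_. s) y"
  "Q \<in> pfpoly T" "\<forall>y s. g (h y s) = poly Q (\<lambda>_. s) y" by blast
 then show ?case by (intro bexI[of _ "P + Q"]) (auto intro: pfpoly_add)
next
 case (pf_mult f g)
 then obtain P Q where "P \<in> pfpoly T" "\<forall>y s. f (h y s) = poly P (\<lambda>_. s) y"
  "Q \<in> pfpoly T" "\<forall>y s. g (h y s) = poly Q (\<lambda>_. s) y" by blast
 then show ?case by (intro bexI[of _ "P * Q"]) (auto intro: pfpoly_mult)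
qed

lemma pf_line:
 assumes "f \<in> pf S"
 shows "\<exists>P\<in>pfpoly S. \<forall>y s. f (y + s *s v) = poly P (\<lambda>_. s) y"
proof (rule pf_subst_poly[OF assms])
 fix i assume "i \<in> S"
 then show "\<exists>Q\<in>pfpoly S. \<forall>y s. (y + s *s v) $ i = poly Q (\<lambda>_. s) y"
  by (intro bexI[of _ "[:\<lambda>y. y $ i, \<lambda>_. v $ i:]"])
   (auto intro!: pfpoly_pCons pf.intros simp: algebra_simps)
qed

lemma pf_line':
 assumes "f \<in> pf S"
 shows "\<exists>P\<in>pfpoly S. \<forall>y s. f (v + s *s y) = poly P (\<lambda>_. s) y"
proof (rule pf_subst_poly[OF assms])
 fix i assume "i \<in> S"
 then show "\<exists>Q\<in>pfpoly S. \<forall>y s. (v + s *s y) $ i = poly Q (\<lambda>_. s) y"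
  by (intro bexI[of _ "[:\<lambda>_. v $ i, \<lambda>y. y $ i:]"])
   (auto intro!: pfpoly_pCons pf.intros simp: algebra_simps)
qed

lemma pf_scale:
 assumes "f \<in> pf S"
 shows "\<exists>P\<in>pfpoly S. \<forall>y s. f (s *s y) = poly P (\<lambda>_. s) y"
 using pf_line'[OF assms, of 0] by simp

lemma pf_extract_coord:
 assumes "f \<in> pf (insert i S)"
 shows "\<exists>P\<in>pfpoly S. f = poly P (\<lambda>x. x $ i)"
 using assms
proof (induction rule: pf.induct)
 case (pf_const c)
 then show ?case by (intro bexI[of _ "[:\<lambda>_. c:]"]) (auto intro: pfpoly_const pf.pf_const)
next
 case (pf_coord j)
 show ?case
 proof (cases "j = i")
  case True
  then show ?thesis by (intro bexI[of _ "[:0, 1:]"]) (auto intro!: pfpoly_pCons simp: fun_eq_iff)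
 next
  case False
  then show ?thesis using pf_coord
   by (intro bexI[of _ "[:\<lambda>x. x $ j:]"]) (auto intro: pfpoly_const pf.pf_coord)
 qed
next
 case (pf_add f g)
 then obtain P Q where "P \<in> pfpoly S" "f = poly P (\<lambda>x. x $ i)"
  "Q \<in> pfpoly S" "g = poly Q (\<lambda>x. x $ i)" by blast
 then show ?case by (intro bexI[of _ "P + Q"]) (auto intro: pfpoly_add)
next
 case (pf_mult f g)
 then obtain P Q where "P \<in> pfpoly S" "f = poly P (\<lambda>x. x $ i)"
  "Q \<in> pfpoly S" "g = poly Q (\<lambda>x. x $ i)" by blast
 then show ?case by (intro bexI[of _ "P * Q"]) (auto intro: pfpoly_mult)
qed

subsection \<open>Infinite grids\<close>

text \<open>Coordinates are released from the grid one at a time. The property \<open>Q\<close> is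
  the vanishing of a function in one application and the membership of a specialized function in an
  ideal in another.\<close>

lemma grid_induct:
 fixes Q :: "('k::comm_ring_1 ^ 'v::finite) => bool" and S :: "'v => 'k set"
 assumes line: "!!u i. infinite {s. Q (u + s *s axis i 1)} ==> Q u"
  and inf: "!!i. infinite (S i)"
  and grid: "!!u. (!!i. u $ i \<in> S i) ==> Q u"
 shows "Q u"
proof -
 have "finite A ==> (!!i. i ~: A ==> u $ i \<in> S i) ==> Q u" for A u
 proof (induction A arbitrary: u rule: finite_induct)
  case empty
  then show ?case by (auto intro: grid)
 next
  case (insert i A)
  have "(\<lambda>a. a - u $ i) ` S i \<subseteq> {s. Q (u + s *s axis i 1)}"
  proof clarify
   fix a assume a: "a \<in> S i"
   show "Q (u + (a - u $ i) *s axis i 1)"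
    by (rule insert.IH) (use insert.prems a in \<open>auto simp: axis_def\<close>)
  qed
  moreover have "infinite ((\<lambda>a. a - u $ i) ` S i)"
   using inf[of i] by (subst finite_image_iff) (auto simp: inj_on_def)
  ultimately show ?case using line infinite_super by blast
 qed
 from this[of UNIV u] show ?thesis by simp
qed

lemma pf_grid_eq_0:
 fixes f :: "('k::{idom} ^ 'v::finite) => 'k"
 assumes f: "f \<in> pf UNIV" and inf: "!!i. infinite (S i)"
  and grid: "!!u. (!!i. u $ i \<in> S i) ==> f u = 0"
 shows "f = 0"
proof -
 have "f u = 0" for u
 proof (rule grid_induct[where S = S and Q = "\<lambda>u. f u = 0"])
  fix u :: "'k ^ 'v" and i assume *: "infinite {s. f (u + s *s axis i 1) = 0}"
  obtain P where P: "!!y s. f (y + s *s axis i 1) = poly P (\<lambda>_. s) y"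
   using pf_line[OF f, of "axis i 1"] by metis
  have "infinite {s. poly (at_pt u P) s = 0}" using * by (simp add: P poly_at_pt)
  then have "at_pt u P = 0" using poly_roots_finite by blast
  with P[of u 0] show "f u = 0" by (simp flip: poly_at_pt)
 qed (use inf grid in auto)
 then show ?thesis by (simp add: fun_eq_iff)
qed

lemma infinite_nats: "infinite (range (\<lambda>n. of_nat (Suc n) :: 'k::semiring_char_0))"
 by (rule range_inj_infinite) (simp add: inj_on_def del: of_nat_Suc)

text \<open>The multipliers are positive integers, which have norm 1 later on; so a generic point is
  found whose coordinates have the prescribed norms of \<open>sg\<close>.\<close>

lemma pf_nonzero_at:
 fixes f :: "('k::{field_char_0} ^ 'v::finite) => 'k"
 assumes f: "f \<in> pf UNIV" "f ~= 0" and sg: "!!i. sg i ~= 0"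
 shows "\<exists>n :: 'v => nat. f (\<chi> i. of_nat (Suc (n i)) * sg i) ~= 0"
proof (rule ccontr)
 assume neg: "\<not> ?thesis"
 let ?S = "\<lambda>i. (\<lambda>a. a * sg i) ` range (\<lambda>n. of_nat (Suc n) :: 'k)"
 have "f = 0"
 proof (rule pf_grid_eq_0[OF f(1), of ?S])
  show "infinite (?S i)" for i
   using infinite_nats[where 'k = 'k] sg[of i] by (subst finite_image_iff) (auto simp: inj_on_def)
  fix u assume "!!i. u $ i \<in> ?S i"
  then have "\<forall>i. \<exists>n. u $ i = of_nat (Suc n) * sg i" by blast
  then obtain n where n: "\<forall>i. u $ i = of_nat (Suc (n i)) * sg i" by (rule choice[THEN exE])
  have "u $ i = (\<chi> i. of_nat (Suc (n i)) * sg i) $ i" for i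
   using n[rule_format, of i] by (simp only: vec_lambda_beta)
  then have "u = (\<chi> i. of_nat (Suc (n i)) * sg i)"
   by (subst cart_eq_iff) (rule allI)
  with neg show "f u = 0" by blast
 qed
 with f show False by simp
qed

subsection \<open>Linear dependence over a domain of functions\<close>

text \<open>Fraction-free Gaussian elimination: a pivot \<open>b p t0\<close> clears the equation
  for \<open>t0\<close> by cross multiplication. The set \<open>A\<close> is only a subset of a ring
  with zero divisors, which is why its closure properties are listed.\<close>

lemma linear_dependence_subdomain:
 fixes b :: "'s => 't => 'r::comm_ring_1"
 assumes "finite T" "finite S" "card S > card T" "!!s t. b s t \<in> A"
  and A: "0 \<in> A" "1 \<in> A" "(1::'r) ~= 0" "!!x y. x \<in> A ==> y \<in> A ==> x + y \<in> A"
   "!!x y. x \<in> A ==> y \<in> A ==> x - y \<in> A"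
   "!!x y. x \<in> A ==> y \<in> A ==> x * y \<in> A"
   "!!x y. x \<in> A ==> y \<in> A ==> x * y = 0 ==> x = 0 \<or> y = 0"
 shows "\<exists>c. (\<forall>s. c s \<in> A) \<and> (\<exists>s\<in>S. c s ~= 0) \<and> (\<forall>t\<in>T. (\<Sum>s\<in>S. c s * b s t) = 0)"
 using assms(1-4)
proof (induction T arbitrary: S b rule: finite_induct)
 case empty
 then have "S ~= {}" by auto
 with A(1-3) show ?case by (intro exI[of _ "\<lambda>_. 1"]) auto
next
 case (insert t0 T)
 show ?case
 proof (cases "\<forall>s\<in>S. b s t0 = 0")
  case True
  have "card T < card S" using insert by auto
  from insert.IH[OF \<open>finite S\<close> this insert.prems(3)] True show ?thesis by fastforce
 next
  case False
  then obtain p where p: "p \<in> S" "b p t0 ~= 0" by blast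
  define b' where "b' s t = b p t0 * b s t - b s t0 * b p t" for s t
  have "card T < card (S - {p})" using insert p by auto
  moreover have "b' s t \<in> A" for s t unfolding b'_def by (intro A insert.prems)
  ultimately obtain c where c: "!!s. c s \<in> A" "\<exists>s\<in>S-{p}. c s ~= 0"
   "!!t. t \<in> T ==> (\<Sum>s\<in>S-{p}. c s * b' s t) = 0"
   using insert.IH[of "S - {p}" b'] insert.prems(1) by (metis finite_Diff)
  \<comment> \<open>The coefficient of the pivot that makes the equation for \<open>t0\<close> hold.
    The other coefficients are multiplied by \<open>b p t0\<close> to avoid a division.\<close>
  define e where "e = - (\<Sum>s\<in>S-{p}. c s * b s t0)"
  have sumA: "(\<Sum>s\<in>R. c s * b s t0) \<in> A" for R
   by (induction R rule: infinite_finite_induct) (auto intro!: A c insert.prems)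
  have eA: "e \<in> A" unfolding e_def using A(5)[OF A(1) sumA] by simp
  define c' where "c' s = (if s = p then e else c s * b p t0)" for s
  have split: "(\<Sum>s\<in>S. c' s * b s t) = e * b p t + (\<Sum>s\<in>S-{p}. c s * b p t0 * b s t)" for t
   using p insert.prems(1) by (subst sum.remove[of S p]) (auto simp: c'_def intro!: sum.cong)
  show ?thesis
  proof (intro exI[of _ c'] conjI allI ballI)
   show "c' s \<in> A" for s unfolding c'_def using eA c insert.prems A by auto
   obtain s where s: "s \<in> S - {p}" "c s ~= 0" using c by blast
   then have "c' s ~= 0" unfolding c'_def using A(7)[of "c s" "b p t0"] c(1) insert.prems(3) p by auto
   with s show "\<exists>s\<in>S. c' s ~= 0" by blast
   fix t assume "t \<in> insert t0 T"
   then show "(\<Sum>s\<in>S. c' s * b s t) = 0"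
   proof
    assume "t = t0"
    then show ?thesis unfolding split e_def
     by (simp add: sum_distrib_left sum_distrib_right algebra_simps)
   next
    assume "t \<in> T"
    have "0 = (\<Sum>s\<in>S-{p}. c s * b' s t)" using c(3)[OF \<open>t \<in> T\<close>] by simp
    also have "\<dots> = (\<Sum>s\<in>S-{p}. c s * b p t0 * b s t) - (\<Sum>s\<in>S-{p}. c s * b s t0) * b p t"
     unfolding b'_def by (simp add: algebra_simps sum_subtractf sum_distrib_left sum_distrib_right)
    finally show ?thesis unfolding split e_def by (simp add: algebra_simps)
   qed
  qed
 qed
qed

section \<open>Prime ideals of polynomial functions and transcendence bases\<close>

lemma pf_generalized_ind [consumes 1, case_names const coord add mult]:
 assumes "f \<in> pf S" "!!c. Q (\<lambda>_. c)" "!!i. i \<in> S ==> Q (\<lambda>x. x $ i)"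
  "!!f g. f \<in> pf S ==> g \<in> pf S ==> Q f ==> Q g ==> Q (f + g)"
  "!!f g. f \<in> pf S ==> g \<in> pf S ==> Q f ==> Q g ==> Q (f * g)"
 shows "Q f"
 using assms by (induction rule: pf.induct) auto

locale pf_prime =
 fixes I :: "('k::{alg_closed_field, field_char_0} ^ 'v::finite => 'k) set"
 assumes ideal_subset: "I \<subseteq> pf UNIV"
  and ideal_zero [simp]: "0 \<in> I"
  and ideal_add: "f \<in> I ==> g \<in> I ==> f + g \<in> I"
  and ideal_mult: "f \<in> I ==> g \<in> pf UNIV ==> g * f \<in> I"
  and ideal_proper: "1 ~: I"
  and ideal_prime: "f \<in> pf UNIV ==> g \<in> pf UNIV ==> f * g \<in> I ==> f \<in> I \<or> g \<in> I"

definition zeros :: "('k ^ 'v => 'k::comm_ring_1) set => ('k ^ 'v) set" where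
 "zeros I = {y. \<forall>f\<in>I. f y = 0}"

definition alg_indep :: "('k::comm_ring_1 ^ 'v::finite => 'k) set => 'v set => bool" where
 "alg_indep I B \<longleftrightarrow> pf B \<inter> I \<subseteq> {0}"

text \<open>Only coordinates are candidates for basis elements. As they generate all polynomial
  functions, a maximal independent set of them is a transcendence basis of the fraction field of the
  quotient by a prime ideal.\<close>

definition tr_basis :: "('k::comm_ring_1 ^ 'v::finite => 'k) set => 'v set => bool" where
 "tr_basis I B \<longleftrightarrow> alg_indep I B \<and> (\<forall>i. i ~: B --> \<not> alg_indep I (insert i B))"

lemma alg_indepD: "alg_indep I B ==> f \<in> pf B ==> f \<in> I ==> f = 0"
 by (auto simp: alg_indep_def)

context pf_prime
begin

lemma ideal_uminus: "f \<in> I ==> - f \<in> I"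
 using ideal_mult[of f "\<lambda>_. -1"] pf_const[of "-1" UNIV] by (simp add: times_fun_def fun_Compl_def)

lemma ideal_diff: "f \<in> I ==> g \<in> I ==> f - g \<in> I"
 using ideal_add[of f "- g"] ideal_uminus[of g] by simp

lemma ideal_sum: "(!!i. i \<in> A ==> f i \<in> I) ==> sum f A \<in> I"
 by (induction A rule: infinite_finite_induct) (auto intro: ideal_add)

lemma ideal_mult_right: "f \<in> I ==> g \<in> pf UNIV ==> f * g \<in> I"
 using ideal_mult[of f g] by (simp add: mult.commute)

lemma ideal_pf: "f \<in> I ==> f \<in> pf UNIV"
 using ideal_subset by blast

lemma ideal_prime_power: "f \<in> pf UNIV ==> f ^ n \<in> I ==> f \<in> I"
proof (induction n)
 case 0 then show ?case using ideal_proper by (metis power_0)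
next
 case (Suc n) then show ?case using ideal_prime[of f "f ^ n"] by (metis pf_power power_Suc)
qed

lemma ideal_prime_prod:
 "(!!i. i \<in> A ==> f i \<in> pf UNIV \<and> f i ~: I) ==> prod f A ~: I"
proof (induction A rule: infinite_finite_induct)
 case (insert x A)
 then show ?case using ideal_prime[of "f x" "prod f A"] pf_prod[of A f UNIV]
  by (metis insertCI prod.insert)
next
 case (infinite A)
 then show ?case using ideal_proper by (simp only: prod.infinite not_False_eq_True)
next
 case empty
 then show ?case using ideal_proper by (simp only: prod.empty not_False_eq_True)
qed

text \<open>Independence embeds \<open>pf B\<close> into the quotient by the prime ideal, which has
  no zero divisors.\<close>

lemma indep_domain:
 fixes f g :: "'k ^ 'v => 'k"
 assumes "alg_indep I B" "f \<in> pf B" "g \<in> pf B" "f * g = 0"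
 shows "f = 0 \<or> g = 0"
 using assms ideal_prime[of f g] alg_indepD[OF assms(1)] by (metis ideal_zero pf_UNIV)

lemma indep_prod_nonzero:
 fixes f :: "'z => 'k ^ 'v => 'k"
 assumes ind: "alg_indep I B" and f: "!!i. i \<in> A ==> f i \<in> pf B \<and> f i ~= 0"
 shows "prod f A ~= 0"
proof -
 have "prod f A ~: I"
  by (rule ideal_prime_prod) (use f ind in \<open>auto dest: alg_indepD intro: pf_UNIV\<close>)
 then show ?thesis by auto
qed

lemma extend_tr_basis:
 assumes "alg_indep I A"
 shows "\<exists>B. A \<subseteq> B \<and> tr_basis I B"
proof -
 let ?F = "{B. A \<subseteq> B \<and> alg_indep I B}"
 have "finite ?F" "?F ~= {}" using assms by auto
 from finite_has_maximal[OF this] obtain B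
  where B: "A \<subseteq> B" "alg_indep I B" "\<forall>C\<in>?F. B \<subseteq> C --> B = C" by auto
 have "\<not> alg_indep I (insert i B)" if "i ~: B" for i
 proof
  assume "alg_indep I (insert i B)"
  then have "insert i B \<in> ?F" using B(1) by auto
  then show False using B(3) that by blast
 qed
 then show ?thesis unfolding tr_basis_def using B by blast
qed

lemma alg_indep_empty: "alg_indep I {}"
proof -
 have c: "\<exists>c. f = (\<lambda>_. c)" if "f \<in> pf {}" for f :: "'k ^ 'v => 'k"
  using that by (induction rule: pf.induct) (auto simp: fun_eq_iff)
 have "c = 0" if "(\<lambda>_. c) \<in> I" for c
 proof (rule ccontr)
  assume "c ~= 0"
  then have "(\<lambda>_. inverse c) * (\<lambda>_. c) = (1 :: 'k ^ 'v => 'k)" by (simp add: fun_eq_iff)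
  then show False using ideal_mult[OF that pf_const[of "inverse c"]] ideal_proper by simp
 qed
 then have "f = 0" if "f \<in> pf {}" "f \<in> I" for f
  using c[OF that(1)] that(2) unfolding zero_fun_def by blast
 then show ?thesis unfolding alg_indep_def by blast
qed

lemma ex_tr_basis: "\<exists>B. tr_basis I B"
 using extend_tr_basis[OF alg_indep_empty] by blast

lemma coord_relation:
 assumes B: "tr_basis I B" and i: "i ~: B"
 shows "\<exists>P\<in>pfpoly B. P ~= 0 \<and> poly P (\<lambda>x. x $ i) \<in> I"
proof -
 obtain f where f: "f \<in> pf (insert i B)" "f \<in> I" "f ~= 0"
  using B i unfolding tr_basis_def alg_indep_def by blast
 obtain P where P: "P \<in> pfpoly B" "f = poly P (\<lambda>x. x $ i)" using pf_extract_coord[OF f(1)] by blast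
 then show ?thesis using f by (intro bexI[of _ P]) auto
qed

lemma relation_degree_pos:
 assumes B: "alg_indep I B" and P: "P \<in> pfpoly B" "P ~= 0" "poly P h \<in> I"
 shows "degree P > 0"
proof (rule ccontr)
 assume "\<not> degree P > 0"
 then obtain a where a: "P = [:a:]" by (auto elim: degree_eq_zeroE)
 then have "a \<in> I" "a \<in> pf B" "a ~= 0" using P pfpoly_pConsD by auto
 then show False using alg_indepD[OF B] by blast
qed

subsection \<open>Every polynomial function is algebraic over a transcendence basis\<close>

text \<open>Each coordinate outside \<open>B\<close> satisfies a relation over \<open>pf B\<close>,
  which reduces its powers below the degree of the relation. After inverting the product
  \<open>a\<close> of the leading coefficients, the finitely many reduced monomials
  \<open>w ga\<close> therefore generate all polynomial functions modulo \<open>I\<close>; the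
  exponent \<open>k\<close> keeps track of the denominator.\<close>

lemma tr_basis_module:
 assumes B: "tr_basis I B"
 shows "\<exists>(Ga :: ('v => nat) set) w a. finite Ga \<and> a \<in> pf B \<and> a ~= 0 \<and> (\<forall>ga\<in>Ga. w ga \<in> pf UNIV) \<and>
  (\<forall>h\<in>pf UNIV. \<exists>k q. (\<forall>ga. q ga \<in> pf B) \<and> a ^ k * h - (\<Sum>ga\<in>Ga. q ga * w ga) \<in> I)"
proof -
 have ind: "alg_indep I B" using B by (simp add: tr_basis_def)
 have "\<exists>P. i ~: B --> P \<in> pfpoly B \<and> P ~= 0 \<and> poly P (\<lambda>x. x $ i) \<in> I" for i
  using coord_relation[OF B] by blast
 then obtain P where P: "!!i. i ~: B ==> P i \<in> pfpoly B" "!!i. i ~: B ==> P i ~= 0"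
  "!!i. i ~: B ==> poly (P i) (\<lambda>x. x $ i) \<in> I" by metis
 define e where "e i = degree (P i)" for i
 have e: "e i > 0" if "i ~: B" for i
  unfolding e_def using relation_degree_pos[OF ind P[OF that]] .
 define a where "a = (\<Prod>i\<in>-B. lead_coeff (P i))"
 have lc: "lead_coeff (P i) \<in> pf B" "lead_coeff (P i) ~= 0" if "i ~: B" for i
  using P[OF that] by (auto intro: pfpolyD)
 have a: "a \<in> pf B" "a ~= 0"
  unfolding a_def using lc by (auto intro!: pf_prod indep_prod_nonzero[OF ind])
 define Ga :: "('v => nat) set" where "Ga = {ga. \<forall>i. if i \<in> B then ga i = 0 else ga i < e i}"
 have "Ga \<subseteq> PiE UNIV (\<lambda>i. {..e i})"
 proof
  fix ga assume "ga \<in> Ga"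
  then have "if i \<in> B then ga i = 0 else ga i < e i" for i by (simp add: Ga_def)
  then have "ga i <= e i" for i by (metis less_imp_le le0)
  then show "ga \<in> PiE UNIV (\<lambda>i. {..e i})" by (auto simp: PiE_def Pi_def)
 qed
 then have fin: "finite Ga" by (rule finite_subset) (auto intro: finite_PiE)
 define w :: "('v => nat) => 'k ^ 'v => 'k" where "w ga = (\<Prod>i\<in>UNIV. (\<lambda>x. x $ i) ^ ga i)" for ga
 have w_pf: "w ga \<in> pf UNIV" for ga
  unfolding w_def by (intro pf_prod pf_power pf_coord) auto
 define M where "M = {h\<in>pf UNIV. \<exists>k q. (\<forall>ga. q ga \<in> pf B) \<and> a ^ k * h - (\<Sum>ga\<in>Ga. q ga * w ga) \<in> I}"
 have MI: "h \<in> M" if "h \<in> pf UNIV" "!!ga. q ga \<in> pf B" "a ^ k * h - (\<Sum>ga\<in>Ga. q ga * w ga) \<in> I" for h k q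
  unfolding M_def using that by blast
 have M_pf: "h \<in> pf UNIV" if "h \<in> M" for h using that by (simp add: M_def)
 have M_add: "h + h' \<in> M" if h: "h \<in> M" and h': "h' \<in> M" for h h'
 proof -
  obtain k q where q: "!!ga. q ga \<in> pf B" "a ^ k * h - (\<Sum>ga\<in>Ga. q ga * w ga) \<in> I"
   using h unfolding M_def by blast
  obtain k' q' where q': "!!ga. q' ga \<in> pf B" "a ^ k' * h' - (\<Sum>ga\<in>Ga. q' ga * w ga) \<in> I"
   using h' unfolding M_def by blast
  have "a ^ k' * (a ^ k * h - (\<Sum>ga\<in>Ga. q ga * w ga)) + a ^ k * (a ^ k' * h' - (\<Sum>ga\<in>Ga. q' ga * w ga)) \<in> I"
   by (intro ideal_add ideal_mult q q' pf_power) (use a in \<open>auto intro: pf_UNIV\<close>)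
  also have "a ^ k' * (a ^ k * h - (\<Sum>ga\<in>Ga. q ga * w ga)) + a ^ k * (a ^ k' * h' - (\<Sum>ga\<in>Ga. q' ga * w ga))
   = a ^ (k + k') * (h + h') - (\<Sum>ga\<in>Ga. (a ^ k' * q ga + a ^ k * q' ga) * w ga)"
   by (simp add: algebra_simps sum.distrib sum_distrib_left power_add)
  finally show ?thesis
   by (rule MI[rotated 2]) (use q q' a M_pf h h' in \<open>auto intro!: pf_add pf_mult pf_power\<close>)
 qed
 have M_B: "b * h \<in> M" if h: "h \<in> M" and b: "b \<in> pf B" for h b
 proof -
  obtain k q where q: "!!ga. q ga \<in> pf B" "a ^ k * h - (\<Sum>ga\<in>Ga. q ga * w ga) \<in> I"
   using h unfolding M_def by blast
  have "b * (a ^ k * h - (\<Sum>ga\<in>Ga. q ga * w ga)) \<in> I"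
   by (intro ideal_mult q pf_UNIV[OF b])
  also have "b * (a ^ k * h - (\<Sum>ga\<in>Ga. q ga * w ga)) = a ^ k * (b * h) - (\<Sum>ga\<in>Ga. (b * q ga) * w ga)"
   by (simp add: algebra_simps sum_distrib_left)
  finally show ?thesis
   by (rule MI[rotated 2]) (use q b M_pf[OF h] in \<open>auto intro!: pf_mult intro: pf_UNIV\<close>)
 qed
 have M_sum: "sum f A \<in> M" if "finite A" "A ~= {}" "!!i. i \<in> A ==> f i \<in> M" for f and A :: "'z set"
  using that by (induction A rule: finite_ne_induct) (auto intro: M_add)
 have M_cong: "h \<in> M" if h: "h \<in> pf UNIV" and h': "h' \<in> M" and eq: "a ^ l * h - h' \<in> I" for h h' l
 proof -
  obtain k q where q: "!!ga. q ga \<in> pf B" "a ^ k * h' - (\<Sum>ga\<in>Ga. q ga * w ga) \<in> I"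
   using h' unfolding M_def by blast
  have "a ^ k * (a ^ l * h - h') + (a ^ k * h' - (\<Sum>ga\<in>Ga. q ga * w ga)) \<in> I"
   by (intro ideal_add ideal_mult q eq pf_power) (use a in \<open>auto intro: pf_UNIV\<close>)
  also have "a ^ k * (a ^ l * h - h') + (a ^ k * h' - (\<Sum>ga\<in>Ga. q ga * w ga))
   = a ^ (k + l) * h - (\<Sum>ga\<in>Ga. q ga * w ga)"
   by (simp add: algebra_simps power_add)
  finally show ?thesis by (rule MI[OF h q(1)])
 qed
 have M_w: "w ga \<in> M" if "ga \<in> Ga" for ga
 proof (rule MI[where k = 0 and q = "\<lambda>de. if de = ga then 1 else 0"])
  have "(\<Sum>de\<in>Ga. (if de = ga then 1 else 0) * w de) = (\<Sum>de\<in>Ga. if de = ga then w de else 0)"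
   by (intro sum.cong) auto
  also have "\<dots> = w ga" using that fin by simp
  finally show "a ^ 0 * w ga - (\<Sum>de\<in>Ga. (if de = ga then 1 else 0) * w de) \<in> I" by simp
 qed (auto intro: w_pf)
 have w_upd: "w (ga(i := n)) = (\<lambda>x. x $ i) ^ n * w (ga(i := 0))" for ga i n
 proof -
  have "w (ga(i := m)) = (\<lambda>x. x $ i) ^ m * (\<Prod>j\<in>UNIV-{i}. (\<lambda>x. x $ j) ^ ga j)" for m
   unfolding w_def by (subst prod.remove[of _ i]) auto
  then show ?thesis by simp
 qed
 \<comment> \<open>Multiplication by a coordinate either leaves a monomial reduced or raises one
   exponent to \<open>e i\<close>, where the relation \<open>P i\<close> rewrites it by lower
   exponents at the cost of one factor \<open>a\<close>.\<close>
 have M_coord_w: "(\<lambda>x. x $ i) * w ga \<in> M" if i: "i ~: B" and ga: "ga \<in> Ga" for i ga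
 proof -
  have wga: "w ga = (\<lambda>x. x $ i) ^ ga i * w (ga(i := 0))" using w_upd[of ga i "ga i"] by simp
  have upd: "ga(i := n) \<in> Ga" if "n < e i" for n using ga that i by (auto simp: Ga_def)
  have less: "ga i < e i" using ga i by (auto simp: Ga_def split: if_splits)
  show ?thesis
  proof (cases "Suc (ga i) < e i")
   case True
   have "(\<lambda>x. x $ i) * w ga = w (ga(i := Suc (ga i)))"
    unfolding wga w_upd[of ga i "Suc (ga i)"] by (simp add: mult.assoc)
   then show ?thesis using M_w[OF upd[OF True]] by simp
  next
   case False
   then have ei: "Suc (ga i) = e i" using less by simp
   define x0 :: "'k ^ 'v => 'k" where "x0 = w (ga(i := 0))"
   define X :: "'k ^ 'v => 'k" where "X = (\<lambda>x. x $ i)"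
   have Xw: "X ^ n * x0 = w (ga(i := n))" for n unfolding X_def x0_def w_upd[of ga i n] ..
   have Xpf: "X \<in> pf UNIV" unfolding X_def by (intro pf_coord) simp
   \<comment> \<open>The product of the leading coefficients of the other relations, which turns the
     leading coefficient of \<open>P i\<close> into the common denominator \<open>a\<close>.\<close>
   define r where "r = (\<Prod>j\<in>-B-{i}. lead_coeff (P j))"
   have r: "r \<in> pf B" unfolding r_def using lc by (auto intro!: pf_prod)
   have ar: "a = r * lead_coeff (P i)"
    unfolding a_def r_def using i by (subst prod.remove[of _ i]) (auto simp: mult.commute)
   have polyP: "poly (P i) X = lead_coeff (P i) * X ^ e i + (\<Sum>j<e i. coeff (P i) j * X ^ j)"
    unfolding poly_altdef e_def by (simp add: lessThan_Suc_atMost[symmetric])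
   have "r * x0 * poly (P i) X \<in> I"
    by (intro ideal_mult pf_mult) (use P(3)[OF i] r in \<open>auto simp: X_def x0_def w_pf intro: pf_UNIV\<close>)
   also have "r * x0 * poly (P i) X = a ^ 1 * (X ^ e i * x0) - (\<Sum>j<e i. (- r * coeff (P i) j) * (X ^ j * x0))"
    unfolding polyP ar by (simp add: algebra_simps sum_distrib_left sum_negf)
   finally have *: "a ^ 1 * (X ^ e i * x0) - (\<Sum>j<e i. (- r * coeff (P i) j) * (X ^ j * x0)) \<in> I" .
   have "X * w ga = X ^ e i * x0" unfolding ei[symmetric] using Xw[of "ga i"] by (simp add: mult.assoc)
   moreover have "X ^ e i * x0 \<in> M"
   proof (rule M_cong[OF _ _ *])
    show "X ^ e i * x0 \<in> pf UNIV" unfolding x0_def by (intro pf_mult pf_power Xpf w_pf)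
    show "(\<Sum>j<e i. (- r * coeff (P i) j) * (X ^ j * x0)) \<in> M"
    proof (rule M_sum, goal_cases)
     case 2 show ?case using e[OF i] by auto
    next
     case (3 j)
     then have "X ^ j * x0 \<in> M" unfolding Xw by (intro M_w upd) auto
     then show ?case by (rule M_B) (intro pf_mult pf_uminus r pfpolyD[OF P(1)[OF i]])
    qed auto
   qed
   ultimately show ?thesis by (simp add: X_def)
  qed
 qed
 have Ga_ne: "(\<lambda>_. 0) \<in> Ga" using e by (auto simp: Ga_def)
 have M_coord: "(\<lambda>x. x $ i) * h \<in> M" if h: "h \<in> M" for h i
 proof (cases "i \<in> B")
  case True then show ?thesis by (intro M_B h pf_coord)
 next
  case False
  obtain k q where q: "!!ga. q ga \<in> pf B" "a ^ k * h - (\<Sum>ga\<in>Ga. q ga * w ga) \<in> I"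
   using h unfolding M_def by blast
  have X: "(\<lambda>x. x $ i) \<in> pf UNIV" by (intro pf_coord) simp
  have "(\<lambda>x. x $ i) * (a ^ k * h - (\<Sum>ga\<in>Ga. q ga * w ga)) \<in> I" by (intro ideal_mult q X)
  also have "(\<lambda>x. x $ i) * (a ^ k * h - (\<Sum>ga\<in>Ga. q ga * w ga))
   = a ^ k * ((\<lambda>x. x $ i) * h) - (\<Sum>ga\<in>Ga. q ga * ((\<lambda>x. x $ i) * w ga))"
   by (simp add: algebra_simps sum_distrib_left)
  finally show ?thesis
  proof (rule M_cong[rotated 2])
   show "(\<lambda>x. x $ i) * h \<in> pf UNIV" by (intro pf_mult X M_pf h)
   show "(\<Sum>ga\<in>Ga. q ga * ((\<lambda>x. x $ i) * w ga)) \<in> M"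
    by (rule M_sum[OF fin]) (use Ga_ne in blast, intro M_B M_coord_w q False)
  qed
 qed
 have "\<forall>h\<in>M. f * h \<in> M" if "f \<in> pf UNIV" for f
  using that
 proof (induction rule: pf_generalized_ind)
  case (const c) show ?case using M_B[OF _ pf_const] by blast
 next
  case (coord i) show ?case using M_coord by blast
 next
  case (add f g) then show ?case using M_add by (metis distrib_right)
 next
  case (mult f g) then show ?case by (metis mult.assoc)
 qed
 moreover have "w (\<lambda>_. 0) \<in> M" by (intro M_w Ga_ne)
 then have "1 \<in> M" by (simp add: w_def)
 ultimately have "h \<in> M" if "h \<in> pf UNIV" for h using that by (metis mult.right_neutral)
 then show ?thesis using fin a w_pf unfolding M_def by blast
qed

text \<open>Up to powers of \<open>a\<close>, the powers of \<open>h\<close> with exponents from 0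
  to \<open>card Ga\<close> lie in a module with \<open>card Ga\<close> generators. There is one
  power too many, so they are linearly dependent over \<open>pf B\<close>.\<close>

theorem tr_basis_algebraic:
 assumes B: "tr_basis I B" and h: "h \<in> pf UNIV"
 shows "\<exists>P\<in>pfpoly B. P ~= 0 \<and> poly P h \<in> I"
proof -
 have ind: "alg_indep I B" using B by (simp add: tr_basis_def)
 obtain Ga :: "('v => nat) set" and w a where Ga: "finite Ga" "a \<in> pf B" "a ~= 0"
  and M: "\<forall>h\<in>pf UNIV. \<exists>k q. (\<forall>ga. q ga \<in> pf B) \<and> a ^ k * h - (\<Sum>ga\<in>Ga. q ga * w ga) \<in> I"
  using tr_basis_module[OF B] by (elim exE conjE) (rule that)
 have aI: "a ~: I" using Ga alg_indepD[OF ind] by blast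
 have "\<forall>n. \<exists>k q. (\<forall>ga. q ga \<in> pf B) \<and> a ^ k * h ^ n - (\<Sum>ga\<in>Ga. q ga * w ga) \<in> I"
  using bspec[OF M pf_power[OF h]] by blast
 then obtain k where "\<forall>n. \<exists>q. (\<forall>ga. q ga \<in> pf B) \<and> a ^ k n * h ^ n - (\<Sum>ga\<in>Ga. q ga * w ga) \<in> I"
  by (rule choice[THEN exE])
 then obtain q where "\<forall>n. (\<forall>ga. q n ga \<in> pf B) \<and> a ^ k n * h ^ n - (\<Sum>ga\<in>Ga. q n ga * w ga) \<in> I"
  by (rule choice[THEN exE])
 then have q: "!!n ga. q n ga \<in> pf B" "!!n. a ^ k n * h ^ n - (\<Sum>ga\<in>Ga. q n ga * w ga) \<in> I"
  by simp_all
 obtain c where c: "!!n. c n \<in> pf B" "\<exists>n\<in>{..card Ga}. c n ~= 0"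
  "!!ga. ga \<in> Ga ==> (\<Sum>n\<le>card Ga. c n * q n ga) = 0"
 proof -
  have "\<exists>c. (\<forall>n. c n \<in> pf B) \<and> (\<exists>n\<in>{..card Ga}. c n ~= 0) \<and>
   (\<forall>ga\<in>Ga. (\<Sum>n\<le>card Ga. c n * q n ga) = 0)"
  proof (rule linear_dependence_subdomain)
   show "(1 :: 'k ^ 'v => 'k) ~= 0" by (simp add: fun_eq_iff)
   show "x = 0 \<or> y = 0" if "x \<in> pf B" "y \<in> pf B" "x * y = 0" for x y :: "'k ^ 'v => 'k"
    using indep_domain[OF ind that] .
  qed (use Ga q in \<open>auto intro: pf_add pf_mult pf_diff\<close>)
  then show ?thesis using that by blast
 qed
 define P where "P = (\<Sum>n\<le>card Ga. monom (c n * a ^ k n) n)"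
 have coeffP: "coeff P n = c n * a ^ k n" if "n <= card Ga" for n
  unfolding P_def using that by (simp add: coeff_sum coeff_monom)
 have "(\<Sum>n\<le>card Ga. c n * (\<Sum>ga\<in>Ga. q n ga * w ga)) = (\<Sum>n\<le>card Ga. \<Sum>ga\<in>Ga. c n * q n ga * w ga)"
  by (simp only: sum_distrib_left mult.assoc)
 also have "\<dots> = (\<Sum>ga\<in>Ga. (\<Sum>n\<le>card Ga. c n * q n ga) * w ga)"
  by (subst sum.swap) (simp only: sum_distrib_right)
 also have "\<dots> = 0" by (intro sum.neutral ballI) (simp only: c(3) mult_zero_left)
 finally have 0: "(\<Sum>n\<le>card Ga. c n * (\<Sum>ga\<in>Ga. q n ga * w ga)) = 0" .
 have "poly P h = (\<Sum>n\<le>card Ga. c n * (a ^ k n * h ^ n))"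
  unfolding P_def by (simp only: poly_sum poly_monom mult.assoc)
 also have "\<dots> = (\<Sum>n\<le>card Ga. c n * (a ^ k n * h ^ n - (\<Sum>ga\<in>Ga. q n ga * w ga)))"
  by (simp only: right_diff_distrib sum_subtractf 0 diff_zero)
 also have "\<dots> \<in> I"
  by (intro ideal_sum ideal_mult q(2) pf_UNIV[OF c(1)])
 finally have "poly P h \<in> I" .
 moreover have "P \<in> pfpoly B"
  unfolding P_def by (intro pfpoly_sum pfpoly_monom pf_mult pf_power c Ga)
 moreover have "P ~= 0"
 proof -
  obtain n where n: "n <= card Ga" "c n ~= 0" using c(2) by auto
  have "a ^ k n ~= 0" using aI ideal_prime_power[of a "k n"] pf_UNIV[OF Ga(2)] by auto
  then have "c n * a ^ k n ~= 0" using indep_domain[OF ind c(1)[of n] pf_power[OF Ga(2)]] n by blast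
  then show ?thesis using coeffP[OF n(1)] by auto
 qed
 ultimately show ?thesis by blast
qed

text \<open>A relation of least degree takes the place of the minimal polynomial over the fraction
  field of \<open>pf B\<close>. Irreducibility enters only through the last property.\<close>

lemma minimal_relation:
 assumes B: "tr_basis I B" and h: "h \<in> pf UNIV"
 obtains P where "P \<in> pfpoly B" "P ~= 0" "poly P h \<in> I" "degree P > 0"
  "!!Q. Q \<in> pfpoly B ==> poly Q h \<in> I ==> degree Q < degree P ==> Q = 0"
proof -
 define D where "D n \<longleftrightarrow> (\<exists>P\<in>pfpoly B. P ~= 0 \<and> poly P h \<in> I \<and> degree P = n)" for n
 have "\<exists>n. D n" unfolding D_def using tr_basis_algebraic[OF B h] by blast
 then have "D (LEAST n. D n)" by (rule LeastI_ex)
 then obtain P where P: "P \<in> pfpoly B" "P ~= 0" "poly P h \<in> I" "degree P = (LEAST n. D n)"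
  unfolding D_def by blast
 show thesis
 proof (rule that[OF P(1-3)])
  show "degree P > 0" by (rule relation_degree_pos[OF _ P(1-3)]) (use B in \<open>simp add: tr_basis_def\<close>)
  fix Q assume Q: "Q \<in> pfpoly B" "poly Q h \<in> I" "degree Q < degree P"
  show "Q = 0"
  proof (rule ccontr)
   assume "Q ~= 0"
   then have "D (degree Q)" unfolding D_def using Q by blast
   then show False using Q(3) P(4) not_less_Least by metis
  qed
 qed
qed

text \<open>The constant coefficient of a minimal relation is nonzero, since otherwise
  \<open>h\<close> could be cancelled by primality. Hence \<open>h\<close> divides a nonzero element
  of \<open>pf B\<close> modulo \<open>I\<close>; this is the inverse of \<open>h\<close> with its
  denominator cleared.\<close>

lemma clear_denominator:
 assumes B: "tr_basis I B" and h: "h \<in> pf UNIV" "h ~: I"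
 shows "\<exists>Q\<in>pfpoly B. \<exists>a\<in>pf B. a ~= 0 \<and> h * poly Q h - a \<in> I"
proof -
 obtain P where P: "P \<in> pfpoly B" "P ~= 0" "poly P h \<in> I" "degree P > 0"
  "!!Q. Q \<in> pfpoly B ==> poly Q h \<in> I ==> degree Q < degree P ==> Q = 0"
  using minimal_relation[OF B h(1)] by metis
 obtain a P' where aP: "P = pCons a P'" by (cases P)
 have pf: "a \<in> pf B" "P' \<in> pfpoly B" using P(1) pfpoly_pConsD unfolding aP by auto
 have P'0: "P' ~= 0" using P(4) aP by auto
 have "a ~= 0"
 proof
  assume "a = 0"
  then have "h * poly P' h \<in> I" using P(3) aP by simp
  moreover have "poly P' h \<in> pf UNIV" using pf h by (auto intro: pfpoly_poly pfpoly_mono)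
  ultimately have "poly P' h \<in> I" using ideal_prime[of h "poly P' h"] h by blast
  moreover have "degree P' < degree P" using aP P'0 by simp
  ultimately show False using P(5)[OF pf(2)] P'0 by blast
 qed
 moreover have "h * poly (- P') h - a = - poly P h" using aP by (simp add: algebra_simps)
 ultimately show ?thesis using ideal_uminus[OF P(3)] pf by (intro bexI[of _ "- P'"] bexI[of _ a]) (auto intro: pfpoly_uminus)
qed

lemma zerosD: "y \<in> zeros I ==> f \<in> I ==> f y = 0" by (simp add: zeros_def)

text \<open>An open condition on the cone is thus implied by an open condition on the basis
  coordinates alone, which can be chosen freely.\<close>

lemma nonvanishing_over_basis:
 assumes B: "tr_basis I B" and h: "h \<in> pf UNIV" "h ~: I"
 shows "\<exists>a\<in>pf B. a ~= 0 \<and> (\<forall>y\<in>zeros I. a y ~= 0 --> h y ~= 0)"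
proof -
 obtain Q a where *: "a \<in> pf B" "a ~= 0" "h * poly Q h - a \<in> I" using clear_denominator[OF assms] by blast
 have "h y ~= 0" if "y \<in> zeros I" "a y ~= 0" for y
 proof -
  have "h y * poly Q h y - a y = 0" using zerosD[OF that(1) *(3)] by simp
  then show ?thesis using that(2) by auto
 qed
 then show ?thesis using *(1,2) by blast
qed

text \<open>Synthetic division at one good parameter \<open>s0\<close> gives a quotient of lower
  degree whose values at the other good parameters still lie in \<open>I\<close>, because
  \<open>s - s0\<close> is an invertible constant. Induction on the degree replaces a Vandermonde
  determinant.\<close>

lemma infinite_combination:
 assumes P: "P \<in> pfpoly UNIV" and inf: "infinite {s. poly P (\<lambda>_. s) \<in> I}"
 shows "coeff P j \<in> I"
 using assms
proof (induction "degree P" arbitrary: P j rule: less_induct)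
 case less
 obtain s0 where s0: "poly P (\<lambda>_. s0) \<in> I" using infinite_imp_nonempty[OF less.prems(2)] by auto
 show ?case
 proof (cases "degree P = 0")
  case True
  then obtain a where a: "P = [:a:]" by (auto elim: degree_eq_zeroE)
  have "poly P (\<lambda>_. s0) = a" unfolding a by simp
  with s0 have "a \<in> I" by (simp only:)
  then show ?thesis unfolding a by (cases j) auto
 next
  case False
  let ?c = "\<lambda>_::'k ^ 'v. s0"
  define Q where "Q = synthetic_div P ?c"
  have PQ: "P + Polynomial.smult ?c Q = pCons (poly P ?c) Q"
   unfolding Q_def by (rule synthetic_div_correct)
  have Qpf: "Q \<in> pfpoly UNIV"
  proof -
   have "!!P. P \<in> pfpoly UNIV ==> synthetic_div P ?c \<in> pfpoly UNIV"
   proof -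
    fix P :: "('k ^ 'v => 'k) poly" assume "P \<in> pfpoly UNIV"
    then show "synthetic_div P ?c \<in> pfpoly UNIV"
     by (induction P) (auto dest!: pfpoly_pConsD intro!: pfpoly_pCons pfpoly_poly pf_const)
   qed
   then show ?thesis unfolding Q_def using less.prems by blast
  qed
  have eq: "poly P (\<lambda>_. s) = poly P ?c + (\<lambda>_. s - s0) * poly Q (\<lambda>_. s)" for s
  proof -
   have "poly P (\<lambda>_. s) y + s0 * poly Q (\<lambda>_. s) y = poly P ?c y + s * poly Q (\<lambda>_. s) y" for y
    using arg_cong[OF PQ, of "\<lambda>R. poly R (\<lambda>_. s) y"] by simp
   then have "poly P (\<lambda>_. s) y = poly P ?c y + s * poly Q (\<lambda>_. s) y - s0 * poly Q (\<lambda>_. s) y" for y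
    by (simp only: eq_diff_eq)
   then show ?thesis by (simp add: fun_eq_iff left_diff_distrib)
  qed
  have "{s. poly P (\<lambda>_. s) \<in> I} - {s0} \<subseteq> {s. poly Q (\<lambda>_. s) \<in> I}"
  proof clarify
   fix s assume s: "poly P (\<lambda>_. s) \<in> I" "s ~= s0"
   have "poly P (\<lambda>_. s) - poly P ?c \<in> I" using s s0 by (intro ideal_diff)
   then have "(\<lambda>_. s - s0) * poly Q (\<lambda>_. s) \<in> I" by (simp only: eq[of s] add_diff_cancel_left')
   then have "(\<lambda>_. inverse (s - s0)) * ((\<lambda>_. s - s0) * poly Q (\<lambda>_. s)) \<in> I"
    by (rule ideal_mult[OF _ pf_const])
   also have "(\<lambda>_. inverse (s - s0)) * ((\<lambda>_. s - s0) * poly Q (\<lambda>_. s)) = poly Q (\<lambda>_. s)"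
    using s by (simp add: fun_eq_iff)
   finally show "poly Q (\<lambda>_. s) \<in> I" .
  qed
  moreover have "infinite ({s. poly P (\<lambda>_. s) \<in> I} - {s0})" using less.prems(2) by simp
  ultimately have "infinite {s. poly Q (\<lambda>_. s) \<in> I}" using infinite_super by blast
  moreover have "degree Q < degree P" unfolding Q_def degree_synthetic_div using False by simp
  ultimately have Q: "coeff Q j \<in> I" for j using less.hyps Qpf by blast
  have "P = pCons (poly P ?c) Q - Polynomial.smult ?c Q" using PQ by (simp add: algebra_simps)
  then have "coeff P j = coeff (pCons (poly P ?c) Q) j - ?c * coeff Q j" by (metis coeff_diff coeff_smult)
  also have "\<dots> \<in> I" using Q s0
   by (intro ideal_diff ideal_mult pf_const) (auto simp: coeff_pCons split: nat.split)
  finally show ?thesis .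
 qed
qed

end

section \<open>Primitive elements\<close>

lemma simple_roots_split:
 fixes p :: "'k::{alg_closed_field} poly"
 assumes "p ~= 0" "!!z. poly p z = 0 ==> poly (pderiv p) z ~= 0"
 shows "finite {z. poly p z = 0} \<and> card {z. poly p z = 0} = degree p \<and>
  (\<forall>ze. poly p ze = lead_coeff p * (\<Prod>z\<in>{z. poly p z = 0}. (ze - z)))"
 using assms
proof (induction "degree p" arbitrary: p)
 case 0
 then obtain a where p: "p = [:a:]" using degree_eq_zeroE[of p] by metis
 with 0 have "a ~= 0" by simp
 with p show ?case by simp
next
 case (Suc n)
 then obtain x where x: "poly p x = 0"
  using alg_closed_imp_poly_has_root[of p] by auto
 then have "[:-x, 1:] dvd p" by (simp only: poly_eq_0_iff_dvd)
 then obtain q where q: "p = [:-x, 1:] * q" by (rule dvdE)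
 have q0: "q ~= 0" using q Suc.prems by auto
 have deg: "degree p = Suc (degree q)" unfolding q using q0 by (subst degree_mult_eq) auto
 have pd: "poly (pderiv p) z = poly q z + (z - x) * poly (pderiv q) z" for z
  unfolding q pderiv_mult by (simp add: pderiv_pCons algebra_simps)
 have qx: "poly q x ~= 0" using Suc.prems(2)[OF x] pd[of x] by simp
 have pq: "poly (pderiv q) z ~= 0" if "poly q z = 0" for z
 proof -
  have "poly p z = 0" using that unfolding q by simp
  from Suc.prems(2)[OF this] show ?thesis using pd[of z] that by auto
 qed
 have "n = degree q" using deg Suc.hyps(2) by simp
 note H = Suc.hyps(1)[OF this q0 pq]
 note IH = H[THEN conjunct1] H[THEN conjunct2, THEN conjunct1] H[THEN conjunct2, THEN conjunct2, rule_format]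
 have roots: "{z. poly p z = 0} = insert x {z. poly q z = 0}" unfolding q by auto
 have lc: "lead_coeff p = lead_coeff q" unfolding q by (simp only: lead_coeff_mult) simp
 have "\<forall>ze. poly p ze = lead_coeff p * (\<Prod>z\<in>{z. poly p z = 0}. (ze - z))"
 proof
  fix ze
  have "poly p ze = (ze - x) * poly q ze" unfolding q by (simp add: algebra_simps)
  also have "\<dots> = (ze - x) * (lead_coeff q * (\<Prod>z\<in>{z. poly q z = 0}. (ze - z)))"
   by (rule arg_cong[OF IH(3)], assumption)
  also have "\<dots> = lead_coeff p * (\<Prod>z\<in>{z. poly p z = 0}. (ze - z))"
   unfolding roots lc using IH(1) qx by (subst prod.insert) auto
  finally show "poly p ze = lead_coeff p * (\<Prod>z\<in>{z. poly p z = 0}. (ze - z))" .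
 qed
 moreover have "finite {z. poly p z = 0}" unfolding roots using IH(1) by simp
 moreover have "card {z. poly p z = 0} = degree p"
  unfolding roots using IH(1,2) qx deg by (subst card_insert_disjoint) auto
 ultimately show ?case by blast
qed

lemma pfpoly_at_cong:
 assumes "P \<in> pfpoly B" "!!b. b \<in> B ==> y $ b = z $ b"
 shows "poly P (\<lambda>_. s) y = poly P (\<lambda>_. s) z"
 using assms(1)
proof (induction P)
 case 0 show ?case by (simp only: poly_0 zero_fun_apply)
next
 case (pCons a P)
 have aP: "a \<in> pf B" "P \<in> pfpoly B" using pfpoly_pConsD[OF pCons.prems(1)] by (rule conjunct1, rule conjunct2)
 have 1: "a y = a z" by (rule pf_cong_coords[OF aP(1) assms(2)])
 have 2: "poly P (\<lambda>_. s) y = poly P (\<lambda>_. s) z" by (rule pCons.IH[OF aP(2)])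
 show ?case by (simp only: poly_pCons plus_fun_apply times_fun_apply 1 2)
qed

context pf_prime
begin

lemma combination_in_ideal:
 assumes "!!j. coeff P j \<in> I" "h \<in> pf UNIV"
 shows "poly P h \<in> I"
 unfolding poly_altdef using assms by (intro ideal_sum ideal_mult_right pf_power)

lemma pseudo_division:
 assumes G: "G \<in> pfpoly B" "degree G > 0" and R: "R \<in> pfpoly B"
 shows "\<exists>M. \<exists>Q\<in>pfpoly B. \<exists>S\<in>pfpoly B. degree S < degree G \<and>
  Polynomial.smult (lead_coeff G ^ M) R = Q * G + S"
 using R
proof (induction "degree R" arbitrary: R rule: less_induct)
 case less
 show ?case
 proof (cases "degree R < degree G")
  case True
  then show ?thesis using less.prems by (intro exI[of _ 0] bexI[of _ 0] bexI[of _ R]) auto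
 next
  case False
  define g where "g = lead_coeff G"
  define m where "m = monom (lead_coeff R) (degree R - degree G)"
  define R' where "R' = Polynomial.smult g R - m * G"
  have mpf: "m \<in> pfpoly B" unfolding m_def by (intro pfpoly_monom pfpolyD less.prems)
  have gpf: "g \<in> pf B" unfolding g_def by (intro pfpolyD G)
  have R'pf: "R' \<in> pfpoly B" unfolding R'_def by (intro pfpoly_diff pfpoly_smult pfpoly_mult mpf gpf less.prems G)
  have "degree (m * G) <= degree R"
   using degree_mult_le[of m G] degree_monom_le[of "lead_coeff R" "degree R - degree G"] False
   unfolding m_def by linarith
  then have le: "degree R' <= degree R" unfolding R'_def
   by (intro degree_diff_le) (auto intro: order_trans[OF degree_smult_le])
  have "coeff (m * G) (degree R) = lead_coeff R * g"
   unfolding m_def coeff_monom_mult g_def using False by simp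
  then have "coeff R' (degree R) = 0" unfolding R'_def by (simp add: mult.commute)
  then have "degree R' < degree R" using le False G(2)
   by (metis degree_0 leading_coeff_0_iff le_neq_implies_less not_less)
  from less.hyps[OF this R'pf] obtain M Q S where S: "Q \<in> pfpoly B" "S \<in> pfpoly B" "degree S < degree G"
   "Polynomial.smult (lead_coeff G ^ M) R' = Q * G + S" by blast
  have "Polynomial.smult (g ^ M) (Polynomial.smult g R - m * G) = Q * G + S"
   using S(4) unfolding R'_def g_def .
  then have "Polynomial.smult (g ^ Suc M) R = (Q + Polynomial.smult (g ^ M) m) * G + S"
   by (simp add: smult_diff_right algebra_simps smult_add_right)
  then show ?thesis unfolding g_def[symmetric] using S mpf gpf
   by (intro exI[of _ "Suc M"] bexI[of _ "Q + Polynomial.smult (g ^ M) m"] bexI[of _ S])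
    (auto simp: g_def intro!: pfpoly_add pfpoly_smult pf_power)
 qed
qed

lemma zderiv_nonzero:
 fixes P :: "('k ^ 'v => 'k) poly"
 assumes "degree P > 0"
 shows "zderiv P ~= 0" "degree (zderiv P) < degree P"
proof -
 obtain n where n: "degree P = Suc n" using assms by (cases "degree P") auto
 have "lead_coeff P ~= 0" using assms by auto
 then obtain y where "lead_coeff P y ~= 0" by (auto simp: fun_eq_iff)
 then have "coeff (zderiv P) n y ~= 0" by (simp add: coeff_zderiv of_nat_fun_apply n del: of_nat_Suc)
 then show "zderiv P ~= 0" by auto
 have "degree (zderiv P) <= n"
  by (rule degree_le) (auto simp: coeff_zderiv n coeff_eq_0)
 then show "degree (zderiv P) < degree P" using n by simp
qed

text \<open>The hypothesis on \<open>H\<close> says that every coordinate is the quotient of two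
  polynomials in \<open>te\<close> over \<open>pf B\<close>. A point of a generic fibre is then
  determined by its value of \<open>te\<close>, and conversely every root of the specialized minimal
  relation gives a point.\<close>

lemma primitive_element_core:
 assumes B: "tr_basis I B" and th: "te \<in> pf UNIV"
  and D: "D \<in> pfpoly B" "poly D te ~: I"
  and H: "!!i. H i \<in> pfpoly B" "!!i. (\<lambda>x. x $ i) * poly D te - poly (H i) te \<in> I"
 shows "\<exists>a\<in>pf B. \<exists>G\<in>pfpoly B. a ~= 0 \<and> degree G > 0 \<and> lead_coeff G ~= 0 \<and> poly G te \<in> I \<and>
  (\<forall>y. a y ~= 0 --> (let Y = {z\<in>zeros I. \<forall>b\<in>B. z $ b = y $ b} in finite Y \<and> card Y = degree G \<and>
   lead_coeff G y ~= 0 \<and> (\<forall>ze. poly G (\<lambda>_. ze) y = lead_coeff G y * (\<Prod>z\<in>Y. (ze - te z)))))"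
proof -
 have ind: "alg_indep I B" using B by (simp add: tr_basis_def)
 have toU: "P \<in> pfpoly UNIV" if "P \<in> pfpoly B" for P using that by (rule pfpoly_mono) simp
 define X :: "'v => 'k ^ 'v => 'k" where "X i = (\<lambda>x. x $ i)" for i
 have Xpf: "X i \<in> pf UNIV" for i unfolding X_def by (intro pf_coord) simp
 obtain Q a1 where Q: "Q \<in> pfpoly B" "a1 \<in> pf B" "a1 ~= 0" "poly D te * poly Q (poly D te) - a1 \<in> I"
  using clear_denominator[OF B pfpoly_poly[OF toU[OF D(1)] th] D(2)] by blast
 \<comment> \<open>Multiplication by the cofactor of \<open>D\<close> replaces the denominator
   \<open>poly D te\<close> by \<open>a1\<close>, which depends on the basis coordinates
   only.\<close>
 define H' where "H' i = H i * pcompose Q D" for i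
 have H'pf: "H' i \<in> pfpoly B" for i unfolding H'_def by (intro pfpoly_mult H pfpoly_pcompose Q D)
 have H': "X i * a1 - poly (H' i) te \<in> I" for i
 proof -
  have "poly (pcompose Q D) te * (X i * poly D te - poly (H i) te)
   - X i * (poly D te * poly Q (poly D te) - a1) \<in> I"
   by (rule ideal_diff[OF ideal_mult[OF H(2)[of i, folded X_def] pfpoly_poly[OF toU th]]
    ideal_mult[OF Q(4) Xpf]]) (intro pfpoly_pcompose Q D)
  also have "poly (pcompose Q D) te * (X i * poly D te - poly (H i) te)
   - X i * (poly D te * poly Q (poly D te) - a1) = X i * a1 - poly (H' i) te"
   unfolding H'_def poly_mult poly_pcompose by (simp add: algebra_simps)
  finally show ?thesis .
 qed
 obtain G where G: "G \<in> pfpoly B" "G ~= 0" "poly G te \<in> I" "degree G > 0"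
  and Gmin: "!!Q. Q \<in> pfpoly B ==> poly Q te \<in> I ==> degree Q < degree G ==> Q = 0"
  using minimal_relation[OF B th] by blast
 define g where "g = lead_coeff G"
 have g: "g \<in> pf B" "g ~= 0" unfolding g_def using G by (auto intro: pfpolyD)
 define E where "E = zderiv G"
 have E: "E \<in> pfpoly B" "poly E te ~: I"
  unfolding E_def using G zderiv_nonzero[of G] Gmin[of "zderiv G"] by (auto intro: pfpoly_zderiv)
 obtain Q2 a2 where Q2: "Q2 \<in> pfpoly B" "a2 \<in> pf B" "a2 ~= 0" "poly E te * poly Q2 (poly E te) - a2 \<in> I"
  using clear_denominator[OF B pfpoly_poly[OF toU[OF E(1)] th] E(2)] by blast
 \<comment> \<open>The factor \<open>a1\<close> allows the coordinates to be recovered from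
   \<open>te\<close>, \<open>a2\<close> keeps the roots of \<open>G\<close> simple, and
   \<open>g\<close> keeps the degree of \<open>G\<close> from dropping.\<close>
 define a where "a = a1 * (a2 * g)"
 have a: "a \<in> pf B" unfolding a_def by (intro pf_mult Q Q2 g)
 have a0: "a ~= 0"
  using indep_domain[OF ind Q(2) pf_mult[OF Q2(2) g(1)]] indep_domain[OF ind Q2(2) g(1)] Q(3) Q2(3) g(2)
  unfolding a_def by blast
 \<comment> \<open>A relation of \<open>te\<close> is a multiple of \<open>G\<close> up to powers of
   \<open>g\<close>: the remainder of the pseudo-division is again a relation, of smaller degree,
   hence zero. So relations survive when \<open>te\<close> is replaced by a root of \<open>G\<close>
   at \<open>y\<close>.\<close>
 have spec: "poly R (\<lambda>_. z) y = 0"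
  if R: "R \<in> pfpoly B" "poly R te \<in> I" and y: "g y ~= 0" "poly G (\<lambda>_. z) y = 0" for R z y
 proof -
  obtain M Q S where S: "Q \<in> pfpoly B" "S \<in> pfpoly B" "degree S < degree G"
   "Polynomial.smult (g ^ M) R = Q * G + S"
   using pseudo_division[OF G(1,4) R(1)] unfolding g_def by blast
  have "g ^ M * poly R te = poly Q te * poly G te + poly S te"
   using arg_cong[OF S(4), of "\<lambda>P. poly P te"] by simp
  then have "poly S te = g ^ M * poly R te - poly Q te * poly G te" by (simp add: algebra_simps)
  also have "\<dots> \<in> I"
   by (intro ideal_diff ideal_mult pfpoly_poly toU S th pf_power R G pf_UNIV[OF g(1)])
  finally have "S = 0" using Gmin S by blast
  then have "g y ^ M * poly R (\<lambda>_. z) y = poly Q (\<lambda>_. z) y * poly G (\<lambda>_. z) y"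
   using arg_cong[OF S(4), of "\<lambda>P. poly P (\<lambda>_. z) y"] by simp
  then show ?thesis using y by simp
 qed
 define w where "w y z = (\<chi> i. poly (H' i) (\<lambda>_. z) y / a1 y)" for y z
 have subst: "\<exists>M. \<exists>R\<in>pfpoly B. a1 ^ M * f - poly R te \<in> I \<and>
   (\<forall>y z. a1 y ~= 0 --> a1 y ^ M * f (w y z) = poly R (\<lambda>_. z) y)" if "f \<in> pf UNIV" for f
  using that
 proof (induction rule: pf.induct)
  case (pf_const c)
  have "a1 ^ 0 * (\<lambda>_. c) - poly [:\<lambda>_. c:] te = 0" by (simp add: fun_eq_iff)
  then have 1: "a1 ^ 0 * (\<lambda>_. c) - poly [:\<lambda>_. c:] te \<in> I" by (simp only: ideal_zero)
  show ?case
   by (intro exI[of _ 0] bexI[of _ "[:\<lambda>_. c:]"] conjI 1) (simp_all add: pfpoly_const pf.pf_const)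
 next
  case (pf_coord i)
  have 1: "a1 ^ 1 * (\<lambda>x. x $ i) - poly (H' i) te \<in> I"
   using H'[of i] unfolding X_def by (simp only: power_one_right mult.commute)
  show ?case
   by (intro exI[of _ 1] bexI[of _ "H' i"] conjI 1) (auto simp: w_def H'pf)
 next
  case (pf_add f f')
  then obtain M R M' R' where R: "R \<in> pfpoly B" "a1 ^ M * f - poly R te \<in> I"
    "!!y z. a1 y ~= 0 ==> a1 y ^ M * f (w y z) = poly R (\<lambda>_. z) y"
   and R': "R' \<in> pfpoly B" "a1 ^ M' * f' - poly R' te \<in> I"
    "!!y z. a1 y ~= 0 ==> a1 y ^ M' * f' (w y z) = poly R' (\<lambda>_. z) y" by blast
  define S where "S = Polynomial.smult (a1 ^ M') R + Polynomial.smult (a1 ^ M) R'"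
  have "a1 ^ M' * (a1 ^ M * f - poly R te) + a1 ^ M * (a1 ^ M' * f' - poly R' te) \<in> I"
   by (intro ideal_add ideal_mult R R' pf_power pf_UNIV[OF Q(2)])
  also have "a1 ^ M' * (a1 ^ M * f - poly R te) + a1 ^ M * (a1 ^ M' * f' - poly R' te) =
   a1 ^ (M + M') * (f + f') - poly S te"
   unfolding S_def by (simp add: algebra_simps power_add)
  finally have 1: "a1 ^ (M + M') * (f + f') - poly S te \<in> I" .
  have 2: "a1 y ^ (M + M') * (f + f') (w y z) = poly S (\<lambda>_. z) y" if "a1 y ~= 0" for y z
   unfolding S_def by (simp add: power_add algebra_simps flip: R(3)[OF that] R'(3)[OF that])
  show ?case by (intro exI[of _ "M + M'"] bexI[of _ S] conjI 1 allI impI 2)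
   (auto simp: S_def intro!: pfpoly_add pfpoly_smult pf_power Q R R')
 next
  case (pf_mult f f')
  then obtain M R M' R' where R: "R \<in> pfpoly B" "a1 ^ M * f - poly R te \<in> I"
    "!!y z. a1 y ~= 0 ==> a1 y ^ M * f (w y z) = poly R (\<lambda>_. z) y"
   and R': "R' \<in> pfpoly B" "a1 ^ M' * f' - poly R' te \<in> I"
    "!!y z. a1 y ~= 0 ==> a1 y ^ M' * f' (w y z) = poly R' (\<lambda>_. z) y" by blast
  have "(a1 ^ M' * f') * (a1 ^ M * f - poly R te) + poly R te * (a1 ^ M' * f' - poly R' te) \<in> I"
   by (intro ideal_add ideal_mult R(2) R'(2) pf.pf_mult pf_power pf_UNIV[OF Q(2)] pfpoly_poly toU R(1) th pf_mult.hyps)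
  also have "(a1 ^ M' * f') * (a1 ^ M * f - poly R te) + poly R te * (a1 ^ M' * f' - poly R' te) =
   a1 ^ (M + M') * (f * f') - poly (R * R') te"
   by (simp add: algebra_simps power_add)
  finally have 1: "a1 ^ (M + M') * (f * f') - poly (R * R') te \<in> I" .
  have 2: "a1 y ^ (M + M') * (f * f') (w y z) = poly (R * R') (\<lambda>_. z) y" if "a1 y ~= 0" for y z
   by (simp add: power_add algebra_simps flip: R(3)[OF that] R'(3)[OF that])
  show ?case by (intro exI[of _ "M + M'"] bexI[of _ "R * R'"] conjI 1 allI impI 2 pfpoly_mult R R')
 qed
 have main: "finite Y \<and> card Y = degree G \<and> g y ~= 0 \<and>
   (\<forall>ze. poly G (\<lambda>_. ze) y = g y * (\<Prod>z\<in>Y. (ze - te z)))"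
  if ay: "a y ~= 0" and Y: "Y = {z\<in>zeros I. \<forall>b\<in>B. z $ b = y $ b}" for y Y
 proof -
  have y: "a1 y ~= 0" "a2 y ~= 0" "g y ~= 0" using ay unfolding a_def by auto
  define p where "p = at_pt y G"
  have pp: "poly p z = poly G (\<lambda>_. z) y" for z unfolding p_def by (rule poly_at_pt)
  have degp: "degree p = degree G"
   using y(3) unfolding p_def g_def by (intro antisym le_degree degree_at_pt) simp
  have lcp: "lead_coeff p = g y" unfolding degp unfolding p_def g_def by simp
  then have p0: "p ~= 0" using y by auto
  have simple: "poly (pderiv p) z ~= 0" if "poly p z = 0" for z
  proof -
   \<comment> \<open>The identity \<open>E * Q2(E) = a2\<close> holds for \<open>te\<close> modulo
     \<open>I\<close> and passes to every root by \<open>spec\<close>. As \<open>a2 y\<close> is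
     nonzero, the derivative \<open>E\<close> cannot vanish there.\<close>
   define R where "R = E * pcompose Q2 E - [:a2:]"
   have "poly R te = poly E te * poly Q2 (poly E te) - a2"
    unfolding R_def by (simp add: poly_pcompose)
   then have "poly R te \<in> I" using Q2 by simp
   moreover have "R \<in> pfpoly B" unfolding R_def by (intro pfpoly_diff pfpoly_mult E pfpoly_pcompose Q2 pfpoly_const)
   ultimately have "poly R (\<lambda>_. z) y = 0" using spec that y unfolding pp by blast
   then have "poly E (\<lambda>_. z) y ~= 0" using y(2) unfolding R_def by auto
   then show ?thesis unfolding p_def pderiv_at_pt poly_at_pt E_def .
  qed
  define Z where "Z = {z. poly p z = 0}"
  have Z: "finite Z" "card Z = degree G" "!!ze. poly p ze = g y * (\<Prod>z\<in>Z. (ze - z))"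
  proof -
   have S: "finite {z. poly p z = 0} \<and> card {z. poly p z = 0} = degree p \<and>
    (\<forall>ze. poly p ze = lead_coeff p * (\<Prod>z\<in>{z. poly p z = 0}. (ze - z)))"
    by (rule simple_roots_split[OF p0 simple])
   then show "finite Z" "card Z = degree G" unfolding Z_def degp by blast+
   show "poly p ze = g y * (\<Prod>z\<in>Z. (ze - z))" for ze
    using S[THEN conjunct2, THEN conjunct2, rule_format, of ze] unfolding lcp Z_def .
  qed
  have wI: "w y z \<in> zeros I" and wB: "!!b. b \<in> B ==> w y z $ b = y $ b" and wth: "te (w y z) = z"
   if z: "z \<in> Z" for z
  proof -
   have root: "poly G (\<lambda>_. z) y = 0" using z unfolding Z_def pp by simp
   show "w y z \<in> zeros I" unfolding zeros_def
   proof (intro CollectI ballI)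
    fix f assume f: "f \<in> I"
    obtain M R where R: "R \<in> pfpoly B" "a1 ^ M * f - poly R te \<in> I"
     "a1 y ^ M * f (w y z) = poly R (\<lambda>_. z) y" using subst[OF ideal_pf[OF f]] y by blast
    have "poly R te = a1 ^ M * f - (a1 ^ M * f - poly R te)" by simp
    also have "\<dots> \<in> I" by (intro ideal_diff R(2) ideal_mult f pf_power pf_UNIV[OF Q(2)])
    finally have "poly R (\<lambda>_. z) y = 0" using spec[OF R(1) _ y(3) root] by blast
    then show "f (w y z) = 0" using R(3) y by simp
   qed
   show "w y z $ b = y $ b" if b: "b \<in> B" for b
   proof -
    have "[:X b * a1:] - H' b \<in> pfpoly B"
     unfolding X_def by (intro pfpoly_diff pfpoly_const pf_mult pf_coord b Q H'pf)
    moreover have "poly ([:X b * a1:] - H' b) te \<in> I" using H'[of b] by simp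
    ultimately have "poly ([:X b * a1:] - H' b) (\<lambda>_. z) y = 0" using spec y(3) root by blast
    then show ?thesis using y unfolding w_def X_def by (simp add: field_simps)
   qed
   obtain M R where R: "R \<in> pfpoly B" "a1 ^ M * te - poly R te \<in> I"
    "a1 y ^ M * te (w y z) = poly R (\<lambda>_. z) y" using subst[OF th] y by blast
   have "[:0, a1 ^ M:] - R \<in> pfpoly B" by (intro pfpoly_diff pfpoly_pCons pf_power Q R pf_zero pfpoly_zero)
   moreover have "poly ([:0, a1 ^ M:] - R) te \<in> I" using R(2) by (simp add: mult.commute)
   ultimately have "poly ([:0, a1 ^ M:] - R) (\<lambda>_. z) y = 0" using spec y(3) root by blast
   then have "a1 y ^ M * te (w y z) = a1 y ^ M * z" using R(3) by (simp add: mult.commute)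
   then show "te (w y z) = z" using y by simp
  qed
  have Yw: "Y = w y ` Z"
  proof
   show "w y ` Z \<subseteq> Y" unfolding Y using wI wB by auto
   show "Y \<subseteq> w y ` Z"
   proof
    fix x assume "x \<in> Y"
    then have x: "x \<in> zeros I" "!!b. b \<in> B ==> x $ b = y $ b" unfolding Y by auto
    have "poly G te x = 0" using zerosD[OF x(1) G(3)] .
    then have "poly G (\<lambda>_. te x) y = 0"
     using poly_fun_apply[of G te x] pfpoly_at_cong[OF G(1), of x y] x(2) by simp
    then have "te x \<in> Z" unfolding Z_def pp by simp
    moreover have "w y (te x) = x"
    proof -
     have "x $ i = poly (H' i) (\<lambda>_. te x) y / a1 y" for i
     proof -
      have "x $ i * a1 x = poly (H' i) te x" using zerosD[OF x(1) H'[of i]] unfolding X_def by simp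
      moreover have "a1 x = a1 y" by (rule pf_cong_coords[OF Q(2) x(2)])
      moreover have "poly (H' i) te x = poly (H' i) (\<lambda>_. te x) y"
       using poly_fun_apply[of "H' i" te x] pfpoly_at_cong[OF H'pf, of x y] x(2) by simp
      ultimately show ?thesis using y by (simp add: field_simps)
     qed
     then show ?thesis unfolding w_def by (simp add: cart_eq_iff)
    qed
    ultimately show "x \<in> w y ` Z" by (metis imageI)
   qed
  qed
  have inj: "inj_on (w y) Z" by (rule inj_on_inverseI[of _ te]) (rule wth)
  have prod: "(\<Prod>z\<in>Y. (ze - te z)) = (\<Prod>z\<in>Z. (ze - z))" for ze
   unfolding Yw by (subst prod.reindex[OF inj]) (auto intro!: prod.cong simp: wth)
  have cardY: "card Y = card Z" unfolding Yw by (rule card_image[OF inj])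
  show ?thesis
  proof (intro conjI allI)
   show "finite Y" unfolding Yw using Z by simp
   show "card Y = degree G" using cardY Z by simp
   show "g y ~= 0" by fact
   show "poly G (\<lambda>_. ze) y = g y * (\<Prod>z\<in>Y. (ze - te z))" for ze
    unfolding prod pp[symmetric] by (rule Z)
  qed
 qed
 show ?thesis
 proof (intro bexI[OF _ a] bexI[OF _ G(1)] conjI a0 G(4,3) allI impI)
  show "lead_coeff G ~= 0" using g(2) unfolding g_def .
  fix y assume "a y ~= 0"
  from main[OF this refl, unfolded g_def]
  show "let Y = {z\<in>zeros I. \<forall>b\<in>B. z $ b = y $ b} in finite Y \<and> card Y = degree G \<and>
   lead_coeff G y ~= 0 \<and> (\<forall>ze. poly G (\<lambda>_. ze) y = lead_coeff G y * (\<Prod>z\<in>Y. (ze - te z)))"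
   unfolding Let_def .
 qed
qed

end

section \<open>Pairs of points, and derivatives of relations\<close>

definition jn :: "'k ^ 'a::finite => 'k ^ 'b::finite => 'k ^ ('a + 'b)" where
 "jn u x = (\<chi> i. case i of Inl a => u $ a | Inr b => x $ b)"

lemma jn_Inl [simp]: "jn u x $ Inl i = u $ i" and jn_Inr [simp]: "jn u x $ Inr j = x $ j"
 by (simp_all add: jn_def)

definition pr1 :: "'k ^ ('a::finite + 'b::finite) => 'k ^ 'a" where "pr1 z = (\<chi> i. z $ Inl i)"
definition pr2 :: "'k ^ ('a::finite + 'b::finite) => 'k ^ 'b" where "pr2 z = (\<chi> i. z $ Inr i)"

lemma jn_pr: "jn (pr1 z) (pr2 z) = z"
 unfolding cart_eq_iff
proof
 fix i show "jn (pr1 z) (pr2 z) $ i = z $ i" by (cases i) (simp_all add: pr1_def pr2_def)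
qed

lemma pr1_jn [simp]: "pr1 (jn u x) = u" and pr2_jn [simp]: "pr2 (jn u x) = x"
 by (simp_all add: pr1_def pr2_def cart_eq_iff)

lemma pf_jn:
 assumes "f \<in> pf S" "!!j. Inr j \<in> S ==> j \<in> T"
 shows "(\<lambda>x. f (jn u x)) \<in> pf T"
proof (rule pf_compose[OF assms(1)])
 fix i assume "i \<in> S"
 then show "(\<lambda>x. jn u x $ i) \<in> pf T"
  using assms(2) by (cases i) (auto intro: pf_const pf_coord)
qed

lemma pf_pr2: "f \<in> pf S ==> (\<lambda>z. f (pr2 z)) \<in> pf (Inr ` S)"
 by (erule pf_compose) (auto simp: pr2_def intro: pf_coord)

lemma pf_pr1: "f \<in> pf S ==> (\<lambda>z. f (pr1 z)) \<in> pf (Inl ` S)"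
 by (erule pf_compose) (auto simp: pr1_def intro: pf_coord)

definition comp_poly :: "('b => 'a) => ('a => 'k::comm_ring_1) poly => ('b => 'k) poly" where
 "comp_poly ph P = map_poly (\<lambda>f x. f (ph x)) P"

lemma coeff_comp_poly: "coeff (comp_poly ph P) j = (\<lambda>x. coeff P j (ph x))"
proof -
 have "(\<lambda>x. (0 :: 'c => 'b) (ph x)) = 0" by (rule ext) simp
 then show ?thesis by (simp add: comp_poly_def coeff_map_poly)
qed

lemma comp_poly_pCons: "comp_poly ph (pCons a P) = pCons (\<lambda>x. a (ph x)) (comp_poly ph P)"
proof (rule poly_eqI)
 fix n show "coeff (comp_poly ph (pCons a P)) n = coeff (pCons (\<lambda>x. a (ph x)) (comp_poly ph P)) n"
  by (cases n) (simp_all add: coeff_comp_poly)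
qed

lemma comp_poly_0: "comp_poly ph 0 = 0"
 by (rule poly_eqI, rule ext) (simp add: coeff_comp_poly)

lemma poly_comp_poly: "poly (comp_poly ph P) (\<lambda>x. h (ph x)) x = poly P h (ph x)"
 by (induction P) (auto simp: comp_poly_pCons comp_poly_0)

lemma coeff_pow_linear:
 fixes a b :: "'r::comm_ring_1"
 shows "coeff ([:a, b:] ^ n) 0 = a ^ n" "coeff ([:a, b:] ^ n) 1 = of_nat n * a ^ (n - 1) * b"
proof -
 show 0: "coeff ([:a, b:] ^ n) 0 = a ^ n" for n by (induction n) (auto simp: mult_pCons_left)
 show "coeff ([:a, b:] ^ n) 1 = of_nat n * a ^ (n - 1) * b"
 proof (induction n)
  case (Suc n)
  have "coeff ([:a, b:] ^ Suc n) 1 = a * coeff ([:a, b:] ^ n) 1 + b * coeff ([:a, b:] ^ n) 0"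
   by (simp add: mult_pCons_left)
  also have "\<dots> = of_nat (Suc n) * a ^ (Suc n - 1) * b"
   unfolding Suc 0 by (cases n) (auto simp: algebra_simps)
  finally show ?case .
 qed simp
qed

lemma coeff_mult_1: "coeff (p * q) 1 = coeff p 0 * coeff q 1 + coeff p 1 * coeff q 0"
 by (simp add: coeff_mult)

text \<open>The derivative of a family of relations \<open>P(u, te) = 0\<close> in the direction of \<open>u\<^sub>i\<close>.\<close>

lemma relation_line:
 fixes te X :: "'k::comm_ring_1 ^ 'w::finite => 'k"
 assumes P: "P \<in> pfpoly S" and th: "te \<in> pf UNIV" "X \<in> pf UNIV"
  and thv: "!!z s. te (z + s *s v) = te z + s * X z"
 shows "\<exists>DP\<in>pfpoly S. \<exists>F\<in>pfpoly UNIV. (\<forall>z s. poly P te (z + s *s v) = poly F (\<lambda>_. s) z) \<and>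
  coeff F 1 = poly DP te + X * poly (zderiv P) te"
proof -
 have "\<forall>j. \<exists>L. L \<in> pfpoly S \<and> (\<forall>z s. coeff P j (z + s *s v) = poly L (\<lambda>_. s) z)"
  using pf_line[OF pfpolyD[OF P]] by blast
 then obtain L where "\<forall>j. L j \<in> pfpoly S \<and> (\<forall>z s. coeff P j (z + s *s v) = poly (L j) (\<lambda>_. s) z)"
  by (rule choice[THEN exE])
 then have L: "!!j. L j \<in> pfpoly S" "!!j z s. coeff P j (z + s *s v) = poly (L j) (\<lambda>_. s) z"
  by simp_all
 have L0: "coeff (L j) 0 = coeff P j" for j
 proof
  fix z
  have "poly (L j) (\<lambda>_. 0) z = coeff (L j) 0 z"
   by (simp add: poly_0_coeff_0[symmetric] zero_fun_def)
  then show "coeff (L j) 0 z = coeff P j z" using L(2)[of j z 0] by simp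
 qed
 \<comment> \<open>\<open>DP\<close> differentiates the coefficients of the relation; the linear
   term of \<open>(te + s * X) ^ j\<close> accounts for the other summand.\<close>
 define DP where "DP = (\<Sum>j\<le>degree P. monom (coeff (L j) 1) j)"
 define F where "F = (\<Sum>j\<le>degree P. L j * [:te, X:] ^ j)"
 have "poly P te (z + s *s v) = poly F (\<lambda>_. s) z" for z s
 proof -
  have "poly P te (z + s *s v) = (\<Sum>j\<le>degree P. coeff P j (z + s *s v) * te (z + s *s v) ^ j)"
   unfolding poly_altdef by simp
  also have "\<dots> = (\<Sum>j\<le>degree P. poly (L j) (\<lambda>_. s) z * (te z + s * X z) ^ j)"
   by (simp only: L(2) thv)
  also have "\<dots> = poly F (\<lambda>_. s) z"
   unfolding F_def by (simp add: poly_sum)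
  finally show ?thesis .
 qed
 moreover have "coeff F 1 = poly DP te + X * poly (zderiv P) te"
 proof -
  have c: "coeff (L j * [:te, X:] ^ j) 1 = coeff P j * (of_nat j * te ^ (j - 1) * X) + coeff (L j) 1 * te ^ j" for j
   by (simp only: coeff_mult_1 coeff_pow_linear L0)
  have "coeff F 1 = (\<Sum>j\<le>degree P. coeff P j * (of_nat j * te ^ (j - 1) * X)) + poly DP te"
   unfolding F_def DP_def by (simp only: coeff_sum c sum.distrib poly_sum poly_monom)
  also have "(\<Sum>j\<le>degree P. coeff P j * (of_nat j * te ^ (j - 1) * X)) = X * poly (zderiv P) te"
  proof -
   have "(\<Sum>j\<le>degree P. coeff P j * (of_nat j * te ^ (j - 1) * X))
    = (\<Sum>j\<le>Suc (degree P). coeff P j * (of_nat j * te ^ (j - 1) * X))"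
    by (simp add: coeff_eq_0)
   also have "\<dots> = (\<Sum>j\<le>degree P. coeff P (Suc j) * (of_nat (Suc j) * te ^ j * X))"
    by (subst sum.atMost_Suc_shift) simp
   also have "\<dots> = X * poly (zderiv P) te"
    unfolding zderiv_def poly_sum poly_monom sum_distrib_left by (intro sum.cong refl) (simp only: mult_ac)
   finally show ?thesis .
  qed
  finally show ?thesis by (simp only: add.commute)
 qed
 moreover have "DP \<in> pfpoly S" unfolding DP_def by (intro pfpoly_sum pfpoly_monom pfpolyD L)
 moreover have "F \<in> pfpoly UNIV" unfolding F_def
  by (intro pfpoly_sum pfpoly_mult pfpoly_power pfpoly_pCons th pfpoly_zero pfpoly_mono[OF L(1)]) simp
 ultimately show ?thesis by blast
qed

context pf_prime
begin

text \<open>The ideal of the product of an affine space with the zero set of \<open>I\<close>. The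
  left coordinates are indeterminates and become the coefficients of a generic linear form.\<close>

definition gen_ideal :: "('k ^ ('v + 'v) => 'k) set" where
 "gen_ideal = {f \<in> pf UNIV. \<forall>u. (\<lambda>x. f (jn u x)) \<in> I}"

lemma pf_jn_UNIV: "f \<in> pf UNIV ==> (\<lambda>x. f (jn u x)) \<in> pf UNIV"
 by (rule pf_jn) auto

lemma gen_line:
 fixes u v :: "'k ^ 'v" and f :: "'k ^ ('v + 'v) => 'k"
 assumes f: "f \<in> pf UNIV"
 shows "\<exists>P\<in>pfpoly UNIV. \<forall>s. (\<lambda>x. f (jn (u + s *s v) x)) = poly P (\<lambda>_. s)"
proof -
 have "\<exists>P\<in>pfpoly UNIV. \<forall>x s. f (jn (u + s *s v) x) = poly P (\<lambda>_. s) x"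
 proof (rule pf_subst_poly[OF f])
  fix i :: "'v + 'v"
  show "\<exists>Q\<in>pfpoly UNIV. \<forall>(x::'k ^ 'v) s. jn (u + s *s v) x $ i = poly Q (\<lambda>_. s) x"
  proof (cases i)
   case (Inl a)
   then show ?thesis
    by (intro bexI[of _ "[:\<lambda>_. u $ a, \<lambda>_. v $ a:]"])
     (auto intro!: pfpoly_pCons pf_const pfpoly_zero)
  next
   case (Inr a)
   then show ?thesis
    by (intro bexI[of _ "[:\<lambda>x. x $ a:]"]) (auto intro!: pfpoly_const pf_coord)
  qed
 qed
 then show ?thesis by (auto simp: fun_eq_iff)
qed

lemma gen_ideal_finite_line:
 fixes u v :: "'k ^ 'v" and f :: "'k ^ ('v + 'v) => 'k"
 assumes f: "f \<in> pf UNIV" and nI: "(\<lambda>x. f (jn u x)) ~: I"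
 shows "finite {s. (\<lambda>x. f (jn (u + s *s v) x)) \<in> I}"
proof (rule ccontr)
 assume inf: "infinite {s. (\<lambda>x. f (jn (u + s *s v) x)) \<in> I}"
 obtain P where P: "P \<in> pfpoly UNIV" "!!s. (\<lambda>x. f (jn (u + s *s v) x)) = poly P (\<lambda>_. s)"
  using gen_line[OF f] by blast
 have "infinite {s. poly P (\<lambda>_. s) \<in> I}" using inf unfolding P(2) .
 then have "!!j. coeff P j \<in> I" by (rule infinite_combination[OF P(1)])
 then have "poly P (\<lambda>_. 0) \<in> I" by (rule combination_in_ideal) (rule pf_const)
 then have "(\<lambda>x. f (jn (u + 0 *s v) x)) \<in> I" by (simp only: P(2))
 then show False using nI by simp
qed

lemma gen_ideal_prime: "pf_prime gen_ideal"
proof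
 show "gen_ideal \<subseteq> pf UNIV" by (auto simp: gen_ideal_def)
 have "(\<lambda>x::'k ^ 'v. 0 :: 'k) \<in> I" using ideal_zero by (simp only: zero_fun_def)
 then show "0 \<in> gen_ideal" by (simp add: gen_ideal_def)
 have "(\<lambda>x::'k ^ 'v. 1 :: 'k) ~: I" using ideal_proper by (simp only: one_fun_def not_False_eq_True)
 then show "1 ~: gen_ideal" by (simp add: gen_ideal_def)
 fix f g :: "'k ^ ('v + 'v) => 'k"
 have add: "(\<lambda>x. (f + g) (jn u x)) = (\<lambda>x. f (jn u x)) + (\<lambda>x. g (jn u x))"
  and mult: "(\<lambda>x. (f * g) (jn u x)) = (\<lambda>x. f (jn u x)) * (\<lambda>x. g (jn u x))"
  and mult': "(\<lambda>x. (g * f) (jn u x)) = (\<lambda>x. g (jn u x)) * (\<lambda>x. f (jn u x))" for u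
  by (simp_all add: fun_eq_iff)
 show "f + g \<in> gen_ideal" if "f \<in> gen_ideal" "g \<in> gen_ideal"
  using that ideal_add unfolding gen_ideal_def mem_Collect_eq add by (blast intro: pf_add)
 show "g * f \<in> gen_ideal" if "f \<in> gen_ideal" "g \<in> pf UNIV"
  using that ideal_mult[OF _ pf_jn_UNIV[OF that(2)]] unfolding gen_ideal_def mem_Collect_eq mult' by (blast intro: pf_mult)
 show "f \<in> gen_ideal \<or> g \<in> gen_ideal" if fg: "f \<in> pf UNIV" "g \<in> pf UNIV" "f * g \<in> gen_ideal"
 proof (rule ccontr)
  assume "\<not> ?thesis"
  then obtain u0 u1 where u: "(\<lambda>x. f (jn u0 x)) ~: I" "(\<lambda>x. g (jn u1 x)) ~: I"
   using fg unfolding gen_ideal_def by blast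
  \<comment> \<open>On the line joining \<open>u0\<close> and \<open>u1\<close>, both
    specializations leave \<open>I\<close> for all but finitely many parameters; the second line is
    parametrized from the opposite end, hence the reflection \<open>1 - s\<close>.\<close>
  have "finite {s. (\<lambda>x. f (jn (u0 + s *s (u1 - u0)) x)) \<in> I}"
   by (rule gen_ideal_finite_line[OF fg(1) u(1)])
  moreover have "finite ((\<lambda>s. 1 - s) ` {s. (\<lambda>x. g (jn (u1 + s *s (u0 - u1)) x)) \<in> I})"
   by (rule finite_imageI[OF gen_ideal_finite_line[OF fg(2) u(2)]])
  ultimately have "finite ({s. (\<lambda>x. f (jn (u0 + s *s (u1 - u0)) x)) \<in> I} \<union>
    (\<lambda>s. 1 - s) ` {s. (\<lambda>x. g (jn (u1 + s *s (u0 - u1)) x)) \<in> I})" by simp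
  then obtain s :: 'k where s: "(\<lambda>x. f (jn (u0 + s *s (u1 - u0)) x)) ~: I"
   "s ~: (\<lambda>s. 1 - s) ` {s. (\<lambda>x. g (jn (u1 + s *s (u0 - u1)) x)) \<in> I}"
   using ex_new_if_finite[OF infinite_UNIV_char_0] by blast
  have "u1 + (1 - s) *s (u0 - u1) = u0 + s *s (u1 - u0)"
   unfolding cart_eq_iff by (simp add: algebra_simps)
  moreover have "(\<lambda>x. g (jn (u1 + (1 - s) *s (u0 - u1)) x)) ~: I"
  proof
   assume "(\<lambda>x. g (jn (u1 + (1 - s) *s (u0 - u1)) x)) \<in> I"
   then have "1 - (1 - s) \<in> (\<lambda>s. 1 - s) ` {s. (\<lambda>x. g (jn (u1 + s *s (u0 - u1)) x)) \<in> I}" by blast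
   then show False using s(2) by simp
  qed
  ultimately have "(\<lambda>x. g (jn (u0 + s *s (u1 - u0)) x)) ~: I" by (simp only: not_False_eq_True)
  moreover have "(\<lambda>x. f (jn (u0 + s *s (u1 - u0)) x)) * (\<lambda>x. g (jn (u0 + s *s (u1 - u0)) x)) \<in> I"
   using fg(3) unfolding gen_ideal_def mem_Collect_eq mult by blast
  ultimately show False using s(1) ideal_prime[OF pf_jn_UNIV[OF fg(1)] pf_jn_UNIV[OF fg(2)]] by blast
 qed
qed

lemma gen_ideal_tr_basis:
 assumes B: "tr_basis I B"
 shows "tr_basis gen_ideal (range Inl \<union> Inr ` B)"
proof -
 have ind: "alg_indep I B" using B by (simp add: tr_basis_def)
 have "f = 0" if f: "f \<in> pf (range Inl \<union> Inr ` B)" "f \<in> gen_ideal" for f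
 proof -
  have "(\<lambda>x. f (jn u x)) \<in> pf B" for u by (rule pf_jn[OF f(1)]) auto
  moreover have "(\<lambda>x. f (jn u x)) \<in> I" for u using f(2) unfolding gen_ideal_def by blast
  ultimately have "(\<lambda>x. f (jn u x)) = 0" for u by (rule alg_indepD[OF ind])
  then have "f (jn u x) = 0" for u x by (simp add: fun_eq_iff)
  then have "f (jn (pr1 z) (pr2 z)) = 0" for z by blast
  then show ?thesis unfolding jn_pr by (simp add: fun_eq_iff)
 qed
 then have 1: "alg_indep gen_ideal (range Inl \<union> Inr ` B)" unfolding alg_indep_def by blast
 have 2: "\<not> alg_indep gen_ideal (insert i (range Inl \<union> Inr ` B))" if i: "i ~: range Inl \<union> Inr ` B" for i
 proof -
  obtain j where j: "i = Inr j" "j ~: B" using i by (cases i) auto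
  obtain f where f: "f \<in> pf (insert j B)" "f \<in> I" "f ~= 0"
   using B j unfolding tr_basis_def alg_indep_def by blast
  have "(\<lambda>z. f (pr2 z)) \<in> pf (insert i (range Inl \<union> Inr ` B))"
   by (rule pf_mono[OF pf_pr2[OF f(1)]]) (auto simp: j)
  moreover have "(\<lambda>z. f (pr2 z)) \<in> gen_ideal"
   unfolding gen_ideal_def using f(2) pf_UNIV[OF pf_pr2[OF f(1)]] by simp
  moreover obtain x where "f x ~= 0" using f(3) by (auto simp: fun_eq_iff)
  then have "(\<lambda>z. f (pr2 z)) (jn 0 x) ~= (0 :: 'k ^ ('v + 'v) => 'k) (jn 0 x)" by simp
  then have "(\<lambda>z. f (pr2 z)) ~= (0 :: 'k ^ ('v + 'v) => 'k)" by metis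
  ultimately show ?thesis unfolding alg_indep_def by blast
 qed
 show ?thesis unfolding tr_basis_def using 1 2 by blast
qed

definition fiber :: "'v set => 'k ^ 'v => ('k ^ 'v) set" where
 "fiber B y = {z \<in> zeros I. \<forall>b\<in>B. z $ b = y $ b}"

text \<open>As a polynomial in \<open>c\<close>, this has the coordinates of \<open>x\<close> among its coefficients, so that they are
 bounded by its values at sufficiently many integers \<open>c\<close>.\<close>

definition lin_form :: "('v => nat) => ('v => nat) => 'k => 'k ^ 'v => 'k" where
 "lin_form n e c x = (\<Sum>i\<in>UNIV. (of_nat (Suc (n i)) + c ^ e i) * x $ i)"

text \<open>The degree of \<open>G\<close> equals the number of points of a generic fibre, so it is
  the same for all primitive elements over the same basis.\<close>

definition fiber_poly :: "'v set => ('k ^ 'v => 'k) => ('k ^ 'v => 'k) => ('k ^ 'v => 'k) poly => bool" where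
 "fiber_poly B te a G \<longleftrightarrow> a \<in> pf B \<and> G \<in> pfpoly B \<and> a ~= 0 \<and> degree G > 0 \<and> lead_coeff G ~= 0 \<and> poly G te \<in> I \<and>
  (\<forall>y. a y ~= 0 --> finite (fiber B y) \<and> card (fiber B y) = degree G \<and>
   lead_coeff G y ~= 0 \<and> (\<forall>ze. poly G (\<lambda>_. ze) y = lead_coeff G y * (\<Prod>z\<in>fiber B y. (ze - te z))))"

text \<open>The generic linear form \<open>T\<close>, with indeterminate coefficients, is primitive:
  differentiating its minimal relation with respect to the coefficient of the coordinate
  \<open>i\<close> expresses this coordinate as a quotient of polynomials in \<open>T\<close>, with
  the derivative \<open>D\<close> of the relation as denominator. This survives every specialization
  of the coefficients that keeps \<open>poly D T\<close> out of \<open>I\<close>, and along a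
  suitable curve only finitely many parameters are lost.\<close>

theorem primitive_elements:
 assumes B: "tr_basis I B"
 shows "\<exists>n e F. inj e \<and> (\<forall>i. e i > 0) \<and> finite F \<and>
  (\<forall>c. c ~: F --> (\<exists>a G. fiber_poly B (lin_form n e c) a G))"
proof -
 interpret J: pf_prime gen_ideal by (rule gen_ideal_prime)
 define B1 :: "('v + 'v) set" where "B1 = range Inl \<union> Inr ` B"
 have B1: "tr_basis gen_ideal B1" unfolding B1_def by (rule gen_ideal_tr_basis[OF B])
 define T :: "'k ^ ('v + 'v) => 'k" where "T = (\<lambda>z. \<Sum>i\<in>UNIV. z $ Inl i * z $ Inr i)"
 have T: "T \<in> pf UNIV" unfolding T_def by (intro pf_lambda_sum pf_lambda pf_coord) auto
 obtain P where P: "P \<in> pfpoly B1" "P ~= 0" "poly P T \<in> gen_ideal" "degree P > 0"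
  and Pmin: "!!Q. Q \<in> pfpoly B1 ==> poly Q T \<in> gen_ideal ==> degree Q < degree P ==> Q = 0"
  using J.minimal_relation[OF B1 T] by blast
 define D where "D = zderiv P"
 have Dpf: "D \<in> pfpoly B1" unfolding D_def by (rule pfpoly_zderiv[OF P(1)])
 have DT: "poly D T \<in> pf UNIV" by (rule pfpoly_poly[OF pfpoly_mono[OF Dpf] T]) simp
 have DI: "poly D T ~: gen_ideal"
  using Pmin[OF Dpf] J.zderiv_nonzero[OF P(4)] unfolding D_def by blast
 have rel: "\<exists>DP\<in>pfpoly B1. poly DP T + (\<lambda>z. z $ Inr i) * poly D T \<in> gen_ideal" for i
 proof -
  have Xpf: "(\<lambda>z. z $ Inr i) \<in> pf UNIV" by (intro pf_coord) simp
  have "T (z + s *s axis (Inl i) 1) = T z + s * z $ Inr i" for z s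
  proof -
   have "(z + s *s axis (Inl i) 1) $ Inl k * (z + s *s axis (Inl i) 1) $ Inr k
    = z $ Inl k * z $ Inr k + (if k = i then s * z $ Inr i else 0)" for k
    by (auto simp: axis_def algebra_simps)
   then show ?thesis unfolding T_def by (simp add: sum.distrib)
  qed
  from relation_line[OF P(1) T Xpf this] obtain DP F where DP: "DP \<in> pfpoly B1" "F \<in> pfpoly UNIV"
   "!!z s. poly P T (z + s *s axis (Inl i) 1) = poly F (\<lambda>_. s) z"
   "coeff F 1 = poly DP T + (\<lambda>z. z $ Inr i) * poly D T" unfolding D_def by blast
  \<comment> \<open>For fixed \<open>u\<close>, the polynomial \<open>F\<close> describes the
    relation at the shifted coefficients \<open>u + s *s axis i 1\<close>. All its values lie in
    \<open>I\<close>, hence so does its linear coefficient.\<close>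
  have "coeff F 1 \<in> gen_ideal"
   unfolding gen_ideal_def
  proof (intro CollectI conjI allI)
   show "coeff F 1 \<in> pf UNIV" by (rule pfpolyD[OF DP(2)])
   fix u
   have c: "(\<lambda>x. coeff F 1 (jn u x)) = coeff (comp_poly (jn u) F) 1" by (simp only: coeff_comp_poly)
   have "poly (comp_poly (jn u) F) (\<lambda>_. s) \<in> I" for s
   proof -
    have "poly (comp_poly (jn u) F) (\<lambda>_. s) = (\<lambda>x. poly P T (jn (u + s *s axis i 1) x))"
    proof
     fix x :: "'k ^ 'v"
     have "jn u x + s *s axis (Inl i) 1 = jn (u + s *s axis i 1) x"
      unfolding cart_eq_iff
     proof
      fix j show "(jn u x + s *s axis (Inl i) 1) $ j = jn (u + s *s axis i 1) x $ j"
       by (cases j) (auto simp: axis_def)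
     qed
     then show "poly (comp_poly (jn u) F) (\<lambda>_. s) x = poly P T (jn (u + s *s axis i 1) x)"
      using poly_comp_poly[of "jn u" F "\<lambda>_. s" x] DP(3)[of "jn u x" s] by simp
    qed
    also have "\<dots> \<in> I" using P(3) unfolding gen_ideal_def by blast
    finally show ?thesis .
   qed
   then have "infinite {s. poly (comp_poly (jn u) F) (\<lambda>_. s) \<in> I}"
    using infinite_UNIV_char_0[where 'a = 'k] by simp
   moreover have "comp_poly (jn u) F \<in> pfpoly UNIV"
    by (rule pfpolyI) (simp only: coeff_comp_poly pf_jn_UNIV[OF pfpolyD[OF DP(2)]])
   ultimately show "(\<lambda>x. coeff F 1 (jn u x)) \<in> I" unfolding c by (intro infinite_combination)
  qed
  then show ?thesis using DP(1,4) by (intro bexI[of _ DP]) (simp only:)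
 qed
 have "\<exists>n. (\<lambda>x. poly D T (jn (\<chi> i. of_nat (Suc (n i))) x)) ~: I"
 proof (rule ccontr)
  assume neg: "\<not> ?thesis"
  have "(\<lambda>x. poly D T (jn u x)) \<in> I" for u
  proof (rule grid_induct[where S = "\<lambda>_. range (\<lambda>n. of_nat (Suc n))" and Q = "\<lambda>u. (\<lambda>x. poly D T (jn u x)) \<in> I"])
   fix u i assume "infinite {s. (\<lambda>x. poly D T (jn (u + s *s axis i 1) x)) \<in> I}"
   then show "(\<lambda>x. poly D T (jn u x)) \<in> I" using gen_ideal_finite_line[OF DT, of u "axis i 1"] by blast
  next
   show "infinite (range (\<lambda>n. of_nat (Suc n) :: 'k))" by (rule infinite_nats)
  next
   fix u :: "'k ^ 'v" assume "!!i. u $ i \<in> range (\<lambda>n. of_nat (Suc n))"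
   then have "\<forall>i. \<exists>n. u $ i = of_nat (Suc n)" by blast
   then obtain n where n: "\<forall>i. u $ i = of_nat (Suc (n i))" by (rule choice[THEN exE])
   have "u = (\<chi> i. of_nat (Suc (n i)))"
    by (subst cart_eq_iff) (simp only: n vec_lambda_beta simp_thms)
   then show "(\<lambda>x. poly D T (jn u x)) \<in> I" using neg by blast
  qed
  then have "poly D T \<in> gen_ideal" unfolding gen_ideal_def using DT by blast
  then show False using DI by blast
 qed
 then obtain n where n: "(\<lambda>x. poly D T (jn (\<chi> i. of_nat (Suc (n i))) x)) ~: I" by blast
 obtain e0 :: "'v => nat" where e0: "inj e0"
  using finite_imp_inj_to_nat_seg[OF finite[of UNIV]] by blast
 define e where "e = Suc \<circ> e0"
 have e: "inj e" "!!i. e i > 0" unfolding e_def using e0 by (auto simp: inj_def)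
 \<comment> \<open>A curve through the good integral point at \<open>c = 0\<close>; it starts there
   because all exponents are positive. Hence the bad parameters cannot be infinite in
   number.\<close>
 define U where "U c = (\<chi> i. of_nat (Suc (n i)) + c ^ e i)" for c :: 'k
 define F where "F = {c. (\<lambda>x. poly D T (jn (U c) x)) \<in> I}"
 have "finite F"
 proof (rule ccontr)
  assume inf: "infinite F"
  have "\<exists>R\<in>pfpoly UNIV. \<forall>x c. poly D T (jn (U c) x) = poly R (\<lambda>_. c) x"
  proof (rule pf_subst_poly[OF DT])
   fix i :: "'v + 'v"
   show "\<exists>Q\<in>pfpoly UNIV. \<forall>(x::'k ^ 'v) c. jn (U c) x $ i = poly Q (\<lambda>_. c) x"
   proof (cases i)
    case (Inl a)
    then show ?thesis
     by (intro bexI[of _ "[:\<lambda>_. of_nat (Suc (n a)):] + monom (\<lambda>_. 1) (e a)"])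
      (auto intro!: pfpoly_add pfpoly_const pfpoly_monom pf_const simp: U_def poly_monom simp del: of_nat_Suc)
   next
    case (Inr a)
    then show ?thesis
     by (intro bexI[of _ "[:\<lambda>x. x $ a:]"]) (auto intro!: pfpoly_const pf_coord)
   qed
  qed
  then obtain R where R: "R \<in> pfpoly UNIV" "!!x c. poly D T (jn (U c) x) = poly R (\<lambda>_. c) x" by blast
  have Rf: "(\<lambda>x. poly D T (jn (U c) x)) = poly R (\<lambda>_. c)" for c by (rule ext) (rule R(2))
  have "infinite {c. poly R (\<lambda>_. c) \<in> I}" using inf unfolding F_def Rf .
  then have "!!j. coeff R j \<in> I" by (rule infinite_combination[OF R(1)])
  then have "poly R (\<lambda>_. 0) \<in> I" by (rule combination_in_ideal) (rule pf_const)
  then have "(\<lambda>x. poly D T (jn (U 0) x)) \<in> I" unfolding Rf .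
  moreover have "U 0 = (\<chi> i. of_nat (Suc (n i)))"
   unfolding U_def cart_eq_iff using e(2) by (simp add: zero_power)
  ultimately show False using n by simp
 qed
 moreover have "\<exists>a G. fiber_poly B (lin_form n e c) a G" if c: "c ~: F" for c
 proof -
  have Tlin: "T (jn (U c) x) = lin_form n e c x" for x
   unfolding T_def lin_form_def U_def by simp
  have sp: "poly (comp_poly (jn (U c)) Q) (lin_form n e c) = (\<lambda>x. poly Q T (jn (U c) x))" for Q
   using poly_comp_poly[of "jn (U c)" Q T] unfolding Tlin by (simp only: fun_eq_iff simp_thms)
  have pfB: "comp_poly (jn (U c)) Q \<in> pfpoly B" if "Q \<in> pfpoly B1" for Q
  proof (rule pfpolyI)
   fix j
   have "(\<lambda>x. coeff Q j (jn (U c) x)) \<in> pf B" by (rule pf_jn[OF pfpolyD[OF that]]) (auto simp: B1_def)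
   then show "coeff (comp_poly (jn (U c)) Q) j \<in> pf B" by (simp only: coeff_comp_poly)
  qed
  have th: "lin_form n e c \<in> pf UNIV"
   unfolding lin_form_def[abs_def] by (intro pf_lambda_sum pf_lambda pf_const pf_coord) auto
  have D: "comp_poly (jn (U c)) D \<in> pfpoly B" "poly (comp_poly (jn (U c)) D) (lin_form n e c) ~: I"
   using c unfolding sp F_def by (simp_all add: pfB[OF Dpf])
  have "\<forall>i. \<exists>DP. DP \<in> pfpoly B1 \<and> poly DP T + (\<lambda>z. z $ Inr i) * poly D T \<in> gen_ideal"
   using rel by blast
  then obtain DP where "\<forall>i. DP i \<in> pfpoly B1 \<and> poly (DP i) T + (\<lambda>z. z $ Inr i) * poly D T \<in> gen_ideal"
   by (rule choice[THEN exE])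
  then have DP: "!!i. DP i \<in> pfpoly B1" "!!i. poly (DP i) T + (\<lambda>z. z $ Inr i) * poly D T \<in> gen_ideal" by simp_all
  define H where "H i = - comp_poly (jn (U c)) (DP i)" for i
  have H: "H i \<in> pfpoly B" for i unfolding H_def by (intro pfpoly_uminus pfB DP)
  have "(\<lambda>x. x $ i) * poly (comp_poly (jn (U c)) D) (lin_form n e c) - poly (H i) (lin_form n e c) \<in> I" for i
  proof -
   have "(\<lambda>x. (poly (DP i) T + (\<lambda>z. z $ Inr i) * poly D T) (jn (U c) x)) \<in> I"
    using DP(2)[of i] unfolding gen_ideal_def by blast
   also have "(\<lambda>x. (poly (DP i) T + (\<lambda>z. z $ Inr i) * poly D T) (jn (U c) x)) =
    (\<lambda>x. x $ i) * poly (comp_poly (jn (U c)) D) (lin_form n e c) - poly (H i) (lin_form n e c)"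
    unfolding H_def poly_minus sp by (simp add: fun_eq_iff)
   finally show ?thesis .
  qed
  from primitive_element_core[OF B th D H this]
  show ?thesis unfolding fiber_poly_def Let_def fiber_def[symmetric] by blast
 qed
 ultimately show ?thesis using e by blast
qed

end

section \<open>Ultrametric absolute values\<close>

text \<open>The valuation in multiplicative form, \<open>exp (- val)\<close>. That nonzero integers
  have norm 1 means residue characteristic zero, the source of all choices of integers
  below.\<close>

locale na_abs =
 fixes nrm :: "'k::{alg_closed_field, field_char_0} => real"
 assumes nrm_nonneg [simp]: "nrm x >= 0"
  and nrm_eq_0 [simp]: "nrm x = 0 \<longleftrightarrow> x = 0"
  and nrm_mult: "nrm (x * y) = nrm x * nrm y"
  and nrm_add: "nrm (x + y) <= max (nrm x) (nrm y)"
  and nrm_of_int: "z ~= 0 ==> nrm (of_int z) = 1"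
  and nrm_nontrivial: "\<exists>x. x ~= 0 \<and> nrm x ~= 1"
begin

lemma nrm_0 [simp]: "nrm 0 = 0" by simp

lemma nrm_1 [simp]: "nrm 1 = 1" using nrm_of_int[of 1] by simp

lemma nrm_pos [simp]: "nrm x > 0 \<longleftrightarrow> x ~= 0"
 using nrm_nonneg[of x] nrm_eq_0[of x] by linarith

lemma nrm_minus [simp]: "nrm (- x) = nrm x"
 using nrm_mult[of "-1" x] nrm_of_int[of "-1"] by simp

lemma nrm_diff: "nrm (x - y) <= max (nrm x) (nrm y)"
 using nrm_add[of x "- y"] by simp

lemma nrm_minus_commute: "nrm (x - y) = nrm (y - x)"
 using nrm_minus[of "x - y"] by simp

lemma nrm_power: "nrm (x ^ n) = nrm x ^ n"
 by (induction n) (auto simp: nrm_mult)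

lemma nrm_divide: "nrm (x / y) = nrm x / nrm y"
proof (cases "y = 0")
 case False
 then have "nrm (x / y) * nrm y = nrm x" by (simp flip: nrm_mult)
 then show ?thesis using False by (simp add: field_simps)
qed simp

lemma nrm_prod: "nrm (prod f A) = (\<Prod>i\<in>A. nrm (f i))"
 by (induction A rule: infinite_finite_induct) (auto simp: nrm_mult)

lemma nrm_of_nat_le: "nrm (of_nat n) <= 1"
 using nrm_of_int[of "int n"] by (cases "n = 0") auto

lemma nrm_of_nat: "n > 0 ==> nrm (of_nat n) = 1"
 using nrm_of_int[of "int n"] by auto

lemma nrm_of_nat_diff: "m ~= n ==> nrm (of_nat m - of_nat n) = 1"
 using nrm_of_int[of "int m - int n"] by simp

lemma nrm_add_le: "nrm x <= r ==> nrm y <= r ==> nrm (x + y) <= r"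
 using nrm_add[of x y] by linarith

lemma nrm_add_less: "nrm x < r ==> nrm y < r ==> nrm (x + y) < r"
 using nrm_add[of x y] by linarith

lemma nrm_diff_le: "nrm x <= r ==> nrm y <= r ==> nrm (x - y) <= r"
 using nrm_diff[of x y] by linarith

lemma nrm_sum_le: "r >= 0 ==> (!!i. i \<in> A ==> nrm (f i) <= r) ==> nrm (sum f A) <= r"
 by (induction A rule: infinite_finite_induct) (auto intro: nrm_add_le)

lemma nrm_add_eq: "nrm y < nrm x ==> nrm (x + y) = nrm x"
 using nrm_add[of x y] nrm_diff[of "x + y" y] by simp

lemma nrm_eqI: "nrm (x - y) < nrm y ==> nrm x = nrm y"
 using nrm_add_eq[of "x - y" y] by simp

text \<open>Roots of an element of norm greater than 1 have norms \<open>q > 1\<close> arbitrarily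
  close to 1, and the integral powers of such a \<open>q\<close> advance by steps too small to jump
  over the interval.\<close>

lemma nrm_dense:
 assumes "0 <= a" "a < b"
 shows "\<exists>x. a < nrm x \<and> nrm x < b"
proof -
 \<comment> \<open>A positive lower end, so that the ratio \<open>b / a'\<close> bounds the
   admissible step also for \<open>a = 0\<close>.\<close>
 define a' where "a' = (if a = 0 then b / 2 else a)"
 have a': "0 < a'" "a' < b" "a <= a'" using assms by (auto simp: a'_def)
 obtain x0 where x0: "x0 ~= 0" "nrm x0 ~= 1" using nrm_nontrivial by blast
 have "\<exists>x. nrm x > 1"
 proof (cases "nrm x0 > 1")
  case False
  then have "nrm (1 / x0) > 1" using x0 by (simp add: nrm_divide field_simps)
  then show ?thesis by blast
 qed blast
 then obtain x where x: "nrm x > 1" by blast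
 have "(\<lambda>n. root (Suc n) (nrm x)) \<longlonglongrightarrow> 1"
 proof -
  have "0 < nrm x" using x by linarith
  then show ?thesis by (intro LIMSEQ_Suc LIMSEQ_root_const)
 qed
 moreover have "b / a' > 1" using a' by simp
 ultimately have "eventually (\<lambda>n. root (Suc n) (nrm x) < b / a') sequentially"
  by (rule order_tendstoD)
 then obtain n where n: "root (Suc n) (nrm x) < b / a'" by (auto simp: eventually_sequentially)
 obtain y where y: "y ^ Suc n = x" using nth_root_exists[of "Suc n" x] by auto
 define q where "q = nrm y"
 have qn: "q ^ Suc n = nrm x" unfolding q_def using y nrm_power[of y "Suc n"] by simp
 have "q = root (Suc n) (nrm x)" unfolding qn[symmetric] using real_root_power_cancel[of "Suc n" q] by (simp add: q_def)
 then have q: "q < b / a'" "q > 1" using n x by (auto simp: real_root_gt_1_iff)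
 define k where "k = \<lfloor>log q a'\<rfloor> + 1"
 have "log q a' < real_of_int k" "real_of_int k <= log q a' + 1" unfolding k_def by linarith+
 then have "q powr log q a' < q powr real_of_int k" "q powr real_of_int k <= q powr (log q a' + 1)"
  using q by (auto intro: powr_less_mono)
 then have "a' < q powr real_of_int k" "q powr real_of_int k <= a' * q"
  using q a' by (auto simp: powr_add)
 moreover have "a' * q < b" using q a' by (simp add: field_simps)
 moreover have "\<exists>z. nrm z = q powr real_of_int k"
 proof (cases "k >= 0")
  case True
  have "nrm (y ^ nat k) = q powr real_of_int k"
   unfolding nrm_power q_def[symmetric] using True q by (simp flip: powr_realpow)
  then show ?thesis by blast
 next
  case False
  have "nrm (1 / y ^ nat (- k)) = q powr real_of_int k"
   unfolding nrm_divide nrm_power q_def[symmetric] using False q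
   by (simp add: powr_minus_divide flip: powr_realpow)
  then show ?thesis by blast
 qed
 ultimately show ?thesis using a' by (metis le_less_trans less_le_trans order.strict_trans1)
qed

lemma infinite_small: "r > 0 ==> infinite {x. nrm x < r}"
proof
 assume r: "r > 0" and fin: "finite {x. nrm x < r}"
 have "{x. nrm x < r} ~= {}" using r by (auto intro: exI[of _ 0])
 obtain x where x: "0 < nrm x" "nrm x < r" using nrm_dense[of 0 r] r by auto
 have "(\<lambda>n. of_nat (Suc n) * x) ` UNIV \<subseteq> {x. nrm x < r}"
  using x by (auto simp: nrm_mult nrm_of_nat simp del: of_nat_Suc)
 moreover have "inj (\<lambda>n. of_nat (Suc n) * x)" using x by (auto simp: inj_def)
 ultimately have "finite (UNIV :: nat set)" using fin finite_imageD finite_subset by blast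
 then show False by simp
qed

subsection \<open>Vectors\<close>

definition vn :: "'k ^ 'v::finite => real" where "vn x = Max (range (\<lambda>i. nrm (x $ i)))"

lemma vn_le_iff: "vn x <= r \<longleftrightarrow> (\<forall>i. nrm (x $ i) <= r)"
 by (simp add: vn_def)

lemma vn_less_iff: "vn x < r \<longleftrightarrow> (\<forall>i. nrm (x $ i) < r)"
 by (simp add: vn_def)

lemma nrm_le_vn: "nrm (x $ i) <= vn x"
 using vn_le_iff[of x "vn x"] by simp

lemma vn_attained: "\<exists>i. vn x = nrm (x $ i)"
proof -
 have "vn x \<in> range (\<lambda>i. nrm (x $ i))" unfolding vn_def by (rule Max_in) auto
 then show ?thesis by auto
qed

lemma vn_nonneg [simp]: "vn x >= 0"
 using nrm_le_vn[of x undefined] nrm_nonneg order_trans by blast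

lemma vn_eq_0 [simp]: "vn x = 0 \<longleftrightarrow> x = 0"
proof
 assume "vn x = 0"
 then have "nrm (x $ i) <= 0" for i using nrm_le_vn[of x i] by simp
 then have "x $ i = 0" for i using nrm_nonneg[of "x $ i"] nrm_eq_0[of "x $ i"] by (metis antisym)
 then show "x = 0" by (simp add: cart_eq_iff)
next
 assume "x = 0" then show "vn x = 0" by (simp add: vn_def)
qed

lemma vn_add_le: "vn x <= r ==> vn y <= r ==> vn (x + y) <= r"
 by (simp add: vn_le_iff nrm_add_le)

lemma vn_diff_le: "vn x <= r ==> vn y <= r ==> vn (x - y) <= r"
 by (simp add: vn_le_iff nrm_diff_le)

lemma vn_minus_commute: "vn (x - y) = vn (y - x)"
 by (simp add: vn_def nrm_minus_commute)

lemma vn_smult: "vn (c *s x) = nrm c * vn x"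
proof (rule antisym)
 show "vn (c *s x) <= nrm c * vn x"
  by (auto simp: vn_le_iff nrm_mult intro!: mult_left_mono nrm_le_vn)
 obtain i where "vn x = nrm (x $ i)" using vn_attained by blast
 then show "nrm c * vn x <= vn (c *s x)"
  using nrm_le_vn[of "c *s x" i] by (simp add: nrm_mult)
qed

subsection \<open>Continuity of polynomial functions\<close>

text \<open>One constant serves as a bound and as a Lipschitz constant on the ball, so that
  constants combine by \<open>max\<close> for sums and by multiplication for products.\<close>

lemma pf_lipschitz:
 fixes f :: "'k ^ 'v::finite => 'k"
 assumes "f \<in> pf S"
 shows "\<exists>C\<ge>0. (\<forall>y. vn y <= r --> nrm (f y) <= C) \<and>
  (\<forall>y z. vn y <= r --> vn z <= r --> nrm (f y - f z) <= C * vn (y - z))"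
 using assms
proof (induction rule: pf.induct)
 case (pf_const c)
 show ?case by (intro exI[of _ "nrm c"]) auto
next
 case (pf_coord i)
 have "nrm (y $ i - z $ i) <= max \<bar>r\<bar> 1 * vn (y - z)" for y z :: "'k ^ 'v"
 proof -
  have "nrm (y $ i - z $ i) <= vn (y - z)" using nrm_le_vn[of "y - z" i] by simp
  also have "1 * vn (y - z) <= max \<bar>r\<bar> 1 * vn (y - z)" by (intro mult_right_mono) auto
  finally show ?thesis by simp
 qed
 moreover have "nrm (y $ i) <= max \<bar>r\<bar> 1" if "vn y <= r" for y :: "'k ^ 'v"
  using nrm_le_vn[of y i] that by linarith
 ultimately show ?case by (intro exI[of _ "max \<bar>r\<bar> 1"]) auto
next
 case (pf_add f g)
 then obtain C C' where C: "C >= 0" "!!y. vn y <= r ==> nrm (f y) <= C"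
   "!!y z. vn y <= r ==> vn z <= r ==> nrm (f y - f z) <= C * vn (y - z)"
  and C': "C' >= 0" "!!y. vn y <= r ==> nrm (g y) <= C'"
   "!!y z. vn y <= r ==> vn z <= r ==> nrm (g y - g z) <= C' * vn (y - z)" by auto
 show ?case
 proof (intro exI[of _ "max C C'"] conjI allI impI)
  show "0 <= max C C'" using C by simp
  show "nrm ((f + g) y) <= max C C'" if "vn y <= r" for y
   using C(2)[OF that] C'(2)[OF that] nrm_add[of "f y" "g y"] by auto
  fix y z :: "'k ^ 'v" assume yz: "vn y <= r" "vn z <= r"
  have "C * vn (y - z) <= max C C' * vn (y - z)" "C' * vn (y - z) <= max C C' * vn (y - z)"
   by (intro mult_right_mono; simp)+
  then have "nrm ((f y - f z) + (g y - g z)) <= max C C' * vn (y - z)"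
   using C(3)[OF yz] C'(3)[OF yz] by (intro nrm_add_le) linarith+
  then show "nrm ((f + g) y - (f + g) z) <= max C C' * vn (y - z)" by (simp add: algebra_simps)
 qed
next
 case (pf_mult f g)
 then obtain C C' where C: "C >= 0" "!!y. vn y <= r ==> nrm (f y) <= C"
   "!!y z. vn y <= r ==> vn z <= r ==> nrm (f y - f z) <= C * vn (y - z)"
  and C': "C' >= 0" "!!y. vn y <= r ==> nrm (g y) <= C'"
   "!!y z. vn y <= r ==> vn z <= r ==> nrm (g y - g z) <= C' * vn (y - z)" by auto
 show ?case
 proof (intro exI[of _ "C * C'"] conjI allI impI)
  show "0 <= C * C'" using C C' by simp
  show "nrm ((f * g) y) <= C * C'" if "vn y <= r" for y
   using C(2)[OF that] C'(2)[OF that] C C' by (auto simp: nrm_mult intro: mult_mono)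
  fix y z :: "'k ^ 'v" assume yz: "vn y <= r" "vn z <= r"
  have "nrm (f y * (g y - g z)) <= C * (C' * vn (y - z))"
   unfolding nrm_mult by (intro mult_mono C(2)[OF yz(1)] C'(3)[OF yz]) (auto simp: C)
  moreover have "nrm ((f y - f z) * g z) <= (C * vn (y - z)) * C'"
   unfolding nrm_mult by (intro mult_mono C'(2)[OF yz(2)] C(3)[OF yz]) (auto simp: C)
  ultimately have "nrm (f y * (g y - g z) + (f y - f z) * g z) <= C * C' * vn (y - z)"
   by (intro nrm_add_le) (auto simp: mult_ac)
  then show "nrm ((f * g) y - (f * g) z) <= C * C' * vn (y - z)" by (simp add: algebra_simps)
 qed
qed

lemma pf_continuous:
 assumes f: "f \<in> pf S" and r: "r > 0"
 shows "\<exists>d>0. \<forall>y. vn (y - x) < d --> nrm (f y - f x) < r"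
proof -
 obtain C where C: "C >= 0" "!!y z. vn y <= vn x + 1 ==> vn z <= vn x + 1 ==> nrm (f y - f z) <= C * vn (y - z)"
  using pf_lipschitz[OF f, of "vn x + 1"] by blast
 define d where "d = min 1 (r / (C + 1))"
 have "nrm (f y - f x) < r" if y: "vn (y - x) < d" for y
 proof -
  have "vn (x + (y - x)) <= vn x + 1"
   using y vn_nonneg[of x] unfolding d_def by (intro vn_add_le) linarith+
  then have "nrm (f y - f x) <= C * vn (y - x)" by (intro C(2)) auto
  also have "\<dots> <= C * d" using y C by (intro mult_left_mono) auto
  also have "\<dots> <= C * (r / (C + 1))" using C by (intro mult_left_mono) (auto simp: d_def)
  also have "\<dots> < r" using C r by (simp add: field_simps)
  finally show ?thesis .
 qed
 moreover have "d > 0" using r C by (auto simp: d_def)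
 ultimately show ?thesis by blast
qed

lemma pf_nrm_locally_constant:
 assumes f: "f \<in> pf S" and nz: "f x ~= 0"
 shows "\<exists>d>0. \<forall>y. vn (y - x) < d --> nrm (f y) = nrm (f x)"
proof -
 obtain d where "d > 0" "!!y. vn (y - x) < d ==> nrm (f y - f x) < nrm (f x)"
  using pf_continuous[OF f, of "nrm (f x)" x] nz by auto
 then show ?thesis using nrm_eqI by blast
qed

lemma uniform_neighbourhood:
 fixes x :: "'k ^ 'v::finite"
 assumes "finite C" "!!c. c \<in> C ==> \<exists>d>0. \<forall>y. vn (y - x) < d --> P c y"
 shows "\<exists>d>0. \<forall>y. vn (y - x) < d --> (\<forall>c\<in>C. P c y)"
 using assms
proof (induction C rule: finite_induct)
 case empty show ?case by (intro exI[of _ 1]) auto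
next
 case (insert c C)
 obtain d1 where d1: "d1 > 0" "!!y. vn (y - x) < d1 ==> \<forall>c\<in>C. P c y" using insert by blast
 obtain d2 where d2: "d2 > 0" "!!y. vn (y - x) < d2 ==> P c y" using insert.prems[of c] by blast
 show ?case using d1 d2 by (intro exI[of _ "min d1 d2"]) auto
qed

subsection \<open>Values of polynomials at integers\<close>

text \<open>Newton interpolation at natural numbers: differences of distinct nodes have norm 1, so
  the divided differences stay within the bound of the values.\<close>

lemma coeff_bound_of_values:
 fixes q :: "'k poly"
 assumes "finite C" "card C > degree q" "!!c. c \<in> C ==> nrm (poly q (of_nat c)) <= r"
 shows "nrm (coeff q j) <= r"
 using assms
proof (induction "degree q" arbitrary: q C j)
 case 0
 then obtain a where a: "q = [:a:]" using degree_eq_zeroE[of q] by metis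
 obtain c where "c \<in> C" using 0 by fastforce
 then have "nrm a <= r" using 0(4)[of c] a by simp
 then show ?case using a order_trans[OF nrm_nonneg] by (cases j) auto
next
 case (Suc n)
 obtain c where c: "c \<in> C" using Suc.prems by fastforce
 define p where "p = synthetic_div q (of_nat c)"
 have qp: "q + Polynomial.smult (of_nat c) p = pCons (poly q (of_nat c)) p"
  unfolding p_def by (rule synthetic_div_correct)
 have pv: "poly q x = poly q (of_nat c) + (x - of_nat c) * poly p x" for x
  using arg_cong[OF qp, of "\<lambda>p. poly p x"] by (simp add: algebra_simps)
 have deg: "degree p = n" unfolding p_def degree_synthetic_div using Suc.hyps(2) by simp
 have pb: "nrm (coeff p i) <= r" for i
 proof (rule Suc.hyps(1)[OF deg[symmetric]])
  show "finite (C - {c})" using Suc.prems by simp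
  show "degree p < card (C - {c})" using deg c Suc.prems Suc.hyps(2) by simp
  fix c' assume c': "c' \<in> C - {c}"
  have "nrm ((of_nat c' - of_nat c) * poly p (of_nat c')) = nrm (poly q (of_nat c') - poly q (of_nat c))"
   using pv[of "of_nat c'"] by simp
  also have "\<dots> <= r" using c' c by (intro nrm_diff_le Suc.prems) auto
  finally show "nrm (poly p (of_nat c')) <= r" using c' nrm_of_nat_diff[of c' c] by (simp add: nrm_mult)
 qed
 have r: "r >= 0" using pb order_trans[OF nrm_nonneg] by blast
 have "coeff q j = coeff (pCons (poly q (of_nat c)) p) j - of_nat c * coeff p j"
  using arg_cong[OF qp, of "\<lambda>p. coeff p j"] by (simp add: algebra_simps)
 also have "nrm \<dots> <= r"
 proof (rule nrm_diff_le)
  show "nrm (coeff (pCons (poly q (of_nat c)) p) j) <= r"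
   using pb Suc.prems(3)[OF c] by (cases j) auto
  show "nrm (of_nat c * coeff p j) <= r"
   using mult_mono[OF nrm_of_nat_le[of c] pb[of j]] by (simp add: nrm_mult)
 qed
 finally show ?case .
qed

text \<open>Each polynomial has at most \<open>D\<close> integers at which some coefficient exceeds
  the value; with more of them the interpolation bound would apply to these integers and contradict
  their choice. Counting over \<open>Y\<close> leaves an integer that is good for all
  polynomials.\<close>

lemma good_integer:
 fixes q :: "'y => 'k poly"
 assumes Y: "finite Y" "!!y. y \<in> Y ==> degree (q y) <= D" and C: "finite C" "card C > card Y * D"
 shows "\<exists>c\<in>C. \<forall>y\<in>Y. \<forall>j. nrm (coeff (q y) j) <= nrm (poly (q y) (of_nat c))"
proof -
 define bad where "bad y = {c\<in>C. \<exists>j. nrm (coeff (q y) j) > nrm (poly (q y) (of_nat c))}" for y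
 have fin: "finite (bad y)" for y unfolding bad_def using C by simp
 have "card (bad y) <= D" if y: "y \<in> Y" for y
 proof (rule ccontr)
  assume "\<not> card (bad y) <= D"
  then have card: "card (bad y) > degree (q y)" using Y(2)[OF y] by simp
  then have ne: "bad y ~= {}" by auto
  define r where "r = Max ((\<lambda>c. nrm (poly (q y) (of_nat c))) ` bad y)"
  have "r \<in> (\<lambda>c. nrm (poly (q y) (of_nat c))) ` bad y" unfolding r_def using fin ne by (intro Max_in) auto
  then obtain c where c: "c \<in> bad y" "r = nrm (poly (q y) (of_nat c))" by blast
  then obtain j where j: "nrm (coeff (q y) j) > r" unfolding bad_def by auto
  have "nrm (coeff (q y) j) <= r"
   by (rule coeff_bound_of_values[OF fin card]) (auto simp: r_def fin)
  with j show False by simp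
 qed
 then have "(\<Sum>y\<in>Y. card (bad y)) <= card Y * D" using sum_bounded_above[of Y "\<lambda>y. card (bad y)" D] by simp
 then have "card (\<Union>y\<in>Y. bad y) < card C" using card_UN_le[OF Y(1), of bad] C(2) by linarith
 moreover have "(\<Union>y\<in>Y. bad y) \<subseteq> C" unfolding bad_def by blast
 ultimately obtain c where "c \<in> C" "c ~: (\<Union>y\<in>Y. bad y)" using C(1)
  by (metis less_irrefl subsetI subset_antisym)
 then show ?thesis unfolding bad_def by (intro bexI[of _ c]) (auto simp: not_less)
qed

end

section \<open>Coordinate projections of subspaces\<close>

lemma dim_eq_card_coords:
 fixes W :: "('k::field ^ 'v::finite) set"
 assumes W: "vec.subspace W" and inj: "!!v. v \<in> W ==> \<forall>b\<in>B. v $ b = 0 ==> v = 0"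
  and surj: "!!t. \<exists>v\<in>W. \<forall>b\<in>B. v $ b = t $ b"
 shows "vec.dim W = card B"
proof -
 have "\<forall>b. \<exists>v. v \<in> W \<and> (\<forall>b'\<in>B. v $ b' = (axis b 1 :: 'k ^ 'v) $ b')" using surj by blast
 then obtain e where "\<forall>b. e b \<in> W \<and> (\<forall>b'\<in>B. e b $ b' = (axis b 1 :: 'k ^ 'v) $ b')"
  by (rule choice[THEN exE])
 then have e: "!!b. e b \<in> W" "!!b b'. b' \<in> B ==> e b $ b' = (if b' = b then 1 else 0)"
  by (auto simp: axis_def)
 have injon: "inj_on e B"
 proof (rule inj_onI, rule ccontr)
  fix b c assume "b \<in> B" "c \<in> B" "e b = e c" "b ~= c"
  then show False using e(2)[of b b] e(2)[of b c] by simp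
 qed
 have comb: "(\<Sum>b\<in>B. u b *s e b) $ c = u c" if "c \<in> B" for u c
 proof -
  have "(\<Sum>b\<in>B. u b *s e b) $ c = (\<Sum>b\<in>B. if b = c then u b else 0)"
   unfolding sum_component vector_smult_component by (intro sum.cong refl) (simp add: e(2)[OF that])
  then show ?thesis using that by simp
 qed
 have "vec.independent (e ` B)"
 proof (rule vec.independent_if_scalars_zero)
  fix f x assume s: "(\<Sum>x\<in>e ` B. f x *s x) = 0" and "x \<in> e ` B"
  then obtain c where c: "c \<in> B" "x = e c" by blast
  have "(\<Sum>b\<in>B. f (e b) *s e b) = 0" using s by (simp add: sum.reindex[OF injon])
  then have "f (e c) = (0 :: 'k ^ 'v) $ c" using comb[OF c(1), of "\<lambda>b. f (e b)"] by simp
  then show "f x = 0" using c by simp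
 qed simp
 moreover have "vec.span (e ` B) = vec.span W"
 proof
  show "vec.span (e ` B) \<subseteq> vec.span W" using e by (intro vec.span_mono) auto
  have "w \<in> vec.span (e ` B)" if w: "w \<in> W" for w
  proof -
   have "w - (\<Sum>b\<in>B. w $ b *s e b) = 0"
   proof (rule inj)
    show "w - (\<Sum>b\<in>B. w $ b *s e b) \<in> W"
     by (intro vec.subspace_diff[OF W] w vec.subspace_sum[OF W] vec.subspace_scale[OF W] e)
    show "\<forall>c\<in>B. (w - (\<Sum>b\<in>B. w $ b *s e b)) $ c = 0" using comb by (simp del: sum_component)
   qed
   then have "w = (\<Sum>b\<in>B. w $ b *s e b)" by simp
   also have "\<dots> \<in> vec.span (e ` B)" by (intro vec.span_sum vec.span_scale vec.span_base) auto
   finally show ?thesis .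
  qed
  then show "vec.span W \<subseteq> vec.span (e ` B)" by (intro vec.span_minimal) (auto simp: vec.subspace_span)
 qed
 ultimately have "vec.dim W = card (e ` B)" by (intro vec.dim_eq_card)
 then show ?thesis using card_image[OF injon] by simp
qed

section \<open>Points close to a given point\<close>

lemma zderiv_pCons: "zderiv (pCons a P) = P + pCons 0 (zderiv P)"
proof (rule poly_eqI)
 fix n
 show "coeff (zderiv (pCons a P)) n = coeff (P + pCons 0 (zderiv P)) n"
  by (cases n) (simp_all add: coeff_zderiv algebra_simps)
qed

locale na_prime = pf_prime I + na_abs nrm
 for I :: "('k::{alg_closed_field, field_char_0} ^ 'v::finite => 'k) set" and nrm :: "'k => real"
begin

definition lin_poly :: "('v => nat) => ('v => nat) => 'k ^ 'v => 'k poly" where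
 "lin_poly n e x = [:\<Sum>i\<in>UNIV. of_nat (Suc (n i)) * x $ i:] + (\<Sum>i\<in>UNIV. monom (x $ i) (e i))"

lemma poly_lin_poly: "poly (lin_poly n e x) c = lin_form n e c x"
 by (simp add: lin_poly_def lin_form_def poly_sum poly_monom sum.distrib[symmetric] algebra_simps)

text \<open>Positive exponents keep the integral part of the form in the constant coefficient, and
  injectivity keeps the coordinates apart.\<close>

lemma coeff_lin_poly:
 assumes "inj e" "!!i. e i > 0"
 shows "coeff (lin_poly n e x) (e i) = x $ i"
proof -
 have "(\<Sum>j\<in>UNIV. coeff (monom (x $ j) (e j)) (e i)) = (\<Sum>j\<in>UNIV. if j = i then x $ j else 0)"
  using assms(1) by (intro sum.cong) (auto simp: inj_def)
 moreover have "coeff [:\<Sum>i\<in>UNIV. of_nat (Suc (n i)) * x $ i:] (e i) = 0"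
  using assms(2)[of i] by (cases "e i") auto
 ultimately show ?thesis unfolding lin_poly_def coeff_add coeff_sum by simp
qed

lemma degree_lin_poly: "(!!i. e i <= N) ==> degree (lin_poly n e x) <= N"
 unfolding lin_poly_def
 by (intro degree_add_le degree_sum_le) (auto intro: order_trans[OF degree_monom_le])

lemma lin_form_diff: "lin_form n e c (x - y) = lin_form n e c x - lin_form n e c y"
 by (simp add: lin_form_def algebra_simps sum_subtractf)

lemma lin_form_le: "nrm (lin_form n e (of_nat c) x) <= vn x"
 unfolding lin_form_def
proof (rule nrm_sum_le)
 fix i
 have "nrm (of_nat (Suc (n i)) + of_nat c ^ e i) <= 1"
  using nrm_of_nat_le[of "Suc (n i) + c ^ e i"] by (simp only: of_nat_add of_nat_power)
 then have "nrm (of_nat (Suc (n i)) + of_nat c ^ e i) * nrm (x $ i) <= 1 * vn x"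
  using nrm_le_vn[of x i] by (intro mult_mono) auto
 then show "nrm ((of_nat (Suc (n i)) + of_nat c ^ e i) * x $ i) <= vn x" by (simp add: nrm_mult)
qed simp

text \<open>If all points of \<open>Y\<close> had distance at least \<open>r\<close> from
  \<open>x\<close>, then an integer good for all differences \<open>x - z\<close> at once would make
  every factor of the product at least \<open>r\<close>.\<close>

lemma near_point:
 assumes e: "inj e" "!!i. e i > 0" "!!i. e i <= N"
  and Y: "finite Y" and C: "finite C" "card C > card Y * N" and r: "r > 0"
  and small: "!!c. c \<in> C ==>
   nrm (\<Prod>z\<in>Y. (lin_form n e (of_nat c) x - lin_form n e (of_nat c) z)) < r ^ card Y"
 shows "\<exists>z\<in>Y. vn (x - z) < r"
proof (rule ccontr)
 assume "\<not> ?thesis"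
 then have far: "!!z. z \<in> Y ==> vn (x - z) >= r" by force
 obtain c where c: "c \<in> C" "\<forall>z\<in>Y. \<forall>j. nrm (coeff (lin_poly n e (x - z)) j) <= nrm (poly (lin_poly n e (x - z)) (of_nat c))"
  using good_integer[OF Y _ C, of "\<lambda>z. lin_poly n e (x - z)"] degree_lin_poly[of e N n, OF e(3)] by blast
 have "r <= nrm (lin_form n e (of_nat c) x - lin_form n e (of_nat c) z)" if z: "z \<in> Y" for z
 proof -
  obtain i where "vn (x - z) = nrm ((x - z) $ i)" using vn_attained by blast
  also have "\<dots> = nrm (coeff (lin_poly n e (x - z)) (e i))" by (simp only: coeff_lin_poly[OF e(1,2)])
  also have "\<dots> <= nrm (lin_form n e (of_nat c) (x - z))" using c(2) z by (simp only: poly_lin_poly[symmetric])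
  finally show ?thesis using far[OF z] by (simp only: lin_form_diff)
 qed
 then have "(\<Prod>z\<in>Y. r) <= (\<Prod>z\<in>Y. nrm (lin_form n e (of_nat c) x - lin_form n e (of_nat c) z))"
  using r by (intro prod_mono) auto
 then show False using small[OF c(1)] by (simp add: nrm_prod)
qed

text \<open>The number of integers that is required depends on the size of the fibres, which is
  known only after one primitive element has been chosen; hence the arbitrary bound
  \<open>K\<close>.\<close>

lemma primitive_integers:
 assumes B: "tr_basis I B"
 obtains n e N where "inj e" "!!i. e i > 0" "!!i. e i <= N"
  "!!K::nat. \<exists>C a G. finite C \<and> card C > K \<and> (\<forall>c\<in>C. fiber_poly B (lin_form n e (of_nat c)) (a c) (G c))"
proof -
 obtain n e F where e: "inj e" "!!i. e i > 0" "finite F"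
  "!!c. c ~: F ==> \<exists>a G. fiber_poly B (lin_form n e c) a G"
  using primitive_elements[OF B] by blast
 have "e i <= Max (range e)" for i by (rule Max_ge) auto
 moreover have "\<exists>C a G. finite C \<and> card C > K \<and> (\<forall>c\<in>C. fiber_poly B (lin_form n e (of_nat c)) (a c) (G c))" for K :: nat
 proof -
  define A where "A = {c::nat. (of_nat c :: 'k) ~: F}"
  have "finite (UNIV - A)"
  proof (rule inj_on_finite)
   show "inj_on (of_nat :: nat => 'k) (UNIV - A)" by (simp add: inj_on_def)
   show "of_nat ` (UNIV - A) \<subseteq> F" by (auto simp: A_def)
  qed (rule e(3))
  then have "infinite A" using infinite_UNIV_nat finite_Diff2 by blast
  then obtain C where C: "finite C" "card C = Suc K" "C \<subseteq> A" using infinite_arbitrarily_large by blast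
  have "\<forall>c. \<exists>aG. c \<in> C --> fiber_poly B (lin_form n e (of_nat c)) (fst aG) (snd aG)"
  proof
   fix c
   show "\<exists>aG. c \<in> C --> fiber_poly B (lin_form n e (of_nat c)) (fst aG) (snd aG)"
   proof (cases "c \<in> C")
    case True
    then have "of_nat c ~: F" using C(3) by (auto simp: A_def)
    from e(4)[OF this] obtain a G where "fiber_poly B (lin_form n e (of_nat c)) a G" by blast
    then show ?thesis by (intro exI[of _ "(a, G)"]) simp
   qed simp
  qed
  then obtain aG where "\<forall>c. c \<in> C --> fiber_poly B (lin_form n e (of_nat c)) (fst (aG c)) (snd (aG c))"
   by (rule choice[THEN exE])
  then show ?thesis using C by (intro exI[of _ C] exI[of _ "\<lambda>c. fst (aG c)"] exI[of _ "\<lambda>c. snd (aG c)"]) auto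
 qed
 ultimately show thesis using that[OF e(1,2)] by blast
qed

lemma fiber_polyD:
 assumes "fiber_poly B te a G"
 shows "a \<in> pf B" "G \<in> pfpoly B" "a ~= 0" "degree G > 0" "poly G te \<in> I" "lead_coeff G ~= 0"
  "a y ~= 0 ==> finite (fiber B y)" "a y ~= 0 ==> card (fiber B y) = degree G" "a y ~= 0 ==> lead_coeff G y ~= 0"
  "a y ~= 0 ==> poly G (\<lambda>_. ze) y = lead_coeff G y * (\<Prod>z\<in>fiber B y. (ze - te z))"
 using assms unfolding fiber_poly_def by blast+

lemma fiber_cong:
 "(!!b. b \<in> B ==> y $ b = y' $ b) ==> fiber B y = fiber B y'"
 unfolding fiber_def by auto

text \<open>Continuity of roots without completeness: the polynomial \<open>G c\<close> at the value
  \<open>te c x\<close> vanishes at \<open>x\<close>, so it is small at nearby \<open>y\<close>,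
  where it is the leading coefficient times the product of \<open>te c x - te c z\<close> over the
  fibre of \<open>y\<close>. The leading coefficient keeps its norm, so the product is small for
  every \<open>c\<close> in \<open>C\<close>.\<close>

theorem fiber_near:
 assumes B: "tr_basis I B"
 shows "\<exists>a\<in>pf B. a ~= 0 \<and> (\<forall>y. a y ~= 0 --> finite (fiber B y) \<and> fiber B y ~= {}) \<and>
  (\<forall>x\<in>zeros I. a x ~= 0 --> (\<forall>r>0. \<exists>d>0. \<forall>y. (\<forall>b\<in>B. nrm (y $ b - x $ b) < d) -->
   (\<exists>z\<in>fiber B y. vn (x - z) < r)))"
proof -
 have ind: "alg_indep I B" using B by (simp add: tr_basis_def)
 obtain n e N where e: "inj e" "!!i. e i > 0" "!!i. e i <= N"
  and PE: "!!K::nat. \<exists>C a G. finite C \<and> card C > K \<and> (\<forall>c\<in>C. fiber_poly B (lin_form n e (of_nat c)) (a c) (G c))"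
  by (rule primitive_integers[OF B]) (rule that)
 obtain C0 a0 G0 where C0: "finite C0" "card C0 > (0::nat)"
  "\<forall>c\<in>C0. fiber_poly B (lin_form n e (of_nat c)) (a0 c) (G0 c)" using PE[of 0] by blast
 obtain c0 where c0: "c0 \<in> C0" using C0(2) by fastforce
 \<comment> \<open>This first primitive element serves to determine the common size \<open>D\<close>
   of the generic fibres, on which the number of integers in \<open>C\<close> depends.\<close>
 note P0 = fiber_polyD[OF C0(3)[rule_format, OF c0]]
 define D where "D = degree (G0 c0)"
 obtain C a G where C: "finite C" "card C > D * N"
  "\<forall>c\<in>C. fiber_poly B (lin_form n e (of_nat c)) (a c) (G c)" using PE[of "D * N"] by blast
 note P = fiber_polyD[OF C(3)[rule_format]]
 define A where "A = a0 c0 * (\<Prod>c\<in>C. a c)"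
 have Apf: "A \<in> pf B" unfolding A_def by (intro pf_mult pf_prod P0 P)
 have prod0: "(\<Prod>c\<in>C. a c) ~= 0" by (rule indep_prod_nonzero[OF ind]) (simp add: P)
 have prodpf: "(\<Prod>c\<in>C. a c) \<in> pf B" by (intro pf_prod P)
 have A0: "A ~= 0" using indep_domain[OF ind P0(1) prodpf] prod0 P0(3) unfolding A_def by blast
 have Ay: "a0 c0 y ~= 0" "c \<in> C ==> a c y ~= 0" if "A y ~= 0" for y c
  using that C(1) unfolding A_def by auto
 have fib: "finite (fiber B y)" "card (fiber B y) = D" "fiber B y ~= {}" if "A y ~= 0" for y
 proof -
  show f: "finite (fiber B y)" "card (fiber B y) = D" using P0(7,8)[OF Ay(1)[OF that]] unfolding D_def by blast+
  then show "fiber B y ~= {}" using P0(4) unfolding D_def by auto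
 qed
 have near: "\<exists>d>0. \<forall>y. (\<forall>b\<in>B. nrm (y $ b - x $ b) < d) --> (\<exists>z\<in>fiber B y. vn (x - z) < r)"
  if x: "x \<in> zeros I" "A x ~= 0" and r: "r > 0" for x r
 proof -
  define te where "te c = lin_form n e (of_nat c)" for c
  define f where "f c = poly (G c) (\<lambda>_. te c x)" for c
  have fpf: "f c \<in> pf B" if "c \<in> C" for c unfolding f_def by (intro pfpoly_poly P pf_const that)
  have fx: "f c x = 0" if "c \<in> C" for c
   using zerosD[OF x(1) P(5)[OF that]] poly_fun_apply[of "G c" "te c" x] unfolding f_def te_def by simp
  have gpf: "lead_coeff (G c) \<in> pf B" if "c \<in> C" for c by (intro pfpolyD P that)
  have gx: "lead_coeff (G c) x ~= 0" if "c \<in> C" for c by (rule P(9)[OF that Ay(2)[OF x(2) that]])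
  have "\<exists>d>0. \<forall>y. vn (y - x) < d --> (\<forall>c\<in>C. nrm (f c y) < nrm (lead_coeff (G c) x) * r ^ D \<and>
    nrm (lead_coeff (G c) y) = nrm (lead_coeff (G c) x))"
  proof (rule uniform_neighbourhood[OF C(1)])
   fix c assume c: "c \<in> C"
   have "nrm (lead_coeff (G c) x) * r ^ D > 0" using gx[OF c] r by simp
   from pf_continuous[OF fpf[OF c] this, of x] obtain d1 where
    d1: "d1 > 0" "!!y. vn (y - x) < d1 ==> nrm (f c y) < nrm (lead_coeff (G c) x) * r ^ D" using fx[OF c] by auto
   obtain d2 where d2: "d2 > 0" "!!y. vn (y - x) < d2 ==> nrm (lead_coeff (G c) y) = nrm (lead_coeff (G c) x)"
    using pf_nrm_locally_constant[OF gpf[OF c] gx[OF c]] by blast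
   show "\<exists>d>0. \<forall>y. vn (y - x) < d --> nrm (f c y) < nrm (lead_coeff (G c) x) * r ^ D \<and>
    nrm (lead_coeff (G c) y) = nrm (lead_coeff (G c) x)"
    using d1 d2 by (intro exI[of _ "min d1 d2"]) auto
  qed
  then obtain d1 where d1: "d1 > 0" "!!y c. vn (y - x) < d1 ==> c \<in> C ==> nrm (f c y) < nrm (lead_coeff (G c) x) * r ^ D \<and>
    nrm (lead_coeff (G c) y) = nrm (lead_coeff (G c) x)" by blast
  obtain d2 where d2: "d2 > 0" "!!y. vn (y - x) < d2 ==> nrm (A y) = nrm (A x)"
   using pf_nrm_locally_constant[OF Apf x(2)] by blast
  have "\<exists>z\<in>fiber B y. vn (x - z) < r" if y: "\<forall>b\<in>B. nrm (y $ b - x $ b) < min d1 d2" for y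
  proof -
   \<comment> \<open>Only the coordinates in \<open>B\<close> of \<open>y\<close> are controlled.
     Replacing the others by those of \<open>x\<close> leaves the fibre unchanged.\<close>
   define y' where "y' = (\<chi> i. if i \<in> B then y $ i else x $ i)"
   have vy: "vn (y' - x) < min d1 d2" unfolding vn_less_iff y'_def using y d1(1) d2(1) by auto
   then have "nrm (A y') = nrm (A x)" using d2(2) by simp
   then have Ay': "A y' ~= 0" using x(2) nrm_eq_0[of "A y'"] nrm_eq_0[of "A x"] by metis
   have fy: "fiber B y = fiber B y'" by (rule fiber_cong) (simp add: y'_def)
   have "\<exists>z\<in>fiber B y'. vn (x - z) < r"
   proof (rule near_point[OF e fib(1)[OF Ay'] C(1) _ r])
    show "card (fiber B y') * N < card C" unfolding fib(2)[OF Ay'] by (rule C(2))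
    fix c assume c: "c \<in> C"
    have eq: "f c y' = lead_coeff (G c) y' * (\<Prod>z\<in>fiber B y'. (te c x - te c z))"
     unfolding f_def te_def by (rule P(10)[OF c Ay(2)[OF Ay' c]])
    have "vn (y' - x) < d1" using vy by simp
    from d1(2)[OF this c] have 1: "nrm (f c y') < nrm (lead_coeff (G c) x) * r ^ D"
     and 2: "nrm (lead_coeff (G c) y') = nrm (lead_coeff (G c) x)" by blast+
    have "nrm (lead_coeff (G c) x) * nrm (\<Prod>z\<in>fiber B y'. (te c x - te c z)) < nrm (lead_coeff (G c) x) * r ^ D"
     using 1 unfolding eq nrm_mult 2 .
    then show "nrm (\<Prod>z\<in>fiber B y'. (lin_form n e (of_nat c) x - lin_form n e (of_nat c) z)) < r ^ card (fiber B y')"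
     using gx[OF c] unfolding fib(2)[OF Ay'] te_def by simp
   qed
   then show ?thesis unfolding fy .
  qed
  then show ?thesis using d1(1) d2(1) by (intro exI[of _ "min d1 d2"]) auto
 qed
 show ?thesis
  by (intro bexI[OF _ Apf] conjI A0 allI impI ballI fib(1) fib(3) near)
qed

text \<open>Over suitable values of the basis coordinates the fibre is nonempty and \<open>h\<close>
  vanishes nowhere on it.\<close>

theorem nullstellensatz:
 assumes h: "h \<in> pf UNIV" "h ~: I"
 shows "\<exists>x\<in>zeros I. h x ~= 0"
proof -
 obtain B where B: "tr_basis I B" using ex_tr_basis by blast
 then have ind: "alg_indep I B" by (simp add: tr_basis_def)
 obtain a where a: "a \<in> pf B" "a ~= 0" "\<forall>y\<in>zeros I. a y ~= 0 --> h y ~= 0"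
  using nonvanishing_over_basis[OF B h] by blast
 obtain a' where a': "a' \<in> pf B" "a' ~= 0" "\<forall>y. a' y ~= 0 --> finite (fiber B y) \<and> fiber B y ~= {}"
  using fiber_near[OF B] by (elim bexE conjE) (rule that)
 have "a * a' ~= 0" using indep_domain[OF ind a(1) a'(1)] a a' by blast
 then obtain y where y: "a y ~= 0" "a' y ~= 0" by (auto simp: fun_eq_iff)
 then obtain z where z: "z \<in> fiber B y" using a'(3) by blast
 have "a z = a y" by (rule pf_cong_coords[OF a(1)]) (use z in \<open>simp add: fiber_def\<close>)
 then show ?thesis using a(3) z y by (intro bexI[of _ z]) (auto simp: fiber_def)
qed

end

section \<open>Gradients and tangent spaces\<close>

context na_abs
begin

text \<open>A quadratic remainder on every ball determines the gradient from the function, without a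
  choice of a polynomial, and fits the estimates with nearby points of the cone.\<close>

definition has_grad :: "('k ^ 'v::finite => 'k) => ('v => 'k ^ 'v => 'k) => bool" where
 "has_grad f g \<longleftrightarrow> (\<forall>r. \<exists>C\<ge>0. \<forall>y h. vn y <= r --> vn h <= r -->
   nrm (f (y + h) - f y - (\<Sum>i\<in>UNIV. g i y * h $ i)) <= C * (vn h)\<^sup>2)"

lemma has_gradE:
 assumes "has_grad f g"
 obtains C where "C >= 0" "!!y h. vn y <= r ==> vn h <= r ==>
   nrm (f (y + h) - f y - (\<Sum>i\<in>UNIV. g i y * h $ i)) <= C * (vn h)\<^sup>2"
 using assms[unfolded has_grad_def, THEN spec, of r] by (elim exE conjE) (rule that, assumption, blast)

lemma has_grad_const: "has_grad (\<lambda>_. c) (\<lambda>_. 0)"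
 unfolding has_grad_def by (auto intro!: exI[of _ 0])

lemma has_grad_coord:
 fixes i :: "'v::finite"
 shows "has_grad (\<lambda>x. x $ i) (\<lambda>j. if j = i then 1 else 0)"
proof -
 have d: "(\<lambda>j. if j = i then 1 else 0) = (\<lambda>j (_ :: 'k ^ 'v). if j = i then 1 else (0 :: 'k))"
  by (auto simp: fun_eq_iff)
 have "(\<Sum>j\<in>UNIV. (if j = i then 1 else 0) * h $ j) = h $ i" for h :: "'k ^ 'v"
  by (simp add: if_distrib[of "\<lambda>a. a * _"] cong: if_cong)
 then show ?thesis unfolding has_grad_def d by (auto intro!: exI[of _ 0])
qed

lemma has_grad_add:
 assumes f: "has_grad f f'" and g: "has_grad g g'"
 shows "has_grad (f + g) (\<lambda>i. f' i + g' i)"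
 unfolding has_grad_def
proof
 fix r
 obtain C where C: "C >= 0" "!!y h. vn y <= r ==> vn h <= r ==>
   nrm (f (y + h) - f y - (\<Sum>i\<in>UNIV. f' i y * h $ i)) <= C * (vn h)\<^sup>2" by (rule has_gradE[OF f, of r]) (rule that)
 obtain D where D: "D >= 0" "!!y h. vn y <= r ==> vn h <= r ==>
   nrm (g (y + h) - g y - (\<Sum>i\<in>UNIV. g' i y * h $ i)) <= D * (vn h)\<^sup>2" by (rule has_gradE[OF g, of r]) (rule that)
 have "nrm ((f + g) (y + h) - (f + g) y - (\<Sum>i\<in>UNIV. (f' i + g' i) y * h $ i)) <= max C D * (vn h)\<^sup>2"
  if "vn y <= r" "vn h <= r" for y h
 proof -
  have "C * (vn h)\<^sup>2 <= max C D * (vn h)\<^sup>2" "D * (vn h)\<^sup>2 <= max C D * (vn h)\<^sup>2"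
   by (intro mult_right_mono; simp)+
  then have "nrm ((f (y + h) - f y - (\<Sum>i\<in>UNIV. f' i y * h $ i)) + (g (y + h) - g y - (\<Sum>i\<in>UNIV. g' i y * h $ i)))
   <= max C D * (vn h)\<^sup>2"
   using C(2)[OF that] D(2)[OF that] by (intro nrm_add_le) linarith+
  then show ?thesis by (simp add: algebra_simps sum.distrib)
 qed
 then show "\<exists>C\<ge>0. \<forall>y h. vn y <= r --> vn h <= r -->
   nrm ((f + g) (y + h) - (f + g) y - (\<Sum>i\<in>UNIV. (f' i + g' i) y * h $ i)) <= C * (vn h)\<^sup>2"
  using C(1) by (intro exI[of _ "max C D"]) auto
qed

lemma has_grad_mult:
 assumes f: "has_grad f f'" and g: "has_grad g g'"
  and pf: "f \<in> pf UNIV" "g \<in> pf UNIV" "!!i. g' i \<in> pf UNIV"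
 shows "has_grad (f * g) (\<lambda>i. f * g' i + f' i * g)"
 unfolding has_grad_def
proof
 fix r
 obtain C where C: "C >= 0" "!!y h. vn y <= r ==> vn h <= r ==>
   nrm (f (y + h) - f y - (\<Sum>i\<in>UNIV. f' i y * h $ i)) <= C * (vn h)\<^sup>2" by (rule has_gradE[OF f, of r]) (rule that)
 obtain D where D: "D >= 0" "!!y h. vn y <= r ==> vn h <= r ==>
   nrm (g (y + h) - g y - (\<Sum>i\<in>UNIV. g' i y * h $ i)) <= D * (vn h)\<^sup>2" by (rule has_gradE[OF g, of r]) (rule that)
 obtain Cf where Cf: "Cf >= 0" "!!y. vn y <= r ==> nrm (f y) <= Cf"
  "!!y z. vn y <= r ==> vn z <= r ==> nrm (f y - f z) <= Cf * vn (y - z)" using pf_lipschitz[OF pf(1), of r] by auto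
 obtain Cg where Cg: "Cg >= 0" "!!y. vn y <= r ==> nrm (g y) <= Cg" using pf_lipschitz[OF pf(2), of r] by auto
 have "\<forall>i. \<exists>G. G >= 0 \<and> (\<forall>y. vn y <= r --> nrm (g' i y) <= G)" using pf_lipschitz[OF pf(3), of r] by blast
 then obtain G where "\<forall>i. G i >= 0 \<and> (\<forall>y. vn y <= r --> nrm (g' i y) <= G i)" by (rule choice[THEN exE])
 then have G: "!!i. G i >= 0" "!!i y. vn y <= r ==> nrm (g' i y) <= G i" by blast+
 define M where "M = Max (range G)"
 have M: "G i <= M" for i unfolding M_def by (rule Max_ge) auto
 have M0: "M >= 0" using M[of undefined] G(1)[of undefined] by linarith
 \<comment> \<open>Bounds for the three error terms of a product: the remainder of \<open>g\<close>,
   the remainder of \<open>f\<close>, and the increment of \<open>f\<close> times the differential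
   of \<open>g\<close>.\<close>
 define K where "K = max (Cf * D) (max (C * Cg) (Cf * M))"
 have K: "Cf * D <= K" "C * Cg <= K" "Cf * M <= K" unfolding K_def by auto
 have K0: "K >= 0" using K(1) Cf(1) D(1) by (meson mult_nonneg_nonneg order_trans)
 have "nrm ((f * g) (y + h) - (f * g) y - (\<Sum>i\<in>UNIV. (f * g' i + f' i * g) y * h $ i)) <= K * (vn h)\<^sup>2"
  if y: "vn y <= r" "vn h <= r" for y h
 proof -
  define Df where "Df = (\<Sum>i\<in>UNIV. f' i y * h $ i)"
  define Dg where "Dg = (\<Sum>i\<in>UNIV. g' i y * h $ i)"
  have yh: "vn (y + h) <= r" using y by (rule vn_add_le)
  have Dg: "nrm Dg <= M * vn h" unfolding Dg_def
  proof (rule nrm_sum_le)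
   fix i
   have "nrm (g' i y) * nrm (h $ i) <= M * vn h"
    using G(2)[OF y(1), of i] M[of i] M0 by (intro mult_mono nrm_le_vn) auto
   then show "nrm (g' i y * h $ i) <= M * vn h" by (simp add: nrm_mult)
  qed (use M0 in simp)
  have 1: "nrm (f (y + h) * (g (y + h) - g y - Dg)) <= K * (vn h)\<^sup>2"
  proof -
   have "nrm (f (y + h) * (g (y + h) - g y - Dg)) <= Cf * (D * (vn h)\<^sup>2)"
    unfolding nrm_mult Dg_def by (intro mult_mono Cf(2) D(2) y yh) (auto simp: Cf)
   also have "\<dots> <= K * (vn h)\<^sup>2" using mult_right_mono[OF K(1), of "(vn h)\<^sup>2"] by (simp add: mult.assoc)
   finally show ?thesis .
  qed
  have 2: "nrm ((f (y + h) - f y - Df) * g y) <= K * (vn h)\<^sup>2"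
  proof -
   have "nrm ((f (y + h) - f y - Df) * g y) <= (C * (vn h)\<^sup>2) * Cg"
    unfolding nrm_mult Df_def by (intro mult_mono Cg(2) C(2) y) (auto simp: C)
   also have "\<dots> <= K * (vn h)\<^sup>2" using mult_right_mono[OF K(2), of "(vn h)\<^sup>2"] by (simp add: mult_ac)
   finally show ?thesis .
  qed
  have 3: "nrm ((f (y + h) - f y) * Dg) <= K * (vn h)\<^sup>2"
  proof -
   have "nrm (f (y + h) - f y) <= Cf * vn h" using Cf(3)[OF yh y(1)] by simp
   then have "nrm ((f (y + h) - f y) * Dg) <= (Cf * vn h) * (M * vn h)"
    unfolding nrm_mult by (intro mult_mono Dg) (auto simp: Cf)
   also have "\<dots> <= K * (vn h)\<^sup>2" using mult_right_mono[OF K(3), of "(vn h)\<^sup>2"] by (simp add: mult_ac power2_eq_square)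
   finally show ?thesis .
  qed
  have "(\<Sum>i\<in>UNIV. (f * g' i + f' i * g) y * h $ i) = f y * Dg + Df * g y"
   unfolding Df_def Dg_def by (simp add: algebra_simps sum.distrib sum_distrib_left sum_distrib_right)
  then have "(f * g) (y + h) - (f * g) y - (\<Sum>i\<in>UNIV. (f * g' i + f' i * g) y * h $ i) =
   f (y + h) * (g (y + h) - g y - Dg) + ((f (y + h) - f y - Df) * g y + (f (y + h) - f y) * Dg)"
   by (simp add: algebra_simps)
  then show ?thesis using 1 2 3 by (simp only: nrm_add_le)
 qed
 then show "\<exists>C\<ge>0. \<forall>y h. vn y <= r --> vn h <= r -->
   nrm ((f * g) (y + h) - (f * g) y - (\<Sum>i\<in>UNIV. (f * g' i + f' i * g) y * h $ i)) <= C * (vn h)\<^sup>2"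
  using K0 by (intro exI[of _ K]) blast
qed

lemma pf_has_grad:
 fixes f :: "'k ^ 'v::finite => 'k"
 assumes "f \<in> pf S"
 shows "\<exists>g. has_grad f g \<and> (\<forall>i. g i \<in> pf S) \<and> (\<forall>i. i ~: S --> g i = 0)"
 using assms
proof (induction rule: pf.induct)
 case (pf_const c)
 show ?case by (intro exI[of _ "\<lambda>_. 0"] conjI allI impI has_grad_const pf_zero refl)
next
 case (pf_coord i)
 have "(if j = i then 1 else 0) \<in> pf S" for j
  by (cases "j = i") (simp_all only: if_True if_False pf_one pf_zero simp_thms)
 moreover have "(if j = i then 1 else 0) = (0 :: 'k ^ 'v => 'k)" if "j ~: S" for j
 proof -
  have "j ~= i" using pf_coord that by blast
  then show ?thesis by (simp only: if_False)
 qed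
 ultimately show ?case by (intro exI[of _ "\<lambda>j. if j = i then 1 else 0"] conjI allI impI has_grad_coord)
next
 case (pf_add f g)
 then obtain f' g' where *: "has_grad f f'" "\<forall>i. f' i \<in> pf S" "\<forall>i. i ~: S --> f' i = 0"
  "has_grad g g'" "\<forall>i. g' i \<in> pf S" "\<forall>i. i ~: S --> g' i = 0" by blast
 have "f' i + g' i = 0" if "i ~: S" for i
  by (simp only: *(3,6)[rule_format, OF that] add_0_left)
 then show ?case
  by (intro exI[of _ "\<lambda>i. f' i + g' i"] conjI allI impI has_grad_add pf.pf_add *(1,4) *(2,5)[rule_format])
next
 case (pf_mult f g)
 then obtain f' g' where *: "has_grad f f'" "\<forall>i. f' i \<in> pf S" "\<forall>i. i ~: S --> f' i = 0"
  "has_grad g g'" "\<forall>i. g' i \<in> pf S" "\<forall>i. i ~: S --> g' i = 0" by blast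
 have "f * g' i + f' i * g = 0" if "i ~: S" for i
  by (simp only: *(3,6)[rule_format, OF that] add_0_left mult_zero_left mult_zero_right)
 moreover have "f * g' i + f' i * g \<in> pf S" for i
  by (intro pf.pf_add pf.pf_mult pf_mult.hyps *(2,5)[rule_format])
 moreover have "has_grad (f * g) (\<lambda>i. f * g' i + f' i * g)"
  by (intro has_grad_mult *(1,4) pf_UNIV[OF pf_mult.hyps(1)] pf_UNIV[OF pf_mult.hyps(2)] pf_UNIV[OF *(5)[rule_format]])
 ultimately show ?case by (intro exI[of _ "\<lambda>i. f * g' i + f' i * g"] conjI allI impI)
qed

lemma has_grad_unique:
 fixes f :: "'k ^ 'v::finite => 'k"
 assumes "has_grad f g" "has_grad f g'"
 shows "g i y = g' i y"
proof (rule ccontr)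
 assume ne: "g i y ~= g' i y"
 define r where "r = vn y + 1"
 obtain C where C: "C >= 0" "!!y h. vn y <= r ==> vn h <= r ==>
   nrm (f (y + h) - f y - (\<Sum>i\<in>UNIV. g i y * h $ i)) <= C * (vn h)\<^sup>2" by (rule has_gradE[OF assms(1), of r]) (rule that)
 obtain D where D: "D >= 0" "!!y h. vn y <= r ==> vn h <= r ==>
   nrm (f (y + h) - f y - (\<Sum>i\<in>UNIV. g' i y * h $ i)) <= D * (vn h)\<^sup>2" by (rule has_gradE[OF assms(2), of r]) (rule that)
 define K where "K = max C D"
 define e where "e = nrm (g i y - g' i y)"
 have e: "e > 0" unfolding e_def using ne by simp
 have K: "K >= 0" unfolding K_def using C by simp
 obtain s where s: "0 < nrm s" "nrm s < min 1 (e / (K + 1))"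
  using nrm_dense[of 0 "min 1 (e / (K + 1))"] e K by auto
 define h :: "'k ^ 'v" where "h = s *s axis i 1"
 have vh: "vn h <= nrm s" unfolding h_def by (auto simp: vn_le_iff axis_def)
 then have hr: "vn h <= r" using s(2) unfolding r_def using vn_nonneg[of y] by linarith
 have yr: "vn y <= r" unfolding r_def by simp
 have sum: "(\<Sum>j\<in>UNIV. q j y * h $ j) = q i y * s" for q :: "'v => 'k ^ 'v => 'k"
 proof -
  have "(\<Sum>j\<in>UNIV. q j y * h $ j) = (\<Sum>j\<in>UNIV. if j = i then q j y * s else 0)"
   unfolding h_def by (intro sum.cong) (auto simp: axis_def)
  then show ?thesis by simp
 qed
 have b: "nrm (f (y + h) - f y - q i y * s) <= K * (nrm s)\<^sup>2" if "q = g \<or> q = g'" for q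
 proof -
  have "C * (vn h)\<^sup>2 <= K * (nrm s)\<^sup>2" "D * (vn h)\<^sup>2 <= K * (nrm s)\<^sup>2"
   unfolding K_def using C(1) D(1) vh by (intro mult_mono power_mono; simp)+
  then show ?thesis using C(2)[OF yr hr] D(2)[OF yr hr] that unfolding sum by auto
 qed
 have "nrm ((f (y + h) - f y - g' i y * s) - (f (y + h) - f y - g i y * s)) <= K * (nrm s)\<^sup>2"
  by (intro nrm_diff_le b) auto
 also have "(f (y + h) - f y - g' i y * s) - (f (y + h) - f y - g i y * s) = (g i y - g' i y) * s"
  by (simp add: algebra_simps)
 finally have "e * nrm s <= (K * nrm s) * nrm s" by (simp add: nrm_mult e_def power2_eq_square)
 then have "e <= K * nrm s" using s(1) by simp
 moreover have "K * nrm s <= K * (e / (K + 1))" using s(2) K by (intro mult_left_mono) auto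
 moreover have "K * (e / (K + 1)) < e" using K e by (simp add: field_simps)
 ultimately show False by linarith
qed

lemma poly_has_grad:
 fixes P :: "('k ^ 'v::finite => 'k) poly"
 assumes "P \<in> pfpoly B" "i ~: B"
 shows "\<exists>g. has_grad (poly P (\<lambda>x. x $ i)) g \<and> (\<forall>j. g j \<in> pf (insert i B)) \<and>
  (\<forall>j. j ~: insert i B --> g j = 0) \<and> g i = poly (zderiv P) (\<lambda>x. x $ i)"
 using assms(1)
proof (induction P)
 case 0
 have "has_grad (0 :: 'k ^ 'v => 'k) (\<lambda>_. 0)" using has_grad_const[of 0] by (simp only: zero_fun_def)
 moreover have "zderiv (0 :: ('k ^ 'v => 'k) poly) = 0" by (simp add: zderiv_def)
 ultimately show ?case
  by (intro exI[of _ "\<lambda>_. 0"] conjI allI impI pf_zero refl) (simp_all only: poly_0)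
next
 case (pCons a P)
 define X :: "'k ^ 'v => 'k" where "X = (\<lambda>x. x $ i)"
 have X: "X \<in> pf (insert i B)" unfolding X_def by (intro pf_coord) simp
 have aP: "a \<in> pf B" "P \<in> pfpoly B" using pfpoly_pConsD[OF pCons.prems] by simp_all
 obtain g where g: "has_grad (poly P X) g" "\<forall>j. g j \<in> pf (insert i B)"
  "\<forall>j. j ~: insert i B --> g j = 0" "g i = poly (zderiv P) X"
  using pCons.IH[OF aP(2)] unfolding X_def by blast
 obtain a' where a': "has_grad a a'" "\<forall>j. a' j \<in> pf B" "\<forall>j. j ~: B --> a' j = 0"
  using pf_has_grad[OF aP(1)] by blast
 have PX: "poly P X \<in> pf (insert i B)" by (rule pfpoly_poly[OF pfpoly_mono[OF aP(2)] X]) blast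
 define d where "d j = (if j = i then (1 :: 'k ^ 'v => 'k) else 0)" for j
 have dX: "has_grad X d"
  unfolding X_def d_def by (rule has_grad_coord)
 have "has_grad (a + X * poly P X) (\<lambda>j. a' j + (X * g j + d j * poly P X))"
  by (intro has_grad_add has_grad_mult a' g dX pf_UNIV[OF X] pf_UNIV[OF PX] pf_UNIV[OF g(2)[rule_format]])
 moreover have "a' j + (X * g j + d j * poly P X) \<in> pf (insert i B)" for j
  by (intro pf_add pf_mult X PX g(2)[rule_format] pf_mono[OF a'(2)[rule_format, of j]]) (auto simp: d_def)
 moreover have "a' j + (X * g j + d j * poly P X) = 0" if "j ~: insert i B" for j
  using that a'(3) g(3) by (simp add: d_def)
 moreover have "a' i + (X * g i + d i * poly P X) = poly (zderiv (pCons a P)) X"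
  unfolding zderiv_pCons g(4) using a'(3) assms(2) by (simp add: d_def)
 ultimately show ?case unfolding poly_pCons X_def[symmetric]
  by (intro exI[of _ "\<lambda>j. a' j + (X * g j + d j * poly P X)"]) blast
qed

end

context na_prime
begin

definition tang :: "'k ^ 'v => ('k ^ 'v) set" where
 "tang x = {v. \<forall>f\<in>I. \<forall>g. has_grad f g --> (\<Sum>i\<in>UNIV. g i x * v $ i) = 0}"

lemma subspace_tang: "vec.subspace (tang x)"
 unfolding vec.subspace_def tang_def
 by (auto simp: algebra_simps sum.distrib) (simp add: sum_distrib_left[symmetric] mult.left_commute)

text \<open>Injectivity: the minimal relation of a coordinate outside \<open>B\<close> involves only
  this coordinate and \<open>B\<close>, and its derivative with respect to the coordinate is
  generically nonzero. Surjectivity: these relations leave one candidate \<open>u\<close> over each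
  \<open>t\<close>, and other elements of the ideal might obstruct it. But the fibre over
  \<open>x + q *s t\<close> contains a point \<open>x + h\<close> with \<open>h\<close> equal to
  \<open>q *s u\<close> up to second order, so the differential of every element of the ideal
  vanishes on \<open>u\<close>.\<close>

theorem tangent_projection:
 assumes B: "tr_basis I B"
 shows "\<exists>a\<in>pf UNIV. a ~: I \<and> (\<forall>x\<in>zeros I. a x ~= 0 -->
  (\<forall>v\<in>tang x. (\<forall>b\<in>B. v $ b = 0) --> v = 0) \<and> (\<forall>t. \<exists>v\<in>tang x. \<forall>b\<in>B. v $ b = t $ b))"
proof -
 have ind: "alg_indep I B" using B by (simp add: tr_basis_def)
 define X :: "'v => 'k ^ 'v => 'k" where "X i = (\<lambda>x. x $ i)" for i
 have Xpf: "X i \<in> pf UNIV" for i unfolding X_def by (intro pf_coord) simp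
 have "\<forall>i. \<exists>p. i ~: B --> fst p \<in> I \<and> has_grad (fst p) (snd p) \<and>
  (\<forall>j. snd p j \<in> pf UNIV) \<and> (\<forall>j. j ~: insert i B --> snd p j = 0) \<and> snd p i ~: I"
 proof
  fix i
  show "\<exists>p. i ~: B --> fst p \<in> I \<and> has_grad (fst p) (snd p) \<and>
   (\<forall>j. snd p j \<in> pf UNIV) \<and> (\<forall>j. j ~: insert i B --> snd p j = 0) \<and> snd p i ~: I"
  proof (cases "i \<in> B")
   case False
   obtain P where P: "P \<in> pfpoly B" "P ~= 0" "poly P (X i) \<in> I" "degree P > 0"
    and Pmin: "!!Q. Q \<in> pfpoly B ==> poly Q (X i) \<in> I ==> degree Q < degree P ==> Q = 0"
    by (rule minimal_relation[OF B Xpf[of i]]) (rule that)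
   have D: "poly (zderiv P) (X i) ~: I"
    using Pmin[OF pfpoly_zderiv[OF P(1)]] zderiv_nonzero[OF P(4)] by blast
   obtain g where "has_grad (poly P (X i)) g" "\<forall>j. g j \<in> pf (insert i B)"
    "\<forall>j. j ~: insert i B --> g j = 0" "g i = poly (zderiv P) (X i)"
    using poly_has_grad[OF P(1) False] unfolding X_def by blast
   then show ?thesis using P(3) D by (intro exI[of _ "(poly P (X i), g)"]) (auto intro: pf_UNIV)
  qed simp
 qed
 then obtain p where "\<forall>i. i ~: B --> fst (p i) \<in> I \<and> has_grad (fst (p i)) (snd (p i)) \<and>
  (\<forall>j. snd (p i) j \<in> pf UNIV) \<and> (\<forall>j. j ~: insert i B --> snd (p i) j = 0) \<and> snd (p i) i ~: I"
  by (rule choice[THEN exE])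
 define F where "F i = fst (p i)" for i
 define G where "G i = snd (p i)" for i
 have F: "!!i. i ~: B ==> F i \<in> I" "!!i. i ~: B ==> has_grad (F i) (G i)"
  and Gpf: "!!i j. i ~: B ==> G i j \<in> pf UNIV" and G0: "!!i j. i ~: B ==> j ~: insert i B ==> G i j = 0"
  and GI: "!!i. i ~: B ==> G i i ~: I"
  using \<open>\<forall>i. i ~: B --> _ i\<close> unfolding F_def G_def by blast+
 obtain a0 where a0: "a0 \<in> pf B" "a0 ~= 0"
  and near: "\<forall>x\<in>zeros I. a0 x ~= 0 --> (\<forall>r>0. \<exists>d>0. \<forall>y. (\<forall>b\<in>B. nrm (y $ b - x $ b) < d) -->
   (\<exists>z\<in>fiber B y. vn (x - z) < r))"
  using fiber_near[OF B] by (elim bexE conjE) (rule that)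
 define a where "a = a0 * (\<Prod>i\<in>-B. G i i)"
 have apf: "a \<in> pf UNIV" unfolding a_def by (intro pf_mult pf_prod pf_UNIV[OF a0(1)] Gpf) auto
 have aI: "a ~: I"
 proof
  assume "a \<in> I"
  moreover have "(\<Prod>i\<in>-B. G i i) ~: I" by (rule ideal_prime_prod) (use GI Gpf in auto)
  moreover have "a0 ~: I" using a0 alg_indepD[OF ind] by blast
  moreover have "(\<Prod>i\<in>-B. G i i) \<in> pf UNIV" by (intro pf_prod Gpf) auto
  ultimately show False using ideal_prime[OF pf_UNIV[OF a0(1)]] unfolding a_def by blast
 qed
 have main: "(\<forall>v\<in>tang x. (\<forall>b\<in>B. v $ b = 0) --> v = 0) \<and> (\<forall>t. \<exists>v\<in>tang x. \<forall>b\<in>B. v $ b = t $ b)"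
  if x: "x \<in> zeros I" and ax: "a x ~= 0" for x
 proof -
  have a0x: "a0 x ~= 0" and Gx: "!!i. i ~: B ==> G i i x ~= 0" using ax unfolding a_def by auto
  have split: "(\<Sum>j\<in>UNIV. G i j x * v $ j) = G i i x * v $ i + (\<Sum>b\<in>B. G i b x * v $ b)" if i: "i ~: B" for i v
  proof -
   have "(\<Sum>j\<in>UNIV. G i j x * v $ j) = (\<Sum>j\<in>insert i B. G i j x * v $ j)"
    using G0[OF i] by (intro sum.mono_neutral_right) auto
   then show ?thesis using i by simp
  qed
  have inj: "v = 0" if v: "v \<in> tang x" "\<forall>b\<in>B. v $ b = 0" for v
  proof -
   have "v $ i = 0" for i
   proof (cases "i \<in> B")
    case False
    have "(\<Sum>j\<in>UNIV. G i j x * v $ j) = 0" using v(1) F[OF False] unfolding tang_def by blast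
    then have "G i i x * v $ i = 0" using v(2) unfolding split[OF False] by simp
    then show ?thesis using Gx[OF False] by simp
   qed (use v in simp)
   then show ?thesis by (simp add: cart_eq_iff)
  qed
  have surj: "\<exists>v\<in>tang x. \<forall>b\<in>B. v $ b = t $ b" for t
  proof -
   \<comment> \<open>The linear equations given by the gradients of the relations \<open>F i\<close>
     prescribe the coordinates outside \<open>B\<close>.\<close>
   define u where "u = (\<chi> i. if i \<in> B then t $ i else - (\<Sum>b\<in>B. G i b x * t $ b) / G i i x)"
   have uB: "u $ b = t $ b" if "b \<in> B" for b using that by (simp add: u_def)
   have uG: "(\<Sum>b\<in>B. G i b x * t $ b) = - (G i i x * u $ i)" if "i ~: B" for i
    using that Gx[OF that] by (simp add: u_def)
   have "(\<Sum>i\<in>UNIV. g i x * u $ i) = 0" if f: "f \<in> I" and g: "has_grad f g" for f g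
   proof (rule ccontr)
    define s where "s = (\<Sum>i\<in>UNIV. g i x * u $ i)"
    assume "(\<Sum>i\<in>UNIV. g i x * u $ i) ~= 0"
    then have s: "s ~= 0" by (simp add: s_def)
    define r where "r = vn x + 1"
    have xr: "vn x <= r" unfolding r_def by simp
    have "\<forall>i. \<exists>C. C >= 0 \<and> (i ~: B --> (\<forall>y h. vn y <= r --> vn h <= r -->
     nrm (F i (y + h) - F i y - (\<Sum>j\<in>UNIV. G i j y * h $ j)) <= C * (vn h)\<^sup>2))"
    proof
     fix i
     show "\<exists>C. C >= 0 \<and> (i ~: B --> (\<forall>y h. vn y <= r --> vn h <= r -->
      nrm (F i (y + h) - F i y - (\<Sum>j\<in>UNIV. G i j y * h $ j)) <= C * (vn h)\<^sup>2))"
     proof (cases "i \<in> B")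
      case False
      show ?thesis using F(2)[OF False, unfolded has_grad_def, THEN spec, of r] by blast
     qed (auto intro: exI[of _ 0])
    qed
    then obtain C where "\<forall>i. C i >= 0 \<and> (i ~: B --> (\<forall>y h. vn y <= r --> vn h <= r -->
     nrm (F i (y + h) - F i y - (\<Sum>j\<in>UNIV. G i j y * h $ j)) <= C i * (vn h)\<^sup>2))" by (rule choice[THEN exE])
    then have C: "!!i. C i >= 0" "!!i y h. i ~: B ==> vn y <= r ==> vn h <= r ==>
     nrm (F i (y + h) - F i y - (\<Sum>j\<in>UNIV. G i j y * h $ j)) <= C i * (vn h)\<^sup>2" by blast+
    obtain Cf where Cf: "Cf >= 0" "!!y h. vn y <= r ==> vn h <= r ==>
     nrm (f (y + h) - f y - (\<Sum>j\<in>UNIV. g j y * h $ j)) <= Cf * (vn h)\<^sup>2" by (rule has_gradE[OF g, of r]) (rule that)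
    \<comment> \<open>A bound for all second-order errors after solving the relation of coordinate
      \<open>i\<close> for that coordinate; the value 1 is inserted to keep it positive also when
      there are no relations.\<close>
    define K where "K = Max (insert 1 ((\<lambda>i. C i / nrm (G i i x)) ` (- B)))"
    have K1: "K >= 1" unfolding K_def by (rule Max_ge) auto
    have KC: "C i / nrm (G i i x) <= K" if "i ~: B" for i unfolding K_def using that by (intro Max_ge) auto
    define M where "M = Max (range (\<lambda>i. nrm (g i x)))"
    have M: "nrm (g i x) <= M" for i unfolding M_def by (rule Max_ge) auto
    have M0: "M >= 0" using M[of undefined] nrm_nonneg[of "g undefined x"] by linarith
    \<comment> \<open>The constant in the final bound \<open>L * (nrm q)\<^sup>2\<close> for
      \<open>nrm (q * s)\<close>. It forces \<open>nrm s\<close> to be at most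
      \<open>L * nrm q\<close>, against the choice of \<open>q\<close>; adding 1 makes the division
      by \<open>L\<close> legitimate.\<close>
    define L where "L = (Cf + M * K) * (vn u)\<^sup>2 + 1"
    have L: "L > 0" unfolding L_def using Cf(1) M0 K1 by (intro add_nonneg_pos mult_nonneg_nonneg) auto
    have eps: "1 / (2 * K) > 0" using K1 by simp
    obtain d where d: "d > 0" "\<forall>y. (\<forall>b\<in>B. nrm (y $ b - x $ b) < d) --> (\<exists>z\<in>fiber B y. vn (x - z) < 1 / (2 * K))"
     using near[rule_format, OF x a0x eps] by blast
    have vt: "vn t + 1 > 0" using vn_nonneg[of t] by linarith
    have "min (d / (vn t + 1)) (nrm s / L) > 0" using d(1) L s divide_pos_pos[OF d(1) vt] by simp
    then obtain q where q: "0 < nrm q" "nrm q < min (d / (vn t + 1)) (nrm s / L)"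
     using nrm_dense[of 0] by blast
    have "nrm ((x + q *s t) $ b - x $ b) < d" for b
    proof -
     have "nrm q * nrm (t $ b) <= nrm q * (vn t + 1)" using nrm_le_vn[of t b] by (intro mult_left_mono) auto
     also have "\<dots> < d" using q(2) vn_nonneg[of t] by (simp add: field_simps)
     finally show ?thesis by (simp add: nrm_mult)
    qed
    then obtain z where z: "z \<in> fiber B (x + q *s t)" "vn (x - z) < 1 / (2 * K)" using d(2) by blast
    define h where "h = z - x"
    have zI: "z \<in> zeros I" using z(1) by (simp add: fiber_def)
    have hB: "h $ b = q * t $ b" if "b \<in> B" for b using z(1) that by (simp add: fiber_def h_def)
    have zh: "z = x + h" by (simp add: h_def)
    have vh: "vn h < 1 / (2 * K)" using z(2) unfolding h_def by (simp only: vn_minus_commute)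
    have "1 / (2 * K) <= 1" using K1 by simp
    then have hr: "vn h <= r" using vh unfolding r_def using vn_nonneg[of x] by linarith
    define w where "w = h - q *s u"
    have wB: "w $ b = 0" if "b \<in> B" for b using hB[OF that] uB[OF that] by (simp add: w_def)
    have wi: "nrm (w $ i) <= K * (vn h)\<^sup>2" for i
    proof (cases "i \<in> B")
     case False
     have "F i (x + h) = 0" "F i x = 0"
      using zerosD[OF zI F(1)[OF False]] zerosD[OF x F(1)[OF False]] by (simp_all only: zh)
     then have "nrm (\<Sum>j\<in>UNIV. G i j x * h $ j) <= C i * (vn h)\<^sup>2"
      using C(2)[OF False xr hr] by simp
     moreover have "(\<Sum>j\<in>UNIV. G i j x * h $ j) = G i i x * w $ i"
     proof -
      have "(\<Sum>b\<in>B. G i b x * h $ b) = q * (\<Sum>b\<in>B. G i b x * t $ b)"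
       unfolding sum_distrib_left by (intro sum.cong refl) (simp add: hB)
      then show ?thesis unfolding split[OF False] uG[OF False] w_def by (simp add: algebra_simps)
     qed
     ultimately have "nrm (w $ i) <= C i / nrm (G i i x) * (vn h)\<^sup>2"
      using Gx[OF False] by (simp add: nrm_mult field_simps)
     also have "\<dots> <= K * (vn h)\<^sup>2" by (intro mult_right_mono KC False) simp
     finally show ?thesis .
    next
     case True
     then show ?thesis using wB K1 by simp
    qed
    then have vw: "vn w <= K * (vn h)\<^sup>2" by (simp add: vn_le_iff)
    \<comment> \<open>If \<open>h\<close> were larger than \<open>q *s u\<close>, it would be
      bounded by the error \<open>w\<close>. The radius \<open>1 / (2 * K)\<close> makes this error
      at most half of \<open>h\<close>.\<close>
    have hu: "vn h <= nrm q * vn u"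
    proof (rule ccontr)
     assume neg: "\<not> vn h <= nrm q * vn u"
     then have "vn h > 0" using mult_nonneg_nonneg[OF nrm_nonneg[of q] vn_nonneg[of u]] by linarith
     then have "K * vn h * vn h < 1 / 2 * vn h" using vh K1 by (intro mult_strict_right_mono) (auto simp: field_simps)
     then have "vn w <= vn h / 2" using vw by (simp add: power2_eq_square mult.assoc)
     moreover have "h = w + q *s u" by (simp add: w_def)
     then have "vn h <= max (vn w) (nrm q * vn u)" using vn_add_le[of w _ "q *s u"] by (simp add: vn_smult)
     ultimately show False using neg \<open>vn h > 0\<close> by linarith
    qed
    have hu2: "(vn h)\<^sup>2 <= (nrm q)\<^sup>2 * (vn u)\<^sup>2"
     using power_mono[OF hu vn_nonneg, of 2] by (simp add: power_mult_distrib)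
    have "f (x + h) = 0" "f x = 0"
     using zerosD[OF zI f] zerosD[OF x f] by (simp_all only: zh)
    then have 1: "nrm (\<Sum>j\<in>UNIV. g j x * h $ j) <= Cf * (vn h)\<^sup>2" using Cf(2)[OF xr hr] by simp
    have 2: "nrm (\<Sum>j\<in>UNIV. g j x * w $ j) <= M * (K * (vn h)\<^sup>2)"
    proof (rule nrm_sum_le)
     fix j show "nrm (g j x * w $ j) <= M * (K * (vn h)\<^sup>2)"
      unfolding nrm_mult by (intro mult_mono M wi) (auto simp: M0)
    qed (use M0 K1 in simp)
    have "q * s = (\<Sum>j\<in>UNIV. g j x * h $ j) - (\<Sum>j\<in>UNIV. g j x * w $ j)"
     unfolding s_def w_def by (simp add: algebra_simps sum_subtractf sum_distrib_left)
    then have "nrm (q * s) <= max (Cf * (vn h)\<^sup>2) (M * (K * (vn h)\<^sup>2))"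
     using 1 2 nrm_diff[of "\<Sum>j\<in>UNIV. g j x * h $ j" "\<Sum>j\<in>UNIV. g j x * w $ j"] by auto
    also have "\<dots> <= (Cf + M * K) * (vn h)\<^sup>2" using Cf(1) M0 K1 by (auto simp: algebra_simps)
    also have "\<dots> <= (Cf + M * K) * ((nrm q)\<^sup>2 * (vn u)\<^sup>2)"
     using hu2 Cf(1) M0 K1 by (intro mult_left_mono) auto
    also have "\<dots> <= L * (nrm q)\<^sup>2" unfolding L_def by (simp add: algebra_simps)
    finally have "nrm s <= L * nrm q" using q(1) by (simp add: nrm_mult power2_eq_square)
    moreover have "L * nrm q < nrm s" using q(2) L by (simp add: field_simps)
    ultimately show False by simp
   qed
   then have "u \<in> tang x" unfolding tang_def by blast
   then show ?thesis using uB by blast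
  qed
  show ?thesis using inj surj by blast
 qed
 show ?thesis by (intro bexI[OF _ apf] conjI aI ballI impI main)
qed

text \<open>Both cardinalities are the dimension of the tangent space at a point that is generic for
  both bases, which replaces an exchange argument.\<close>

theorem tr_basis_card:
 assumes B: "tr_basis I B" and B': "tr_basis I B'"
 shows "card B = card B'"
proof -
 obtain a where a: "a \<in> pf UNIV" "a ~: I" "\<forall>x\<in>zeros I. a x ~= 0 -->
  (\<forall>v\<in>tang x. (\<forall>b\<in>B. v $ b = 0) --> v = 0) \<and> (\<forall>t. \<exists>v\<in>tang x. \<forall>b\<in>B. v $ b = t $ b)"
  using tangent_projection[OF B] by (elim bexE conjE) (rule that)
 obtain a' where a': "a' \<in> pf UNIV" "a' ~: I" "\<forall>x\<in>zeros I. a' x ~= 0 -->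
  (\<forall>v\<in>tang x. (\<forall>b\<in>B'. v $ b = 0) --> v = 0) \<and> (\<forall>t. \<exists>v\<in>tang x. \<forall>b\<in>B'. v $ b = t $ b)"
  using tangent_projection[OF B'] by (elim bexE conjE) (rule that)
 have "a * a' ~: I" using ideal_prime[OF a(1) a'(1)] a(2) a'(2) by blast
 then obtain x where x: "x \<in> zeros I" "(a * a') x ~= 0" using nullstellensatz[OF pf_mult[OF a(1) a'(1)]] by blast
 have ax: "a x ~= 0" "a' x ~= 0" using x(2) by auto
 have "vec.dim (tang x) = card B"
  using a(3)[rule_format, OF x(1) ax(1)] by (intro dim_eq_card_coords[OF subspace_tang]) blast+
 moreover have "vec.dim (tang x) = card B'"
  using a'(3)[rule_format, OF x(1) ax(2)] by (intro dim_eq_card_coords[OF subspace_tang]) blast+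
 ultimately show ?thesis by simp
qed

end

section \<open>Locally bounded quotients of polynomial functions\<close>

text \<open>The recursion for the coefficients of the power series \<open>P / Q\<close>, with
  \<open>u\<close> in the place of the inverse of the constant coefficient of
  \<open>Q\<close>.\<close>

fun quot_coeff :: "'r::comm_ring_1 poly => 'r poly => 'r => nat => 'r" where
 "quot_coeff P Q u k = u * (coeff P k - (\<Sum>i<k. coeff Q (k - i) * quot_coeff P Q u i))"

declare quot_coeff.simps [simp del]

lemma pf_line_poly:
 fixes f :: "'k::field_char_0 ^ 'v::finite => 'k"
 assumes "f \<in> pf S"
 obtains p :: "'k poly" where "!!s. f (x + s *s v) = poly p s"
proof -
 obtain P where P: "!!y s. f (y + s *s v) = poly P (\<lambda>_. s) y" using pf_line[OF assms, of v] by blast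
 show thesis by (rule that[of "at_pt x P"]) (simp only: P poly_at_pt)
qed

text \<open>On the line through a nonzero of each function, both restrict to nonzero polynomials in
  one variable.\<close>

lemma pf_domain:
 fixes f g :: "'k::field_char_0 ^ 'v::finite => 'k"
 assumes "f \<in> pf S" "g \<in> pf T" "f ~= 0" "g ~= 0"
 shows "\<exists>x. f x ~= 0 \<and> g x ~= 0"
proof -
 obtain u w where uw: "f u ~= 0" "g w ~= 0" using assms(3,4) by (auto simp: fun_eq_iff)
 obtain p where p: "!!s. f (u + s *s (w - u)) = poly p s" by (rule pf_line_poly[OF assms(1)]) (rule that)
 obtain q where q: "!!s. g (u + s *s (w - u)) = poly q s" by (rule pf_line_poly[OF assms(2)]) (rule that)
 have "poly p 0 ~= 0" "poly q 1 ~= 0" using p[of 0] q[of 1] uw by simp_all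
 then have "p * q ~= 0" by auto
 then have "finite {s. poly (p * q) s = 0}" by (rule poly_roots_finite)
 then obtain s where "poly (p * q) s ~= 0" using ex_new_if_finite[OF infinite_UNIV_char_0] by blast
 then show ?thesis using p[of s] q[of s] by (intro exI[of _ "u + s *s (w - u)"]) auto
qed

context na_abs
begin

lemma pf_nonzero_near:
 fixes f :: "'k ^ 'v::finite => 'k"
 assumes f: "f \<in> pf S" "f ~= 0" and r: "r > 0"
 shows "\<exists>y. vn (y - x) < r \<and> f y ~= 0"
proof -
 obtain u where u: "f u ~= 0" using f(2) by (auto simp: fun_eq_iff)
 obtain p where p: "!!s. f (x + s *s (u - x)) = poly p s" by (rule pf_line_poly[OF f(1)]) (rule that)
 have "poly p 1 ~= 0" using p[of 1] u by simp
 then have "finite {s. poly p s = 0}" by (intro poly_roots_finite) auto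
 moreover have v: "vn (u - x) + 1 > 0" using vn_nonneg[of "u - x"] by linarith
 then have "infinite {s. nrm s < r / (vn (u - x) + 1)}" using r by (intro infinite_small) simp
 ultimately obtain s where s: "nrm s < r / (vn (u - x) + 1)" "poly p s ~= 0"
  using Diff_infinite_finite[THEN infinite_imp_nonempty, of "{s. poly p s = 0}"] by blast
 have "nrm s * vn (u - x) <= nrm s * (vn (u - x) + 1)" by (intro mult_left_mono) auto
 also have "\<dots> < r" using s(1) v by (simp add: field_simps)
 finally have "vn (x + s *s (u - x) - x) < r" by (simp only: add_diff_cancel_left' vn_smult)
 then show ?thesis using s(2) p[of s] by (intro exI[of _ "x + s *s (u - x)"]) auto
qed

lemma poly_bounded: "\<exists>M\<ge>0. \<forall>s. nrm s <= r --> nrm (poly p s) <= M"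
proof (induction p)
 case (pCons a p)
 then obtain M where M: "M >= 0" "!!s. nrm s <= r ==> nrm (poly p s) <= M" by blast
 have "nrm (poly (pCons a p) s) <= max (nrm a) (\<bar>r\<bar> * M)" if s: "nrm s <= r" for s
 proof -
  have "nrm s * nrm (poly p s) <= \<bar>r\<bar> * M" using M(2)[OF s] s by (intro mult_mono) auto
  then show ?thesis using nrm_add[of a "s * poly p s"] by (auto simp: nrm_mult)
 qed
 then show ?case by (intro exI[of _ "max (nrm a) (\<bar>r\<bar> * M)"]) (auto simp: le_max_iff_disj)
qed (auto intro: exI[of _ 0])

lemma poly_dvd_of_bounded:
 assumes "Q ~= 0" "A ~= 0"
  and "!!r. \<exists>C. \<forall>s. nrm s <= r --> poly A s ~= 0 --> nrm (poly P s) <= C * nrm (poly Q s)"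
 shows "Q dvd P"
 using assms
proof (induction "degree Q" arbitrary: P Q A)
 case 0
 then obtain c where "Q = [:c:]" using degree_eq_zeroE[of Q] by metis
 then show ?case using 0 by (simp add: const_poly_dvd_iff dvd_field_iff)
next
 case (Suc n)
 obtain s0 where s0: "poly Q s0 = 0" using alg_closed_imp_poly_has_root[of Q] Suc.hyps(2) by auto
 then have "[:-s0, 1:] dvd Q" by (simp only: poly_eq_0_iff_dvd)
 then obtain Q1 where Q1: "Q = [:-s0, 1:] * Q1" by (rule dvdE)
 have Q10: "Q1 ~= 0" using Q1 Suc.prems(1) by auto
 have deg: "n = degree Q1" using Suc.hyps(2) Q10 unfolding Q1 by (subst (asm) degree_mult_eq) auto
 have "poly P s0 = 0"
 proof (rule ccontr)
  assume P0: "poly P s0 ~= 0"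
  define R where "R = synthetic_div P s0"
  have PR: "poly P s = poly P s0 + (s - s0) * poly R s" for s
   using arg_cong[OF synthetic_div_correct[of P s0], of "\<lambda>p. poly p s"] by (simp add: R_def algebra_simps)
  define r where "r = nrm s0 + 1"
  obtain C where C: "!!s. nrm s <= r ==> poly A s ~= 0 ==> nrm (poly P s) <= C * nrm (poly Q s)"
   using Suc.prems(3)[of r] by blast
  obtain M where M: "M >= 0" "!!s. nrm s <= r ==> nrm (poly R s) <= M" using poly_bounded[of r R] by blast
  obtain L where L: "L >= 0" "!!s. nrm s <= r ==> nrm (poly Q1 s) <= L" using poly_bounded[of r Q1] by blast
  define K where "K = M + \<bar>C\<bar> * L + 1"
  have K: "K > 0" "M < K" "\<bar>C\<bar> * L < K" unfolding K_def using M(1) L(1) by (auto intro: add_nonneg_pos add_pos_nonneg)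
  have d: "min 1 (nrm (poly P s0) / K) > 0" using K P0 by simp
  have "finite {h. poly A (s0 + h) = 0}"
  proof -
   have "finite ((\<lambda>s. s - s0) ` {s. poly A s = 0})" using poly_roots_finite[OF Suc.prems(2)] by simp
   moreover have "{h. poly A (s0 + h) = 0} \<subseteq> (\<lambda>s. s - s0) ` {s. poly A s = 0}"
    by (auto intro!: image_eqI[of _ _ "s0 + _"])
   ultimately show ?thesis by (rule finite_subset[rotated])
  qed
  then obtain h where h: "nrm h < min 1 (nrm (poly P s0) / K)" "poly A (s0 + h) ~= 0"
   using Diff_infinite_finite[OF _ infinite_small[OF d], THEN infinite_imp_nonempty] by blast
  have hr: "nrm (s0 + h) <= r" unfolding r_def using h(1) nrm_nonneg[of s0] by (intro nrm_add_le) linarith+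
  have hK: "nrm h * K < nrm (poly P s0)" using h(1) K by (simp add: field_simps)
  have "nrm (h * poly R (s0 + h)) <= nrm h * K"
   unfolding nrm_mult using M(2)[OF hr] K by (intro mult_left_mono) auto
  then have "nrm (poly P (s0 + h)) = nrm (poly P s0)"
   using PR[of "s0 + h"] hK by (simp add: nrm_add_eq)
  moreover have "nrm (poly P (s0 + h)) <= nrm h * K"
  proof -
   have "nrm (poly P (s0 + h)) <= C * nrm (poly Q (s0 + h))" by (rule C[OF hr h(2)])
   also have "\<dots> <= \<bar>C\<bar> * nrm (poly Q (s0 + h))" by (intro mult_right_mono) auto
   also have "poly Q (s0 + h) = h * poly Q1 (s0 + h)" unfolding Q1 by (simp add: algebra_simps)
   also have "\<bar>C\<bar> * nrm (h * poly Q1 (s0 + h)) = nrm h * (\<bar>C\<bar> * nrm (poly Q1 (s0 + h)))"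
    by (simp add: nrm_mult)
   also have "\<dots> <= nrm h * (\<bar>C\<bar> * L)" by (intro mult_left_mono L(2) hr) auto
   also have "\<dots> <= nrm h * K" using K by (intro mult_left_mono) auto
   finally show ?thesis .
  qed
  ultimately show False using hK by simp
 qed
 then have "[:-s0, 1:] dvd P" by (simp only: poly_eq_0_iff_dvd)
 then obtain P1 where P1: "P = [:-s0, 1:] * P1" by (rule dvdE)
 have "Q1 dvd P1"
 proof (rule Suc.hyps(1)[OF deg Q10])
  show "A * [:-s0, 1:] ~= 0" using Suc.prems(2) by (simp only: mult_eq_0_iff) simp
  fix r
  obtain C where C: "!!s. nrm s <= r ==> poly A s ~= 0 ==> nrm (poly P s) <= C * nrm (poly Q s)"
   using Suc.prems(3)[of r] by blast
  have "nrm (poly P1 s) <= C * nrm (poly Q1 s)" if s: "nrm s <= r" "poly (A * [:-s0, 1:]) s ~= 0" for s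
  proof -
   have A: "poly A s ~= 0" "s - s0 ~= 0" using s(2) by auto
   have "poly P s = (s - s0) * poly P1 s" "poly Q s = (s - s0) * poly Q1 s"
    unfolding P1 Q1 by (simp_all add: algebra_simps)
   then have "nrm (s - s0) * nrm (poly P1 s) <= nrm (s - s0) * (C * nrm (poly Q1 s))"
    using C[OF s(1) A(1)] by (simp add: nrm_mult mult_ac)
   then show ?thesis using A(2) by simp
  qed
  then show "\<exists>C. \<forall>s. nrm s <= r --> poly (A * [:-s0, 1:]) s ~= 0 --> nrm (poly P1 s) <= C * nrm (poly Q1 s)"
   by blast
 qed
 then show ?case unfolding P1 Q1 by (intro mult_dvd_mono dvd_refl)
qed

text \<open>Normality of the polynomial ring: on each line through a point where \<open>q\<close> does not vanish the
 quotient is a polynomial, and its coefficients are those of the power series expansion.\<close>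

theorem pf_divides_of_bounded:
 fixes p q a :: "'k ^ 'v::finite => 'k"
 assumes p: "p \<in> pf S" and q: "q \<in> pf S" "q ~= 0" and a: "a \<in> pf S" "a ~= 0"
  and bound: "!!r. \<exists>C. \<forall>y. vn y <= r --> a y ~= 0 --> nrm (p y) <= C * nrm (q y)"
 shows "\<exists>c\<in>pf S. p = q * c"
proof -
 obtain z where z: "q z ~= 0" "a z ~= 0" using pf_domain[OF q(1) a(1) q(2) a(2)] by blast
 obtain P where P: "P \<in> pfpoly S" "!!y s. p (z + s *s y) = poly P (\<lambda>_. s) y" using pf_line'[OF p, of z] by blast
 obtain Q where Q: "Q \<in> pfpoly S" "!!y s. q (z + s *s y) = poly Q (\<lambda>_. s) y" using pf_line'[OF q(1), of z] by blast
 obtain A where A: "A \<in> pfpoly S" "!!y s. a (z + s *s y) = poly A (\<lambda>_. s) y" using pf_line'[OF a(1), of z] by blast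
 define u :: "'k ^ 'v => 'k" where "u = (\<lambda>_. 1 / q z)"
 define c where "c = quot_coeff P Q u"
 have c_eq: "c k = u * (coeff P k - (\<Sum>i<k. coeff Q (k - i) * c i))" for k
  unfolding c_def by (rule quot_coeff.simps)
 have c_pf: "c k \<in> pf S" for k
 proof (induction k rule: less_induct)
  case (less k)
  show ?case unfolding c_eq[of k] u_def
   by (intro pf_mult pf_const pf_diff pfpolyD P Q pf_sum less.IH) auto
 qed
 have Q0: "coeff Q 0 y = q z" for y
  using Q(2)[of 0 y] unfolding poly_at_pt[symmetric] by (simp add: poly_0_coeff_0)
 have U: "\<exists>U. at_pt y P = at_pt y Q * U \<and> (\<forall>k. coeff U k = c k y) \<and> degree U <= degree P" for y
 proof -
  have qy: "poly (at_pt y Q) s = q (z + s *s y)" "poly (at_pt y P) s = p (z + s *s y)"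
   "poly (at_pt y A) s = a (z + s *s y)" for s
   by (simp_all only: poly_at_pt P Q A)
  have "poly (at_pt y Q) 0 ~= 0" "poly (at_pt y A) 0 ~= 0" unfolding qy using z by simp_all
  then have nz: "at_pt y Q ~= 0" "at_pt y A ~= 0" by auto
  have "at_pt y Q dvd at_pt y P"
  proof (rule poly_dvd_of_bounded[OF nz])
   fix r
   obtain C where C: "!!t. vn t <= max (vn z) (\<bar>r\<bar> * vn y) ==> a t ~= 0 ==> nrm (p t) <= C * nrm (q t)"
    using bound by blast
   have "vn (z + s *s y) <= max (vn z) (\<bar>r\<bar> * vn y)" if "nrm s <= r" for s
   proof (rule vn_add_le)
    have "nrm s * vn y <= \<bar>r\<bar> * vn y" using that by (intro mult_right_mono) auto
    then show "vn (s *s y) <= max (vn z) (\<bar>r\<bar> * vn y)" by (simp add: vn_smult)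
   qed simp
   then show "\<exists>C. \<forall>s. nrm s <= r --> poly (at_pt y A) s ~= 0 -->
    nrm (poly (at_pt y P) s) <= C * nrm (poly (at_pt y Q) s)"
    unfolding qy using C by blast
  qed
  then obtain U where U: "at_pt y P = at_pt y Q * U" by (rule dvdE)
  have "coeff U k = c k y" for k
  proof (induction k rule: less_induct)
   case (less k)
   have "coeff P k y = (\<Sum>i\<le>k. coeff Q i y * coeff U (k - i))"
    using arg_cong[OF U, of "\<lambda>p. coeff p k"] by (simp add: coeff_mult)
   also have "\<dots> = (\<Sum>i\<le>k. coeff Q (k - i) y * coeff U i)"
    by (rule sum.reindex_bij_witness[of _ "\<lambda>i. k - i" "\<lambda>i. k - i"]) auto
   also have "\<dots> = (\<Sum>i<k. coeff Q (k - i) y * coeff U i) + q z * coeff U k"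
    by (simp add: lessThan_Suc_atMost[symmetric] Q0)
   also have "(\<Sum>i<k. coeff Q (k - i) y * coeff U i) = (\<Sum>i<k. coeff Q (k - i) y * c i y)"
    by (intro sum.cong) (auto simp: less.IH)
   finally have "q z * coeff U k = coeff P k y - (\<Sum>i<k. coeff Q (k - i) y * c i y)" by simp
   moreover have "c k y = (1 / q z) * (coeff P k y - (\<Sum>i<k. coeff Q (k - i) y * c i y))"
    unfolding c_eq[of k] u_def by simp
   ultimately have "q z * c k y = q z * coeff U k" using z(1) by simp
   then show ?case using z(1) by simp
  qed
  moreover have "degree U <= degree P"
  proof (cases "U = 0")
   case False
   then have "degree (at_pt y P) = degree (at_pt y Q) + degree U" unfolding U using nz by (simp add: degree_mult_eq)
   then show ?thesis using degree_at_pt[of y P] by linarith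
  qed simp
  ultimately show ?thesis using U by blast
 qed
 \<comment> \<open>The line from \<open>z\<close> in the direction \<open>y - z\<close> reaches
   \<open>y\<close> at parameter 1, so the value of the quotient polynomial there is the sum of its
   coefficients.\<close>
 define d where "d = (\<lambda>y. \<Sum>k\<le>degree P. c k (y - z))"
 have "(\<lambda>y. c k (y - z)) \<in> pf S" for k
 proof (rule pf_compose[OF c_pf])
  fix i assume "i \<in> S"
  then show "(\<lambda>y. (y - z) $ i) \<in> pf S" by (simp only: vector_minus_component) (intro pf_lambda pf_coord pf_const)
 qed
 then have "d \<in> pf S" unfolding d_def by (intro pf_lambda_sum)
 moreover have "p y = q y * d y" for y
 proof -
  obtain U where U: "at_pt (y - z) P = at_pt (y - z) Q * U" "\<forall>k. coeff U k = c k (y - z)" "degree U <= degree P"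
   using U by blast
  have "p y = poly (at_pt (y - z) P) 1" "q y = poly (at_pt (y - z) Q) 1"
   unfolding poly_at_pt using P(2)[of 1 "y - z"] Q(2)[of 1 "y - z"] by simp_all
  moreover have "poly U 1 = d y"
  proof -
   have "poly U 1 = (\<Sum>k\<le>degree P. coeff U k * 1 ^ k)"
    unfolding poly_altdef using U(3) by (intro sum.mono_neutral_left) (auto simp: coeff_eq_0)
   then show ?thesis using U(2) by (simp add: d_def)
  qed
  ultimately show ?thesis using arg_cong[OF U(1), of "\<lambda>p. poly p 1"] by simp
 qed
 ultimately show ?thesis by (intro bexI[of _ d]) (simp_all add: fun_eq_iff)
qed

lemma coeff_prod_linear_bound:
 assumes "finite Y" "!!z. z \<in> Y ==> nrm (h z) <= R" "R >= 1"
 shows "nrm (coeff (\<Prod>z\<in>Y. [:- h z, 1:]) j) <= R ^ card Y"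
 using assms(1,2)
proof (induction Y arbitrary: j rule: finite_induct)
 case empty
 then show ?case by (cases j) auto
next
 case (insert z Y)
 define p where "p = (\<Prod>z\<in>Y. [:- h z, 1:])"
 have p: "nrm (coeff p i) <= R ^ card Y" for i unfolding p_def using insert by blast
 have "(\<Prod>z\<in>insert z Y. [:- h z, 1:]) = Polynomial.smult (- h z) p + pCons 0 p"
  unfolding p_def using insert by (simp add: mult_pCons_left)
 moreover have "nrm (- h z * coeff p j) <= R * R ^ card Y"
  unfolding nrm_mult using insert.prems[of z] p[of j] assms(3) by (intro mult_mono) auto
 moreover have "nrm (coeff (pCons 0 p) j) <= R * R ^ card Y"
 proof -
  have "nrm (coeff (pCons 0 p) j) <= 1 * R ^ card Y" using p assms(3) by (cases j) auto
  also have "\<dots> <= R * R ^ card Y" using assms(3) by (intro mult_right_mono) auto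
  finally show ?thesis .
 qed
 ultimately show ?case using insert(1,2) by (simp only: coeff_add coeff_smult) (simp add: nrm_diff_le)
qed

end

section \<open>Noether normalization of cones and density\<close>

context pf_prime
begin

text \<open>The ideal of the closure of the image of the zero set under \<open>ph\<close>. It is
  applied to the graph of a projection and to the projection to a set of coordinates.\<close>

lemma comp_ideal_prime:
 fixes ph :: "'k ^ 'v => 'k ^ 'w::finite"
 assumes ph: "!!i. (\<lambda>x. ph x $ i) \<in> pf UNIV"
 shows "pf_prime {f \<in> pf UNIV. (\<lambda>x. f (ph x)) \<in> I}"
proof
 have pf: "(\<lambda>x. f (ph x)) \<in> pf UNIV" if "f \<in> pf UNIV" for f
  by (rule pf_compose[OF that ph])
 have "(\<lambda>x::'k ^ 'v. 0 :: 'k) \<in> I" using ideal_zero by (simp only: zero_fun_def)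
 then show "0 \<in> {f \<in> pf UNIV. (\<lambda>x. f (ph x)) \<in> I}" by simp
 have "(\<lambda>x::'k ^ 'v. 1 :: 'k) ~: I" using ideal_proper by (simp only: one_fun_def not_False_eq_True)
 then show "1 ~: {f \<in> pf UNIV. (\<lambda>x. f (ph x)) \<in> I}" by simp
 fix f g :: "'k ^ 'w => 'k"
 have add: "(\<lambda>x. (f + g) (ph x)) = (\<lambda>x. f (ph x)) + (\<lambda>x. g (ph x))"
  and mult: "(\<lambda>x. (f * g) (ph x)) = (\<lambda>x. f (ph x)) * (\<lambda>x. g (ph x))"
  and mult': "(\<lambda>x. (g * f) (ph x)) = (\<lambda>x. g (ph x)) * (\<lambda>x. f (ph x))"
  by (simp_all add: fun_eq_iff)
 show "f + g \<in> {f \<in> pf UNIV. (\<lambda>x. f (ph x)) \<in> I}"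
  if "f \<in> {f \<in> pf UNIV. (\<lambda>x. f (ph x)) \<in> I}" "g \<in> {f \<in> pf UNIV. (\<lambda>x. f (ph x)) \<in> I}"
  using that ideal_add unfolding mem_Collect_eq add by (blast intro: pf_add)
 show "g * f \<in> {f \<in> pf UNIV. (\<lambda>x. f (ph x)) \<in> I}"
  if "f \<in> {f \<in> pf UNIV. (\<lambda>x. f (ph x)) \<in> I}" "g \<in> pf UNIV"
  using that ideal_mult[OF _ pf[OF that(2)]] unfolding mem_Collect_eq mult' by (blast intro: pf_mult)
 show "f \<in> {f \<in> pf UNIV. (\<lambda>x. f (ph x)) \<in> I} \<or> g \<in> {f \<in> pf UNIV. (\<lambda>x. f (ph x)) \<in> I}"
  if fg: "f \<in> pf UNIV" "g \<in> pf UNIV" "f * g \<in> {f \<in> pf UNIV. (\<lambda>x. f (ph x)) \<in> I}"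
  using fg ideal_prime[OF pf[OF fg(1)] pf[OF fg(2)]] unfolding mem_Collect_eq mult by blast
qed auto

end

locale na_cone = na_prime I nrm
 for I :: "('k::{alg_closed_field, field_char_0} ^ 'v::finite => 'k) set" and nrm :: "'k => real" +
 assumes homogeneous_ideal: "f \<in> I ==> (\<lambda>x. f (s *s x)) \<in> I"
begin

text \<open>The coordinates of \<open>l x\<close> in \<open>B\<close> bound the points \<open>x\<close> of the cone; this replaces integrality in Noether
 normalization.\<close>

definition finite_proj :: "'v set => ('k ^ 'v => 'k ^ 'v) => bool" where
 "finite_proj B l \<longleftrightarrow> (\<forall>i. (\<lambda>x. l x $ i) \<in> pf UNIV) \<and> (\<forall>s x. l (s *s x) = s *s l x) \<and>
  (\<exists>C\<ge>0. \<forall>x. vn (l x) <= C * vn x) \<and>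
  (\<exists>C\<ge>0. \<forall>x\<in>zeros I. \<forall>r\<ge>0. (\<forall>b\<in>B. nrm (l x $ b) <= r) --> vn x <= C * r)"

text \<open>Some homogeneous part \<open>h\<close> of the relation is nonzero at a vector
  \<open>v\<close>, and the projection along \<open>v\<close> stays finite: write \<open>l x\<close>
  on \<open>B\<close> as \<open>w + sg *s v\<close>, where \<open>h\<close> vanishes. If
  \<open>sg\<close> were large compared with \<open>w\<close>, then \<open>h\<close> would also
  vanish at \<open>(1 / sg) *s w + v\<close>, too close to \<open>v\<close> where it does
  not.\<close>

lemma finite_proj_step:
 assumes fp: "finite_proj B l" and f: "f \<in> pf B" "f ~= 0" "(\<lambda>x. f (l x)) \<in> I"
 shows "\<exists>k\<in>B. \<exists>l'. finite_proj (B - {k}) l'"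
proof -
 obtain P where P: "P \<in> pfpoly B" "!!y s. f (s *s y) = poly P (\<lambda>_. s) y" using pf_scale[OF f(1)] by blast
 have lpf: "!!i. (\<lambda>x. l x $ i) \<in> pf UNIV" and lhom: "!!s x. l (s *s x) = s *s l x"
  using fp unfolding finite_proj_def by blast+
 obtain C1 where C1: "C1 >= 0" "!!x. vn (l x) <= C1 * vn x" using fp unfolding finite_proj_def by blast
 obtain C2 where C2: "C2 >= 0" "!!x r. x \<in> zeros I ==> r >= 0 ==> (!!b. b \<in> B ==> nrm (l x $ b) <= r) ==> vn x <= C2 * r"
  using fp unfolding finite_proj_def by blast
 have coeffI: "(\<lambda>x. coeff P d (l x)) \<in> I" for d
 proof -
  have "poly (comp_poly l P) (\<lambda>_. s) \<in> I" for s
  proof -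
   have "poly (comp_poly l P) (\<lambda>_. s) = (\<lambda>x. f (l (s *s x)))"
    using poly_comp_poly[of l P "\<lambda>_. s"] by (simp add: fun_eq_iff P(2) lhom)
   then show ?thesis using homogeneous_ideal[OF f(3), of s] by simp
  qed
  then have "infinite {s. poly (comp_poly l P) (\<lambda>_. s) \<in> I}" using infinite_UNIV_char_0[where 'a = 'k] by simp
  moreover have "comp_poly l P \<in> pfpoly UNIV"
  proof (rule pfpolyI)
   fix j show "coeff (comp_poly l P) j \<in> pf UNIV"
    unfolding coeff_comp_poly by (rule pf_compose[OF pfpolyD[OF P(1)] lpf])
  qed
  ultimately have "coeff (comp_poly l P) d \<in> I" by (intro infinite_combination)
  then show ?thesis by (simp only: coeff_comp_poly)
 qed
 obtain y0 where y0: "f y0 ~= 0" using f(2) by (auto simp: fun_eq_iff)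
 have "poly (at_pt y0 P) 1 ~= 0" using P(2)[of 1 y0] y0 by (simp add: poly_at_pt)
 then have "at_pt y0 P ~= 0" by auto
 then obtain d where d: "coeff P d y0 ~= 0" by (metis coeff_at_pt leading_coeff_0_iff)
 define h where "h = coeff P d"
 have hpf: "h \<in> pf B" unfolding h_def by (rule pfpolyD[OF P(1)])
 have hhom: "h (s *s y) = s ^ d * h y" for s y
 proof -
  have "poly (at_pt (s *s y) P) t = poly (pcompose (at_pt y P) [:0, s:]) t" for t
  proof -
   have "poly (at_pt (s *s y) P) t = f (t *s (s *s y))" by (simp only: poly_at_pt P(2))
   also have "\<dots> = f ((t * s) *s y)" by simp
   also have "\<dots> = poly (at_pt y P) (t * s)" by (simp only: poly_at_pt P(2))
   finally show ?thesis by (simp add: poly_pcompose mult.commute)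
  qed
  then have "at_pt (s *s y) P = pcompose (at_pt y P) [:0, s:]" by (subst poly_eq_poly_eq_iff[symmetric]) auto
  then have "coeff (at_pt (s *s y) P) d = coeff (pcompose (at_pt y P) [:0, s:]) d" by simp
  then show ?thesis by (simp add: coeff_pcompose_linear h_def)
 qed
 have hI: "(\<lambda>x. h (l x)) \<in> I" unfolding h_def by (rule coeffI)
 \<comment> \<open>A relation of degree 0 would put a nonzero constant into the ideal. Positive
   degree makes \<open>h\<close> vanish at the origin, so that \<open>v\<close> has a nonzero
   coordinate \<open>k\<close> to be eliminated.\<close>
 have d0: "d > 0"
 proof (rule ccontr)
  assume "\<not> d > 0"
  then have hc: "h y = h 0" for y using hhom[of 0 y] by simp
  have "(\<lambda>x. h (l x)) = (\<lambda>_. h y0)"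
  proof
   fix x show "h (l x) = h y0" using hc[of "l x"] hc[of y0] by (rule trans[OF _ sym])
  qed
  with hI have "(\<lambda>_. h y0) \<in> I" by (simp only:)
  then have "(\<lambda>_. 1 / h y0) * (\<lambda>_. h y0) \<in> I" by (rule ideal_mult[OF _ pf_const])
  also have "(\<lambda>_. 1 / h y0) * (\<lambda>_. h y0) = (1 :: 'k ^ 'v => 'k)" using d by (simp add: fun_eq_iff h_def)
  finally show False using ideal_proper by blast
 qed
 define v where "v = (\<chi> i. if i \<in> B then y0 $ i else 0)"
 have hv: "h v ~= 0"
 proof -
  have "h v = h y0" by (rule pf_cong_coords[OF hpf]) (simp add: v_def)
  then show ?thesis using d by (simp add: h_def)
 qed
 have "\<exists>k\<in>B. v $ k ~= 0"
 proof (rule ccontr)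
  assume "\<not> ?thesis"
  then have "v = 0" by (simp add: cart_eq_iff v_def)
  then have "h v = h (0 *s v)" by simp
  also have "\<dots> = 0" unfolding hhom using d0 by simp
  finally show False using hv by simp
 qed
 then obtain k where k: "k \<in> B" "v $ k ~= 0" by blast
 define l' where "l' x = l x - (l x $ k / v $ k) *s v" for x
 define V where "V = max 1 (vn v / nrm (v $ k))"
 have V: "V >= 1" "vn v / nrm (v $ k) <= V" by (simp_all add: V_def)
 have 1: "(\<lambda>x. l' x $ i) \<in> pf UNIV" for i
 proof -
  have "(\<lambda>x. l x $ i - l x $ k * (v $ i / v $ k)) \<in> pf UNIV" by (intro pf_lambda lpf pf_const)
  then show ?thesis by (simp add: l'_def)
 qed
 have 2: "l' (s *s x) = s *s l' x" for s x
  unfolding l'_def lhom by (simp add: cart_eq_iff algebra_simps)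
 have 3: "\<exists>C\<ge>0. \<forall>x. vn (l' x) <= C * vn x"
 proof (intro exI[of _ "V * C1"] conjI allI)
  show "V * C1 >= 0" using V C1 by simp
  fix x
  have lx: "vn (l x) <= V * (C1 * vn x)" using C1(2)[of x] V(1) mult_right_mono[OF V(1), of "vn (l x)"] C1(1)
   by (smt (verit) mult_left_mono mult_1 vn_nonneg)
  have "vn ((l x $ k / v $ k) *s v) = nrm (l x $ k) * (vn v / nrm (v $ k))" by (simp add: vn_smult nrm_divide)
  also have "\<dots> <= (C1 * vn x) * V"
   using order_trans[OF nrm_le_vn C1(2)] V by (intro mult_mono) (auto intro: mult_nonneg_nonneg C1)
  finally have "vn ((l x $ k / v $ k) *s v) <= V * (C1 * vn x)" by (simp only: mult.commute)
  with lx have "vn (l' x) <= V * (C1 * vn x)" unfolding l'_def by (rule vn_diff_le)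
  then show "vn (l' x) <= V * C1 * vn x" by (simp only: mult.assoc)
 qed
 obtain L where L: "L >= 0" "!!p q. vn p <= max 1 (vn v) ==> vn q <= max 1 (vn v) ==> nrm (h p - h q) <= L * vn (p - q)"
  using pf_lipschitz[OF hpf, of "max 1 (vn v)"] by blast
 \<comment> \<open>The Lipschitz estimate for \<open>h\<close> near \<open>v\<close> bounds
   \<open>nrm (h v) * nrm sg\<close> by \<open>L * vn w\<close>; the 1 covers the case in which
   \<open>sg\<close> is already small.\<close>
 define M where "M = max 1 (L / nrm (h v))"
 define N where "N = max 1 (M * vn v)"
 have 4: "vn x <= C2 * N * r" if x: "x \<in> zeros I" and r: "r >= 0" and small: "\<forall>b\<in>B - {k}. nrm (l' x $ b) <= r" for x r
 proof -
  define sg where "sg = l x $ k / v $ k"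
  define w where "w = (\<chi> i. if i \<in> B then l' x $ i else 0)"
  have wk: "w $ k = 0" using k by (simp add: w_def l'_def)
  have vw: "vn w <= r" unfolding vn_le_iff
  proof
   fix i show "nrm (w $ i) <= r" using small wk r by (cases "i \<in> B"; cases "i = k") (auto simp: w_def)
  qed
  have wB: "(w + sg *s v) $ b = l x $ b" if "b \<in> B" for b
   using that by (simp add: w_def l'_def sg_def)
  have "h (w + sg *s v) = h (l x)" by (rule pf_cong_coords[OF hpf wB])
  also have "\<dots> = 0" using zerosD[OF x hI] .
  finally have h0: "h (w + sg *s v) = 0" .
  have sgM: "nrm sg <= M * r"
  proof (cases "nrm sg <= r")
   case True
   then show ?thesis using mult_right_mono[of 1 M r] r by (simp add: M_def)
  next
   case False
   then have sg0: "sg ~= 0" using r by auto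
   define p where "p = (1 / sg) *s w + v"
   have "sg *s p = w + sg *s v" unfolding p_def using sg0 by (simp add: cart_eq_iff algebra_simps)
   then have "sg ^ d * h p = 0" using h0 hhom[of sg p] by simp
   then have hp: "h p = 0" using sg0 by simp
   have vp: "vn ((1 / sg) *s w) = vn w / nrm sg" by (simp add: vn_smult nrm_divide)
   have "vn w / nrm sg <= 1" using False vw sg0 by (simp add: field_simps)
   then have "vn p <= max 1 (vn v)" unfolding p_def by (intro vn_add_le) (simp_all add: vp)
   then have "nrm (h p - h v) <= L * vn (p - v)" by (intro L(2)) auto
   moreover have "p - v = (1 / sg) *s w" by (simp add: p_def)
   ultimately have "nrm (h v) <= L * (vn w / nrm sg)" by (simp only: hp vp diff_0 nrm_minus)
   then have "nrm (h v) * nrm sg <= L * vn w" using sg0 by (simp add: field_simps)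
   also have "\<dots> <= L * r" using vw L(1) by (intro mult_left_mono)
   finally have "nrm sg <= L / nrm (h v) * r" using hv by (simp add: field_simps)
   also have "\<dots> <= M * r" unfolding M_def using r by (intro mult_right_mono) auto
   finally show ?thesis .
  qed
  have "vn x <= C2 * (N * r)"
  proof (rule C2(2)[OF x])
   show "N * r >= 0" using r by (simp add: N_def)
   fix b assume b: "b \<in> B"
   have "r <= N * r" using mult_right_mono[of 1 N r] r by (simp add: N_def)
   then have 1: "nrm (w $ b) <= N * r" using nrm_le_vn[of w b] vw by linarith
   have "nrm (sg * v $ b) <= (M * r) * vn v"
    unfolding nrm_mult using sgM nrm_le_vn r by (intro mult_mono) (auto simp: M_def)
   also have "\<dots> = (M * vn v) * r" by simp
   also have "\<dots> <= N * r" using r by (intro mult_right_mono) (auto simp: N_def)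
   finally have "nrm (w $ b + sg * v $ b) <= N * r" using 1 by (intro nrm_add_le)
   then show "nrm (l x $ b) <= N * r" using wB[OF b] by simp
  qed
  then show ?thesis by (simp only: mult.assoc)
 qed
 have "finite_proj (B - {k}) l'"
  unfolding finite_proj_def using 1 2 3 4 C2(1)
  by (intro conjI allI) (auto intro!: exI[of _ "C2 * N"] simp: N_def)
 then show ?thesis using k(1) by blast
qed

lemma noether_normalization:
 "\<exists>B l. finite_proj B l \<and> (\<forall>f\<in>pf B. (\<lambda>x. f (l x)) \<in> I --> f = 0)"
proof -
 define Q where "Q n \<longleftrightarrow> (\<exists>B l. finite_proj B l \<and> card B = n)" for n
 have "finite_proj UNIV (\<lambda>x. x)"
  unfolding finite_proj_def
  by (auto intro!: pf_coord exI[of _ 1] nrm_le_vn simp: vn_le_iff)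
 then have "\<exists>n. Q n" unfolding Q_def by blast
 then have "Q (LEAST n. Q n)" by (rule LeastI_ex)
 then obtain B l where B: "finite_proj B l" "card B = (LEAST n. Q n)" unfolding Q_def by blast
 have "f = 0" if f: "f \<in> pf B" "(\<lambda>x. f (l x)) \<in> I" for f
 proof (rule ccontr)
  assume "f ~= 0"
  from finite_proj_step[OF B(1) f(1) this f(2)] obtain k l' where k: "k \<in> B" "finite_proj (B - {k}) l'" by blast
  then have "Q (card (B - {k}))" unfolding Q_def by blast
  then have "card B <= card (B - {k})" unfolding B(2) by (rule Least_le)
  then show False using k(1) by (simp add: card_Diff_singleton card_gt_0_iff) (metis Suc_pred card_gt_0_iff empty_iff finite not_less_eq_eq order_refl)
 qed
 then show ?thesis using B(1) by blast
qed

text \<open>At an arbitrary point the denominators used for generic fibres may vanish. Over a finite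
  projection they can be removed: the coefficients of \<open>G c\<close> divided by the leading one
  are bounded on bounded sets, hence polynomial. The resulting \<open>H c\<close> is a product over
  the fibre of every generic \<open>y\<close>, however close to the given point, and the product is
  small near that point.\<close>

theorem cone_density:
 assumes x: "x \<in> zeros I" and g: "g \<in> pf UNIV" "g ~: I" and r: "r > 0"
 shows "\<exists>y\<in>zeros I. g y ~= 0 \<and> vn (x - y) < r"
proof -
 obtain B l where l: "finite_proj B l" and lind: "\<forall>f\<in>pf B. (\<lambda>x. f (l x)) \<in> I --> f = 0"
  using noether_normalization by blast
 have lpf: "!!i. (\<lambda>x. l x $ i) \<in> pf UNIV" using l unfolding finite_proj_def by blast
 obtain C1 where C1: "C1 >= 0" "!!x. vn (l x) <= C1 * vn x" using l unfolding finite_proj_def by blast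
 obtain C2 where C2: "C2 >= 0" "!!x r. x \<in> zeros I ==> r >= 0 ==> (!!b. b \<in> B ==> nrm (l x $ b) <= r) ==> vn x <= C2 * r"
  using l unfolding finite_proj_def by blast
 \<comment> \<open>Passing to the graph turns the projected coordinates into coordinates of the
   ambient space, so that the results on transcendence bases apply to them.\<close>
 define ph where "ph x = jn x (l x)" for x
 have phpf: "(\<lambda>x. ph x $ i) \<in> pf UNIV" for i unfolding ph_def by (cases i) (auto intro: pf_coord lpf)
 define GI where "GI = {f \<in> pf UNIV. (\<lambda>x. f (ph x)) \<in> I}"
 interpret G: na_prime GI nrm
  unfolding na_prime_def GI_def using comp_ideal_prime[OF phpf] na_abs_axioms by blast
 have pr1pf: "(\<lambda>z. f (pr1 z)) \<in> pf UNIV" if "f \<in> pf UNIV" for f :: "'k ^ 'v => 'k"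
  by (rule pf_UNIV[OF pf_pr1[OF that]])
 have zin: "ph x \<in> zeros GI" if "x \<in> zeros I" for x
  unfolding zeros_def GI_def using zerosD[OF that] by fastforce
 have zout: "pr1 z \<in> zeros I" "z = ph (pr1 z)" if z: "z \<in> zeros GI" for z
 proof -
  show "pr1 z \<in> zeros I" unfolding zeros_def
  proof (intro CollectI ballI)
   fix f assume f: "f \<in> I"
   have "(\<lambda>z. f (pr1 z)) \<in> GI" unfolding GI_def using f pr1pf[OF ideal_pf[OF f]] by (simp add: ph_def)
   then show "f (pr1 z) = 0" by (rule G.zerosD[OF z])
  qed
  have "pr2 z = l (pr1 z)" unfolding cart_eq_iff
  proof
   fix i
   have "(\<lambda>z. z $ Inr i - l (pr1 z) $ i) \<in> pf UNIV" by (intro pf_lambda pf_coord pr1pf lpf) simp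
   moreover have "(\<lambda>x. ph x $ Inr i - l (pr1 (ph x)) $ i) \<in> I"
    using ideal_zero unfolding zero_fun_def by (simp add: ph_def)
   ultimately have "(\<lambda>z. z $ Inr i - l (pr1 z) $ i) \<in> GI" unfolding GI_def by simp
   from G.zerosD[OF z this] show "pr2 z $ i = l (pr1 z) $ i" by (simp add: pr2_def)
  qed
  then show "z = ph (pr1 z)" unfolding ph_def using jn_pr[of z] by simp
 qed
 define B1 :: "('v + 'v) set" where "B1 = Inr ` B"
 have B1ind: "alg_indep GI B1"
  unfolding alg_indep_def
 proof
  fix f assume "f \<in> pf B1 \<inter> GI"
  then have f: "f \<in> pf B1" "(\<lambda>x. f (ph x)) \<in> I" unfolding GI_def by auto
  define f' where "f' = (\<lambda>y. f (jn 0 y))"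
  have f'pf: "f' \<in> pf B" unfolding f'_def by (rule pf_jn[OF f(1)]) (auto simp: B1_def)
  have eq: "f' (pr2 z) = f z" for z
   unfolding f'_def by (rule pf_cong_coords[OF f(1)]) (auto simp: B1_def pr2_def)
  have "(\<lambda>x. f' (l x)) = (\<lambda>x. f (ph x))"
  proof
   fix x show "f' (l x) = f (ph x)" using eq[of "ph x"] by (simp add: ph_def)
  qed
  then have "f' = 0" using lind f'pf f(2) by simp
  then have "f z = 0" for z using eq[of z] by simp
  then show "f \<in> {0}" by (simp add: fun_eq_iff)
 qed
 have bound: "vn z <= max C2 (C1 * C2) * R" if z: "z \<in> zeros GI" and R: "R >= 0" "!!b. b \<in> B1 ==> nrm (z $ b) <= R" for z R
 proof -
  have z': "z = ph (pr1 z)" by (rule zout(2)[OF z])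
  have lz: "l (pr1 z) $ b = z $ Inr b" for b by (subst (2) z') (simp add: ph_def)
  have 1: "vn (pr1 z) <= C2 * R" by (rule C2(2)[OF zout(1)[OF z] R(1)]) (simp add: lz R(2) B1_def)
  then have 2: "vn (l (pr1 z)) <= C1 * (C2 * R)" using C1(2)[of "pr1 z"] C1(1) mult_left_mono[OF 1 C1(1)] by linarith
  have 3: "C2 * R <= max C2 (C1 * C2) * R" "C1 * C2 * R <= max C2 (C1 * C2) * R" using R(1) by (intro mult_right_mono; simp)+
  show ?thesis unfolding vn_le_iff
  proof
   fix i show "nrm (z $ i) <= max C2 (C1 * C2) * R"
   proof (cases i)
    case (Inl j)
    then have "nrm (z $ i) <= vn (pr1 z)" using nrm_le_vn[of "pr1 z" j] by (simp add: pr1_def)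
    then show ?thesis using 1 3 by linarith
   next
    case (Inr j)
    then have "nrm (z $ i) <= vn (l (pr1 z))" using nrm_le_vn[of "l (pr1 z)" j] by (simp add: lz)
    then show ?thesis using 2 3 by (simp only: mult.assoc)
   qed
  qed
 qed
 have B1: "tr_basis GI B1"
 proof -
  obtain B2 where B2: "B1 \<subseteq> B2" "tr_basis GI B2" using G.extend_tr_basis[OF B1ind] by blast
  have "B2 \<subseteq> B1"
  proof (rule ccontr)
   assume "\<not> B2 \<subseteq> B1"
   then obtain i where i: "i \<in> B2" "i ~: B1" by blast
   obtain a where a: "a \<in> pf B2" "a ~= 0" "\<forall>y. a y ~= 0 --> finite (G.fiber B2 y) \<and> G.fiber B2 y ~= {}"
    using G.fiber_near[OF B2(2)] by (elim bexE conjE) (rule that)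
   \<comment> \<open>A further basis coordinate could be given a norm beyond the finiteness bound
     while all coordinates in \<open>B1\<close> have norm at most 1.\<close>
   have "0 <= max C2 (C1 * C2)" "max C2 (C1 * C2) < max C2 (C1 * C2) + 1" using C2(1) by simp_all
   from nrm_dense[OF this] obtain t where t: "max C2 (C1 * C2) < nrm t" by blast
   then have t0: "t ~= 0" using C2(1) by auto
   define sg where "sg j = (if j = i then t else 1)" for j
   obtain n :: "'v + 'v => nat" where n: "a (\<chi> j. of_nat (Suc (n j)) * sg j) ~= 0"
   proof -
    have "sg j ~= 0" for j using t0 by (simp add: sg_def)
    from pf_nonzero_at[OF pf_UNIV[OF a(1)] a(2), of sg, OF this] show ?thesis using that by blast
   qed
   obtain z where z: "z \<in> G.fiber B2 (\<chi> j. of_nat (Suc (n j)) * sg j)" using a(3)[rule_format, OF n] by blast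
   have zI: "z \<in> zeros GI" and zB: "!!b. b \<in> B2 ==> z $ b = of_nat (Suc (n b)) * sg b"
    using z unfolding G.fiber_def by auto
   have "nrm (z $ b) <= 1" if b: "b \<in> B1" for b
   proof -
    have "sg b = 1" using b i(2) by (auto simp: sg_def)
    then show ?thesis using zB[of b] b B2(1) nrm_of_nat_le[of "Suc (n b)"] by auto
   qed
   then have "vn z <= max C2 (C1 * C2) * 1" by (intro bound[OF zI]) auto
   moreover have "nrm (z $ i) = nrm t" unfolding zB[OF i(1)] nrm_mult sg_def using nrm_of_nat[of "Suc (n i)"] by simp
   ultimately show False using nrm_le_vn[of z i] t by simp
  qed
  then show ?thesis using B2 by simp
 qed
 obtain n e N where e: "inj e" "!!i. e i > 0" "!!i. e i <= N"
  and PE: "!!K::nat. \<exists>C a G. finite C \<and> card C > K \<and> (\<forall>c\<in>C. G.fiber_poly B1 (G.lin_form n e (of_nat c)) (a c) (G c))"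
  by (rule G.primitive_integers[OF B1]) (rule that)
 obtain C0 a0 G0 where C0: "finite C0" "card C0 > (0::nat)"
  "\<forall>c\<in>C0. G.fiber_poly B1 (G.lin_form n e (of_nat c)) (a0 c) (G0 c)" using PE[of 0] by blast
 obtain c0 where c0: "c0 \<in> C0" using C0(2) by fastforce
 note P0 = G.fiber_polyD[OF C0(3)[rule_format, OF c0]]
 define D where "D = degree (G0 c0)"
 obtain C a G where C: "finite C" "card C > D * N"
  "\<forall>c\<in>C. G.fiber_poly B1 (G.lin_form n e (of_nat c)) (a c) (G c)" using PE[of "D * N"] by blast
 note P = G.fiber_polyD[OF C(3)[rule_format]]
 define te where "te c = G.lin_form n e (of_nat c)" for c
 have "\<exists>H\<in>pfpoly B1. poly H (te c) \<in> GI \<and>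
  (\<forall>y ze. a c y ~= 0 --> poly H (\<lambda>_. ze) y = (\<Prod>z\<in>G.fiber B1 y. (ze - te c z)))" if c: "c \<in> C" for c
 proof -
  define p where "p = lead_coeff (G c)"
  have p: "p \<in> pf B1" "p ~= 0" unfolding p_def using P(2)[OF c] P(6)[OF c] by (auto intro: pfpolyD)
  \<comment> \<open>Over a bounded set of \<open>y\<close> the finite projection bounds all points
    of the fibres. The coefficients divided by the leading one are elementary symmetric functions of
    the values of \<open>te c\<close>, up to sign, and so they are bounded too.\<close>
  have "\<exists>q\<in>pf B1. coeff (G c) j = p * q" for j
  proof (rule pf_divides_of_bounded[OF pfpolyD[OF P(2)[OF c]] p P(1)[OF c] P(3)[OF c]])
   fix R
   define R' where "R' = max 1 (max C2 (C1 * C2) * \<bar>R\<bar>)"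
   have "nrm (coeff (G c) j y) <= R' ^ degree (G c) * nrm (p y)" if y: "vn y <= R" "a c y ~= 0" for y
   proof -
    have "nrm (te c z) <= R'" if z: "z \<in> G.fiber B1 y" for z
    proof -
     have "vn z <= max C2 (C1 * C2) * \<bar>R\<bar>"
     proof (rule bound)
      show "z \<in> zeros GI" using z by (simp add: G.fiber_def)
      fix b assume "b \<in> B1"
      then show "nrm (z $ b) <= \<bar>R\<bar>" using z y(1) nrm_le_vn[of y b] by (simp add: G.fiber_def)
     qed simp
     then show ?thesis using G.lin_form_le[of n e c z] unfolding R'_def te_def by linarith
    qed
    then have 1: "nrm (coeff (\<Prod>z\<in>G.fiber B1 y. [:- te c z, 1:]) j) <= R' ^ card (G.fiber B1 y)"
     by (intro coeff_prod_linear_bound P(7)[OF c y(2)]) (auto simp: R'_def)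
    have "at_pt y (G c) = Polynomial.smult (p y) (\<Prod>z\<in>G.fiber B1 y. [:- te c z, 1:])"
    proof (subst poly_eq_poly_eq_iff[symmetric], rule ext)
     fix ze
     show "poly (at_pt y (G c)) ze = poly (Polynomial.smult (p y) (\<Prod>z\<in>G.fiber B1 y. [:- te c z, 1:])) ze"
      unfolding poly_at_pt P(10)[OF c y(2)] p_def te_def by (simp add: poly_prod)
    qed
    then have "coeff (G c) j y = p y * coeff (\<Prod>z\<in>G.fiber B1 y. [:- te c z, 1:]) j"
     using coeff_at_pt[of y "G c" j] by simp
    then show ?thesis using mult_left_mono[OF 1, of "nrm (p y)"] P(8)[OF c y(2)] by (simp add: nrm_mult mult.commute)
   qed
   then show "\<exists>K. \<forall>y. vn y <= R --> a c y ~= 0 --> nrm (coeff (G c) j y) <= K * nrm (p y)" by blast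
  qed
  then have "\<forall>j. \<exists>q. q \<in> pf B1 \<and> coeff (G c) j = p * q" by blast
  then obtain q where q: "\<forall>j. q j \<in> pf B1 \<and> coeff (G c) j = p * q j" by (rule choice[THEN exE])
  define H where "H = (\<Sum>j\<le>degree (G c). monom (q j) j)"
  have H: "H \<in> pfpoly B1" unfolding H_def using q by (intro pfpoly_sum pfpoly_monom) blast
  have pH: "p * poly H h = poly (G c) h" for h
  proof -
   have "p * poly H h = (\<Sum>j\<le>degree (G c). p * q j * h ^ j)"
    unfolding H_def poly_sum poly_monom sum_distrib_left by (simp only: mult.assoc)
   also have "\<dots> = poly (G c) h" unfolding poly_altdef using q by (intro sum.cong refl) (simp only:)
   finally show ?thesis .
  qed
  have tepf: "te c \<in> pf UNIV" unfolding te_def G.lin_form_def[abs_def]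
   by (intro pf_lambda_sum pf_lambda pf_const pf_coord) auto
  have "p * poly H (te c) \<in> GI" unfolding pH te_def by (rule P(5)[OF c])
  moreover have "p ~: GI" using alg_indepD[OF B1ind p(1)] p(2) by blast
  moreover have "poly H (te c) \<in> pf UNIV" by (rule pfpoly_poly[OF pfpoly_mono[OF H] tepf]) simp
  ultimately have "poly H (te c) \<in> GI" using G.ideal_prime[OF pf_UNIV[OF p(1)]] by blast
  moreover have "poly H (\<lambda>_. ze) y = (\<Prod>z\<in>G.fiber B1 y. (ze - te c z))" if y: "a c y ~= 0" for y ze
  proof -
   have "p y * poly H (\<lambda>_. ze) y = p y * (\<Prod>z\<in>G.fiber B1 y. (ze - te c z))"
    using fun_cong[OF pH[of "\<lambda>_. ze"], of y] P(10)[OF c y, of ze] unfolding p_def te_def by simp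
   then show ?thesis using P(9)[OF c y] unfolding p_def by simp
  qed
  ultimately show ?thesis using H by blast
 qed
 then have "\<forall>c. \<exists>H. c \<in> C --> H \<in> pfpoly B1 \<and> poly H (te c) \<in> GI \<and>
  (\<forall>y ze. a c y ~= 0 --> poly H (\<lambda>_. ze) y = (\<Prod>z\<in>G.fiber B1 y. (ze - te c z)))" by blast
 then obtain H where H: "\<forall>c. c \<in> C --> H c \<in> pfpoly B1 \<and> poly (H c) (te c) \<in> GI \<and>
  (\<forall>y ze. a c y ~= 0 --> poly (H c) (\<lambda>_. ze) y = (\<Prod>z\<in>G.fiber B1 y. (ze - te c z)))" by (rule choice[THEN exE])
 have gG: "(\<lambda>z. g (pr1 z)) \<in> pf UNIV" "(\<lambda>z. g (pr1 z)) ~: GI"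
  using pr1pf[OF g(1)] g(2) unfolding GI_def by (simp_all add: ph_def)
 obtain ag where ag: "ag \<in> pf B1" "ag ~= 0" "\<forall>z\<in>zeros GI. ag z ~= 0 --> g (pr1 z) ~= 0"
  using G.nonvanishing_over_basis[OF B1 gG] by blast
 define A where "A = ag * (a0 c0 * (\<Prod>c\<in>C. a c))"
 have Apf: "A \<in> pf B1" unfolding A_def by (intro pf_mult pf_prod ag P0 P)
 have prod0: "(\<Prod>c\<in>C. a c) ~= 0" by (rule G.indep_prod_nonzero[OF B1ind]) (simp add: P)
 have prodpf: "(\<Prod>c\<in>C. a c) \<in> pf B1" by (intro pf_prod P)
 have A0: "A ~= 0"
  using G.indep_domain[OF B1ind P0(1) prodpf] G.indep_domain[OF B1ind ag(1) pf_mult[OF P0(1) prodpf]] prod0 P0(3) ag(2)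
  unfolding A_def by blast
 define X where "X = ph x"
 have X: "X \<in> zeros GI" unfolding X_def by (rule zin[OF x])
 have "\<exists>d>0. \<forall>y. vn (y - X) < d --> (\<forall>c\<in>C. nrm (poly (H c) (\<lambda>_. te c X) y) < r ^ D)"
 proof (rule uniform_neighbourhood[OF C(1)])
  fix c assume c: "c \<in> C"
  have "poly (H c) (\<lambda>_. te c X) X = 0"
   using G.zerosD[OF X, of "poly (H c) (te c)"] H c poly_fun_apply[of "H c" "te c" X] by simp
  moreover have "poly (H c) (\<lambda>_. te c X) \<in> pf B1" using H c by (intro pfpoly_poly pf_const) blast
  ultimately show "\<exists>d>0. \<forall>y. vn (y - X) < d --> nrm (poly (H c) (\<lambda>_. te c X) y) < r ^ D"
   using pf_continuous[of "poly (H c) (\<lambda>_. te c X)" B1 "r ^ D" X] r by simp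
 qed
 then obtain d where d: "d > 0" "!!y c. vn (y - X) < d ==> c \<in> C ==> nrm (poly (H c) (\<lambda>_. te c X) y) < r ^ D" by blast
 \<comment> \<open>Only \<open>y\<close> has to avoid the zeros of \<open>A\<close>; the point
   \<open>X\<close> itself may be arbitrarily special.\<close>
 obtain y where y: "vn (y - X) < d" "A y ~= 0" using pf_nonzero_near[OF Apf A0 d(1)] by blast
 have Ay: "ag y ~= 0" "a0 c0 y ~= 0" "!!c. c \<in> C ==> a c y ~= 0" using y(2) C(1) unfolding A_def by auto
 have card: "card (G.fiber B1 y) = D" unfolding D_def by (rule P0(8)[OF Ay(2)])
 have "\<exists>z\<in>G.fiber B1 y. vn (X - z) < r"
 proof (rule G.near_point[OF e P0(7)[OF Ay(2)] C(1) _ r])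
  show "card (G.fiber B1 y) * N < card C" unfolding card by (rule C(2))
  fix c assume c: "c \<in> C"
  have "poly (H c) (\<lambda>_. te c X) y = (\<Prod>z\<in>G.fiber B1 y. (te c X - te c z))" using H c Ay(3)[OF c] by blast
  then show "nrm (\<Prod>z\<in>G.fiber B1 y. G.lin_form n e (of_nat c) X - G.lin_form n e (of_nat c) z) < r ^ card (G.fiber B1 y)"
   using d(2)[OF y(1) c] unfolding card te_def by simp
 qed
 then obtain z where z: "z \<in> G.fiber B1 y" "vn (X - z) < r" by blast
 have zG: "z \<in> zeros GI" using z(1) by (simp add: G.fiber_def)
 have "ag z = ag y" by (rule pf_cong_coords[OF ag(1)]) (use z(1) in \<open>simp add: G.fiber_def\<close>)
 then have "g (pr1 z) ~= 0" using ag(3) zG Ay(1) by simp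
 moreover have "vn (x - pr1 z) < r" unfolding vn_less_iff
 proof
  fix i show "nrm ((x - pr1 z) $ i) < r"
   using z(2) nrm_le_vn[of "X - z" "Inl i"] by (simp add: X_def ph_def pr1_def)
 qed
 ultimately show ?thesis using zout(1)[OF zG] by blast
qed

end

section \<open>Isolated valuations\<close>

lemma continuous_on_Max_image:
 fixes f :: "'i => real => real"
 assumes "finite A" "A ~= {}" "!!i. i \<in> A ==> continuous_on S (f i)"
 shows "continuous_on S (\<lambda>x. Max ((\<lambda>i. f i x) ` A))"
 using assms
proof (induction A rule: finite_ne_induct)
 case (insert i A)
 then have "continuous_on S (\<lambda>x. max (f i x) (Max ((\<lambda>i. f i x) ` A)))"
  by (intro continuous_on_max) auto
 moreover have "Max ((\<lambda>i. f i x) ` insert i A) = max (f i x) (Max ((\<lambda>i. f i x) ` A))" for x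
  using insert by simp
 ultimately show ?case by (simp only:)
qed simp

context na_abs
begin

text \<open>Defined for every real radius, not only for norms of field elements, so that continuity
  in the radius is meaningful.\<close>

definition gauss_norm :: "'k poly => real => real" where
 "gauss_norm p r = Max ((\<lambda>j. nrm (coeff p j) * r ^ j) ` {..degree p})"

lemma gauss_norm_ge: "nrm (coeff p j) * r ^ j <= gauss_norm p r" if "r >= 0"
proof (cases "j <= degree p")
 case True
 then show ?thesis unfolding gauss_norm_def by (intro Max_ge) auto
next
 case False
 have "0 <= nrm (coeff p 0) * r ^ 0" by simp
 also have "\<dots> <= gauss_norm p r" unfolding gauss_norm_def
  by (intro Max_ge finite_imageI image_eqI[of _ _ 0]) auto
 finally show ?thesis using False by (simp add: coeff_eq_0)
qed

lemma gauss_norm_attained: "\<exists>j. gauss_norm p r = nrm (coeff p j) * r ^ j"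
proof -
 have "gauss_norm p r \<in> (\<lambda>j. nrm (coeff p j) * r ^ j) ` {..degree p}"
  unfolding gauss_norm_def by (intro Max_in) auto
 then show ?thesis by blast
qed

lemma gauss_norm_pos: "p ~= 0 ==> r > 0 ==> gauss_norm p r > 0"
proof -
 assume "p ~= 0" and r: "r > 0"
 then have "0 < nrm (lead_coeff p) * r ^ degree p" by simp
 also have "\<dots> <= gauss_norm p r" by (rule gauss_norm_ge) (use r in simp)
 finally show ?thesis .
qed

lemma nrm_poly_le: "nrm (poly p s) <= gauss_norm p (nrm s)"
 unfolding poly_altdef
proof (rule nrm_sum_le)
 fix j show "nrm (coeff p j * s ^ j) <= gauss_norm p (nrm s)"
  using gauss_norm_ge[of "nrm s" p j] by (simp add: nrm_mult nrm_power)
next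
 have "0 <= nrm (coeff p 0)" by simp
 also have "\<dots> <= gauss_norm p (nrm s)" using gauss_norm_ge[of "nrm s" p 0] by simp
 finally show "0 <= gauss_norm p (nrm s)" .
qed

text \<open>After rescaling the variable by \<open>t\<close>, a natural number that is good for all
  the polynomials gives a point of norm \<open>nrm t\<close> at which each of them attains its Gauss
  norm.\<close>

lemma gauss_norm_values:
 assumes P: "finite P" and t: "t ~= 0"
 shows "\<exists>s. nrm s = nrm t \<and> (\<forall>p\<in>P. nrm (poly p s) = gauss_norm p (nrm t))"
proof -
 define D where "D = Max (insert 0 (degree ` P))"
 define q where "q p = pcompose p [:0, t:]" for p
 have D: "degree (q p) <= D" if "p \<in> P" for p
 proof -
  have "degree (q p) <= degree p * degree [:0, t:]" unfolding q_def by (rule degree_pcompose_le)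
  also have "\<dots> = degree p" using t by simp
  also have "\<dots> <= D" unfolding D_def using P that by (intro Max_ge) auto
  finally show ?thesis .
 qed
 obtain m where m: "m \<in> {1..card P * D + 1}" "\<forall>p\<in>P. \<forall>j. nrm (coeff (q p) j) <= nrm (poly (q p) (of_nat m))"
 proof -
  have "\<exists>m\<in>{1..card P * D + 1}. \<forall>p\<in>P. \<forall>j. nrm (coeff (q p) j) <= nrm (poly (q p) (of_nat m))"
   by (rule good_integer[OF P D]) simp_all
  then show ?thesis using that by blast
 qed
 define s where "s = of_nat m * t"
 have ns: "nrm s = nrm t" unfolding s_def nrm_mult using m(1) nrm_of_nat[of m] by simp
 have "nrm (poly p s) = gauss_norm p (nrm t)" if p: "p \<in> P" for p
 proof (rule antisym)
  show "nrm (poly p s) <= gauss_norm p (nrm t)" using nrm_poly_le[of p s] ns by simp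
  obtain j where "gauss_norm p (nrm t) = nrm (coeff p j) * nrm t ^ j" using gauss_norm_attained by blast
  also have "\<dots> = nrm (coeff (q p) j)" unfolding q_def by (simp add: coeff_pcompose_linear nrm_mult nrm_power)
  also have "\<dots> <= nrm (poly (q p) (of_nat m))" using m(2) p by blast
  also have "poly (q p) (of_nat m) = poly p s" by (simp add: q_def s_def poly_pcompose)
  finally show "gauss_norm p (nrm t) <= nrm (poly p s)" .
 qed
 then show ?thesis using ns by blast
qed

lemma continuous_gauss_norm: "continuous_on S (gauss_norm p)"
 unfolding gauss_norm_def[abs_def] by (intro continuous_on_Max_image continuous_intros) auto

end

text \<open>Dividing by the base point \<open>c\<close> and adding the reciprocals makes the torus
  closed. For points of the torus, the maximum norm of \<open>recip c y\<close> is 1 exactly if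
  \<open>y\<close> and \<open>c\<close> have the same coordinatewise norms.\<close>

definition recip :: "'k::field ^ 'v::finite => 'k ^ 'v => 'k ^ ('v + 'v)" where
 "recip c y = jn (\<chi> i. y $ i / c $ i) (\<chi> i. c $ i / y $ i)"

definition unscale :: "'k::field ^ 'v::finite => 'k ^ ('v + 'v) => 'k ^ 'v" where
 "unscale c z = (\<chi> i. c $ i * z $ Inl i)"

lemma recip_simps [simp]: "recip c y $ Inl i = y $ i / c $ i" "recip c y $ Inr i = c $ i / y $ i"
 by (simp_all add: recip_def)

lemma unscale_nth [simp]: "unscale c z $ i = c $ i * z $ Inl i"
 by (simp add: unscale_def)

lemma unscale_recip: "(!!i. c $ i ~= 0) ==> unscale c (recip c y) = y"
 by (simp add: cart_eq_iff)

lemma pf_unscale: "f \<in> pf S ==> (\<lambda>z. f (unscale c z)) \<in> pf (Inl ` S)"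
 by (erule pf_compose) (auto intro!: pf_lambda pf_const pf_coord)

lemma pf_recip:
 fixes c :: "'k::field ^ 'v::finite"
 assumes "f \<in> pf UNIV"
 shows "\<exists>M. \<exists>F\<in>pf UNIV. \<forall>y. (\<forall>i. y $ i ~= 0) --> F y = (\<Prod>i\<in>UNIV. y $ i) ^ M * f (recip c y)"
 using assms
proof (induction rule: pf.induct)
 case (pf_const a)
 show ?case by (intro exI[of _ 0] bexI[of _ "\<lambda>_. a"]) (auto intro: pf.pf_const)
next
 case (pf_coord j)
 show ?case
 proof (cases j)
  case (Inl i)
  have "(\<lambda>y. y $ i * (1 / c $ i)) \<in> pf UNIV" by (intro pf_lambda pf.pf_const pf.pf_coord) simp
  then show ?thesis by (intro exI[of _ 0] bexI[of _ "\<lambda>y. y $ i * (1 / c $ i)"]) (simp_all add: Inl)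
 next
  case (Inr i)
  have "(\<lambda>y. c $ i * (\<Prod>l\<in>UNIV-{i}. y $ l)) \<in> pf UNIV"
   by (intro pf_lambda pf_lambda_sum pf.pf_const pf.pf_coord) simp
  moreover have "c $ i * (\<Prod>l\<in>UNIV-{i}. y $ l) = (\<Prod>l\<in>UNIV. y $ l) ^ 1 * recip c y $ j" if "\<forall>i. y $ i ~= 0" for y
  proof -
   have "(\<Prod>l\<in>UNIV. y $ l) = y $ i * (\<Prod>l\<in>UNIV-{i}. y $ l)" by (subst prod.remove[of _ i]) auto
   then show ?thesis using that by (simp add: Inr)
  qed
  ultimately show ?thesis by (intro exI[of _ 1] bexI[of _ "\<lambda>y. c $ i * (\<Prod>l\<in>UNIV-{i}. y $ l)"]) blast+
 qed
next
 case (pf_add f g)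
 then obtain M F N G where F: "F \<in> pf UNIV" "!!y. (\<forall>i. y $ i ~= 0) ==> F y = (\<Prod>i\<in>UNIV. y $ i) ^ M * f (recip c y)"
  and G: "G \<in> pf UNIV" "!!y. (\<forall>i. y $ i ~= 0) ==> G y = (\<Prod>i\<in>UNIV. y $ i) ^ N * g (recip c y)" by blast
 have "(\<lambda>y. (\<Prod>i\<in>UNIV. y $ i) ^ N * F y + (\<Prod>i\<in>UNIV. y $ i) ^ M * G y) \<in> pf UNIV"
  by (intro pf_lambda pf_lambda_sum pf.pf_coord F G) simp_all
 then show ?case
  by (intro exI[of _ "M + N"] bexI[of _ "\<lambda>y. (\<Prod>i\<in>UNIV. y $ i) ^ N * F y + (\<Prod>i\<in>UNIV. y $ i) ^ M * G y"])
   (auto simp: F(2) G(2) power_add algebra_simps)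
next
 case (pf_mult f g)
 then obtain M F N G where F: "F \<in> pf UNIV" "!!y. (\<forall>i. y $ i ~= 0) ==> F y = (\<Prod>i\<in>UNIV. y $ i) ^ M * f (recip c y)"
  and G: "G \<in> pf UNIV" "!!y. (\<forall>i. y $ i ~= 0) ==> G y = (\<Prod>i\<in>UNIV. y $ i) ^ N * g (recip c y)" by blast
 then show ?case
  by (intro exI[of _ "M + N"] bexI[of _ "F * G"]) (auto simp: power_add algebra_simps intro: pf.pf_mult)
qed

context na_prime
begin

lemma vanishing_in_ideal:
 assumes "f \<in> pf UNIV" "!!x. x \<in> zeros I ==> f x = 0"
 shows "f \<in> I"
 using nullstellensatz[OF assms(1)] assms(2) by blast

definition recip_ideal :: "'k ^ 'v => ('k ^ ('v + 'v) => 'k) set" where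
 "recip_ideal c = {f \<in> pf UNIV. \<forall>y\<in>zeros I. (\<forall>i. y $ i ~= 0) --> f (recip c y) = 0}"

lemma coord_prod_pf: "(\<lambda>y. \<Prod>i\<in>UNIV. y $ i) \<in> pf UNIV"
 by (intro pf_lambda_sum pf_coord) simp

lemma coord_prod_notin:
 assumes "x \<in> zeros I" "!!i. x $ i ~= 0"
 shows "(\<lambda>y. \<Prod>i\<in>UNIV. y $ i) ~: I"
 using zerosD[OF assms(1), of "\<lambda>y. \<Prod>i\<in>UNIV. y $ i"] assms(2) by auto

text \<open>A power of the product of all coordinates clears denominators. This product is not in
  \<open>I\<close> because \<open>x\<close> lies in the torus, so primality is inherited from
  \<open>I\<close>.\<close>

lemma recip_ideal_prime:
 assumes x: "x \<in> zeros I" "!!i. x $ i ~= 0"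
 shows "pf_prime (recip_ideal c)"
proof
 show "recip_ideal c \<subseteq> pf UNIV" unfolding recip_ideal_def by blast
 show "0 \<in> recip_ideal c" unfolding recip_ideal_def by simp
 show "1 ~: recip_ideal c" unfolding recip_ideal_def using x by auto
 fix f g :: "'k ^ ('v + 'v) => 'k"
 show "f + g \<in> recip_ideal c" if "f \<in> recip_ideal c" "g \<in> recip_ideal c"
  using that unfolding recip_ideal_def by (auto intro: pf_add)
 show "g * f \<in> recip_ideal c" if "f \<in> recip_ideal c" "g \<in> pf UNIV"
  using that unfolding recip_ideal_def by (auto intro: pf_mult)
 show "f \<in> recip_ideal c \<or> g \<in> recip_ideal c" if fg: "f \<in> pf UNIV" "g \<in> pf UNIV" "f * g \<in> recip_ideal c"
 proof (rule ccontr)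
  assume neg: "\<not> ?thesis"
  obtain M F where F: "F \<in> pf UNIV" "\<forall>y. (\<forall>i. y $ i ~= 0) --> F y = (\<Prod>i\<in>UNIV. y $ i) ^ M * f (recip c y)"
   using pf_recip[OF fg(1), of c] by blast
  obtain N G where G: "G \<in> pf UNIV" "\<forall>y. (\<forall>i. y $ i ~= 0) --> G y = (\<Prod>i\<in>UNIV. y $ i) ^ N * g (recip c y)"
   using pf_recip[OF fg(2), of c] by blast
  obtain y where y: "y \<in> zeros I" "\<forall>i. y $ i ~= 0" "f (recip c y) ~= 0" using neg fg(1) unfolding recip_ideal_def by blast
  have "F y ~= 0" using F(2) y(2,3) by simp
  then have FI: "F ~: I" using zerosD[OF y(1)] by blast
  obtain y' where y': "y' \<in> zeros I" "\<forall>i. y' $ i ~= 0" "g (recip c y') ~= 0" using neg fg(2) unfolding recip_ideal_def by blast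
  have "G y' ~= 0" using G(2) y'(2,3) by simp
  then have GI: "G ~: I" using zerosD[OF y'(1)] by blast
  define m where "m = (\<lambda>y::'k ^ 'v. \<Prod>i\<in>UNIV. y $ i)"
  have m: "m \<in> pf UNIV" "m ~: I" unfolding m_def using coord_prod_pf coord_prod_notin[OF x] by blast+
  have "F * G ~: I" using ideal_prime[OF F(1) G(1)] FI GI by blast
  then have "m * (F * G) ~: I" using ideal_prime[OF m(1) pf_mult[OF F(1) G(1)]] m(2) by blast
  then obtain z where z: "z \<in> zeros I" "(m * (F * G)) z ~= 0"
   using nullstellensatz[OF pf_mult[OF m(1) pf_mult[OF F(1) G(1)]]] by blast
  have nz: "\<forall>i. z $ i ~= 0" "F z ~= 0" "G z ~= 0" using z(2) by (auto simp: m_def)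
  then have "f (recip c z) * g (recip c z) ~= 0" using F(2) G(2) by auto
  moreover have "(f * g) (recip c z) = 0" using fg(3) z(1) nz(1) unfolding recip_ideal_def by blast
  ultimately show False by simp
 qed
qed

lemma recip_zeros:
 assumes c: "!!i. c $ i ~= 0" and z: "z \<in> zeros (recip_ideal c)"
 shows "z $ Inl i * z $ Inr i = 1" "unscale c z \<in> zeros I"
proof -
 note zD = bspec[OF z[unfolded zeros_def mem_Collect_eq]]
 have "(\<lambda>z. z $ Inl i * z $ Inr i - 1) \<in> recip_ideal c"
  unfolding recip_ideal_def
 proof (intro CollectI conjI ballI impI)
  show "(\<lambda>z::'k ^ ('v + 'v). z $ Inl i * z $ Inr i - 1) \<in> pf UNIV"
   by (intro pf_lambda pf_coord pf_const) simp_all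
 qed (simp add: c)
 from zD[OF this] have "z $ Inl i * z $ Inr i - 1 = 0" .
 then show "z $ Inl i * z $ Inr i = 1" by simp
 show "unscale c z \<in> zeros I" unfolding zeros_def
 proof (intro CollectI ballI)
  fix f assume f: "f \<in> I"
  have "(\<lambda>z. f (unscale c z)) \<in> recip_ideal c"
   unfolding recip_ideal_def using pf_UNIV[OF pf_unscale[OF ideal_pf[OF f]]] zerosD[OF _ f]
   by (simp add: unscale_recip[OF c])
  from zD[OF this] show "f (unscale c z) = 0" .
 qed
qed

lemma recip_in_zeros:
 "y \<in> zeros I ==> (!!i. y $ i ~= 0) ==> recip c y \<in> zeros (recip_ideal c)"
 unfolding zeros_def[of "recip_ideal c"]
proof (intro CollectI ballI)
 fix f assume "f \<in> recip_ideal c" "y \<in> zeros I" "!!i. y $ i ~= 0"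
 then show "f (recip c y) = 0" by (simp add: recip_ideal_def)
qed

lemma recip_tr_basis:
 assumes c: "c \<in> zeros I" "!!i. c $ i ~= 0" and B: "tr_basis I B"
 shows "tr_basis (recip_ideal c) (Inl ` B)"
proof -
 have ind: "alg_indep I B" using B by (simp add: tr_basis_def)
 define m where "m = (\<lambda>y::'k ^ 'v. \<Prod>i\<in>UNIV. y $ i)"
 have m: "m \<in> pf UNIV" "m ~: I" unfolding m_def using coord_prod_pf coord_prod_notin[OF c] by blast+
 have lift0: "unscale c (jn (\<chi> i. y $ i / c $ i) w) = y" for y w
  using c(2) by (simp add: cart_eq_iff)
 have 1: "f = 0" if f: "f \<in> pf (Inl ` B)" "f \<in> recip_ideal c" for f
 proof -
  define f' where "f' = (\<lambda>y. f (jn (\<chi> i. y $ i / c $ i) 0))"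
  have f'pf: "f' \<in> pf B" unfolding f'_def
  proof (rule pf_compose[OF f(1)])
   fix i assume "i \<in> (Inl ` B :: ('v + 'v) set)"
   then obtain b where b: "i = Inl b" "b \<in> B" by blast
   have "(\<lambda>x. x $ b * (1 / c $ b)) \<in> pf B" by (intro pf_lambda pf_coord pf_const b)
   then show "(\<lambda>x. jn (\<chi> i. x $ i / c $ i) 0 $ i) \<in> pf B" by (simp add: b)
  qed
  have eq: "f' (unscale c z) = f z" for z
   unfolding f'_def by (rule pf_cong_coords[OF f(1)]) (use c(2) in auto)
  have "f' * m \<in> I"
  proof (rule vanishing_in_ideal)
   show "f' * m \<in> pf UNIV" by (intro pf_mult pf_UNIV[OF f'pf] m)
   fix y assume y: "y \<in> zeros I"
   show "(f' * m) y = 0"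
   proof (cases "\<forall>i. y $ i ~= 0")
    case True
    then have "f (recip c y) = 0" using f(2) y unfolding recip_ideal_def by blast
    then show ?thesis using eq[of "recip c y"] unscale_recip[OF c(2), of y] by simp
   qed (auto simp: m_def)
  qed
  then have "f' \<in> I" using ideal_prime[OF pf_UNIV[OF f'pf] m(1)] m(2) by blast
  then have "f' = 0" by (rule alg_indepD[OF ind f'pf])
  then have "f z = 0" for z using eq[of z] by simp
  then show ?thesis by (simp add: fun_eq_iff)
 qed
 have 2: "\<not> alg_indep (recip_ideal c) (insert i (Inl ` B))" if i: "i ~: Inl ` B" for i
 proof (cases i)
  case (Inl j)
  then have j: "j ~: B" using i by blast
  obtain f where f: "f \<in> pf (insert j B)" "f \<in> I" "f ~= 0"
   using B j unfolding tr_basis_def alg_indep_def by blast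
  obtain y where y: "f y ~= 0" using f(3) by (auto simp: fun_eq_iff)
  have "(\<lambda>z. f (unscale c z)) \<in> pf (insert i (Inl ` B))"
   using pf_unscale[OF f(1)] by (simp add: Inl)
  moreover have "(\<lambda>z. f (unscale c z)) \<in> recip_ideal c"
   unfolding recip_ideal_def using pf_UNIV[OF pf_unscale[OF ideal_pf[OF f(2)]]] zerosD[OF _ f(2)]
   by (simp add: unscale_recip[OF c(2)])
  moreover have "(\<lambda>z. f (unscale c z)) ~= 0"
  proof
   assume "(\<lambda>z. f (unscale c z)) = 0"
   from fun_cong[OF this, of "jn (\<chi> i. y $ i / c $ i) 0"] show False using y by (simp add: lift0)
  qed
  ultimately show ?thesis unfolding alg_indep_def by blast
 next
  case (Inr j)
  obtain P where P: "P \<in> pfpoly B" "P ~= 0" "poly P (\<lambda>x. x $ j) \<in> I"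
  proof (cases "j \<in> B")
   case True
   show ?thesis
   proof (rule that[of "[:- (\<lambda>x. x $ j), 1:]"])
    show "[:- (\<lambda>x. x $ j), 1:] \<in> pfpoly B"
     by (intro pfpoly_pCons pf_uminus pf_coord True pf_one pfpoly_zero)
    have "poly [:- (\<lambda>x. x $ j), 1:] (\<lambda>x. x $ j) = (0 :: 'k ^ 'v => 'k)" by (simp add: fun_eq_iff)
    then show "poly [:- (\<lambda>x. x $ j), 1:] (\<lambda>x. x $ j) \<in> I" by (simp only: ideal_zero)
   qed simp
  next
   case False
   then show ?thesis using coord_relation[OF B False] that by blast
  qed
  define e where "e = degree P"
  \<comment> \<open>The reversal of the relation \<open>P\<close>, adapted to the scaling by
    \<open>c\<close>: on the torus it equals the value of \<open>P\<close> times a power of the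
    reciprocal coordinate.\<close>
  define R where "R z = (\<Sum>l\<le>e. coeff P l (unscale c z) * (c $ j ^ l * z $ Inr j ^ (e - l)))" for z
  have lift: "(\<lambda>z. f (unscale c z)) \<in> pf (insert i (Inl ` B))" if "f \<in> pf B" for f
   by (rule pf_mono[OF pf_unscale[OF that]]) blast
  have "R \<in> pf (insert i (Inl ` B))" unfolding R_def[abs_def]
   by (intro pf_lambda_sum pf_lambda lift pfpolyD[OF P(1)] pf_const pf_coord) (simp add: Inr)
  moreover have "R \<in> recip_ideal c" unfolding recip_ideal_def
  proof (intro CollectI conjI ballI impI)
   show "R \<in> pf UNIV" by (rule pf_UNIV) fact
   fix y assume y: "y \<in> zeros I" "\<forall>i. y $ i ~= 0"
   have "R (recip c y) = (\<Sum>l\<le>e. coeff P l y * y $ j ^ l * (c $ j / y $ j) ^ e)"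
    unfolding R_def unscale_recip[OF c(2)]
   proof (intro sum.cong refl)
    fix l assume l: "l \<in> {..e}"
    have "(c $ j / y $ j) ^ e = (c $ j / y $ j) ^ l * (c $ j / y $ j) ^ (e - l)"
     using l by (simp flip: power_add)
    moreover have "y $ j ^ l * (c $ j / y $ j) ^ l = c $ j ^ l" using y(2) by (simp flip: power_mult_distrib)
    ultimately show "coeff P l y * (c $ j ^ l * recip c y $ Inr j ^ (e - l)) = coeff P l y * y $ j ^ l * (c $ j / y $ j) ^ e"
     by (simp add: mult.assoc)
   qed
   also have "\<dots> = poly P (\<lambda>x. x $ j) y * (c $ j / y $ j) ^ e"
    unfolding poly_altdef e_def by (simp add: sum_distrib_right)
   finally show "R (recip c y) = 0" using zerosD[OF y(1) P(3)] by simp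
  qed
  moreover have "R ~= 0"
  proof
   assume R0: "R = 0"
   have "coeff P e ~= 0" using P(2) by (simp add: e_def)
   then obtain y where y: "coeff P e y ~= 0" by (auto simp: fun_eq_iff)
   \<comment> \<open>With all reciprocal coordinates set to 0, only the leading term of
     \<open>P\<close> survives.\<close>
   define w :: "'k ^ 'v" where "w = 0"
   have "R (jn (\<chi> i. y $ i / c $ i) w) = (\<Sum>l\<le>e. if l = e then coeff P l y * c $ j ^ l else 0)"
    unfolding R_def lift0 by (intro sum.cong refl) (auto simp: w_def power_0_left)
   also have "\<dots> = coeff P e y * c $ j ^ e" by simp
   finally show False using y c(2)[of j] R0 by simp
  qed
  ultimately show ?thesis unfolding alg_indep_def by blast
 qed
 have "alg_indep (recip_ideal c) (Inl ` B)" unfolding alg_indep_def using 1 by blast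
 then show ?thesis unfolding tr_basis_def using 2 by blast
qed

end

lemma prod_of_nat_power:
 assumes "finite Y" "!!z. z \<in> Y ==> P z ==> f z = (q::real)" "!!z. z \<in> Y ==> \<not> P z ==> f z = 1"
 shows "(\<Prod>z\<in>Y. f z) = q ^ card {z\<in>Y. P z}"
proof -
 have "(\<Prod>z\<in>Y. f z) = (\<Prod>z\<in>Y. if P z then q else 1)"
  using assms(2,3) by (intro prod.cong) auto
 also have "\<dots> = (\<Prod>z\<in>{z\<in>Y. P z}. q)" by (simp add: prod.If_cases[OF assms(1)] Int_def)
 finally show ?thesis by simp
qed

lemma ex_pf_line_poly:
 fixes f :: "'k::field_char_0 ^ 'v::finite => 'k"
 assumes "f \<in> pf S"
 shows "\<exists>p :: 'k poly. \<forall>s. f (x + s *s v) = poly p s"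
proof -
 obtain P where P: "!!y s. f (y + s *s v) = poly P (\<lambda>_. s) y" using pf_line[OF assms, of v] by blast
 show ?thesis by (rule exI[of _ "at_pt x P"]) (simp only: P poly_at_pt simp_thms)
qed

context na_cone
begin

text \<open>The number of points \<open>z\<close> of a fibre with \<open>vn z = 1\<close> is the logarithm of a continuous function of
 the absolute value of the parameter on a line, hence constant along the line.\<close>

theorem no_isolated_valuation:
 assumes x0: "x0 \<in> zeros I" "!!i. x0 $ i ~= 0" and B: "tr_basis I B" "I0 \<subseteq> B" "k \<in> B" "k ~: I0"
  and eps: "ep > 1"
  and gap: "!!y i. y \<in> zeros I ==> (!!i. y $ i ~= 0) ==>
   (!!i. nrm (y $ i / x0 $ i) < ep) ==> (!!i. nrm (x0 $ i / y $ i) < ep) ==>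
   (!!i. i \<in> I0 ==> nrm (y $ i) = nrm (x0 $ i)) ==> nrm (y $ i) = nrm (x0 $ i)"
 shows False
proof -
 have ind: "alg_indep I B" using B(1) by (simp add: tr_basis_def)
 define J where "J = recip_ideal x0"
 interpret J: na_prime J nrm
  unfolding na_prime_def J_def using recip_ideal_prime[OF x0] na_abs_axioms by blast
 define B1 :: "('v + 'v) set" where "B1 = Inl ` B"
 have B1: "tr_basis J B1" unfolding J_def B1_def by (rule recip_tr_basis[OF x0 B(1)])
 have Jind: "alg_indep J B1" using B1 by (simp add: tr_basis_def)
 have zz: "z $ Inl i * z $ Inr i = 1" "unscale x0 z \<in> zeros I" if "z \<in> zeros J" for z i
  using recip_zeros[OF x0(2)] that unfolding J_def by blast+
 have zn: "nrm (z $ Inl i) * nrm (z $ Inr i) = 1" if "z \<in> zeros J" for z i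
  using zz(1)[OF that, of i] by (simp flip: nrm_mult)
 \<comment> \<open>A coordinate and its reciprocal have norms with product 1. The maximum norm is
   therefore at least 1, with equality only if all these norms are 1.\<close>
 have vn1: "vn z >= 1" if z: "z \<in> zeros J" for z
 proof (rule ccontr)
  assume "\<not> vn z >= 1"
  then have "nrm (z $ j) < 1" for j using nrm_le_vn[of z j] by linarith
  then have "nrm (z $ Inl undefined) * nrm (z $ Inr undefined) < 1 * 1" by (intro mult_strict_mono) auto
  then show False using zn[OF z, of undefined] by simp
 qed
 \<comment> \<open>In terms of the maximum norm the hypothesis is a gap: no value lies strictly
   between 1 and \<open>ep\<close>.\<close>
 have gapz: "vn z = 1 \<or> vn z >= ep" if z: "z \<in> zeros J" and zI0: "!!b. b \<in> I0 ==> nrm (z $ Inl b) = 1" for z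
 proof (rule ccontr)
  assume neg: "\<not> (vn z = 1 \<or> vn z >= ep)"
  then have less: "nrm (z $ j) < ep" for j using nrm_le_vn[of z j] by linarith
  define y where "y = unscale x0 z"
  have nz: "z $ Inl i ~= 0" "z $ Inr i ~= 0" for i using zz(1)[OF z, of i] by auto
  have y0: "y $ i ~= 0" for i using x0(2)[of i] nz(1)[of i] by (simp add: y_def)
  have r1: "y $ i / x0 $ i = z $ Inl i" for i using x0(2)[of i] by (simp add: y_def)
  have r2: "x0 $ i / y $ i = z $ Inr i" for i using x0(2)[of i] zz(1)[OF z, of i] nz(1)[of i] by (simp add: y_def field_simps)
  have "nrm (y $ i) = nrm (x0 $ i)" for i
  proof (rule gap)
   show "y \<in> zeros I" unfolding y_def by (rule zz(2)[OF z])
   show "nrm (y $ b) = nrm (x0 $ b)" if "b \<in> I0" for b using zI0[OF that] by (simp add: y_def nrm_mult)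
  qed (use y0 less in \<open>simp_all only: r1 r2 not_False_eq_True\<close>)
  then have "nrm (z $ Inl i) = 1" for i using x0(2)[of i] unfolding r1[symmetric] nrm_divide by simp
  moreover from this have "nrm (z $ Inr i) = 1" for i using zn[OF z, of i] by simp
  ultimately have "nrm (z $ j) <= 1" for j by (cases j) auto
  then have "vn z <= 1" by (simp add: vn_le_iff)
  then show False using neg vn1[OF z] by linarith
 qed
 obtain n e N where e: "inj e" "!!i. e i > 0" "!!i. e i <= N"
  and PE: "!!K::nat. \<exists>C a G. finite C \<and> card C > K \<and> (\<forall>c\<in>C. J.fiber_poly B1 (J.lin_form n e (of_nat c)) (a c) (G c))"
  by (rule J.primitive_integers[OF B1]) (rule that)
 obtain C0 a0 G0 where C0: "finite C0" "card C0 > (0::nat)"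
  "\<forall>c\<in>C0. J.fiber_poly B1 (J.lin_form n e (of_nat c)) (a0 c) (G0 c)" using PE[of 0] by blast
 obtain c0 where c0: "c0 \<in> C0" using C0(2) by fastforce
 note P0 = J.fiber_polyD[OF C0(3)[rule_format, OF c0]]
 define D where "D = degree (G0 c0)"
 \<comment> \<open>The factor \<open>Suc N\<close> instead of \<open>N\<close> leaves room for one
   more coefficient, which will carry the threshold \<open>ka\<close>.\<close>
 obtain C a G where C: "finite C" "card C > D * Suc N"
  "\<forall>c\<in>C. J.fiber_poly B1 (J.lin_form n e (of_nat c)) (a c) (G c)" using PE[of "D * Suc N"] by blast
 note P = J.fiber_polyD[OF C(3)[rule_format]]
 have Cne: "C ~= {}" using C(2) by auto
 define te where "te c = J.lin_form n e (of_nat c)" for c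
 obtain an where an: "an \<in> pf B1" "an ~= 0"
  and near: "\<forall>x\<in>zeros J. an x ~= 0 --> (\<forall>r>0. \<exists>d>0. \<forall>y. (\<forall>b\<in>B1. nrm (y $ b - x $ b) < d) -->
   (\<exists>z\<in>J.fiber B1 y. vn (x - z) < r))"
  using J.fiber_near[OF B1] by (elim bexE conjE) (rule that)
 define A where "A = an * (a0 c0 * (\<Prod>c\<in>C. a c))"
 have Apf: "A \<in> pf B1" unfolding A_def by (intro pf_mult pf_prod an P0 P)
 have prod0: "(\<Prod>c\<in>C. a c) ~= 0" by (rule J.indep_prod_nonzero[OF Jind]) (simp add: P)
 have prodpf: "(\<Prod>c\<in>C. a c) \<in> pf B1" by (intro pf_prod P)
 have A0: "A ~= 0"
  using J.indep_domain[OF Jind P0(1) prodpf] J.indep_domain[OF Jind an(1) pf_mult[OF P0(1) prodpf]] prod0 P0(3) an(2)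
  unfolding A_def by blast
 have Ay: "an y ~= 0" "a0 c0 y ~= 0" "!!c. c \<in> C ==> a c y ~= 0" if "A y ~= 0" for y
  using that C(1) unfolding A_def by auto

 text \<open>A generic starting point with the same absolute values as \<open>x0\<close>.\<close>
 define g where "g y = A (jn (\<chi> i. y $ i / x0 $ i) 0)" for y
 have gpf: "g \<in> pf B" unfolding g_def[abs_def]
 proof (rule pf_compose[OF Apf])
  fix i assume "i \<in> B1"
  then obtain b where b: "i = Inl b" "b \<in> B" unfolding B1_def by blast
  have "(\<lambda>x. x $ b * (1 / x0 $ b)) \<in> pf B" by (intro pf_lambda pf_coord pf_const b)
  then show "(\<lambda>y. jn (\<chi> i. y $ i / x0 $ i) 0 $ i) \<in> pf B" by (simp add: b)
 qed
 have gA: "g (unscale x0 z) = A z" for z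
  unfolding g_def by (rule pf_cong_coords[OF Apf]) (use x0(2) in \<open>auto simp: B1_def\<close>)
 have "g ~: I"
 proof
  assume "g \<in> I"
  then have "g = 0" by (rule alg_indepD[OF ind gpf])
  then have "A z = 0" for z using gA[of z] by simp
  then show False using A0 by (simp add: fun_eq_iff)
 qed
 define rh where "rh = Min (range (\<lambda>i. nrm (x0 $ i)))"
 have rh: "rh > 0" "!!i. rh <= nrm (x0 $ i)" unfolding rh_def using x0(2) by auto
 obtain y0 where y0: "y0 \<in> zeros I" "g y0 ~= 0" "vn (x0 - y0) < rh"
  using cone_density[OF x0(1) pf_UNIV[OF gpf] \<open>g ~: I\<close> rh(1)] by blast
 have ny0: "nrm (y0 $ i) = nrm (x0 $ i)" for i
 proof (rule nrm_eqI)
  have "nrm (y0 $ i - x0 $ i) <= vn (x0 - y0)" using nrm_le_vn[of "x0 - y0" i] by (simp add: nrm_minus_commute)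
  then show "nrm (y0 $ i - x0 $ i) < nrm (x0 $ i)" using y0(3) rh(2)[of i] by linarith
 qed
 have y0nz: "y0 $ i ~= 0" for i using ny0[of i] x0(2)[of i] by (metis nrm_eq_0)
 define p0 where "p0 = recip x0 y0"
 have p0: "p0 \<in> zeros J" unfolding p0_def J_def by (rule recip_in_zeros[OF y0(1) y0nz])
 have np0: "nrm (p0 $ j) = 1" for j
  using ny0 y0nz x0(2) by (cases j) (simp_all add: p0_def nrm_divide)
 have Ap0: "A p0 ~= 0" using y0(2) gA[of p0] unscale_recip[OF x0(2), of y0] by (simp add: p0_def)

 \<comment> \<open>Only the coordinate \<open>k\<close> moves along this line. The coordinates in
   \<open>I0\<close> keep norm 1, so the gap is available in all fibres over it.\<close>
 define t where "t s = p0 + s *s axis (Inl k) 1" for s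
 have tb: "t s $ Inl b = p0 $ Inl b" if "b ~= k" for b s using that by (simp add: t_def axis_def)
 have tk: "t s $ Inl k = p0 $ Inl k + s" for s by (simp add: t_def)
 define Y where "Y s = J.fiber B1 (t s)" for s
 have Y: "finite (Y s)" "card (Y s) = D" if "A (t s) ~= 0" for s
  using P0(7,8)[OF Ay(2)[OF that]] unfolding Y_def D_def by blast+
 have Yz: "z \<in> zeros J" "!!b. b \<in> B ==> z $ Inl b = t s $ Inl b" if "z \<in> Y s" for z s
  using that unfolding Y_def J.fiber_def B1_def by auto
 have Ygap: "vn z = 1 \<or> vn z >= ep" if "z \<in> Y s" for z s
 proof (rule gapz[OF Yz(1)[OF that]])
  fix b assume b: "b \<in> I0"
  then have "b \<in> B" "b ~= k" using B(2,4) by auto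
  then have "z $ Inl b = p0 $ Inl b" using Yz(2)[OF that \<open>b \<in> B\<close>] tb[OF \<open>b ~= k\<close>, of s] by simp
  then show "nrm (z $ Inl b) = 1" by (simp add: np0)
 qed
 \<comment> \<open>If \<open>nrm ka1\<close> lies between 1 and \<open>ep\<close>, passing from the
   threshold 1 to \<open>ka1\<close> multiplies the factor of a point with \<open>vn z = 1\<close>
   by \<open>nrm ka1\<close> and leaves every other factor unchanged.\<close>
 define Ph where "Ph ka s = (\<Prod>z\<in>Y s. max (nrm ka) (vn z))" for ka s
 \<comment> \<open>Evaluation at \<open>ze ka c\<close> adds the term \<open>ka * c ^ Suc N\<close>
   to the linear form. Its degree exceeds all exponents \<open>e i\<close>, so it does not mix with
   the coordinates among the coefficients.\<close>
 define ze where "ze ka c = - (ka * of_nat c ^ Suc N)" for ka :: 'k and c :: nat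
 have "\<exists>q. \<forall>s. lead_coeff (G c) (t s) = poly q s" if "c \<in> C" for c
  unfolding t_def by (rule ex_pf_line_poly[OF pfpolyD[OF P(2)[OF that]]])
 then have "\<forall>c. \<exists>q. c \<in> C --> (\<forall>s. lead_coeff (G c) (t s) = poly q s)" by blast
 then obtain ql where ql: "\<forall>c. c \<in> C --> (\<forall>s. lead_coeff (G c) (t s) = poly (ql c) s)" by (rule choice[THEN exE])
 have "\<exists>q. \<forall>s. poly (G c) (\<lambda>_. ze ka c) (t s) = poly q s" if "c \<in> C" for c ka
 proof -
  have "poly (G c) (\<lambda>_. ze ka c) \<in> pf B1" by (intro pfpoly_poly P that pf_const)
  then show ?thesis unfolding t_def by (rule ex_pf_line_poly)
 qed
 then have "\<forall>p. \<exists>q. fst p \<in> C --> (\<forall>s. poly (G (fst p)) (\<lambda>_. ze (snd p) (fst p)) (t s) = poly q s)" by blast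
 then obtain qq where qq': "\<forall>p. fst p \<in> C --> (\<forall>s. poly (G (fst p)) (\<lambda>_. ze (snd p) (fst p)) (t s) = poly (qq p) s)"
  by (rule choice[THEN exE])
 define qG where "qG ka c = qq (c, ka)" for ka c
 have qG: "poly (G c) (\<lambda>_. ze ka c) (t s) = poly (qG ka c) s" if "c \<in> C" for c ka s
  using qq'[rule_format, of "(c, ka)"] that by (simp add: qG_def)
 obtain qA where "\<forall>s. A (t s) = poly qA s"
  unfolding t_def using ex_pf_line_poly[OF Apf, of p0 "axis (Inl k) 1"] by (rule exE)
 then have qA: "A (t s) = poly qA s" for s by (rule spec)
 have qA0: "qA ~= 0" using qA[of 0] Ap0 by (auto simp: t_def)
 have ql0: "ql c ~= 0" if "c \<in> C" for c
 proof -
  have "lead_coeff (G c) (t 0) ~= 0" using P(9)[OF that, of p0] Ay(3)[OF Ap0 that] by (simp add: t_def)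
  then show ?thesis using ql that by auto
 qed
 \<comment> \<open>For each \<open>c\<close> in \<open>C\<close> the quotient is a product of values
   at \<open>c\<close>, none larger than the corresponding factor of \<open>Ph\<close>. A good
   integer attains all factors at once.\<close>
 have Ph_eq: "Ph ka s = Max ((\<lambda>c. nrm (poly (qG ka c) s) / nrm (poly (ql c) s)) ` C)" if As: "A (t s) ~= 0" for ka s
 proof -
  have quot: "nrm (poly (qG ka c) s) / nrm (poly (ql c) s) = (\<Prod>z\<in>Y s. nrm (te c z + ka * of_nat c ^ Suc N))" if c: "c \<in> C" for c
  proof -
   have l: "poly (ql c) s = lead_coeff (G c) (t s)" using ql c by simp
   have l0: "lead_coeff (G c) (t s) ~= 0" by (rule P(9)[OF c Ay(3)[OF As c]])
   have "poly (qG ka c) s = lead_coeff (G c) (t s) * (\<Prod>z\<in>Y s. (ze ka c - te c z))"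
    unfolding qG[OF c, symmetric] Y_def te_def by (rule P(10)[OF c Ay(3)[OF As c]])
   then have "nrm (poly (qG ka c) s) / nrm (poly (ql c) s) = (\<Prod>z\<in>Y s. nrm (ze ka c - te c z))"
    unfolding l using l0 by (simp add: nrm_mult nrm_prod)
   also have "\<dots> = (\<Prod>z\<in>Y s. nrm (te c z + ka * of_nat c ^ Suc N))"
   proof (intro prod.cong refl)
    fix z
    have "ze ka c - te c z = - (te c z + ka * of_nat c ^ Suc N)" by (simp add: ze_def)
    then show "nrm (ze ka c - te c z) = nrm (te c z + ka * of_nat c ^ Suc N)" by (simp only: nrm_minus)
   qed
   finally show ?thesis .
  qed
  have le: "nrm (te c z + ka * of_nat c ^ Suc N) <= max (nrm ka) (vn z)" for c z
  proof (rule nrm_add_le)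
   show "nrm (te c z) <= max (nrm ka) (vn z)" using J.lin_form_le[of n e c z] unfolding te_def by simp
   have "nrm ka * nrm (of_nat (c ^ Suc N)) <= nrm ka * 1" by (intro mult_left_mono nrm_of_nat_le) simp
   then show "nrm (ka * of_nat c ^ Suc N) <= max (nrm ka) (vn z)" unfolding nrm_mult of_nat_power by simp
  qed
  define q where "q z = J.lin_poly n e z + monom ka (Suc N)" for z
  have pq: "poly (q z) (of_nat c) = te c z + ka * of_nat c ^ Suc N" for z c
   unfolding q_def te_def poly_add J.poly_lin_poly poly_monom ..
  have dl: "degree (J.lin_poly n e z) <= N" for z by (rule J.degree_lin_poly[OF e(3)])
  have dq: "degree (q z) <= Suc N" for z
   unfolding q_def using dl[of z] by (intro degree_add_le) (auto intro: order_trans[OF degree_monom_le])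
  have cardY: "card (Y s) * Suc N < card C" unfolding Y(2)[OF As] by (rule C(2))
  obtain c where c: "c \<in> C" "\<forall>z\<in>Y s. \<forall>j. nrm (coeff (q z) j) <= nrm (poly (q z) (of_nat c))"
   using good_integer[where q = q, OF Y(1)[OF As] dq C(1) cardY] by blast
  have ge: "max (nrm ka) (vn z) <= nrm (te c z + ka * of_nat c ^ Suc N)" if z: "z \<in> Y s" for z
  proof (rule max.boundedI)
   have "coeff (q z) (Suc N) = ka" unfolding q_def using dl[of z] by (simp add: coeff_eq_0)
   then show "nrm ka <= nrm (te c z + ka * of_nat c ^ Suc N)"
    using c(2)[rule_format, OF z, of "Suc N"] by (simp only: pq)
   obtain i where i: "vn z = nrm (z $ i)" using vn_attained by blast
   have "coeff (q z) (e i) = z $ i"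
    unfolding q_def coeff_add J.coeff_lin_poly[OF e(1,2)] using e(3)[of i] by simp
   then show "vn z <= nrm (te c z + ka * of_nat c ^ Suc N)"
    using c(2)[rule_format, OF z, of "e i"] by (simp only: pq i)
  qed
  show ?thesis
  proof (rule antisym)
   have "Ph ka s <= (\<Prod>z\<in>Y s. nrm (te c z + ka * of_nat c ^ Suc N))"
    unfolding Ph_def by (intro prod_mono conjI ge) (simp_all add: le_max_iff_disj)
   also have "\<dots> = nrm (poly (qG ka c) s) / nrm (poly (ql c) s)" by (rule quot[OF c(1), symmetric])
   also have "\<dots> <= Max ((\<lambda>c. nrm (poly (qG ka c) s) / nrm (poly (ql c) s)) ` C)"
    using C(1) c(1) by (intro Max_ge) auto
   finally show "Ph ka s <= Max ((\<lambda>c. nrm (poly (qG ka c) s) / nrm (poly (ql c) s)) ` C)" .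
   show "Max ((\<lambda>c. nrm (poly (qG ka c) s) / nrm (poly (ql c) s)) ` C) <= Ph ka s"
   proof (intro Max.boundedI finite_imageI C(1))
    fix x assume "x \<in> (\<lambda>c. nrm (poly (qG ka c) s) / nrm (poly (ql c) s)) ` C"
    then obtain c' where c': "c' \<in> C" "x = nrm (poly (qG ka c') s) / nrm (poly (ql c') s)" by blast
    show "x <= Ph ka s" unfolding c'(2) quot[OF c'(1)] Ph_def by (intro prod_mono conjI le) simp
   qed (use Cne in simp)
  qed
 qed
 \<comment> \<open>Replacing norms of values by Gauss norms gives a continuous function of a
   positive real radius, which agrees with \<open>Ph\<close> at suitable parameters of each radius
   that is a norm.\<close>
 define Ps where "Ps ka r = Max ((\<lambda>c. gauss_norm (qG ka c) r / gauss_norm (ql c) r) ` C)" for ka r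
 have contPsi: "continuous_on {0<..} (Ps ka)" for ka
  unfolding Ps_def[abs_def]
  by (intro continuous_on_Max_image C(1) Cne continuous_on_divide continuous_gauss_norm)
   (use gauss_norm_pos[OF ql0] in force)
 obtain ka1 where ka1: "1 < nrm ka1" "nrm ka1 < ep" using nrm_dense[of 1 ep] eps by auto
 define num where "num s = card {z\<in>Y s. vn z = 1}" for s
 have vals: "\<exists>s. nrm s = nrm u \<and> A (t s) ~= 0 \<and> Ps ka1 (nrm u) = nrm ka1 ^ num s * Ps 1 (nrm u) \<and> Ps 1 (nrm u) > 0"
  if u: "u ~= 0" for u
 proof -
  define F where "F = insert qA (ql ` C \<union> qG ka1 ` C \<union> qG 1 ` C)"
  have "finite F" unfolding F_def using C(1) by simp
  from gauss_norm_values[OF this u] obtain s where s: "nrm s = nrm u" "!!p. p \<in> F ==> nrm (poly p s) = gauss_norm p (nrm u)" by blast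
  have "nrm (poly qA s) > 0" using s(2)[of qA] gauss_norm_pos[OF qA0, of "nrm u"] u by (simp add: F_def)
  then have As: "A (t s) ~= 0" unfolding qA by simp
  have eq: "Ph ka s = Ps ka (nrm u)" if "ka = ka1 \<or> ka = 1" for ka
   unfolding Ph_eq[OF As] Ps_def using that by (intro arg_cong[of _ _ Max] image_cong refl) (auto simp: s(2) F_def)
  have pos: "Ph 1 s > 0" unfolding Ph_def by (intro prod_pos) simp
  have "Ph ka1 s = (\<Prod>z\<in>Y s. (max (nrm ka1) (vn z) / max (nrm 1) (vn z))) * Ph 1 s"
   unfolding Ph_def prod.distrib[symmetric] by (intro prod.cong refl) (simp add: less_max_iff_disj)
  also have "(\<Prod>z\<in>Y s. (max (nrm ka1) (vn z) / max (nrm 1) (vn z))) = nrm ka1 ^ num s"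
   unfolding num_def
  proof (rule prod_of_nat_power[OF Y(1)[OF As]])
   fix z assume z: "z \<in> Y s"
   show "max (nrm ka1) (vn z) / max (nrm 1) (vn z) = nrm ka1" if "vn z = 1" using that ka1 by simp
   show "max (nrm ka1) (vn z) / max (nrm 1) (vn z) = 1" if "vn z ~= 1"
   proof -
    have "vn z >= ep" using Ygap[OF z] that by simp
    then have "vn z > nrm ka1" "vn z > 1" using ka1 by linarith+
    then have "max (nrm ka1) (vn z) = vn z" "max (nrm 1) (vn z) = vn z" "vn z ~= 0"
     by (simp_all only: nrm_1 max.absorb2 less_imp_le)
    then show ?thesis by (simp only: divide_self if_True simp_thms)
   qed
  qed
  finally show ?thesis using eq[of ka1] eq[of 1] s(1) As pos by (intro exI[of _ s]) simp
 qed
 define h where "h r = ln (Ps ka1 r / Ps 1 r) / ln (nrm ka1)" for r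
 have lnka: "ln (nrm ka1) > 0" using ka1(1) by (rule ln_gt_zero)
 have hval: "\<exists>s. nrm s = nrm u \<and> A (t s) ~= 0 \<and> h (nrm u) = real (num s)" if u: "u ~= 0" for u
 proof -
  obtain s where s: "nrm s = nrm u" "A (t s) ~= 0" "Ps ka1 (nrm u) = nrm ka1 ^ num s * Ps 1 (nrm u)" "Ps 1 (nrm u) > 0"
   using vals[OF u] by blast
  have "Ps ka1 (nrm u) / Ps 1 (nrm u) = nrm ka1 ^ num s" using s(3,4) by simp
  then have "h (nrm u) = real (num s)" unfolding h_def using lnka ka1(1) by (simp add: ln_realpow)
  then show ?thesis using s by blast
 qed
 have Pspos: "Ps ka r > 0" if r: "r > 0" and ka: "ka = ka1 \<or> ka = 1" for r ka
 proof -
  have "nrm ka1 > 0" using ka1(1) by linarith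
  then have "nrm ka1 ^ m * x > 0" if "x > 0" for m x using that by simp
  then have pos: "Ps ka 1 > 0" using vals[of 1] ka by auto
  have "\<exists>c'\<in>C. qG ka c' ~= 0"
  proof (rule ccontr)
   assume "\<not> ?thesis"
   then have "gauss_norm (qG ka c) 1 / gauss_norm (ql c) 1 = 0" if "c \<in> C" for c
    using that by (simp add: gauss_norm_def)
   then have "(\<lambda>c. gauss_norm (qG ka c) 1 / gauss_norm (ql c) 1) ` C = {0}" using Cne by force
   then show False using pos unfolding Ps_def by simp
  qed
  then obtain c' where c': "c' \<in> C" "qG ka c' ~= 0" by blast
  have "0 < gauss_norm (qG ka c') r / gauss_norm (ql c') r"
   by (intro divide_pos_pos gauss_norm_pos r ql0 c')
  also have "\<dots> <= Ps ka r" unfolding Ps_def using C(1) c'(1) by (intro Max_ge) auto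
  finally show ?thesis .
 qed
 have conth: "continuous_on {0<..} h"
  unfolding h_def[abs_def]
  by (intro continuous_on_divide continuous_on_ln contPsi continuous_on_const)
   (use Pspos lnka in \<open>force simp: divide_eq_0_iff\<close>)+
 \<comment> \<open>For small parameters some point of the fibre is at distance less than 1 from
   \<open>p0\<close>, all of whose coordinates have norm 1; that point is counted.\<close>
 have start: "\<exists>u. u ~= 0 \<and> nrm u < 1 \<and> h (nrm u) >= 1"
 proof -
  obtain d where d: "d > 0" "\<forall>y. (\<forall>b\<in>B1. nrm (y $ b - p0 $ b) < d) --> (\<exists>z\<in>J.fiber B1 y. vn (p0 - z) < 1)"
  proof -
   have "(0::real) < 1" by simp
   then show ?thesis using near p0 Ay(1)[OF Ap0] that by blast
  qed
  obtain u where u: "0 < nrm u" "nrm u < min 1 d" using nrm_dense[of 0 "min 1 d"] d(1) by auto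
  then obtain s where s: "nrm s = nrm u" "A (t s) ~= 0" "h (nrm u) = real (num s)" using hval[of u] by auto
  have "nrm (t s $ b - p0 $ b) < d" for b
   using u s(1) d(1) by (simp add: t_def axis_def)
  then obtain z where z: "z \<in> Y s" "vn (p0 - z) < 1" using d(2) unfolding Y_def by blast
  have "nrm (z $ j) <= 1" for j
  proof -
   have "nrm (p0 $ j - (p0 - z) $ j) <= 1"
    using nrm_le_vn[of "p0 - z" j] z(2) by (intro nrm_diff_le) (simp_all add: np0)
   then show ?thesis by simp
  qed
  then have "vn z = 1" using vn1[OF Yz(1)[OF z(1)]] by (intro antisym) (simp_all add: vn_le_iff)
  then have "{z\<in>Y s. vn z = 1} ~= {}" using z(1) by blast
  then have "num s >= 1" unfolding num_def using Y(1)[OF s(2)] by (simp add: Suc_le_eq card_gt_0_iff)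
  then show ?thesis using u s(3) by (intro exI[of _ u]) auto
 qed
 \<comment> \<open>Once the parameter has norm greater than 1, so does the coordinate
   \<open>k\<close> of every point of the fibre, and nothing is counted.\<close>
 have end_: "\<exists>u. nrm u > 1 \<and> h (nrm u) = 0"
 proof -
  obtain s where s: "nrm s = nrm ka1" "A (t s) ~= 0" "h (nrm ka1) = real (num s)"
  proof -
   have "ka1 ~= 0" using ka1(1) by auto
   from hval[OF this] show ?thesis using that by blast
  qed
  have "vn z ~= 1" if z: "z \<in> Y s" for z
  proof -
   have "nrm (s + p0 $ Inl k) = nrm s" using np0 s(1) ka1(1) by (intro nrm_add_eq) simp
   then have "nrm (z $ Inl k) = nrm ka1" using Yz(2)[OF z B(3)] tk[of s] s(1) by (simp add: add.commute)
   then show ?thesis using nrm_le_vn[of z "Inl k"] ka1(1) by simp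
  qed
  then have "num s = 0" unfolding num_def by (simp add: card_eq_0_iff)
  then show ?thesis using ka1(1) s(3) by auto
 qed
 obtain u where u: "u ~= 0" "nrm u < 1" "h (nrm u) >= 1" using start by blast
 obtain w where w: "nrm w > 1" "h (nrm w) = 0" using end_ by blast
 have "continuous_on {nrm u..nrm w} h"
 proof (rule continuous_on_subset[OF conth])
  have "0 < nrm u" using u(1) by simp
  then show "{nrm u..nrm w} \<subseteq> {0<..}" by (meson atLeastAtMost_iff greaterThan_iff order_less_le_trans subsetI)
 qed
 from IVT2'[of h "nrm w" "1/2" "nrm u", OF _ _ _ this] obtain r where r: "nrm u <= r" "h r = 1 / 2"
  using u w by auto
 have r0: "r > 0" using r(1) u(1) nrm_pos[of u] by linarith
 \<comment> \<open>The radius \<open>r\<close> need not be a norm. Norms just above it are dense,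
   and there \<open>h\<close> would be an integer strictly between 0 and 1.\<close>
 have "isCont h r" using conth r0 by (simp add: continuous_on_eq_continuous_at)
 then have "(h \<longlongrightarrow> h r) (at r)" by (simp add: isCont_def)
 then have "\<forall>\<^sub>F x in at r. dist (h x) (h r) < 1 / 2" by (rule tendstoD) simp
 then obtain d where d: "d > 0" "!!x. x ~= r ==> dist x r < d ==> dist (h x) (h r) < 1 / 2"
  unfolding eventually_at by blast
 obtain v where v: "r < nrm v" "nrm v < r + d" using nrm_dense[of r "r + d"] r0 d(1) by auto
 then have "v ~= 0" using r0 by auto
 then obtain s where "h (nrm v) = real (num s)" using hval by blast
 moreover have "dist (h (nrm v)) (h r) < 1 / 2" using v by (intro d(2)) (auto simp: dist_real_def)
 ultimately have "\<bar>real (num s) - 1 / 2\<bar> < 1 / 2" using r(2) by (simp add: dist_real_def)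
 then have "0 < real (num s)" "real (num s) < 1" by linarith+
 then show False by simp
qed

end

section \<open>Polynomials and projective varieties\<close>

definition mon :: "('v::finite \<Rightarrow>\<^sub>0 nat) => 'k::comm_ring_1 ^ 'v => 'k" where
 "mon a x = (\<Prod>i\<in>UNIV. (x $ i) ^ Poly_Mapping.lookup a i)"

lemma mv_eval_mon: "mv_eval p x = (\<Sum>a\<in>Poly_Mapping.keys p. Poly_Mapping.lookup p a * mon a x)"
 unfolding mv_eval_def mon_def ..

lemma mv_eval_superset:
 "finite A ==> Poly_Mapping.keys p \<subseteq> A ==> mv_eval p x = (\<Sum>a\<in>A. Poly_Mapping.lookup p a * mon a x)"
 unfolding mv_eval_mon by (rule sum.mono_neutral_left) (auto simp: in_keys_iff)

lemma mv_eval_add: "mv_eval (p + q) = mv_eval p + mv_eval q"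
proof
 fix x
 let ?A = "Poly_Mapping.keys p \<union> Poly_Mapping.keys q"
 have "mv_eval (p + q) x = (\<Sum>a\<in>?A. Poly_Mapping.lookup (p + q) a * mon a x)"
  by (rule mv_eval_superset) (auto simp: keys_add)
 also have "\<dots> = mv_eval p x + mv_eval q x"
  by (simp add: mv_eval_superset[of ?A] lookup_add distrib_right sum.distrib)
 finally show "mv_eval (p + q) x = (mv_eval p + mv_eval q) x" by simp
qed

lemma mv_eval_0: "mv_eval 0 = 0"
 by (rule ext) (simp add: mv_eval_mon)

lemma mv_eval_sum: "mv_eval (sum f A) = (\<Sum>i\<in>A. mv_eval (f i))"
proof (induction A rule: infinite_finite_induct)
 case (insert i A)
 then show ?case by (simp only: mv_eval_add sum.insert not_False_eq_True)
qed (simp_all only: mv_eval_0 sum.infinite sum.empty not_False_eq_True)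

lemma mv_eval_single: "mv_eval (Poly_Mapping.single a c) x = c * mon a x"
 by (subst mv_eval_superset[of "{a}"]) auto

lemma poly_mapping_eq_sum: "p = (\<Sum>a\<in>Poly_Mapping.keys p. Poly_Mapping.single a (Poly_Mapping.lookup p a))"
 by (rule poly_mapping_eqI) (auto simp: lookup_sum lookup_single when_def in_keys_iff)

lemma mon_add: "mon (a + b) x = mon a x * mon b x"
 by (simp add: mon_def lookup_add power_add prod.distrib)

lemma mon_single: "mon (Poly_Mapping.single i n) x = x $ i ^ n"
proof -
 have "mon (Poly_Mapping.single i n) x = (\<Prod>j\<in>UNIV. if j = i then x $ j ^ n else 1)"
  unfolding mon_def by (intro prod.cong) (auto simp: lookup_single when_def)
 then show ?thesis by simp
qed

lemma mon_0: "mon 0 x = 1" by (simp add: mon_def)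

lemma mv_eval_mult_single: "mv_eval (Poly_Mapping.single a c * q) x = c * mon a x * mv_eval q x"
proof -
 have "Poly_Mapping.single a c * q = (\<Sum>b\<in>Poly_Mapping.keys q. Poly_Mapping.single (a + b) (c * Poly_Mapping.lookup q b))"
  by (subst poly_mapping_eq_sum[of q]) (simp add: sum_distrib_left mult_single)
 then have "mv_eval (Poly_Mapping.single a c * q) x = (\<Sum>b\<in>Poly_Mapping.keys q. c * Poly_Mapping.lookup q b * mon (a + b) x)"
  by (simp add: mv_eval_sum mv_eval_single)
 also have "\<dots> = c * mon a x * mv_eval q x"
  unfolding mv_eval_mon sum_distrib_left by (intro sum.cong refl) (simp add: mon_add mult_ac)
 finally show ?thesis .
qed

lemma mv_eval_mult: "mv_eval (p * q) = mv_eval p * mv_eval q"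
proof
 fix x
 have "p * q = (\<Sum>a\<in>Poly_Mapping.keys p. Poly_Mapping.single a (Poly_Mapping.lookup p a) * q)"
  by (subst poly_mapping_eq_sum[of p]) (simp add: sum_distrib_right)
 then have "mv_eval (p * q) x = (\<Sum>a\<in>Poly_Mapping.keys p. Poly_Mapping.lookup p a * mon a x * mv_eval q x)"
  by (simp add: mv_eval_sum mv_eval_mult_single)
 also have "\<dots> = mv_eval p x * mv_eval q x" by (simp add: mv_eval_mon sum_distrib_right)
 finally show "mv_eval (p * q) x = (mv_eval p * mv_eval q) x" by simp
qed

lemma mv_eval_pf: "mv_eval p \<in> pf UNIV"
 unfolding mv_eval_def[abs_def] by (intro pf_lambda_sum pf_lambda pf_const pf_coord) simp

lemma pf_mv_eval:
 assumes "f \<in> pf UNIV"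
 shows "\<exists>p. f = mv_eval p"
 using assms
proof (induction rule: pf.induct)
 case (pf_const c)
 show ?case by (rule exI[of _ "Poly_Mapping.single 0 c"]) (simp add: fun_eq_iff mv_eval_single mon_0)
next
 case (pf_coord i)
 show ?case
  by (rule exI[of _ "Poly_Mapping.single (Poly_Mapping.single i 1) 1"]) (simp add: fun_eq_iff mv_eval_single mon_single)
next
 case (pf_add f g)
 from pf_add.IH obtain p q where "f = mv_eval p" "g = mv_eval q" by (elim exE)
 then show ?case by (intro exI[of _ "p + q"]) (simp only: mv_eval_add)
next
 case (pf_mult f g)
 from pf_mult.IH obtain p q where "f = mv_eval p" "g = mv_eval q" by (elim exE)
 then show ?case by (intro exI[of _ "p * q"]) (simp only: mv_eval_mult)
qed

definition mdeg :: "('v::finite \<Rightarrow>\<^sub>0 nat) => nat" where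
 "mdeg a = (\<Sum>i\<in>UNIV. Poly_Mapping.lookup a i)"

lemma mon_scale: "mon a (s *s x) = s ^ mdeg a * mon a x"
 by (simp add: mon_def mdeg_def power_mult_distrib prod.distrib power_sum)

lemma mv_eval_scale:
 assumes "homogeneous d p"
 shows "mv_eval p (s *s x) = s ^ d * mv_eval p x"
proof -
 have "mdeg a = d" if "a \<in> Poly_Mapping.keys p" for a using assms that unfolding homogeneous_def mdeg_def by blast
 then show ?thesis unfolding mv_eval_mon sum_distrib_left
  by (intro sum.cong refl) (simp add: mon_scale mult_ac)
qed

definition hom_part :: "nat => ('v::finite, 'k::comm_ring_1) mvpoly => ('v, 'k) mvpoly" where
 "hom_part d p = (\<Sum>a\<in>{a\<in>Poly_Mapping.keys p. mdeg a = d}. Poly_Mapping.single a (Poly_Mapping.lookup p a))"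

lemma homogeneous_hom_part: "homogeneous d (hom_part d p)"
proof -
 have "Poly_Mapping.keys (hom_part d p) \<subseteq> (\<Union>a\<in>{a\<in>Poly_Mapping.keys p. mdeg a = d}. Poly_Mapping.keys (Poly_Mapping.single a (Poly_Mapping.lookup p a)))"
  unfolding hom_part_def by (rule keys_sum)
 also have "\<dots> \<subseteq> {a. mdeg a = d}" by (auto split: if_splits)
 finally show ?thesis unfolding homogeneous_def mdeg_def by blast
qed

definition mtop :: "('v::finite, 'k::comm_ring_1) mvpoly => nat" where
 "mtop p = Max (insert 0 (mdeg ` Poly_Mapping.keys p))"

lemma sum_hom_parts: "(\<Sum>d\<le>mtop p. hom_part d p) = p"
proof -
 have "(\<Sum>d\<le>mtop p. hom_part d p) = (\<Sum>d\<in>mdeg ` Poly_Mapping.keys p. hom_part d p)"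
 proof (rule sum.mono_neutral_right)
  show "mdeg ` Poly_Mapping.keys p \<subseteq> {..mtop p}" unfolding mtop_def by (auto intro: Max_ge)
  show "\<forall>i\<in>{..mtop p} - mdeg ` Poly_Mapping.keys p. hom_part i p = 0"
   unfolding hom_part_def by (auto intro!: sum.neutral)
 qed simp
 also have "\<dots> = (\<Sum>a\<in>Poly_Mapping.keys p. Poly_Mapping.single a (Poly_Mapping.lookup p a))"
  unfolding hom_part_def by (rule sum.group) simp_all
 also have "\<dots> = p" by (rule poly_mapping_eq_sum[symmetric])
 finally show ?thesis .
qed

text \<open>The restriction of \<open>p\<close> to the line through \<open>x\<close> and the origin;
  its coefficients are the values of the homogeneous parts.\<close>

definition hom_poly :: "('v::finite, 'k::comm_ring_1) mvpoly => 'k ^ 'v => 'k poly" where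
 "hom_poly p x = (\<Sum>d\<le>mtop p. monom (mv_eval (hom_part d p) x) d)"

lemma poly_hom_poly: "poly (hom_poly p x) s = mv_eval p (s *s x)"
proof -
 have "mv_eval p (s *s x) = (\<Sum>d\<le>mtop p. mv_eval (hom_part d p) (s *s x))"
  by (subst sum_hom_parts[of p, symmetric]) (simp add: mv_eval_sum)
 also have "\<dots> = (\<Sum>d\<le>mtop p. mv_eval (hom_part d p) x * s ^ d)"
  by (intro sum.cong refl) (simp add: mv_eval_scale[OF homogeneous_hom_part] mult.commute)
 finally show ?thesis by (simp add: hom_poly_def poly_sum poly_monom)
qed

lemma coeff_hom_poly: "d <= mtop p ==> coeff (hom_poly p x) d = mv_eval (hom_part d p) x"
 by (simp add: hom_poly_def coeff_sum coeff_monom)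

lemma hom_poly_eq_0:
 fixes p :: "('v::finite, 'k::field_char_0) mvpoly"
 assumes "!!s. mv_eval p (s *s x) = 0"
 shows "hom_poly p x = 0"
proof -
 have "poly (hom_poly p x) = poly 0" using assms by (simp add: fun_eq_iff poly_hom_poly)
 then show ?thesis by (simp only: poly_eq_poly_eq_iff)
qed

lemma hom_part_vanishes:
 fixes p :: "('v::finite, 'k::field_char_0) mvpoly"
 assumes "!!s. mv_eval p (s *s x) = 0"
 shows "mv_eval (hom_part d p) x = 0"
proof (cases "d <= mtop p")
 case True
 then show ?thesis using coeff_hom_poly[OF True, of x] hom_poly_eq_0[OF assms] by simp
next
 case False
 have "mdeg a <= mtop p" if "a \<in> Poly_Mapping.keys p" for a
  using that unfolding mtop_def by (intro Max_ge) auto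
 then have "{a \<in> Poly_Mapping.keys p. mdeg a = d} = {}" using False by auto
 then show ?thesis unfolding hom_part_def by (simp only: sum.empty mv_eval_0 zero_fun_apply)
qed

subsection \<open>Cones\<close>

definition cone_ideal :: "('k::comm_ring_1 ^ 'v::finite) set set => ('k ^ 'v => 'k) set" where
 "cone_ideal X = {f \<in> pf UNIV. \<forall>P\<in>X. \<forall>x\<in>P. f x = 0}"

lemma proj_space_iff: "P \<in> proj_space \<longleftrightarrow> (\<exists>x. x ~= 0 \<and> P = vec.span {x})"
proof
 assume "P \<in> proj_space"
 then have P: "vec.subspace P" "vec.dim P = 1" unfolding grassmannian_def by auto
 obtain A where A: "A \<subseteq> P" "vec.independent A" "P \<subseteq> vec.span A" "card A = vec.dim P"
  using vec.basis_exists by blast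
 then obtain x where x: "A = {x}" using P(2) card_1_singletonE by metis
 have "x ~= 0" using A(2) x vec.dependent_zero by auto
 moreover have "P = vec.span {x}" using A(1,3) vec.span_minimal[OF A(1) P(1)] x by blast
 ultimately show "\<exists>x. x ~= 0 \<and> P = vec.span {x}" by blast
next
 assume "\<exists>x. x ~= 0 \<and> P = vec.span {x}"
 then obtain x where x: "x ~= 0" "P = vec.span {x}" by blast
 then have "vec.independent {x}" by simp
 then have "vec.dim P = 1" unfolding x(2) vec.dim_span using vec.dim_eq_card_independent by fastforce
 then show "P \<in> proj_space" unfolding grassmannian_def x(2) using vec.subspace_span by blast
qed

lemma span_single: "y \<in> vec.span {x} \<longleftrightarrow> (\<exists>s. y = s *s x)" for x :: "'k::field ^ 'v::finite"
 by (simp add: vec.span_singleton image_iff)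

lemma proj_space_scale: "P \<in> proj_space ==> x \<in> P ==> s *s x \<in> P"
 unfolding grassmannian_def by (auto intro: vec.subspace_scale)

lemma proj_space_eq_span:
 assumes P: "P \<in> proj_space" "x \<in> P" "x ~= 0"
 shows "P = vec.span {x}"
proof -
 obtain y where y: "y ~= 0" "P = vec.span {y}" using P(1) proj_space_iff by blast
 obtain s where s: "x = s *s y" using P(2) y(2) span_single by blast
 have s0: "s ~= 0" using s P(3) by auto
 have "y = (1 / s) *s x" using s s0 by simp
 then have "y \<in> vec.span {x}" using span_single by blast
 moreover have "x \<in> vec.span {y}" using P(2) y(2) by simp
 ultimately show ?thesis unfolding y(2) by (intro antisym vec.span_minimal) (auto simp: vec.subspace_span)
qed

lemma form_on_point:
 assumes "homogeneous d f" "P \<in> proj_space" "x \<in> P" "x ~= 0" "mv_eval f x = 0" "y \<in> P"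
 shows "mv_eval f y = 0"
proof -
 have "y \<in> vec.span {x}" using proj_space_eq_span[OF assms(2-4)] assms(6) by simp
 then obtain s where "y = s *s x" using span_single by blast
 then show ?thesis using mv_eval_scale[OF assms(1), of s x] assms(5) by simp
qed

lemma proj_closed_subset: "proj_closed X ==> X \<subseteq> proj_space"
 unfolding proj_closed_def by blast

lemma proj_closed_refine:
 assumes X: "proj_closed X" and T: "!!f. f \<in> T ==> \<exists>d. homogeneous d f"
 shows "proj_closed {P\<in>X. \<forall>f\<in>T. \<forall>x\<in>P. mv_eval f x = 0}"
proof -
 obtain S where S: "\<forall>f\<in>S. \<exists>d. homogeneous d f" "X = {P \<in> proj_space. \<forall>f\<in>S. \<forall>x\<in>P. mv_eval f x = 0}"
  using X unfolding proj_closed_def by blast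
 show ?thesis unfolding proj_closed_def using S T by (intro exI[of _ "S \<union> T"]) blast
qed

lemma proj_closed_zeros:
 assumes X: "proj_closed X" "X ~= {}"
 shows "zeros (cone_ideal X) = \<Union>X"
proof
 show "\<Union>X \<subseteq> zeros (cone_ideal X)" unfolding zeros_def cone_ideal_def by blast
 obtain S where S: "\<forall>f\<in>S. \<exists>d. homogeneous d f" "X = {P \<in> proj_space. \<forall>f\<in>S. \<forall>x\<in>P. mv_eval f x = 0}"
  using X unfolding proj_closed_def by blast
 show "zeros (cone_ideal X) \<subseteq> \<Union>X"
 proof
  fix y assume y: "y \<in> zeros (cone_ideal X)"
  show "y \<in> \<Union>X"
  proof (cases "y = 0")
   case True
   obtain P where P: "P \<in> X" using X(2) by blast
   then have "vec.subspace P" using proj_closed_subset[OF X(1)] unfolding grassmannian_def by blast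
   then show ?thesis using P True vec.subspace_0 by blast
  next
   case False
   define P where "P = vec.span {y}"
   have P: "P \<in> proj_space" unfolding P_def proj_space_iff using False by blast
   have yP: "y \<in> P" unfolding P_def by (simp add: vec.span_base)
   have "mv_eval f x = 0" if f: "f \<in> S" and x: "x \<in> P" for f x
   proof -
    have "mv_eval f \<in> cone_ideal X" unfolding cone_ideal_def using f mv_eval_pf S(2) by blast
    then have "mv_eval f y = 0" using y unfolding zeros_def by blast
    moreover obtain d where "homogeneous d f" using S(1) f by blast
    ultimately show ?thesis using form_on_point[OF _ P yP False _ x] by blast
   qed
   then have "P \<in> X" using P S(2) by blast
   then show ?thesis using yP by blast
  qed
 qed
qed

lemma cone_idealD: "f \<in> cone_ideal X ==> P \<in> X ==> x \<in> P ==> f x = 0"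
 by (simp add: cone_ideal_def)

lemma cone_idealI: "f \<in> pf UNIV ==> (!!P x. P \<in> X ==> x \<in> P ==> f x = 0) ==> f \<in> cone_ideal X"
 by (simp add: cone_ideal_def)

lemma cone_ideal_homogeneous:
 assumes "X \<subseteq> proj_space" "f \<in> cone_ideal X"
 shows "(\<lambda>x. f (s *s x)) \<in> cone_ideal X"
proof -
 have "(\<lambda>x. f (s *s x)) \<in> pf UNIV"
 proof (rule pf_compose)
  show "f \<in> pf UNIV" using assms(2) by (simp add: cone_ideal_def)
  fix i have "(\<lambda>x::'a ^ 'b. s * x $ i) \<in> pf UNIV" by (intro pf_lambda pf_const pf_coord) simp
  then show "(\<lambda>x. (s *s x) $ i) \<in> pf UNIV" by simp
 qed
 then show ?thesis
 proof (rule cone_idealI)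
  fix P x assume P: "P \<in> X" "x \<in> P"
  show "f (s *s x) = 0"
   by (rule cone_idealD[OF assms(2) P(1) proj_space_scale[OF subsetD[OF assms(1) P(1)] P(2)]])
 qed
qed

lemma cone_ideal_hom_part:
 fixes p :: "('v::finite, 'k::field_char_0) mvpoly"
 assumes X: "X \<subseteq> proj_space" and p: "mv_eval p \<in> cone_ideal X"
 shows "mv_eval (hom_part d p) \<in> cone_ideal X"
proof -
 have "mv_eval (hom_part d p) x = 0" if P: "P \<in> X" "x \<in> P" for P x
 proof (rule hom_part_vanishes)
  fix s show "mv_eval p (s *s x) = 0"
   by (rule cone_idealD[OF p P(1) proj_space_scale[OF subsetD[OF X P(1)] P(2)]])
 qed
 then show ?thesis by (rule cone_idealI[OF mv_eval_pf])
qed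

text \<open>If \<open>f * g\<close> vanishes on the cone, then on each line \<open>P\<close> one of
  the two one-variable polynomials \<open>hom_poly\<close> is zero, so all homogeneous parts of that
  factor vanish on \<open>P\<close>. Hence \<open>X\<close> is the union of two closed subsets and
  irreducibility decides.\<close>

lemma cone_ideal_prime:
 fixes X :: "('k::{alg_closed_field, field_char_0} ^ 'v::finite) set set"
 assumes X: "proj_variety X"
 shows "pf_prime (cone_ideal X)"
proof
 have cl: "proj_closed X" "X ~= {}" and irr: "!!Y Z. proj_closed Y ==> proj_closed Z ==> X = Y \<union> Z ==> X = Y \<or> X = Z"
  using X unfolding proj_variety_def by blast+
 have sub: "X \<subseteq> proj_space" by (rule proj_closed_subset[OF cl(1)])
 show "cone_ideal X \<subseteq> pf UNIV" unfolding cone_ideal_def by blast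
 show "0 \<in> cone_ideal X" unfolding cone_ideal_def by simp
 obtain P where P: "P \<in> X" using cl(2) by blast
 then have "0 \<in> P" using sub unfolding grassmannian_def by (auto intro: vec.subspace_0)
 then show "1 ~: cone_ideal X" unfolding cone_ideal_def using P by auto
 fix f g :: "'k ^ 'v => 'k"
 show "f + g \<in> cone_ideal X" if "f \<in> cone_ideal X" "g \<in> cone_ideal X"
  using that unfolding cone_ideal_def by (auto intro: pf_add)
 show "g * f \<in> cone_ideal X" if "f \<in> cone_ideal X" "g \<in> pf UNIV"
 proof (rule cone_idealI)
  show "g * f \<in> pf UNIV" using that unfolding cone_ideal_def by (intro pf_mult) simp_all
  fix P x assume "P \<in> X" "x \<in> P"
  then have "f x = 0" by (rule cone_idealD[OF that(1)])
  then show "(g * f) x = 0" by simp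
 qed
 show "f \<in> cone_ideal X \<or> g \<in> cone_ideal X" if fg: "f \<in> pf UNIV" "g \<in> pf UNIV" "f * g \<in> cone_ideal X"
 proof -
  obtain p where p: "f = mv_eval p" using pf_mv_eval[OF fg(1)] by (elim exE)
  obtain q where q: "g = mv_eval q" using pf_mv_eval[OF fg(2)] by (elim exE)
  note pq = p q
  define V where "V p = {P\<in>X. \<forall>h\<in>range (\<lambda>d. hom_part d p). \<forall>x\<in>P. mv_eval h x = 0}" for p :: "('v, 'k) mvpoly"
  have Vcl: "proj_closed (V p)" for p unfolding V_def
   by (rule proj_closed_refine[OF cl(1)]) (use homogeneous_hom_part in blast)
  have VI: "mv_eval p \<in> cone_ideal X" if "X = V p" for p
  proof -
   have "mv_eval p x = 0" if "P \<in> X" "x \<in> P" for P x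
   proof -
    have "mv_eval p x = mv_eval (\<Sum>d\<le>mtop p. hom_part d p) x" by (simp only: sum_hom_parts)
    also have "\<dots> = (\<Sum>d\<le>mtop p. mv_eval (hom_part d p) x)" by (simp add: mv_eval_sum)
    also have "\<dots> = 0"
    proof (intro sum.neutral ballI)
     fix d
     have "P \<in> V p" using that(1) \<open>X = V p\<close> by simp
     then show "mv_eval (hom_part d p) x = 0" using that(2) unfolding V_def by simp
    qed
    finally show ?thesis .
   qed
   then show ?thesis by (rule cone_idealI[OF mv_eval_pf])
  qed
  have "P \<in> V p \<union> V q" if P: "P \<in> X" for P
  proof -
   obtain y where y: "y ~= 0" "P = vec.span {y}" using P sub proj_space_iff by blast
   have yP: "y \<in> P" unfolding y(2) by (simp add: vec.span_base)
   have PP: "P \<in> proj_space" using P sub by blast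
   have "poly (hom_poly p y * hom_poly q y) s = 0" for s
   proof -
    have "s *s y \<in> P" by (rule proj_space_scale[OF PP yP])
    then have "(f * g) (s *s y) = 0" by (rule cone_idealD[OF fg(3) P])
    then show ?thesis by (simp add: poly_hom_poly pq)
   qed
   then have "poly (hom_poly p y * hom_poly q y) = poly 0" by (simp add: fun_eq_iff)
   then have "hom_poly p y * hom_poly q y = 0" by (simp only: poly_eq_poly_eq_iff)
   then have z: "hom_poly p y = 0 \<or> hom_poly q y = 0" by simp
   have "P \<in> V r" if "hom_poly r y = 0" for r
   proof -
    have "mv_eval (hom_part d r) x = 0" if "x \<in> P" for d x
    proof (rule form_on_point[OF homogeneous_hom_part PP yP y(1) _ that])
     show "mv_eval (hom_part d r) y = 0"
      by (rule hom_part_vanishes) (simp add: poly_hom_poly[symmetric] \<open>hom_poly r y = 0\<close>)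
    qed
    then show ?thesis unfolding V_def using P by simp
   qed
   then show ?thesis using z by blast
  qed
  then have "X \<subseteq> V p \<union> V q" by (rule subsetI)
  moreover have "V r \<subseteq> X" for r unfolding V_def by (rule Collect_restrict)
  ultimately have "X = V p \<union> V q" by (intro antisym Un_least)
  from irr[OF Vcl Vcl this] show ?thesis
  proof
   assume "X = V p" then show ?thesis unfolding p by (intro disjI1 VI)
  next
   assume "X = V q" then show ?thesis unfolding q by (intro disjI2 VI)
  qed
 qed
qed

section \<open>Varieties of homogeneous prime ideals\<close>

definition cone_points :: "('k::field ^ 'v::finite => 'k) set => ('k ^ 'v) set set" where
 "cone_points I = {P \<in> proj_space. P \<subseteq> zeros I}"

context na_cone
begin

lemma zeros_scale: "x \<in> zeros I ==> s *s x \<in> zeros I"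
 unfolding zeros_def
proof (intro CollectI ballI)
 fix f assume x: "x \<in> {y. \<forall>f\<in>I. f y = 0}" and f: "f \<in> I"
 show "f (s *s x) = 0" using bspec[OF x[unfolded mem_Collect_eq] homogeneous_ideal[OF f, of s]] .
qed

lemma cone_points_cover:
 assumes "x \<in> zeros I" "x ~= 0"
 shows "vec.span {x} \<in> cone_points I"
proof -
 have "vec.span {x} \<subseteq> zeros I"
 proof
  fix y assume "y \<in> vec.span {x}"
  then obtain s where "y = s *s x" using span_single by blast
  then show "y \<in> zeros I" using zeros_scale[OF assms(1)] by simp
 qed
 then show ?thesis unfolding cone_points_def proj_space_iff using assms(2) by blast
qed

text \<open>The projective Nullstellensatz for prime ideals; a nonzero zero excludes the irrelevant
  ideal, which has no projective points.\<close>

lemma cone_ideal_cone_points: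
 assumes x: "x \<in> zeros I" "x ~= 0"
 shows "cone_ideal (cone_points I) = I"
proof
 show "I \<subseteq> cone_ideal (cone_points I)"
  unfolding cone_ideal_def cone_points_def using ideal_pf zerosD by blast
 show "cone_ideal (cone_points I) \<subseteq> I"
 proof
  fix f assume f: "f \<in> cone_ideal (cone_points I)"
  show "f \<in> I"
  proof (rule vanishing_in_ideal)
   show "f \<in> pf UNIV" using f by (simp add: cone_ideal_def)
   fix y assume y: "y \<in> zeros I"
   show "f y = 0"
   proof (cases "y = 0")
    case True
    have "0 \<in> vec.span {x}" by (rule vec.span_zero)
    then show ?thesis using f cone_points_cover[OF x] True unfolding cone_ideal_def by blast
   next
    case False
    have "y \<in> vec.span {y}" by (simp add: vec.span_base)
    then show ?thesis using f cone_points_cover[OF y False] unfolding cone_ideal_def by blast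
   qed
  qed
 qed
qed

lemma cone_points_variety:
 assumes x: "x \<in> zeros I" "x ~= 0"
 shows "proj_variety (cone_points I)"
 unfolding proj_variety_def
proof (intro conjI allI impI)
 have sub: "cone_points I \<subseteq> proj_space" unfolding cone_points_def by blast
 show "cone_points I ~= {}" using cone_points_cover[OF x] by blast
 note CI = cone_ideal_cone_points[OF x]
 show "proj_closed (cone_points I)"
  unfolding proj_closed_def
 proof (intro exI[of _ "{f. (\<exists>d. homogeneous d f) \<and> mv_eval f \<in> I}"] conjI)
  show "cone_points I = {P \<in> proj_space. \<forall>f\<in>{f. (\<exists>d. homogeneous d f) \<and> mv_eval f \<in> I}. \<forall>x\<in>P. mv_eval f x = 0}"
  proof (rule antisym)
   show "cone_points I \<subseteq> {P \<in> proj_space. \<forall>f\<in>{f. (\<exists>d. homogeneous d f) \<and> mv_eval f \<in> I}. \<forall>x\<in>P. mv_eval f x = 0}"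
    unfolding cone_points_def using zerosD by blast
   show "{P \<in> proj_space. \<forall>f\<in>{f. (\<exists>d. homogeneous d f) \<and> mv_eval f \<in> I}. \<forall>x\<in>P. mv_eval f x = 0} \<subseteq> cone_points I"
   proof clarify
    fix P assume P: "P \<in> proj_space" and van: "\<forall>f\<in>{f. (\<exists>d. homogeneous d f) \<and> mv_eval f \<in> I}. \<forall>x\<in>P. mv_eval f x = 0"
    have "f y = 0" if f: "f \<in> I" and y: "y \<in> P" for f y
    proof -
     obtain p where p: "f = mv_eval p" using pf_mv_eval[OF ideal_pf[OF f]] by blast
     have "mv_eval p \<in> cone_ideal (cone_points I)" using f unfolding CI p .
     then have "mv_eval (hom_part d p) \<in> I" for d using cone_ideal_hom_part[OF sub] unfolding CI by blast
     then have "mv_eval (hom_part d p) y = 0" for d using van y homogeneous_hom_part by blast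
     then have "(\<Sum>d\<le>mtop p. mv_eval (hom_part d p)) y = 0" by simp
     then show ?thesis unfolding p mv_eval_sum[symmetric] sum_hom_parts .
    qed
    then have "P \<subseteq> zeros I" unfolding zeros_def by blast
    then show "P \<in> cone_points I" unfolding cone_points_def using P by blast
   qed
  qed
 qed blast
 fix Y Z assume YZ: "proj_closed Y \<and> proj_closed Z \<and> cone_points I = Y \<union> Z"
 show "cone_points I = Y \<or> cone_points I = Z"
 proof (rule ccontr)
  assume neg: "\<not> ?thesis"
  have wit: "\<exists>f. f \<in> pf UNIV \<and> f ~: I \<and> (\<forall>P\<in>W. \<forall>x\<in>P. f x = 0)"
   if W: "proj_closed W" "W \<subseteq> cone_points I" "cone_points I ~= W" for W
  proof -
   obtain S where S: "W = {P \<in> proj_space. \<forall>f\<in>S. \<forall>x\<in>P. mv_eval f x = 0}"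
    using W(1) unfolding proj_closed_def by blast
   obtain P where P: "P \<in> cone_points I" "P ~: W" using W by blast
   then obtain f x where f: "f \<in> S" "x \<in> P" "mv_eval f x ~= 0" using S sub by blast
   have "mv_eval f ~: I" using f(2,3) P(1) zerosD unfolding cone_points_def by blast
   then show ?thesis using f(1) S mv_eval_pf by (intro exI[of _ "mv_eval f"]) blast
  qed
  obtain f where f: "f \<in> pf UNIV" "f ~: I" "\<forall>P\<in>Y. \<forall>x\<in>P. f x = 0" using wit[of Y] YZ neg by blast
  obtain g where g: "g \<in> pf UNIV" "g ~: I" "\<forall>P\<in>Z. \<forall>x\<in>P. g x = 0" using wit[of Z] YZ neg by blast
  have "(f * g) x = 0" if "P \<in> cone_points I" "x \<in> P" for P x
   using that YZ f(3) g(3) by auto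
  then have "f * g \<in> cone_ideal (cone_points I)" unfolding cone_ideal_def using pf_mult[OF f(1) g(1)] by blast
  then show False using ideal_prime[OF f(1) g(1)] f(2) g(2) unfolding CI by blast
 qed
qed

end

section \<open>Dimension\<close>

lemma proj_closed_memberI:
 assumes X: "proj_closed X" "X ~= {}" and P: "P \<in> proj_space" "P \<subseteq> \<Union>X"
 shows "P \<in> X"
proof -
 obtain x where x: "x ~= 0" "P = vec.span {x}" using P(1) proj_space_iff by blast
 have xP: "x \<in> P" unfolding x(2) by (simp add: vec.span_base)
 then obtain Q where Q: "Q \<in> X" "x \<in> Q" using P(2) by blast
 have "Q = vec.span {x}" by (rule proj_space_eq_span[OF subsetD[OF proj_closed_subset[OF X(1)] Q(1)] Q(2) x(1)])
 then show ?thesis using Q(1) x(2) by simp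
qed

context na_abs
begin

lemma na_cone_variety:
 fixes X :: "('k ^ 'v::finite) set set"
 assumes "proj_variety X"
 shows "na_cone (cone_ideal X) nrm"
proof -
 interpret pf_prime "cone_ideal X" by (rule cone_ideal_prime[OF assms])
 have "X \<subseteq> proj_space" using assms proj_closed_subset unfolding proj_variety_def by blast
 then show ?thesis by unfold_locales (rule cone_ideal_homogeneous)
qed

lemma zeros_variety: "proj_variety X ==> zeros (cone_ideal X) = \<Union>X"
 unfolding proj_variety_def by (intro proj_closed_zeros) simp_all

lemma cone_ideal_psubset:
 fixes X Y :: "('k ^ 'v::finite) set set"
 assumes X: "proj_variety X" and Y: "proj_variety Y" and sub: "X \<subset> Y"
 shows "cone_ideal Y \<subset> cone_ideal X"
proof
 show "cone_ideal Y \<subseteq> cone_ideal X" using sub unfolding cone_ideal_def by blast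
 show "cone_ideal Y ~= cone_ideal X"
 proof
  assume "cone_ideal Y = cone_ideal X"
  then have U: "\<Union>Y = \<Union>X" using zeros_variety[OF X] zeros_variety[OF Y] by simp
  have cl: "proj_closed X" "X ~= {}" "proj_closed Y" using X Y unfolding proj_variety_def by blast+
  have "P \<in> X" if P: "P \<in> Y" for P
  proof (rule proj_closed_memberI[OF cl(1,2)])
   show "P \<in> proj_space" using P proj_closed_subset[OF cl(3)] by blast
   show "P \<subseteq> \<Union>X" using P U by blast
  qed
  then show False using sub by blast
 qed
qed

text \<open>A basis for the smaller variety stays independent on the larger one. If it were a basis
  there, a function vanishing on the smaller variety only would divide a nonzero polynomial in the
  basis coordinates, which would then vanish on the smaller variety.\<close>

lemma tr_basis_card_less:
 fixes X Y :: "('k ^ 'v::finite) set set"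
 assumes X: "proj_variety X" and Y: "proj_variety Y" and sub: "X \<subset> Y"
  and B: "tr_basis (cone_ideal X) B" and C: "tr_basis (cone_ideal Y) C"
 shows "card B < card C"
proof -
 interpret Y: na_cone "cone_ideal Y" nrm by (rule na_cone_variety[OF Y])
 interpret X: na_cone "cone_ideal X" nrm by (rule na_cone_variety[OF X])
 have lt: "cone_ideal Y \<subset> cone_ideal X" by (rule cone_ideal_psubset[OF X Y sub])
 have ind: "alg_indep (cone_ideal X) B" using B by (simp add: tr_basis_def)
 then have "alg_indep (cone_ideal Y) B" using lt unfolding alg_indep_def by blast
 from Y.extend_tr_basis[OF this] obtain C' where C': "B \<subseteq> C'" "tr_basis (cone_ideal Y) C'" by (elim exE conjE) (rule that)
 have "B ~= C'"
 proof
  assume eq: "B = C'"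
  obtain f where f: "f \<in> cone_ideal X" "f ~: cone_ideal Y" using lt by blast
  obtain Q a where Q: "Q \<in> pfpoly B" "a \<in> pf B" "a ~= 0" "f * poly Q f - a \<in> cone_ideal Y"
   using Y.clear_denominator[OF C'(2)[folded eq] X.ideal_pf[OF f(1)] f(2)] by (elim bexE conjE) (rule that)
  have "poly Q f \<in> pf UNIV" by (rule pfpoly_poly[OF pfpoly_mono[OF Q(1) subset_UNIV] X.ideal_pf[OF f(1)]])
  then have "f * poly Q f \<in> cone_ideal X" by (rule X.ideal_mult_right[OF f(1)])
  moreover have "f * poly Q f - a \<in> cone_ideal X" using Q(4) lt by blast
  ultimately have "f * poly Q f - (f * poly Q f - a) \<in> cone_ideal X" by (rule X.ideal_diff)
  then have "a \<in> cone_ideal X" by (simp only: diff_diff_eq2 add_diff_cancel_left')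
  then show False using alg_indepD[OF ind Q(2)] Q(3) by blast
 qed
 then have "card B < card C'" using C'(1) by (intro psubset_card_mono) auto
 also have "card C' = card C" by (rule Y.tr_basis_card[OF C'(2) C])
 finally show ?thesis .
qed

text \<open>A nonzero coordinate of a point of the cone takes all values on the line through the
  point.\<close>

lemma tr_basis_card_pos:
 fixes X :: "('k ^ 'v::finite) set set"
 assumes X: "proj_variety X" and B: "tr_basis (cone_ideal X) B"
 shows "card B > 0"
proof -
 interpret X: na_cone "cone_ideal X" nrm by (rule na_cone_variety[OF X])
 obtain P where P: "P \<in> X" using X unfolding proj_variety_def by blast
 then have PP: "P \<in> proj_space" using X proj_closed_subset unfolding proj_variety_def by blast
 then obtain x where x: "x ~= 0" "P = vec.span {x}" using proj_space_iff by blast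
 have xP: "x \<in> P" unfolding x(2) by (simp add: vec.span_base)
 obtain i where i: "x $ i ~= 0" using x(1) by (auto simp: cart_eq_iff)
 have "f = 0" if f: "f \<in> pf {i}" "f \<in> cone_ideal X" for f
 proof
  fix y
  have "f y = f ((y $ i / x $ i) *s x)" by (rule pf_cong_coords[OF f(1)]) (simp add: i)
  also have "\<dots> = 0" by (rule cone_idealD[OF f(2) P proj_space_scale[OF PP xP]])
  finally show "f y = 0 y" by simp
 qed
 then have "alg_indep (cone_ideal X) {i}" unfolding alg_indep_def by blast
 from X.extend_tr_basis[OF this] obtain C where C: "{i} \<subseteq> C" "tr_basis (cone_ideal X) C" by (elim exE conjE) (rule that)
 then have "card C > 0" by (auto simp: card_gt_0_iff)
 then show ?thesis using X.tr_basis_card[OF B C(2)] by simp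
qed

text \<open>The size of a transcendence basis is positive at the bottom of the chain and grows at
  each step.\<close>

lemma chain_length:
 fixes X :: "('k ^ 'v::finite) set set"
 assumes X: "proj_variety X" and B: "tr_basis (cone_ideal X) B"
  and Z: "!!i. i <= d ==> proj_variety (Z i) \<and> Z i \<subseteq> X" "!!i. i < d ==> Z i \<subset> Z (Suc i)"
 shows "d < card B"
proof -
 have "i < card C" if "i <= d" "tr_basis (cone_ideal (Z i)) C" for i C
  using that
 proof (induction i arbitrary: C)
  case 0
  then show ?case using tr_basis_card_pos Z(1) by blast
 next
  case (Suc i)
  then have Zi: "proj_variety (Z i)" "proj_variety (Z (Suc i))" "Z i \<subset> Z (Suc i)" using Z by auto
  interpret Zi: na_cone "cone_ideal (Z i)" nrm by (rule na_cone_variety[OF Zi(1)])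
  obtain C' where C': "tr_basis (cone_ideal (Z i)) C'" using Zi.ex_tr_basis by blast
  have "i < card C'" using Suc C' by auto
  moreover have "card C' < card C" by (rule tr_basis_card_less[OF Zi C' Suc.prems(2)])
  ultimately show ?case by linarith
 qed
 moreover have Zd: "proj_variety (Z d)" "Z d \<subseteq> X" using Z(1) by auto
 interpret Zd: na_cone "cone_ideal (Z d)" nrm by (rule na_cone_variety[OF Zd(1)])
 obtain C where C: "tr_basis (cone_ideal (Z d)) C" using Zd.ex_tr_basis by blast
 have "card C <= card B"
 proof (cases "Z d = X")
  case True
  then show ?thesis using Zd.tr_basis_card[OF C] B by simp
 next
  case False
  then show ?thesis using tr_basis_card_less[OF Zd(1) X _ C B] Zd(2) by fastforce
 qed
 ultimately show ?thesis using C by fastforce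
qed

end

section \<open>Prime ideals avoiding multiplicative sets\<close>

definition pf_ideal :: "('k::comm_ring_1 ^ 'v::finite => 'k) set => bool" where
 "pf_ideal p \<longleftrightarrow> p \<subseteq> pf UNIV \<and> 0 \<in> p \<and> (\<forall>f\<in>p. \<forall>g\<in>p. f + g \<in> p) \<and> (\<forall>f\<in>p. \<forall>g\<in>pf UNIV. g * f \<in> p)"

lemma pf_ideal_extend:
 assumes p: "pf_ideal p" and h: "h \<in> pf UNIV"
 shows "pf_ideal {a + g * h | a g. a \<in> p \<and> g \<in> pf UNIV}"
 unfolding pf_ideal_def
proof (intro conjI ballI)
 have p': "p \<subseteq> pf UNIV" "0 \<in> p" "!!f g. f \<in> p ==> g \<in> p ==> f + g \<in> p" "!!f g. f \<in> p ==> g \<in> pf UNIV ==> g * f \<in> p"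
  using p unfolding pf_ideal_def by blast+
 show "{a + g * h | a g. a \<in> p \<and> g \<in> pf UNIV} \<subseteq> pf UNIV" using p'(1) h by (auto intro!: pf_add pf_mult)
 have "0 = 0 + 0 * h" by simp
 then show "0 \<in> {a + g * h | a g. a \<in> p \<and> g \<in> pf UNIV}" using p'(2) pf_zero by blast
 fix f assume "f \<in> {a + g * h | a g. a \<in> p \<and> g \<in> pf UNIV}"
 then obtain a g where f: "f = a + g * h" "a \<in> p" "g \<in> pf UNIV" by blast
 { fix f' assume "f' \<in> {a + g * h | a g. a \<in> p \<and> g \<in> pf UNIV}"
  then obtain a' g' where f': "f' = a' + g' * h" "a' \<in> p" "g' \<in> pf UNIV" by blast
  have "f + f' = (a + a') + (g + g') * h" unfolding f f' by (simp only: algebra_simps)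
  then show "f + f' \<in> {a + g * h | a g. a \<in> p \<and> g \<in> pf UNIV}" using p'(3)[OF f(2) f'(2)] pf_add[OF f(3) f'(3)] by blast }
 { fix q assume q: "q \<in> (pf UNIV :: ('a ^ 'b => 'a) set)"
  have "q * f = q * a + (q * g) * h" unfolding f by (simp only: algebra_simps)
  then show "q * f \<in> {a + g * h | a g. a \<in> p \<and> g \<in> pf UNIV}" using p'(4)[OF f(2) q] pf_mult[OF q f(3)] by blast }
qed

lemma ex_prime_avoiding:
 fixes I S :: "('k::{alg_closed_field,field_char_0} ^ 'v::finite => 'k) set"
 assumes I: "pf_ideal I" "I \<inter> S = {}" and S: "1 \<in> S" "!!f g. f \<in> S ==> g \<in> S ==> f * g \<in> S"
 shows "\<exists>p. pf_prime p \<and> I \<subseteq> p \<and> p \<inter> S = {}"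
proof -
 define AA where "AA = {p. pf_ideal p \<and> I \<subseteq> p \<and> p \<inter> S = {}}"
 have "\<exists>M\<in>AA. \<forall>p\<in>AA. M \<subseteq> p --> p = M"
 proof (rule subset_Zorn_nonempty)
  show "AA ~= {}" unfolding AA_def using I by blast
  fix C assume C: "C ~= {}" "subset.chain AA C"
  have CA: "!!p. p \<in> C ==> pf_ideal p \<and> I \<subseteq> p \<and> p \<inter> S = {}" and
   ch: "!!p q. p \<in> C ==> q \<in> C ==> p \<subseteq> q \<or> q \<subseteq> p"
   using C(2) unfolding subset.chain_def AA_def by blast+
  have "pf_ideal (\<Union>C)" unfolding pf_ideal_def
  proof (intro conjI ballI)
   show "\<Union>C \<subseteq> pf UNIV" using CA unfolding pf_ideal_def by blast
   show "0 \<in> \<Union>C" using CA C(1) unfolding pf_ideal_def by blast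
   fix f assume "f \<in> \<Union>C"
   then obtain p where p: "p \<in> C" "f \<in> p" by blast
   { fix g assume "g \<in> \<Union>C"
    then obtain q where q: "q \<in> C" "g \<in> q" by blast
    then obtain r where r: "r \<in> C" "f \<in> r" "g \<in> r" using ch[OF p(1) q(1)] p q by blast
    then have "f + g \<in> r" using CA[OF r(1)] unfolding pf_ideal_def by simp
    then show "f + g \<in> \<Union>C" using r(1) by blast }
   { fix g assume g: "g \<in> (pf UNIV :: ('k ^ 'v => 'k) set)"
    have "g * f \<in> p" using CA[OF p(1)] p(2) g unfolding pf_ideal_def by simp
    then show "g * f \<in> \<Union>C" using p(1) by blast }
  qed
  moreover have "I \<subseteq> \<Union>C" using CA C(1) by blast
  moreover have "\<Union>C \<inter> S = {}" using CA by blast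
  ultimately show "\<Union>C \<in> AA" unfolding AA_def by blast
 qed
 then obtain M where M: "M \<in> AA" "!!p. p \<in> AA ==> M \<subseteq> p ==> p = M" by blast
 have Mi: "pf_ideal M" "I \<subseteq> M" "M \<inter> S = {}" using M(1) unfolding AA_def by blast+
 have M': "M \<subseteq> pf UNIV" "0 \<in> M" "!!f g. f \<in> M ==> g \<in> M ==> f + g \<in> M" "!!f g. f \<in> M ==> g \<in> pf UNIV ==> g * f \<in> M"
  using Mi(1) unfolding pf_ideal_def by blast+
 have meet: "\<exists>a\<in>M. \<exists>g\<in>pf UNIV. a + g * f \<in> S" if f: "f \<in> pf UNIV" "f ~: M" for f
 proof (rule ccontr)
  assume neg: "\<not> ?thesis"
  define M2 where "M2 = {a + g * f | a g. a \<in> M \<and> g \<in> pf UNIV}"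
  have "a = a + 0 * f" for a by simp
  then have sub: "M \<subseteq> M2" unfolding M2_def using pf_zero by blast
  have "f = 0 + 1 * f" by simp
  then have "f \<in> M2" unfolding M2_def using M'(2) pf_one by blast
  moreover have "M2 = M"
  proof (rule M(2)[OF _ sub])
   have "pf_ideal M2" unfolding M2_def by (rule pf_ideal_extend[OF Mi(1) f(1)])
   moreover have "M2 \<inter> S = {}" using neg unfolding M2_def by blast
   ultimately show "M2 \<in> AA" unfolding AA_def using sub Mi(2) by blast
  qed
  ultimately show False using f(2) by blast
 qed
 have "pf_prime M"
 proof
  show "M \<subseteq> pf UNIV" "0 \<in> M" by (rule M')+
  show "1 ~: M" using Mi(3) S(1) by blast
  fix f g :: "'k ^ 'v => 'k"
  show "f + g \<in> M" if "f \<in> M" "g \<in> M" using M'(3) that .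
  show "g * f \<in> M" if "f \<in> M" "g \<in> pf UNIV" using M'(4) that .
  show "f \<in> M \<or> g \<in> M" if fg: "f \<in> pf UNIV" "g \<in> pf UNIV" "f * g \<in> M"
  proof (rule ccontr)
   assume neg: "\<not> ?thesis"
   obtain a u where u: "a \<in> M" "u \<in> pf UNIV" "a + u * f \<in> S" using meet[OF fg(1)] neg by blast
   obtain b w where w: "b \<in> M" "w \<in> pf UNIV" "b + w * g \<in> S" using meet[OF fg(2)] neg by blast
   have "(a + u * f) * (b + w * g) = (b + w * g) * a + ((u * f) * b + (u * w) * (f * g))"
    by (simp only: algebra_simps)
   moreover have "(b + w * g) * a + ((u * f) * b + (u * w) * (f * g)) \<in> M"
    by (intro M'(3) M'(4)[OF u(1)] M'(4)[OF w(1)] M'(4)[OF fg(3)] pf_add pf_mult subsetD[OF M'(1) w(1)] fg u w)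
   ultimately show False using S(2)[OF u(3) w(3)] Mi(3) by fastforce
  qed
 qed
 then show ?thesis using Mi by blast
qed

lemma pf_prime_ideal: "pf_prime I ==> pf_ideal I"
 unfolding pf_prime_def pf_ideal_def by blast

context pf_prime
begin

text \<open>The largest scaling-invariant ideal contained in \<open>I\<close>.\<close>

definition hom_ideal :: "('k ^ 'v => 'k) set" where
 "hom_ideal = {f \<in> pf UNIV. \<forall>s. (\<lambda>x. f (s *s x)) \<in> I}"

lemma hom_ideal_subset: "hom_ideal \<subseteq> I"
proof
 fix f assume "f \<in> hom_ideal"
 then have "(\<lambda>x. f (1 *s x)) \<in> I" unfolding hom_ideal_def by blast
 then show "f \<in> I" by simp
qed

lemma pf_scaled: "f \<in> pf UNIV ==> (\<lambda>x. f (s *s x)) \<in> pf UNIV" for f :: "'k ^ 'v => 'k"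
proof (rule pf_compose)
 fix i have "(\<lambda>x::'k ^ 'v. s * x $ i) \<in> pf UNIV" by (intro pf_lambda pf_const pf_coord) simp
 then show "(\<lambda>x. (s *s x) $ i) \<in> pf UNIV" by simp
qed

lemma hom_ideal_finite:
 assumes f: "f \<in> pf UNIV" "f ~: hom_ideal"
 shows "finite {s. (\<lambda>x. f (s *s x)) \<in> I}"
proof (rule ccontr)
 assume inf: "infinite {s. (\<lambda>x. f (s *s x)) \<in> I}"
 obtain P where P: "P \<in> pfpoly UNIV" "\<forall>y s. f (s *s y) = poly P (\<lambda>_. s) y" using pf_scale[OF f(1)] by blast
 have eq: "(\<lambda>x. f (s *s x)) = poly P (\<lambda>_. s)" for s by (rule ext) (simp only: P(2))
 have "coeff P j \<in> I" for j by (rule infinite_combination[OF P(1)]) (use inf in \<open>simp only: eq not_False_eq_True\<close>)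
 then have "poly P (\<lambda>_. s) \<in> I" for s by (rule combination_in_ideal) (rule pf_const)
 then have "(\<lambda>x. f (s *s x)) \<in> I" for s unfolding eq .
 then show False using f unfolding hom_ideal_def by blast
qed

text \<open>Outside the ideal, a function has its rescaling in \<open>I\<close> for finitely many
  scalars only, so one scalar serves two functions.\<close>

lemma hom_ideal_prime: "pf_prime hom_ideal"
proof
 show "hom_ideal \<subseteq> pf UNIV" unfolding hom_ideal_def by blast
 have "(\<lambda>x::'k ^ 'v. 0 :: 'k) \<in> I" using ideal_zero by (simp only: zero_fun_def)
 then show "0 \<in> hom_ideal" unfolding hom_ideal_def by simp
 show "1 ~: hom_ideal" using hom_ideal_subset ideal_proper by blast
 fix f g :: "'k ^ 'v => 'k"
 have add: "(\<lambda>x. (f + g) (s *s x)) = (\<lambda>x. f (s *s x)) + (\<lambda>x. g (s *s x))"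
  and mult: "(\<lambda>x. (f * g) (s *s x)) = (\<lambda>x. f (s *s x)) * (\<lambda>x. g (s *s x))"
  and mult': "(\<lambda>x. (g * f) (s *s x)) = (\<lambda>x. g (s *s x)) * (\<lambda>x. f (s *s x))" for s
  by (simp_all add: fun_eq_iff)
 show "f + g \<in> hom_ideal" if "f \<in> hom_ideal" "g \<in> hom_ideal"
  using that unfolding hom_ideal_def mem_Collect_eq add by (blast intro: pf_add ideal_add)
 show "g * f \<in> hom_ideal" if "f \<in> hom_ideal" "g \<in> pf UNIV"
  using that unfolding hom_ideal_def mem_Collect_eq mult' by (blast intro: pf_mult ideal_mult pf_scaled)
 show "f \<in> hom_ideal \<or> g \<in> hom_ideal" if fg: "f \<in> pf UNIV" "g \<in> pf UNIV" "f * g \<in> hom_ideal"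
 proof (rule ccontr)
  assume neg: "\<not> ?thesis"
  then have "finite ({s. (\<lambda>x. f (s *s x)) \<in> I} \<union> {s. (\<lambda>x. g (s *s x)) \<in> I})"
   using hom_ideal_finite[OF fg(1)] hom_ideal_finite[OF fg(2)] by blast
  then obtain s where s: "(\<lambda>x. f (s *s x)) ~: I" "(\<lambda>x. g (s *s x)) ~: I"
   using ex_new_if_finite[OF infinite_UNIV_char_0] by blast
  have "(\<lambda>x. (f * g) (s *s x)) \<in> I" using fg(3) unfolding hom_ideal_def by blast
  then show False using ideal_prime[OF pf_scaled[OF fg(1)] pf_scaled[OF fg(2)]] s unfolding mult by blast
 qed
qed

lemma hom_ideal_homogeneous:
 assumes "f \<in> hom_ideal"
 shows "(\<lambda>x. f (s *s x)) \<in> hom_ideal"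
proof -
 have "(\<lambda>x. f (s *s (t *s x))) \<in> I" for t using assms unfolding hom_ideal_def by (simp add: vector_smult_assoc)
 then show ?thesis using assms unfolding hom_ideal_def by (simp add: pf_scaled)
qed

end

context na_cone
begin

text \<open>The cone is cut by a hyperplane \<open>h = 0\<close> in the basis coordinates. Points of
  this hyperplane lift to the cone generically, so no nonzero polynomial in \<open>B - {b}\<close>
  lies in the ideal generated by \<open>I\<close> and \<open>h\<close>. A prime avoiding these
  polynomials, made homogeneous, replaces the principal ideal theorem.\<close>

lemma ideal_below:
 assumes B: "tr_basis I B" and b: "b \<in> B" "b' \<in> B" "b ~= b'"
 shows "\<exists>p. na_cone p nrm \<and> I \<subset> p \<and> alg_indep p (B - {b})"
proof -
 have ind: "alg_indep I B" using B by (simp add: tr_basis_def)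
 obtain a where a: "a \<in> pf B" "a ~= 0" "!!y. a y ~= 0 ==> fiber B y ~= {}"
  using fiber_near[OF B] by (elim bexE conjE) blast
 have "(\<lambda>x::'k ^ 'v. x $ b') ~= 0"
 proof
  assume "(\<lambda>x::'k ^ 'v. x $ b') = 0"
  from fun_cong[OF this, of 1] show False by simp
 qed
 from pf_domain[OF a(1) pf_coord[OF b(2)] a(2) this]
 obtain t where t: "a t ~= 0" "t $ b' ~= 0" by blast
 \<comment> \<open>The constant is chosen so that the hyperplane passes through \<open>t\<close>,
   where \<open>a\<close> is nonzero; hence \<open>a\<close> does not vanish identically on
   it.\<close>
 define c where "c = t $ b / t $ b'"
 define h where "h = (\<lambda>x :: 'k ^ 'v. x $ b - c * x $ b')"
 have hB: "h \<in> pf B" unfolding h_def using b by (intro pf_lambda pf_const pf_coord)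
 have h0: "h ~= 0"
 proof
  assume "h = 0"
  from fun_cong[OF this, of "axis b 1"] show False using b(3) by (simp add: h_def axis_def)
 qed
 define S where "S = {f \<in> pf (B - {b}). f ~= (0 :: 'k ^ 'v => 'k)}"
 \<comment> \<open>Moves a point into the hyperplane by changing only its coordinate
   \<open>b\<close>, which polynomials in \<open>B - {b}\<close> do not see.\<close>
 define ph where "ph x = (\<chi> i. if i = b then c * x $ b' else x $ i)" for x :: "'k ^ 'v"
 have a': "(\<lambda>x. a (ph x)) \<in> pf UNIV"
 proof (rule pf_compose[OF a(1)])
  fix i show "(\<lambda>x. ph x $ i) \<in> pf UNIV"
   by (cases "i = b") (auto simp: ph_def intro!: pf_lambda pf_const pf_coord)
 qed
 have "ph t = t" unfolding ph_def c_def using t(2) by (auto simp: cart_eq_iff)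
 then have a'0: "(\<lambda>x. a (ph x)) ~= 0" using t(1) by (metis zero_fun_apply)
 define I1 where "I1 = {u + g * h | u g. u \<in> I \<and> g \<in> pf UNIV}"
 have I1: "pf_ideal I1" unfolding I1_def
  by (rule pf_ideal_extend[OF pf_prime_ideal pf_UNIV[OF hB]]) (rule pf_prime_axioms)
 have disj: "I1 \<inter> S = {}"
 proof (rule ccontr)
  assume "I1 \<inter> S ~= {}"
  then obtain u g where ug: "u \<in> I" "g \<in> pf UNIV" "u + g * h \<in> S" unfolding I1_def by blast
  then have f: "u + g * h \<in> pf (B - {b})" "u + g * h ~= 0" unfolding S_def by blast+
  obtain x where x: "a (ph x) ~= 0" "(u + g * h) x ~= 0" using pf_domain[OF a' f(1) a'0 f(2)] by blast
  obtain z where z: "z \<in> fiber B (ph x)" using a(3)[OF x(1)] by blast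
  then have zz: "z \<in> zeros I" "!!i. i \<in> B ==> z $ i = ph x $ i" unfolding fiber_def by auto
  have "(u + g * h) x = (u + g * h) z"
   by (rule pf_cong_coords[OF f(1)]) (simp add: zz(2) ph_def)
  also have "\<dots> = g z * h z" using zerosD[OF zz(1) ug(1)] by simp
  also have "h z = 0" using zz(2)[OF b(1)] zz(2)[OF b(2)] b(3) by (simp add: h_def ph_def)
  finally show False using x(2) by simp
 qed
 have "\<exists>p. pf_prime p \<and> I1 \<subseteq> p \<and> p \<inter> S = {}"
 proof (rule ex_prime_avoiding[OF I1 disj])
  show "1 \<in> S" unfolding S_def by simp
  fix f g assume fg: "f \<in> S" "g \<in> S"
  have "\<exists>x. f x ~= 0 \<and> g x ~= 0" by (rule pf_domain) (use fg in \<open>auto simp: S_def\<close>)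
  then have "f * g ~= 0" by (auto simp: fun_eq_iff)
  then show "f * g \<in> S" using fg unfolding S_def by (auto intro: pf_mult)
 qed
 then obtain p where p: "pf_prime p" "I1 \<subseteq> p" "p \<inter> S = {}" by blast
 interpret p: pf_prime p by (rule p(1))
 interpret q: pf_prime p.hom_ideal by (rule p.hom_ideal_prime)
 have q: "na_cone p.hom_ideal nrm" by unfold_locales (rule p.hom_ideal_homogeneous)
 have Ip: "I \<subseteq> p"
 proof
  fix f assume "f \<in> I"
  moreover have "f = f + 0 * h" by simp
  ultimately have "f \<in> I1" unfolding I1_def using pf_zero by blast
  then show "f \<in> p" using p(2) by blast
 qed
 have sub: "I \<subseteq> p.hom_ideal"
  using homogeneous_ideal ideal_pf Ip unfolding p.hom_ideal_def by blast
 have "h \<in> I1"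
 proof -
  have "h = 0 + 1 * h" by simp
  then show ?thesis unfolding I1_def using ideal_zero pf_one by blast
 qed
 then have hp: "h \<in> p" using p(2) by blast
 have "(\<lambda>x. h (s *s x)) \<in> p" for s
 proof -
  have "(\<lambda>x. h (s *s x)) = (\<lambda>_. s) * h" by (rule ext) (simp add: h_def algebra_simps)
  then show ?thesis using p.ideal_mult[OF hp pf_const[of s]] by simp
 qed
 then have "h \<in> p.hom_ideal" using pf_UNIV[OF hB] unfolding p.hom_ideal_def by blast
 moreover have "h ~: I" using alg_indepD[OF ind hB] h0 by blast
 moreover have "alg_indep p.hom_ideal (B - {b})"
  using p(3) p.hom_ideal_subset unfolding alg_indep_def S_def by blast
 ultimately show ?thesis using q sub by blast
qed

end

context na_abs
begin

section \<open>Chains of subvarieties\<close>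

lemma variety_below:
 fixes X :: "('k ^ 'v::finite) set set"
 assumes X: "proj_variety X" and B: "tr_basis (cone_ideal X) B" "card B = Suc (Suc d)"
 shows "\<exists>Y C. proj_variety Y \<and> Y \<subset> X \<and> tr_basis (cone_ideal Y) C \<and> card C = Suc d"
proof -
 interpret X: na_cone "cone_ideal X" nrm by (rule na_cone_variety[OF X])
 obtain b where b: "b \<in> B" using B(2) by fastforce
 have cb: "card (B - {b}) = Suc d" using B(2) b by simp
 then have "B - {b} ~= {}" by force
 then obtain b' where b': "b' \<in> B - {b}" by blast
 then have bb: "b' \<in> B" "b ~= b'" by auto
 obtain p where p: "na_cone p nrm" "cone_ideal X \<subset> p" "alg_indep p (B - {b})"
  using X.ideal_below[OF B(1) b bb] by (elim exE conjE) (rule that)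
 interpret p: na_cone p nrm by (rule p(1))
 have "(\<lambda>x::'k^'v. x $ b') ~: p"
 proof
  assume "(\<lambda>x::'k^'v. x $ b') \<in> p"
  then have "(\<lambda>x::'k^'v. x $ b') = 0" using alg_indepD[OF p(3) pf_coord[OF b']] by blast
  from fun_cong[OF this, of 1] show False by simp
 qed
 from p.nullstellensatz[OF pf_coord[OF UNIV_I] this]
 obtain x where x: "x \<in> zeros p" "x $ b' ~= 0" by (elim bexE) (rule that)
 then have x0: "x ~= 0" by auto
 define Y where "Y = cone_points p"
 have Y: "proj_variety Y" "cone_ideal Y = p" unfolding Y_def
  by (rule p.cone_points_variety[OF x(1) x0], rule p.cone_ideal_cone_points[OF x(1) x0])
 have Xc: "proj_closed X" "X ~= {}" using X unfolding proj_variety_def by simp_all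
 have zs: "zeros p \<subseteq> \<Union>X"
  unfolding zeros_variety[OF X, symmetric] zeros_def using p(2) by blast
 have "Y \<subseteq> X"
 proof
  fix P assume "P \<in> Y"
  then have P: "P \<in> proj_space" "P \<subseteq> zeros p" unfolding Y_def cone_points_def by simp_all
  show "P \<in> X" by (rule proj_closed_memberI[OF Xc P(1) subset_trans[OF P(2) zs]])
 qed
 moreover have "Y ~= X"
 proof
  assume "Y = X"
  then show False using Y(2) p(2) by simp
 qed
 ultimately have sub: "Y \<subset> X" by (rule psubsetI)
 from p.extend_tr_basis[OF p(3)] obtain C where C: "B - {b} \<subseteq> C" "tr_basis p C" by (elim exE conjE) (rule that)
 \<comment> \<open>The size of \<open>C\<close> is squeezed: \<open>B - {b}\<close> is still
   independent on \<open>Y\<close>, and a proper subvariety has a smaller basis.\<close>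
 have "card (B - {b}) <= card C" using C(1) by (intro card_mono) auto
 moreover have Cb: "tr_basis (cone_ideal Y) C" unfolding Y(2) by (rule C(2))
 moreover have "card C < card B" by (rule tr_basis_card_less[OF Y(1) X sub Cb B(1)])
 ultimately have "card C = Suc d" using cb B(2) by simp
 then show ?thesis using Y(1) sub Cb by (intro exI[of _ Y] exI[of _ C] conjI)
qed

lemma ex_chain:
 fixes X :: "('k ^ 'v::finite) set set"
 assumes "proj_variety X" "tr_basis (cone_ideal X) B" "card B = Suc d"
 shows "\<exists>Z. (\<forall>i\<le>d. proj_variety (Z i) \<and> Z i \<subseteq> X) \<and> (\<forall>i<d. Z i \<subset> Z (Suc i))"
 using assms
proof (induction d arbitrary: X B)
 case 0
 then show ?case by (intro exI[of _ "\<lambda>_. X"]) simp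
next
 case (Suc d)
 obtain Y C where Y: "proj_variety Y" "Y \<subset> X" "tr_basis (cone_ideal Y) C" "card C = Suc d"
  using variety_below[OF Suc.prems] by (elim exE conjE) (rule that)
 obtain Z where Z: "\<forall>i\<le>d. proj_variety (Z i) \<and> Z i \<subseteq> Y" "\<forall>i<d. Z i \<subset> Z (Suc i)"
  using Suc.IH[OF Y(1,3,4)] by (elim exE conjE) (rule that)
 define Z' where "Z' i = (if i <= d then Z i else X)" for i
 have "proj_variety (Z' i) \<and> Z' i \<subseteq> X" if "i <= Suc d" for i
  using Z(1) Y(2) Suc.prems(1) unfolding Z'_def by auto
 moreover have "Z' i \<subset> Z' (Suc i)" if i: "i < Suc d" for i
 proof (cases "i = d")
  case True
  then show ?thesis using Z(1) Y(2) unfolding Z'_def by auto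
 next
  case False
  then have "i < d" using i by simp
  then show ?thesis using Z(2) unfolding Z'_def by simp
 qed
 ultimately show ?case by (intro exI[of _ Z']) simp
qed

theorem proj_dim_eq:
 fixes X :: "('k ^ 'v::finite) set set"
 assumes X: "proj_variety X" and B: "tr_basis (cone_ideal X) B"
 shows "proj_dim X + 1 = enat (card B)"
proof -
 obtain d where d: "card B = Suc d" using tr_basis_card_pos[OF X B] gr0_implies_Suc by blast
 have "proj_dim X = enat d"
 proof (rule antisym)
  show "proj_dim X <= enat d"
   unfolding proj_dim_def
  proof (rule Sup_least)
   fix e assume "e \<in> {enat d |d. \<exists>Z :: nat => ('k ^ 'v) set set.
    (\<forall>i\<le>d. proj_variety (Z i) \<and> Z i \<subseteq> X) \<and> (\<forall>i<d. Z i \<subset> Z (Suc i))}"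
   then obtain e' Z where e: "e = enat e'" "\<forall>i\<le>e'. proj_variety (Z i) \<and> Z i \<subseteq> X" "\<forall>i<e'. Z i \<subset> Z (Suc i)"
    by blast
   have "e' < card B" by (rule chain_length[OF X B, of e' Z]) (use e in simp_all)
   then show "e <= enat d" using d e(1) by simp
  qed
  obtain Z where Z: "(\<forall>i\<le>d. proj_variety (Z i) \<and> Z i \<subseteq> X) \<and> (\<forall>i<d. Z i \<subset> Z (Suc i))"
   using ex_chain[OF X B d] by (elim exE) (rule that)
  show "enat d <= proj_dim X" unfolding proj_dim_def using Z by (intro Sup_upper) blast
 qed
 then show ?thesis using d by (simp add: one_enat_def)
qed

end

section \<open>Pluecker coordinates and coordinate subspaces\<close>

text \<open>In a smallest set of coordinates with injective projection, dropping \<open>j\<close>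
  gives a vector of \<open>W\<close> that vanishes at all other chosen coordinates but not at
  \<open>j\<close>. These vectors form a basis dual to the coordinates.\<close>

lemma coords_inj_surj:
 fixes W :: "('k::field ^ 'v::finite) set"
 assumes W: "vec.subspace W" and inj: "!!v. v \<in> W ==> \<forall>j\<in>J. v $ j = 0 ==> v = 0"
 shows "\<exists>J'\<subseteq>J. (\<forall>v\<in>W. (\<forall>j\<in>J'. v $ j = 0) --> v = 0) \<and> (\<forall>t. \<exists>v\<in>W. \<forall>j\<in>J'. v $ j = t $ j)"
proof -
 define P where "P J' \<longleftrightarrow> J' \<subseteq> J \<and> (\<forall>v\<in>W. (\<forall>j\<in>J'. v $ j = 0) --> v = 0)" for J'
 have "P J" unfolding P_def using inj by blast
 from ex_has_least_nat[of P J card, OF this] obtain J' where J': "P J'" "!!K. P K ==> card J' <= card K" by blast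
 have "\<exists>w\<in>W. w $ j ~= 0 \<and> (\<forall>i\<in>J' - {j}. w $ i = 0)" if j: "j \<in> J'" for j
 proof -
  have "card (J' - {j}) < card J'" by (rule card_Diff1_less[OF finite[of J'] j])
  then have "\<not> P (J' - {j})" using J'(2) by fastforce
  then obtain w where w: "w \<in> W" "w ~= 0" "\<forall>i\<in>J' - {j}. w $ i = 0" using J'(1) unfolding P_def by blast
  have "w $ j ~= 0"
  proof
   assume "w $ j = 0"
   then have "\<forall>i\<in>J'. w $ i = 0" using w(3) by blast
   then show False using J'(1) w(1,2) unfolding P_def by blast
  qed
  then show ?thesis using w by blast
 qed
 then have "\<forall>j\<in>J'. \<exists>w. w \<in> W \<and> w $ j ~= 0 \<and> (\<forall>i\<in>J' - {j}. w $ i = 0)" by blast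
 from bchoice[OF this] obtain w where w: "!!j. j \<in> J' ==> w j \<in> W \<and> w j $ j ~= 0 \<and> (\<forall>i\<in>J' - {j}. w j $ i = 0)" by blast
 have "\<exists>v\<in>W. \<forall>j\<in>J'. v $ j = t $ j" for t
 proof (intro bexI ballI)
  show "(\<Sum>j\<in>J'. (t $ j / w j $ j) *s w j) \<in> W"
   by (intro vec.subspace_sum[OF W] vec.subspace_scale[OF W]) (use w in blast)
  fix i assume i: "i \<in> J'"
  have "(\<Sum>j\<in>J'. (t $ j / w j $ j) *s w j) $ i = (\<Sum>j\<in>J'. if j = i then t $ i else 0)"
   unfolding sum_component by (intro sum.cong refl) (use w i in auto)
  then show "(\<Sum>j\<in>J'. (t $ j / w j $ j) *s w j) $ i = t $ i" using i by simp
 qed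
 then show ?thesis using J'(1) unfolding P_def by (intro exI[of _ J']) simp
qed

lemma coords_surj:
 fixes W :: "('k::field ^ 'v::finite) set"
 assumes W: "vec.subspace W" and inj: "!!v. v \<in> W ==> \<forall>j\<in>J. v $ j = 0 ==> v = 0"
  and J: "card J = vec.dim W"
 shows "\<exists>v\<in>W. \<forall>j\<in>J. v $ j = t $ j"
proof -
 have "\<exists>J'\<subseteq>J. (\<forall>v\<in>W. (\<forall>j\<in>J'. v $ j = 0) --> v = 0) \<and> (\<forall>t. \<exists>v\<in>W. \<forall>j\<in>J'. v $ j = t $ j)"
  by (rule coords_inj_surj[OF W]) (rule inj)
 then obtain J' where J': "J' \<subseteq> J" "\<forall>v\<in>W. (\<forall>j\<in>J'. v $ j = 0) --> v = 0" "\<forall>t. \<exists>v\<in>W. \<forall>j\<in>J'. v $ j = t $ j"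
  by (elim exE conjE) (rule that)
 have "vec.dim W = card J'" by (rule dim_eq_card_coords[OF W]) ((rule J'(2)[THEN bspec, THEN mp] J'(3)[THEN spec]; assumption?)+)
 then have "J' = J" using J J'(1) by (intro card_subset_eq) auto
 then show ?thesis using J'(3) by blast
qed

lemma ex_coords:
 fixes W :: "('k::field ^ 'v::finite) set"
 assumes W: "vec.subspace W"
 obtains J where "card J = vec.dim W" "!!v. v \<in> W ==> \<forall>j\<in>J. v $ j = 0 ==> v = 0"
  "!!t. \<exists>v\<in>W. \<forall>j\<in>J. v $ j = t $ j"
proof -
 have inj: "v = 0" if "v \<in> W" "\<forall>j\<in>UNIV. v $ j = 0" for v
  using that by (simp add: cart_eq_iff)
 have "\<exists>J'\<subseteq>UNIV. (\<forall>v\<in>W. (\<forall>j\<in>J'. v $ j = 0) --> v = 0) \<and> (\<forall>t. \<exists>v\<in>W. \<forall>j\<in>J'. v $ j = t $ j)"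
  by (rule coords_inj_surj[OF W]) (rule inj)
 then obtain J where J: "\<forall>v\<in>W. (\<forall>j\<in>J. v $ j = 0) --> v = 0" "\<forall>t. \<exists>v\<in>W. \<forall>j\<in>J. v $ j = t $ j"
  by (elim exE conjE) (rule that)
 have "vec.dim W = card J" by (rule dim_eq_card_coords[OF W]) ((rule J(1)[THEN bspec, THEN mp] J(2)[THEN spec]; assumption?)+)
 then show ?thesis using that[of J] J by simp
qed

text \<open>On \<open>W\<close> a coordinate outside the free ones is a linear combination of the
  free ones, and this equation is the functional sought.\<close>

lemma annihilator_nonzero:
 fixes W :: "('k::field ^ 'v::finite) set"
 assumes W: "vec.subspace W" "W ~= UNIV"
 shows "\<exists>v. v ~= 0 \<and> (\<forall>w\<in>W. (\<Sum>i\<in>UNIV. w $ i * v $ i) = 0)"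
proof -
 obtain J where J: "!!v. v \<in> W ==> \<forall>j\<in>J. v $ j = 0 ==> v = 0"
  "!!t. \<exists>v\<in>W. \<forall>j\<in>J. v $ j = t $ j" by (rule ex_coords[OF W(1)]) (rule that)
 have "J ~= UNIV"
 proof
  assume "J = UNIV"
  have "t \<in> W" for t
  proof -
   obtain v where v: "v \<in> W" "\<forall>j\<in>J. v $ j = t $ j" using J(2)[of t] by (elim bexE) (rule that)
   then have "v = t" using \<open>J = UNIV\<close> by (simp add: cart_eq_iff)
   then show ?thesis using v(1) by simp
  qed
  then show False using W(2) by blast
 qed
 then obtain i where i: "i ~: J" by blast
 have "\<forall>j. \<exists>b. b \<in> W \<and> (\<forall>k\<in>J. b $ k = axis j 1 $ k)" using J(2) by blast
 from choice[OF this] obtain b where b: "!!j. b j \<in> W" "!!j k. k \<in> J ==> b j $ k = axis j 1 $ k" by blast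
 define v where "v = (\<chi> j. if j = i then -1 else if j \<in> J then b j $ i else 0)"
 have "v $ i = -1" by (simp add: v_def)
 then have "v ~= 0" by auto
 moreover have "(\<Sum>j\<in>UNIV. w $ j * v $ j) = 0" if w: "w \<in> W" for w
 proof -
  define u where "u = (\<Sum>j\<in>J. w $ j *s b j)"
  have u: "u \<in> W" unfolding u_def by (intro vec.subspace_sum[OF W(1)] vec.subspace_scale[OF W(1)] b)
  have "(w - u) $ k = 0" if k: "k \<in> J" for k
  proof -
   have "u $ k = (\<Sum>j\<in>J. if j = k then w $ k else 0)"
    unfolding u_def sum_component by (intro sum.cong refl) (auto simp: b(2)[OF k] axis_def)
   then show ?thesis using k by simp
  qed
  then have "w - u = 0" using J(1)[OF vec.subspace_diff[OF W(1) w u]] by blast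
  then have "w $ i = u $ i" by simp
  then have wi: "w $ i = (\<Sum>j\<in>J. w $ j * b j $ i)" unfolding u_def sum_component by simp
  have "(\<Sum>j\<in>UNIV. w $ j * v $ j) = (\<Sum>j\<in>insert i J. w $ j * v $ j)"
   by (intro sum.mono_neutral_right) (auto simp: v_def)
  also have "\<dots> = w $ i * v $ i + (\<Sum>j\<in>J. w $ j * v $ j)" using i by simp
  also have "(\<Sum>j\<in>J. w $ j * v $ j) = (\<Sum>j\<in>J. w $ j * b j $ i)"
   using i by (intro sum.cong) (auto simp: v_def)
  finally show ?thesis using wi by (simp add: v_def)
 qed
 ultimately show ?thesis by blast
qed

lemma row_span_combinations:
 fixes A :: "('k::field ^ 'v::finite) list"
 assumes d: "vec.dim (row_span A) = length A"
 shows "distinct A" "row_span A = range (\<lambda>c. \<Sum>i<length A. c i *s A ! i)"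
  "!!c i. (\<Sum>i<length A. c i *s A ! i) = 0 ==> i < length A ==> c i = 0"
proof -
 have "vec.dim (set A) = length A" using d by (simp add: row_span_def)
 moreover have le: "vec.dim (set A) <= card (set A)" by (rule vec.dim_le_card') simp
 moreover have "card (set A) <= length A" by (rule card_length)
 ultimately have card: "card (set A) = length A" by linarith
 then show dist: "distinct A" by (rule card_distinct)
 have "vec.independent (set A)"
  by (rule vec.card_le_dim_spanning[of _ "vec.span (set A)"])
   (use d card in \<open>auto simp: row_span_def vec.span_base\<close>)
 note ind = this
 have bij: "bij_betw ((!) A) {..<length A} (set A)" using dist by (rule bij_betw_nth) auto
 have sum: "(\<Sum>v\<in>set A. u v *s v) = (\<Sum>i<length A. u (A ! i) *s A ! i)" for u
  using sum.reindex_bij_betw[OF bij, of "\<lambda>v. u v *s v"] by simp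
 have sum': "(\<Sum>i<length A. c i *s A ! i) = (\<Sum>v\<in>set A. c (inv_into {..<length A} ((!) A) v) *s v)" for c
  unfolding sum by (intro sum.cong refl) (simp add: inv_into_f_f[OF bij_betw_imp_inj_on[OF bij]])
 show "row_span A = range (\<lambda>c. \<Sum>i<length A. c i *s A ! i)"
  unfolding row_span_def vec.span_finite[OF finite_set]
 proof (intro antisym image_subsetI)
  fix u show "(\<Sum>v\<in>set A. u v *s v) \<in> range (\<lambda>c. \<Sum>i<length A. c i *s A ! i)"
   unfolding sum by (rule range_eqI[of _ _ "\<lambda>i. u (A ! i)"]) simp
 next
  fix c show "(\<Sum>i<length A. c i *s A ! i) \<in> range (\<lambda>u. \<Sum>v\<in>set A. u v *s v)"
   unfolding sum' by (rule range_eqI[of _ _ "\<lambda>v. c (inv_into {..<length A} ((!) A) v)"]) simp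
 qed
 fix c i assume c: "(\<Sum>i<length A. c i *s A ! i) = 0" and i: "i < length A"
 have "c (inv_into {..<length A} ((!) A) (A ! i)) = 0"
  by (rule vec.independentD[OF ind finite_set subset_refl]) (use c i sum' in auto)
 then show "c i = 0" using i by (simp add: inv_into_f_f[OF bij_betw_imp_inj_on[OF bij]])
qed

text \<open>A vector in the kernel of the transposed minor consists of the coefficients of a
  combination of the rows that vanishes on \<open>J\<close>; full rank makes nonzero coefficients
  correspond to nonzero combinations.\<close>

lemma pluecker_eq_0_iff:
 fixes A :: "('k::field ^ 'n::{finite,linorder}) list"
 assumes d: "vec.dim (row_span A) = length A" and J: "card J = length A"
 shows "pluecker A J = 0 \<longleftrightarrow> (\<exists>v\<in>row_span A. v ~= 0 \<and> (\<forall>j\<in>J. v $ j = 0))"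
proof -
 define r where "r = length A"
 define e where "e = sorted_list_of_set J"
 have e: "set e = J" "length e = r" unfolding e_def r_def using J by simp_all
 define M where "M = Matrix.mat r r (\<lambda>(i, j). (A ! i) $ (e ! j))"
 have M: "M \<in> carrier_mat r r" unfolding M_def by simp
 note rs = row_span_combinations[OF d, folded r_def]
 have "pluecker A J = Determinant.det M" using J unfolding pluecker_def M_def e_def r_def by simp
 also have "\<dots> = Determinant.det (Matrix.transpose_mat M)" by (rule Determinant.det_transpose[OF M, symmetric])
 finally have "pluecker A J = 0 \<longleftrightarrow> (\<exists>v\<in>carrier_vec r. v ~= 0\<^sub>v r \<and> Matrix.transpose_mat M *\<^sub>v v = 0\<^sub>v r)"
  using det_0_iff_vec_prod_zero_field[of "Matrix.transpose_mat M" r] M by auto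
 also have "\<dots> \<longleftrightarrow> (\<exists>v\<in>row_span A. v ~= 0 \<and> (\<forall>j\<in>J. v $ j = 0))"
 proof -
  have entry: "Matrix.vec_index (Matrix.transpose_mat M *\<^sub>v v) j = (\<Sum>i<r. Matrix.vec_index v i *s A ! i) $ (e ! j)"
   if "v \<in> carrier_vec r" "j < r" for v j
   using that M unfolding M_def
   by (auto simp: scalar_prod_def sum_component lessThan_atLeast0 mult.commute intro!: sum.cong)
  have key: "Matrix.transpose_mat M *\<^sub>v v = 0\<^sub>v r \<longleftrightarrow> (\<forall>j\<in>J. (\<Sum>i<r. Matrix.vec_index v i *s A ! i) $ j = 0)"
   if v: "v \<in> carrier_vec r" for v
  proof -
   have "Matrix.transpose_mat M *\<^sub>v v = 0\<^sub>v r \<longleftrightarrow> (\<forall>j<r. Matrix.vec_index (Matrix.transpose_mat M *\<^sub>v v) j = 0)"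
    using M v by (auto simp: Matrix.vec_eq_iff)
   also have "\<dots> \<longleftrightarrow> (\<forall>j<r. (\<Sum>i<r. Matrix.vec_index v i *s A ! i) $ (e ! j) = 0)" using entry[OF v] by simp
   also have "\<dots> \<longleftrightarrow> (\<forall>j\<in>J. (\<Sum>i<r. Matrix.vec_index v i *s A ! i) $ j = 0)"
    unfolding e(1)[symmetric] all_set_conv_all_nth e(2) ..
   finally show ?thesis .
  qed
  have nz: "(\<Sum>i<r. Matrix.vec_index v i *s A ! i) ~= 0" if v: "v \<in> carrier_vec r" "v ~= 0\<^sub>v r" for v
  proof
   assume "(\<Sum>i<r. Matrix.vec_index v i *s A ! i) = 0"
   then have "Matrix.vec_index v i = 0" if "i < r" for i using rs(3)[of "Matrix.vec_index v" i] that by simp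
   then have "v = 0\<^sub>v r" using v(1) by (auto simp: Matrix.vec_eq_iff)
   then show False using v(2) by simp
  qed
  show ?thesis
  proof
   assume "\<exists>v\<in>carrier_vec r. v ~= 0\<^sub>v r \<and> Matrix.transpose_mat M *\<^sub>v v = 0\<^sub>v r"
   then obtain v where v: "v \<in> carrier_vec r" "v ~= 0\<^sub>v r" "Matrix.transpose_mat M *\<^sub>v v = 0\<^sub>v r" by blast
   show "\<exists>v\<in>row_span A. v ~= 0 \<and> (\<forall>j\<in>J. v $ j = 0)"
    using key[OF v(1)] v(3) nz[OF v(1,2)] rs(2) by blast
  next
   assume "\<exists>v\<in>row_span A. v ~= 0 \<and> (\<forall>j\<in>J. v $ j = 0)"
   then obtain c where c: "(\<Sum>i<r. c i *s A ! i) ~= 0" "\<forall>j\<in>J. (\<Sum>i<r. c i *s A ! i) $ j = 0"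
    unfolding rs(2) by blast
   define v where "v = Matrix.vec r c"
   have eq: "(\<Sum>i<r. Matrix.vec_index v i *s A ! i) = (\<Sum>i<r. c i *s A ! i)"
    unfolding v_def by (intro sum.cong) simp_all
   have v: "v \<in> carrier_vec r" unfolding v_def by simp
   have "v ~= 0\<^sub>v r" using c(1) unfolding eq[symmetric] by auto
   then show "\<exists>v\<in>carrier_vec r. v ~= 0\<^sub>v r \<and> Matrix.transpose_mat M *\<^sub>v v = 0\<^sub>v r"
    using v key[OF v] c(2) unfolding eq by blast
  qed
 qed
 finally show ?thesis .
qed

lemma ex_row_list:
 fixes W :: "('k::field ^ 'v::finite) set"
 assumes W: "W \<in> grassmannian r"
 obtains A where "length A = r" "row_span A = W"
proof -
 have W: "vec.subspace W" "vec.dim W = r" using W unfolding grassmannian_def by auto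
 obtain B where B: "B \<subseteq> W" "vec.independent B" "W \<subseteq> vec.span B" "card B = vec.dim W"
  using vec.basis_exists by blast
 have "finite B" by (rule vec.finiteI_independent[OF B(2)])
 from finite_distinct_list[OF this] obtain A where A: "set A = B" "distinct A" by blast
 have "vec.span B = W" using B(1,3) W(1) by (intro antisym vec.span_minimal)
 then have "row_span A = W" unfolding row_span_def A(1) .
 moreover have "length A = r" using distinct_card[OF A(2)] A(1) B(4) W(2) by simp
 ultimately show ?thesis using that by blast
qed

text \<open>The rows of \<open>A'\<close> are combinations of the rows of \<open>A\<close>, so all
  minors are multiplied by the determinant of the coefficient matrix.\<close>

lemma pluecker_proportional:
 fixes A A' :: "('k::field ^ 'n::{finite,linorder}) list"
 assumes d: "vec.dim (row_span A) = length A" and eq: "row_span A' = row_span A" "length A' = length A"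
 shows "\<exists>c. \<forall>J. pluecker A' J = c * pluecker A J"
proof -
 define r where "r = length A"
 note rs = row_span_combinations(2)[OF d, folded r_def]
 have "\<exists>c. A' ! i = (\<Sum>k<r. c k *s A ! k)" if "i < r" for i
 proof -
  have "A' ! i \<in> row_span A'" unfolding row_span_def using that eq(2) r_def by (intro vec.span_base) simp
  then show ?thesis unfolding eq(1) rs by blast
 qed
 then obtain c where c: "!!i. i < r ==> A' ! i = (\<Sum>k<r. c i k *s A ! k)" by metis
 define C where "C = Matrix.mat r r (\<lambda>(i, k). c i k)"
 have "pluecker A' J = Determinant.det C * pluecker A J" for J
 proof (cases "card J = r")
  case True
  define e where "e = sorted_list_of_set J"
  define M where "M = Matrix.mat r r (\<lambda>(i, j). (A ! i) $ (e ! j))"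
  define M' where "M' = Matrix.mat r r (\<lambda>(i, j). (A' ! i) $ (e ! j))"
  have "M' = C * M"
   unfolding M'_def C_def M_def
   by (rule eq_matI) (auto simp: c scalar_prod_def sum_component lessThan_atLeast0 intro!: sum.cong)
  then have "Determinant.det M' = Determinant.det C * Determinant.det M"
   using det_mult[of C r M] unfolding C_def M_def by simp
  then show ?thesis using True eq(2) unfolding pluecker_def M'_def M_def e_def r_def by simp
 next
  case False
  then show ?thesis using eq(2) unfolding pluecker_def r_def by simp
 qed
 then show ?thesis by blast
qed

lemma pluecker_point_line:
 fixes W :: "('k::field ^ 'n::{finite,linorder}) set"
 assumes W: "W \<in> grassmannian r"
 shows "pluecker_point r W \<in> proj_space"
proof -
 obtain A where A: "length A = r" "row_span A = W" by (rule ex_row_list[OF W])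
 have W': "vec.subspace W" "vec.dim W = r" using W unfolding grassmannian_def by auto
 have d: "vec.dim (row_span A) = length A" using A W'(2) by simp
 define x where "x = (\<chi> J. pluecker A J)"
 obtain J where J: "card J = vec.dim W" "!!v. v \<in> W ==> \<forall>j\<in>J. v $ j = 0 ==> v = 0"
  by (rule ex_coords[OF W'(1)]) blast
 have "pluecker A J ~= 0" using pluecker_eq_0_iff[OF d, of J] J A W'(2) by auto
 then have "x $ J ~= 0" unfolding x_def by simp
 then have x0: "x ~= 0" by auto
 have "pluecker_point r W = vec.span {x}"
  unfolding pluecker_point_def
 proof (intro antisym vec.span_minimal vec.subspace_span)
  show "{\<chi> J. pluecker A J | A. length A = r \<and> row_span A = W} \<subseteq> vec.span {x}"
  proof clarify
   fix A' assume A': "r = length A'" "W = row_span A'"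
   obtain c where "!!J. pluecker A' J = c * pluecker A J"
    using pluecker_proportional[OF d, of A'] A A' by auto
   then have "(\<chi> J. pluecker A' J) = c *s x" unfolding x_def by (simp add: cart_eq_iff)
   then show "(\<chi> J. pluecker A' J) \<in> vec.span {x}" using span_single by blast
  qed
  show "{x} \<subseteq> vec.span {\<chi> J. pluecker A J | A. length A = r \<and> row_span A = W}"
   unfolding x_def using A by (auto intro!: vec.span_base)
 qed
 then show ?thesis unfolding proj_space_iff using x0 by blast
qed

text \<open>In the Pluecker embedding the condition is a single linear form, the coordinate
  \<open>J\<close>. It is therefore closed, and taking the closure of \<open>S\<close> adds no new
  condition.\<close>

lemma pluecker_vanishes_on_hull:
 fixes S :: "('k::field ^ 'n::{finite,linorder}) set set"
 assumes S: "S \<subseteq> grassmannian r" and J: "card J = r"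
 shows "pluecker_vanishes_on r J (grass_closed r hull S) \<longleftrightarrow> (\<forall>W\<in>S. \<exists>v\<in>W. v ~= 0 \<and> (\<forall>j\<in>J. v $ j = 0))"
proof
 assume van: "pluecker_vanishes_on r J (grass_closed r hull S)"
 show "\<forall>W\<in>S. \<exists>v\<in>W. v ~= 0 \<and> (\<forall>j\<in>J. v $ j = 0)"
 proof
  fix W assume W: "W \<in> S"
  then have WG: "W \<in> grassmannian r" using S by blast
  obtain A where A: "length A = r" "row_span A = W" by (rule ex_row_list[OF WG])
  have "W \<in> grass_closed r hull S" by (rule subsetD[OF hull_subset W])
  then have "pluecker A J = 0" using van A unfolding pluecker_vanishes_on_def by simp
  moreover have d: "vec.dim (row_span A) = length A" using WG A unfolding grassmannian_def by simp
  ultimately show "\<exists>v\<in>W. v ~= 0 \<and> (\<forall>j\<in>J. v $ j = 0)"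
   using pluecker_eq_0_iff[OF d, of J] A J by simp
 qed
next
 assume ex: "\<forall>W\<in>S. \<exists>v\<in>W. v ~= 0 \<and> (\<forall>j\<in>J. v $ j = 0)"
 define f where "f = (Poly_Mapping.single (Poly_Mapping.single J 1) 1 :: ('n set, 'k) mvpoly)"
 have f: "mv_eval f x = x $ J" for x unfolding f_def by (simp add: mv_eval_single mon_single)
 have "homogeneous 1 f" unfolding f_def homogeneous_def by (simp add: lookup_single when_def)
 define Y where "Y = {P \<in> proj_space. \<forall>g\<in>{f}. \<forall>x\<in>P. mv_eval g x = 0}"
 have "proj_closed Y" unfolding proj_closed_def Y_def using \<open>homogeneous 1 f\<close> by (intro exI[of _ "{f}"]) auto
 define Z where "Z = {W \<in> grassmannian r. pluecker_point r W \<in> Y}"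
 have Z: "grass_closed r Z" unfolding grass_closed_def Z_def using \<open>proj_closed Y\<close> by (intro exI[of _ Y]) simp
 have "S \<subseteq> Z"
 proof
  fix W assume W: "W \<in> S"
  then have WG: "W \<in> grassmannian r" using S by blast
  have "pluecker A J = 0" if A: "length A = r" "row_span A = W" for A
  proof -
   have d: "vec.dim (row_span A) = length A" using WG A unfolding grassmannian_def by simp
   then show ?thesis using pluecker_eq_0_iff[OF d, of J] A J bspec[OF ex W] by simp
  qed
  then have "{\<chi> J. pluecker A J | A. length A = r \<and> row_span A = W} \<subseteq> {x. x $ J = 0}" by auto
  moreover have "vec.subspace {x :: 'k ^ 'n set. x $ J = 0}" by (auto simp: vec.subspace_def)
  ultimately have "pluecker_point r W \<subseteq> {x. x $ J = 0}" unfolding pluecker_point_def by (rule vec.span_minimal)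
  then have "pluecker_point r W \<in> Y" unfolding Y_def using pluecker_point_line[OF WG] f by auto
  then show "W \<in> Z" unfolding Z_def using WG by blast
 qed
 then have sub: "grass_closed r hull S \<subseteq> Z" using Z by (rule hull_minimal)
 show "pluecker_vanishes_on r J (grass_closed r hull S)"
  unfolding pluecker_vanishes_on_def
 proof (intro ballI allI impI)
  fix W A assume W: "W \<in> grass_closed r hull S" and A: "length A = r \<and> row_span A = W"
  have "(\<chi> J. pluecker A J) \<in> pluecker_point r W" unfolding pluecker_point_def using A by (intro vec.span_base) blast
  moreover have "pluecker_point r W \<in> Y" using W sub unfolding Z_def by blast
  ultimately have "mv_eval f (\<chi> J. pluecker A J) = 0" unfolding Y_def by blast
  then show "pluecker A J = 0" unfolding f by simp
 qed
qed

section \<open>The Gauss map\<close>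

context na_abs
begin

lemma has_grad_linear:
 fixes f :: "'k ^ 'v::finite => 'k" and L :: "'k ^ 'w::finite => 'k ^ 'v"
 assumes f: "has_grad f g" and add: "!!x y. L (x + y) = L x + L y"
  and bd: "!!h. vn (L h) <= K * vn h" and K: "K >= 0"
  and eq: "!!y h. (\<Sum>i\<in>UNIV. g' i y * h $ i) = (\<Sum>i\<in>UNIV. g i (L y) * L h $ i)"
 shows "has_grad (\<lambda>x. f (L x)) g'"
 unfolding has_grad_def
proof
 fix r
 obtain C where C: "C >= 0" "!!y h. vn y <= K * r ==> vn h <= K * r ==>
  nrm (f (y + h) - f y - (\<Sum>i\<in>UNIV. g i y * h $ i)) <= C * (vn h)\<^sup>2"
  using has_gradE[OF f] by blast
 show "\<exists>C\<ge>0. \<forall>y h. vn y <= r --> vn h <= r -->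
  nrm (f (L (y + h)) - f (L y) - (\<Sum>i\<in>UNIV. g' i y * h $ i)) <= C * (vn h)\<^sup>2"
 proof (intro exI[of _ "C * K\<^sup>2"] conjI allI impI)
  show "C * K\<^sup>2 >= 0" using C(1) by simp
  fix y h :: "'k ^ 'w" assume y: "vn y <= r" and h: "vn h <= r"
  have "vn (L y) <= K * r" "vn (L h) <= K * r"
   using bd[of y] bd[of h] mult_left_mono[OF y K] mult_left_mono[OF h K] by linarith+
  then have "nrm (f (L (y + h)) - f (L y) - (\<Sum>i\<in>UNIV. g' i y * h $ i)) <= C * (vn (L h))\<^sup>2"
   unfolding eq add by (rule C(2))
  also have "\<dots> <= C * (K * vn h)\<^sup>2"
   by (intro mult_left_mono power_mono bd C(1)) simp
  finally show "nrm (f (L (y + h)) - f (L y) - (\<Sum>i\<in>UNIV. g' i y * h $ i)) <= C * K\<^sup>2 * (vn h)\<^sup>2"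
   by (simp add: power_mult_distrib mult_ac)
 qed
qed

lemma mon_pf: "mon a \<in> pf UNIV"
 unfolding mon_def[abs_def] by (intro pf_lambda_sum pf_lambda pf_coord) simp

text \<open>The product rule for a monomial times \<open>x $ i\<close>. The truncated subtraction of
  exponents goes wrong only where the factor in front is 0.\<close>

lemma mon_succ:
 "of_nat (Poly_Mapping.lookup (b + Poly_Mapping.single i 1) j) * mon (b + Poly_Mapping.single i 1 - Poly_Mapping.single j 1) x
  = mon b x * (if j = i then 1 else 0) + of_nat (Poly_Mapping.lookup b j) * mon (b - Poly_Mapping.single j 1) x * x $ i"
proof (cases "Poly_Mapping.lookup b j = 0")
 case True
 then show ?thesis by (auto simp: lookup_add lookup_single when_def)
next
 case False
 have "b + Poly_Mapping.single i 1 - Poly_Mapping.single j 1 = b - Poly_Mapping.single j 1 + Poly_Mapping.single i 1"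
  by (rule poly_mapping_eqI) (use False in \<open>auto simp: lookup_add lookup_minus lookup_single when_def\<close>)
 then have m: "mon (b + Poly_Mapping.single i 1 - Poly_Mapping.single j 1) x = mon (b - Poly_Mapping.single j 1) x * x $ i"
  by (simp add: mon_add mon_single)
 show ?thesis
 proof (cases "j = i")
  case True
  have "b + Poly_Mapping.single i 1 - Poly_Mapping.single j 1 = b" using True by simp
  then show ?thesis using m True by (simp add: lookup_add algebra_simps)
 next
  case False
  then show ?thesis unfolding m by (simp add: lookup_add lookup_single when_def)
 qed
qed

lemma has_grad_mon:
 fixes a :: "'v::finite \<Rightarrow>\<^sub>0 nat"
 shows "has_grad (mon a) (\<lambda>j x. of_nat (Poly_Mapping.lookup a j) * mon (a - Poly_Mapping.single j 1) x)"
proof (induction "mdeg a" arbitrary: a)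
 case 0
 then have "a = 0" unfolding mdeg_def by (intro poly_mapping_eqI) simp
 moreover have "(mon (0 :: 'v \<Rightarrow>\<^sub>0 nat) :: 'k ^ 'v => 'k) = (\<lambda>_. 1)" by (rule ext) (rule mon_0)
 moreover have "(\<lambda>j (x :: 'k ^ 'v). of_nat (Poly_Mapping.lookup 0 j) * mon (0 - Poly_Mapping.single (j :: 'v) 1) x) = (\<lambda>_. (\<lambda>_. 0 :: 'k))"
  by (intro ext) simp
 ultimately show ?case using has_grad_const[of 1] by (simp only: zero_fun_def)
next
 case (Suc d)
 then obtain i where i: "Poly_Mapping.lookup a i > 0" unfolding mdeg_def by (metis gr0I sum.neutral nat.distinct(1))
 define b where "b = a - Poly_Mapping.single i 1"
 have a: "a = b + Poly_Mapping.single i 1"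
  unfolding b_def by (rule poly_mapping_eqI) (use i in \<open>auto simp: lookup_add lookup_minus lookup_single when_def\<close>)
 have "mdeg a = mdeg b + 1" unfolding a mdeg_def
  by (simp add: lookup_add sum.distrib lookup_single when_def)
 then have "mdeg b = d" using Suc.hyps(2) by simp
 then have IH: "has_grad (mon b) (\<lambda>j x. of_nat (Poly_Mapping.lookup b j) * mon (b - Poly_Mapping.single j 1) x)"
  using Suc.hyps(1) by blast
 have h: "has_grad (mon b * (\<lambda>x. x $ i)) (\<lambda>j. mon b * (if j = i then 1 else 0) +
   (\<lambda>x. of_nat (Poly_Mapping.lookup b j) * mon (b - Poly_Mapping.single j 1) x) * (\<lambda>x. x $ i))"
  by (rule has_grad_mult[OF IH has_grad_coord mon_pf pf_coord]) simp_all
 have e1: "mon a = mon b * (\<lambda>x. x $ i)" unfolding a by (rule ext) (simp add: mon_add mon_single)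
 have e2: "(\<lambda>j x. of_nat (Poly_Mapping.lookup a j) * mon (a - Poly_Mapping.single j 1) x) =
  (\<lambda>j. mon b * (if j = i then 1 else 0) +
   (\<lambda>x. of_nat (Poly_Mapping.lookup b j) * mon (b - Poly_Mapping.single j 1) x) * (\<lambda>x. x $ i))"
  unfolding a by (intro ext) (simp only: mon_succ plus_fun_apply times_fun_apply if_distrib[of "\<lambda>f. f _"] one_fun_apply zero_fun_apply)
 show ?case unfolding e2 unfolding e1 by (rule h)
qed

lemma has_grad_sum:
 assumes "!!a. a \<in> A ==> has_grad (f a) (g a)"
 shows "has_grad (\<Sum>a\<in>A. f a) (\<lambda>i. \<Sum>a\<in>A. g a i)"
 using assms
proof (induction A rule: infinite_finite_induct)
 case (insert a A)
 have "has_grad (f a + (\<Sum>a\<in>A. f a)) (\<lambda>i. g a i + (\<Sum>a\<in>A. g a i))"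
  by (intro has_grad_add insert) simp_all
 then show ?case using insert.hyps by (simp only: sum.insert not_False_eq_True)
qed (use has_grad_const[of 0] in \<open>simp_all add: zero_fun_def\<close>)

lemma has_grad_mv_eval: "has_grad (mv_eval p) (\<lambda>i. mv_eval (mv_deriv i p))"
proof -
 let ?g = "\<lambda>a i x. of_nat (Poly_Mapping.lookup a i) * mon (a - Poly_Mapping.single i 1) x"
 have "has_grad ((\<lambda>_. Poly_Mapping.lookup p a) * mon a) (\<lambda>i. (\<lambda>_. Poly_Mapping.lookup p a) * ?g a i + 0 * mon a)" for a
 proof (rule has_grad_mult[OF has_grad_const has_grad_mon pf_const mon_pf])
  fix i show "?g a i \<in> pf UNIV" by (intro pf_lambda pf_const) (rule mon_pf)
 qed
 then have "has_grad (\<Sum>a\<in>Poly_Mapping.keys p. (\<lambda>_. Poly_Mapping.lookup p a) * mon a)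
  (\<lambda>i. \<Sum>a\<in>Poly_Mapping.keys p. (\<lambda>_. Poly_Mapping.lookup p a) * ?g a i + 0 * mon a)"
  by (rule has_grad_sum)
 moreover have "(\<Sum>a\<in>Poly_Mapping.keys p. (\<lambda>_. Poly_Mapping.lookup p a) * mon a) = mv_eval p"
  by (rule ext) (simp add: mv_eval_mon)
 moreover have "(\<lambda>i. \<Sum>a\<in>Poly_Mapping.keys p. (\<lambda>_. Poly_Mapping.lookup p a) * ?g a i + 0 * mon a) =
  (\<lambda>i. mv_eval (mv_deriv i p))"
  by (intro ext) (simp add: mv_deriv_def mv_eval_sum mv_eval_single mult_ac)
 ultimately show ?thesis by simp
qed

end

context pf_prime
begin

lemma indep_coord_notin: "alg_indep I J ==> j \<in> J ==> (\<lambda>x. x $ j) ~: I"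
proof
 assume "alg_indep I J" "j \<in> J" "(\<lambda>x. x $ j) \<in> I"
 then have "(\<lambda>x::'k^'v. x $ j) = 0" using alg_indepD pf_coord by blast
 from fun_cong[OF this, of 1] show False by simp
qed

end

context na_prime
begin

lemma tangD: "v \<in> tang x ==> f \<in> I ==> has_grad f g ==> (\<Sum>i\<in>UNIV. g i x * v $ i) = 0"
 by (simp add: tang_def)

text \<open>Injectivity at \<open>x\<close> means that the gradients at \<open>x\<close> together
  with the coordinate forms of \<open>J\<close> span the dual space; finitely many of them suffice.
  At a nearby \<open>y\<close>, a tangent vector vanishing on \<open>J\<close> pairs with each of
  these only to a small fraction of its norm, so recovering its coordinates from the pairings shows
  that it is zero.\<close>

lemma tang_generic_injective:
 assumes inj: "!!v. v \<in> tang x ==> \<forall>j\<in>J. v $ j = 0 ==> v = 0"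
 shows "\<exists>d>0. \<forall>y. vn (y - x) < d --> (\<forall>v\<in>tang y. (\<forall>j\<in>J. v $ j = 0) --> v = 0)"
proof -
 define G0 where "G0 = {(\<chi> i. g i x) | f g. f \<in> I \<and> has_grad f g \<and> (\<forall>i. g i \<in> pf UNIV)}"
 define G where "G = G0 \<union> (\<lambda>j. axis j 1) ` J"
 have ax: "(\<Sum>i\<in>UNIV. axis j 1 $ i * v $ i) = v $ j" for j and v :: "'k ^ 'v"
  by (simp add: axis_def if_distrib[of "\<lambda>c. c * _"] cong: if_cong)
 have full: "vec.span G = UNIV"
 proof (rule ccontr)
  assume "vec.span G ~= UNIV"
  from annihilator_nonzero[OF vec.subspace_span this]
  obtain v where v: "v ~= 0" "\<forall>w\<in>vec.span G. (\<Sum>i\<in>UNIV. w $ i * v $ i) = 0" by (elim exE conjE) (rule that)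
  have vG: "(\<Sum>i\<in>UNIV. w $ i * v $ i) = 0" if "w \<in> G" for w using v(2) vec.span_base[OF that] by simp
  have "v \<in> tang x" unfolding tang_def
  proof (intro CollectI ballI allI impI)
   fix f g assume f: "f \<in> I" and g: "has_grad f g"
   obtain g' where g': "has_grad f g'" "\<forall>i. g' i \<in> pf UNIV" using pf_has_grad[OF ideal_pf[OF f]] by (elim exE conjE) (rule that)
   have "(\<chi> i. g' i x) \<in> G" unfolding G_def G0_def by (rule UnI1, rule CollectI, rule exI[of _ f], rule exI[of _ g']) (simp add: f g')
   then have "(\<Sum>i\<in>UNIV. (\<chi> i. g' i x) $ i * v $ i) = 0" by (rule vG)
   then show "(\<Sum>i\<in>UNIV. g i x * v $ i) = 0" using has_grad_unique[OF g g'(1)] by simp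
  qed
  moreover have "v $ j = 0" if "j \<in> J" for j
  proof -
   have "axis j 1 \<in> G" unfolding G_def using that by simp
   from vG[OF this] show ?thesis unfolding ax .
  qed
  ultimately have "v = 0" by (intro inj ballI)
  then show False using v(1) by simp
 qed
 have "\<forall>i. \<exists>T u. axis i 1 = (\<Sum>w\<in>T. u w *s w) \<and> finite T \<and> T \<subseteq> G"
 proof
  fix i
  have "axis i 1 \<in> vec.span G" unfolding full by (rule UNIV_I)
  then show "\<exists>T u. axis i 1 = (\<Sum>w\<in>T. u w *s w) \<and> finite T \<and> T \<subseteq> G"
   unfolding vec.span_explicit mem_Collect_eq by (elim exE conjE) (intro exI conjI)
 qed
 from choice[OF this] obtain T where "\<forall>i. \<exists>u. axis i 1 = (\<Sum>w\<in>T i. u w *s w) \<and> finite (T i) \<and> T i \<subseteq> G" by (elim exE)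
 from choice[OF this] obtain u where Tu: "\<forall>i. axis i 1 = (\<Sum>w\<in>T i. u i w *s w) \<and> finite (T i) \<and> T i \<subseteq> G" by (elim exE)
 then have T: "!!i. finite (T i)" "!!i. T i \<subseteq> G" "!!i. axis i 1 = (\<Sum>w\<in>T i. u i w *s w)" by simp_all
 \<comment> \<open>Strictly larger than the norm of every coefficient, so that the final estimate is
   a strict contraction.\<close>
 define R where "R = 1 + (\<Sum>i\<in>UNIV. \<Sum>w\<in>T i. nrm (u i w))"
 have R: "nrm (u i w) < R" if "w \<in> T i" for i w
 proof -
  have "nrm (u i w) <= (\<Sum>w\<in>T i. nrm (u i w))" by (rule member_le_sum[OF that]) (simp_all add: T)
  also have "\<dots> <= (\<Sum>i\<in>UNIV. \<Sum>w\<in>T i. nrm (u i w))"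
   by (rule member_le_sum[of i UNIV "\<lambda>i. \<Sum>w\<in>T i. nrm (u i w)"]) (simp_all add: sum_nonneg)
  finally show ?thesis unfolding R_def by simp
 qed
 have "R >= 1" unfolding R_def by (simp add: sum_nonneg)
 then have R0: "1 / R > 0" by simp
 have near: "\<exists>d>0. \<forall>y. vn (y - x) < d -->
   (\<forall>v\<in>tang y. (\<forall>j\<in>J. v $ j = 0) --> nrm (\<Sum>k\<in>UNIV. w $ k * v $ k) <= vn v / R)" if w: "w \<in> G" for w
 proof (cases "w \<in> (\<lambda>j. axis j 1) ` J")
  case True
  then obtain j where "j \<in> J" "w = axis j 1" by blast
  then show ?thesis using ax \<open>R >= 1\<close> by (intro exI[of _ 1]) simp
 next
  case False
  then have "w \<in> G0" using w unfolding G_def by simp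
  then obtain f g where g: "w = (\<chi> i. g i x)" "f \<in> I" "has_grad f g" "\<forall>i. g i \<in> pf UNIV"
   unfolding G0_def mem_Collect_eq by (elim exE conjE) (rule that)
  have "\<exists>d>0. \<forall>y. vn (y - x) < d --> nrm (g k y - g k x) < 1 / R" for k by (rule pf_continuous[OF g(4)[THEN spec] R0])
  then have "\<exists>d>0. \<forall>y. vn (y - x) < d --> (\<forall>k\<in>UNIV. nrm (g k y - g k x) < 1 / R)"
   by (intro uniform_neighbourhood) simp_all
  then obtain d where d: "d > 0" "!!y k. vn (y - x) < d ==> nrm (g k y - g k x) < 1 / R" by blast
  show ?thesis
  proof (intro exI[of _ d] conjI allI impI ballI)
   show "d > 0" by (rule d(1))
   fix y v assume y: "vn (y - x) < d" and v: "v \<in> tang y"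
   have "(\<Sum>k\<in>UNIV. g k y * v $ k) = 0" by (rule tangD[OF v g(2,3)])
   then have "(\<Sum>k\<in>UNIV. w $ k * v $ k) = (\<Sum>k\<in>UNIV. - (g k y - g k x) * v $ k)"
    unfolding g(1) by (simp add: algebra_simps sum_subtractf)
   also have "nrm \<dots> <= vn v / R"
   proof (rule nrm_sum_le)
    show "vn v / R >= 0" using \<open>R >= 1\<close> by simp
    fix k
    have "nrm (- (g k y - g k x) * v $ k) = nrm (g k y - g k x) * nrm (v $ k)"
     by (simp only: nrm_mult nrm_minus)
    also have "\<dots> <= 1 / R * vn v"
     by (intro mult_mono nrm_le_vn less_imp_le[OF d(2)[OF y]]) (use R0 in simp_all)
    finally show "nrm (- (g k y - g k x) * v $ k) <= vn v / R" by simp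
   qed
   finally show "nrm (\<Sum>k\<in>UNIV. w $ k * v $ k) <= vn v / R" .
  qed
 qed
 have "finite (\<Union>i. T i)" using T(1) by simp
 then have "\<exists>d>0. \<forall>y. vn (y - x) < d --> (\<forall>w\<in>(\<Union>i. T i). \<forall>v\<in>tang y. (\<forall>j\<in>J. v $ j = 0) --> nrm (\<Sum>k\<in>UNIV. w $ k * v $ k) <= vn v / R)"
 proof (rule uniform_neighbourhood)
  fix w assume "w \<in> (\<Union>i. T i)"
  then have "w \<in> G" using T(2) by blast
  then show "\<exists>d>0. \<forall>y. vn (y - x) < d -->
   (\<forall>v\<in>tang y. (\<forall>j\<in>J. v $ j = 0) --> nrm (\<Sum>k\<in>UNIV. w $ k * v $ k) <= vn v / R)" by (rule near)
 qed
 then obtain d where d: "d > 0" "\<forall>y. vn (y - x) < d --> (\<forall>w\<in>(\<Union>i. T i). \<forall>v\<in>tang y. (\<forall>j\<in>J. v $ j = 0) --> nrm (\<Sum>k\<in>UNIV. w $ k * v $ k) <= vn v / R)"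
  by (elim exE conjE) (rule that)
 show ?thesis
 proof (intro exI[of _ d] conjI allI impI ballI)
  show "d > 0" by (rule d(1))
  fix y v assume y: "vn (y - x) < d" and v: "v \<in> tang y" "\<forall>j\<in>J. v $ j = 0"
  show "v = 0"
  proof (rule ccontr)
   assume "v ~= 0"
   then have pos: "vn v > 0" using vn_nonneg[of v] vn_eq_0[of v] by linarith
   obtain i where i: "vn v = nrm (v $ i)" using vn_attained by blast
   have "v $ i = (\<Sum>k\<in>UNIV. (\<Sum>w\<in>T i. u i w *s w) $ k * v $ k)" unfolding T(3)[symmetric] by (rule ax[symmetric])
   also have "\<dots> = (\<Sum>k\<in>UNIV. \<Sum>w\<in>T i. u i w * (w $ k * v $ k))"
    by (simp add: sum_component sum_distrib_right mult.assoc)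
   also have "\<dots> = (\<Sum>w\<in>T i. u i w * (\<Sum>k\<in>UNIV. w $ k * v $ k))"
    by (subst sum.swap) (simp add: sum_distrib_left)
   finally have eq: "v $ i = (\<Sum>w\<in>T i. u i w * (\<Sum>k\<in>UNIV. w $ k * v $ k))" .
   define M where "M = Max (insert 0 ((\<lambda>w. nrm (u i w)) ` T i))"
   have M: "nrm (u i w) <= M" if "w \<in> T i" for w unfolding M_def using that T(1) by (intro Max_ge) auto
   have "M < R" unfolding M_def using T(1) R \<open>R >= 1\<close> by (subst Max_less_iff) auto
   have "M >= 0" unfolding M_def using T(1) by (intro Max_ge) auto
   have "nrm (v $ i) <= M * (vn v / R)" unfolding eq
   proof (rule nrm_sum_le)
    show "M * (vn v / R) >= 0" using \<open>M >= 0\<close> \<open>R >= 1\<close> by simp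
    fix w assume w: "w \<in> T i"
    then have "w \<in> (\<Union>i. T i)" by blast
    then have "nrm (\<Sum>k\<in>UNIV. w $ k * v $ k) <= vn v / R"
     using d(2)[THEN spec, THEN mp, OF y, THEN bspec, THEN bspec, OF _ v(1)] v(2) by simp
    then show "nrm (u i w * (\<Sum>k\<in>UNIV. w $ k * v $ k)) <= M * (vn v / R)"
     unfolding nrm_mult using M[OF w] \<open>M >= 0\<close> by (intro mult_mono) simp_all
   qed
   also have "\<dots> < vn v" using pos \<open>M < R\<close> \<open>R >= 1\<close> by (simp add: field_simps)
   finally show False using i by simp
  qed
 qed
qed

text \<open>The image of the cone under projection to \<open>J\<close> has a basis \<open>J0\<close>
  properly contained in \<open>J\<close>, and its tangent vectors are determined by their
  coordinates in \<open>J0\<close>. A basis of the cone containing \<open>J0\<close> has a further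
  element \<open>b\<close>; the tangent vector with coordinate 1 at \<open>b\<close> and 0 at the
  rest of that basis projects to a tangent vector of the image with no coordinates in
  \<open>J0\<close>, hence to 0.\<close>

lemma dependent_tang:
 assumes B: "tr_basis I B" and J: "card J = card B" "\<not> alg_indep I J"
 shows "\<exists>a\<in>pf UNIV. a ~: I \<and> (\<forall>x\<in>zeros I. a x ~= 0 --> (\<exists>v\<in>tang x. v ~= 0 \<and> (\<forall>j\<in>J. v $ j = 0)))"
proof -
 define pr where "pr x = (\<chi> i. if i \<in> J then x $ i else 0)" for x :: "'k ^ 'v"
 have prpf: "(\<lambda>x. pr x $ i) \<in> pf UNIV" for i
  by (cases "i \<in> J") (simp_all add: pr_def pf_const pf_coord)
 define Q where "Q = {f \<in> pf UNIV. (\<lambda>x. f (pr x)) \<in> I}"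
 interpret Q: pf_prime Q unfolding Q_def by (rule comp_ideal_prime[OF prpf])
 interpret Q: na_prime Q nrm by unfold_locales
 obtain J0 where J0: "tr_basis Q J0" using Q.ex_tr_basis by blast
 then have J0i: "alg_indep Q J0" by (simp add: tr_basis_def)
 have J0J: "J0 \<subseteq> J"
 proof
  fix i assume i: "i \<in> J0"
  show "i \<in> J"
  proof (rule ccontr)
   assume "i ~: J"
   then have "(\<lambda>x. pr x $ i) = 0" by (simp add: pr_def fun_eq_iff)
   then have "(\<lambda>x. x $ i) \<in> Q" unfolding Q_def using ideal_zero by (simp add: pf_coord)
   then show False using Q.indep_coord_notin[OF J0i i] by blast
  qed
 qed
 have "alg_indep I J0"
  unfolding alg_indep_def
 proof (rule subsetI)
  fix f assume f: "f \<in> pf J0 \<inter> I"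
  have "f (pr x) = f x" for x by (rule pf_cong_coords[of f J0]) (use f J0J in \<open>auto simp: pr_def\<close>)
  then have "f \<in> Q" unfolding Q_def using f pf_UNIV by auto
  then show "f \<in> {0}" using alg_indepD[OF J0i] f by blast
 qed
 then obtain B' where B': "J0 \<subseteq> B'" "tr_basis I B'" using extend_tr_basis by blast
 have "J0 ~= J" using \<open>alg_indep I J0\<close> J(2) by blast
 then have "card J0 < card J" using J0J by (intro psubset_card_mono) auto
 then have "card J0 < card B'" using J(1) tr_basis_card[OF B B'(2)] by simp
 then obtain b where b: "b \<in> B'" "b ~: J0" using B'(1) by (metis less_irrefl subsetI subset_antisym)
 obtain a1 where a1: "a1 \<in> pf UNIV" "a1 ~: Q" "\<forall>x\<in>zeros Q. a1 x ~= 0 -->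
  (\<forall>v\<in>Q.tang x. (\<forall>b\<in>J0. v $ b = 0) --> v = 0) \<and> (\<forall>t. \<exists>v\<in>Q.tang x. \<forall>b\<in>J0. v $ b = t $ b)"
  using Q.tangent_projection[OF J0] by (elim bexE conjE) (rule that)
 obtain a2 where a2: "a2 \<in> pf UNIV" "a2 ~: I" "\<forall>x\<in>zeros I. a2 x ~= 0 -->
  (\<forall>v\<in>tang x. (\<forall>b\<in>B'. v $ b = 0) --> v = 0) \<and> (\<forall>t. \<exists>v\<in>tang x. \<forall>b\<in>B'. v $ b = t $ b)"
  using tangent_projection[OF B'(2)] by (elim bexE conjE) (rule that)
 have a1pr: "(\<lambda>x. a1 (pr x)) \<in> pf UNIV" by (rule pf_compose[OF a1(1) prpf])
 have a1I: "(\<lambda>x. a1 (pr x)) ~: I" using a1(1,2) by (simp add: Q_def)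
 have tangpr: "pr v \<in> Q.tang (pr x)" if v: "v \<in> tang x" for x v
  unfolding Q.tang_def
 proof (intro CollectI ballI allI impI)
  fix f g assume f: "f \<in> Q" and g: "has_grad f g"
  define g' where "g' i y = (if i \<in> J then g i (pr y) else 0)" for i y
  have eq: "(\<Sum>i\<in>UNIV. g' i y * h $ i) = (\<Sum>i\<in>UNIV. g i (pr y) * pr h $ i)" for y h
   unfolding g'_def pr_def by (intro sum.cong) auto
  have "has_grad (\<lambda>x. f (pr x)) g'"
  proof (rule has_grad_linear[OF g _ _ _ eq])
   show "pr (x + y) = pr x + pr y" for x y by (auto simp: pr_def cart_eq_iff)
   show "vn (pr h) <= 1 * vn h" for h unfolding vn_le_iff by (auto simp: pr_def nrm_le_vn)
  qed simp
  moreover have "(\<lambda>x. f (pr x)) \<in> I" using f by (simp add: Q_def)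
  ultimately have "(\<Sum>i\<in>UNIV. g' i x * v $ i) = 0" by (intro tangD[OF v])
  then show "(\<Sum>i\<in>UNIV. g i (pr x) * pr v $ i) = 0" unfolding eq .
 qed
 show ?thesis
 proof (intro bexI[of _ "(\<lambda>x. a1 (pr x)) * a2"] conjI ballI impI)
  show "(\<lambda>x. a1 (pr x)) * a2 \<in> pf UNIV" by (rule pf_mult[OF a1pr a2(1)])
  show "(\<lambda>x. a1 (pr x)) * a2 ~: I"
  proof
   assume "(\<lambda>x. a1 (pr x)) * a2 \<in> I"
   from ideal_prime[OF a1pr a2(1) this] show False using a1I a2(2) by (elim disjE) (rule notE; assumption)+
  qed
  fix x assume x: "x \<in> zeros I" "((\<lambda>x. a1 (pr x)) * a2) x ~= 0"
  have ne: "a1 (pr x) ~= 0" "a2 x ~= 0" using x(2) by auto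
  have "pr x \<in> zeros Q" unfolding zeros_def
  proof (intro CollectI ballI)
   fix f assume "f \<in> Q"
   then have "(\<lambda>x. f (pr x)) \<in> I" by (simp add: Q_def)
   from zerosD[OF x(1) this] show "f (pr x) = 0" .
  qed
  from a1(3)[THEN bspec, OF this, THEN mp, OF ne(1), THEN conjunct1]
  have inj: "\<forall>v\<in>Q.tang (pr x). (\<forall>b\<in>J0. v $ b = 0) --> v = 0" .
  from a2(3)[THEN bspec, OF x(1), THEN mp, OF ne(2), THEN conjunct2, THEN spec, of "axis b 1"]
  obtain v where v: "v \<in> tang x" "\<forall>c\<in>B'. v $ c = axis b 1 $ c" by (elim bexE) (rule that)
  have "v $ b = 1" using v(2) b(1) by (simp add: axis_def)
  then have "v ~= 0" by auto
  have "\<forall>c\<in>J0. pr v $ c = 0" using v(2) B'(1) J0J b(2) by (auto simp: pr_def axis_def)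
  then have "pr v = 0" using inj[THEN bspec, OF tangpr[OF v(1)]] by simp
  have "v $ j = 0" if "j \<in> J" for j
  proof -
   have "pr v $ j = 0" unfolding \<open>pr v = 0\<close> by simp
   then show ?thesis using that by (simp add: pr_def)
  qed
  then show "\<exists>v\<in>tang x. v ~= 0 \<and> (\<forall>j\<in>J. v $ j = 0)" using \<open>v ~= 0\<close> by (intro bexI[OF _ v(1)]) simp
 qed
qed

end

context na_cone
begin

lemma tang_scale:
 assumes v: "v \<in> tang x" and s: "s ~= 0"
 shows "v \<in> tang (s *s x)"
 unfolding tang_def
proof (intro CollectI ballI allI impI)
 fix f g assume f: "f \<in> I" and g: "has_grad f g"
 have "has_grad (\<lambda>x. f (s *s x)) (\<lambda>i y. s * g i (s *s y))"
 proof (rule has_grad_linear[OF g])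
  show "s *s (x + y) = s *s x + s *s y" for x y :: "'k ^ 'v" by (rule vector_add_ldistrib)
  show "vn (s *s h) <= nrm s * vn h" for h :: "'k ^ 'v" by (simp add: vn_smult)
  show "(\<Sum>i\<in>UNIV. s * g i (s *s y) * h $ i) = (\<Sum>i\<in>UNIV. g i (s *s y) * (s *s h) $ i)" for y h
   by (simp add: mult_ac)
 qed simp
 from tangD[OF v homogeneous_ideal[OF f] this] have "(\<Sum>i\<in>UNIV. s * g i (s *s x) * v $ i) = 0" .
 then have "s * (\<Sum>i\<in>UNIV. g i (s *s x) * v $ i) = 0" by (simp add: sum_distrib_left mult_ac)
 then show "(\<Sum>i\<in>UNIV. g i (s *s x) * v $ i) = 0" using s by simp
qed

text \<open>One side uses homogeneous forms and formal derivatives, the other all functions in the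
  ideal and analytic gradients. They agree because homogeneous parts stay in the ideal and gradients
  are unique.\<close>

lemma tangent_space_eq:
 assumes X: "I = cone_ideal X" "X \<subseteq> proj_space" and P: "P \<in> X" "x \<in> P" "x ~= 0"
 shows "tangent_space X P = tang x"
proof (intro antisym subsetI)
 fix v assume v: "v \<in> tangent_space X P"
 show "v \<in> tang x" unfolding tang_def
 proof (intro CollectI ballI allI impI)
  fix f g assume f: "f \<in> I" and g: "has_grad f g"
  obtain p where p: "f = mv_eval p" using pf_mv_eval[OF ideal_pf[OF f]] by (elim exE)
  let ?h = "\<lambda>d. hom_part d p"
  have d0: "(\<Sum>i\<in>UNIV. mv_eval (mv_deriv i (?h d)) x * v $ i) = 0" for d
  proof -
   have "mv_eval (?h d) \<in> cone_ideal X" by (rule cone_ideal_hom_part[OF X(2)]) (use f in \<open>simp add: X(1) p\<close>)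
   then have "?h d \<in> vanishing_forms X" unfolding vanishing_forms_def cone_ideal_def
    using homogeneous_hom_part[of d p] by auto
   then show ?thesis using v P(2,3) unfolding tangent_space_def by simp
  qed
  have "has_grad (\<Sum>d\<le>mtop p. mv_eval (?h d)) (\<lambda>i. \<Sum>d\<le>mtop p. mv_eval (mv_deriv i (?h d)))"
   by (rule has_grad_sum) (rule has_grad_mv_eval)
  then have "has_grad f (\<lambda>i. \<Sum>d\<le>mtop p. mv_eval (mv_deriv i (?h d)))"
   unfolding mv_eval_sum[symmetric] sum_hom_parts p .
  from has_grad_unique[OF g this]
  have "(\<Sum>i\<in>UNIV. g i x * v $ i) = (\<Sum>i\<in>UNIV. \<Sum>d\<le>mtop p. mv_eval (mv_deriv i (?h d)) x * v $ i)"
   by (simp add: sum_distrib_right)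
  also have "\<dots> = (\<Sum>d\<le>mtop p. \<Sum>i\<in>UNIV. mv_eval (mv_deriv i (?h d)) x * v $ i)" by (rule sum.swap)
  finally show "(\<Sum>i\<in>UNIV. g i x * v $ i) = 0" using d0 by simp
 qed
next
 fix v assume v: "v \<in> tang x"
 show "v \<in> tangent_space X P" unfolding tangent_space_def
 proof (intro CollectI ballI)
  fix f y assume f: "f \<in> vanishing_forms X" and y: "y \<in> P - {0}"
  have "y \<in> vec.span {x}" using proj_space_eq_span[OF subsetD[OF X(2) P(1)] P(2,3)] y by simp
  then obtain s where s: "y = s *s x" using span_single by blast
  then have "s ~= 0" using y by auto
  then have "v \<in> tang y" unfolding s by (rule tang_scale[OF v])
  moreover have "mv_eval f \<in> I" using f unfolding X(1) cone_ideal_def vanishing_forms_def by (simp add: mv_eval_pf)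
  ultimately show "(\<Sum>i\<in>UNIV. mv_eval (mv_deriv i f) y * v $ i) = 0"
   by (rule tangD[OF _ _ has_grad_mv_eval])
 qed
qed

end

context na_abs
begin

theorem gauss_vanishing:
 fixes X :: "('k ^ 'n::{finite,linorder}) set set"
 assumes X: "proj_variety X" and m: "proj_dim X = enat m" and J: "card J = m + 1"
 shows "pluecker_vanishes_on (m + 1) J (gauss_image m X) \<longleftrightarrow> \<not> alg_indep (cone_ideal X) J"
proof -
 interpret X: na_cone "cone_ideal X" nrm by (rule na_cone_variety[OF X])
 obtain B where B: "tr_basis (cone_ideal X) B" using X.ex_tr_basis by blast
 have cB: "card B = m + 1" using proj_dim_eq[OF X B] m by (simp add: one_enat_def)
 have sub: "X \<subseteq> proj_space" using X proj_closed_subset unfolding proj_variety_def by blast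
 have zer: "zeros (cone_ideal X) = \<Union>X" by (rule zeros_variety[OF X])
 have T: "tangent_space X P = X.tang x" if "P \<in> X" "x \<in> P" "x ~= 0" for P x
  by (rule X.tangent_space_eq[OF refl sub that])
 have pt: "\<exists>x. x \<in> P \<and> x ~= 0" if P: "P \<in> X" for P
 proof -
  obtain x where "x ~= 0" "P = vec.span {x}" using subsetD[OF sub P] proj_space_iff by blast
  then show ?thesis by (auto intro: vec.span_base)
 qed
 have smooth: "P \<in> smooth_points X \<longleftrightarrow> P \<in> X \<and> vec.dim (tangent_space X P) = m + 1" for P
  unfolding smooth_points_def m by (simp add: one_enat_def)
 have sg: "tangent_space X ` smooth_points X \<subseteq> grassmannian (m + 1)"
 proof
  fix W assume "W \<in> tangent_space X ` smooth_points X"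
  then obtain P where P: "P \<in> X" "vec.dim W = m + 1" "W = tangent_space X P" using smooth by blast
  obtain x where x: "x \<in> P" "x ~= 0" using pt[OF P(1)] by blast
  then show "W \<in> grassmannian (m + 1)" unfolding grassmannian_def using P T[OF P(1) x] X.subspace_tang[of x] by simp
 qed
 have "pluecker_vanishes_on (m + 1) J (gauss_image m X) \<longleftrightarrow>
  (\<forall>P\<in>smooth_points X. \<exists>v\<in>tangent_space X P. v ~= 0 \<and> (\<forall>j\<in>J. v $ j = 0))"
  unfolding gauss_image_def pluecker_vanishes_on_hull[OF sg J] by (simp only: ball_simps)
 also have "\<dots> \<longleftrightarrow> \<not> alg_indep (cone_ideal X) J"
 proof
  assume van: "\<forall>P\<in>smooth_points X. \<exists>v\<in>tangent_space X P. v ~= 0 \<and> (\<forall>j\<in>J. v $ j = 0)"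
  show "\<not> alg_indep (cone_ideal X) J"
  proof
   assume ind: "alg_indep (cone_ideal X) J"
   obtain C where C: "J \<subseteq> C" "tr_basis (cone_ideal X) C" using X.extend_tr_basis[OF ind] by (elim exE conjE) (rule that)
   have "card C = card J" using X.tr_basis_card[OF B C(2)] cB J by simp
   then have "J = C" using C(1) by (intro card_subset_eq) auto
   then have JB: "tr_basis (cone_ideal X) J" using C(2) by simp
   obtain j where j: "j \<in> J" using J by fastforce
   obtain a where a: "a \<in> pf UNIV" "a ~: cone_ideal X" "\<forall>x\<in>zeros (cone_ideal X). a x ~= 0 -->
    (\<forall>v\<in>X.tang x. (\<forall>b\<in>J. v $ b = 0) --> v = 0) \<and> (\<forall>t. \<exists>v\<in>X.tang x. \<forall>b\<in>J. v $ b = t $ b)"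
    using X.tangent_projection[OF JB] by (elim bexE conjE) (rule that)
   have "(\<lambda>x. x $ j) ~: cone_ideal X" by (rule X.indep_coord_notin[OF ind j])
   then have "a * (\<lambda>x. x $ j) ~: cone_ideal X" using X.ideal_prime[OF a(1) pf_coord[OF UNIV_I]] a(2) by blast
   from X.nullstellensatz[OF pf_mult[OF a(1) pf_coord[OF UNIV_I]] this]
   obtain x where x: "x \<in> zeros (cone_ideal X)" "a x ~= 0" "x $ j ~= 0" by auto
   then have x0: "x ~= 0" by auto
   obtain P where P: "P \<in> X" "x \<in> P" using x(1) zer by blast
   have ax: "(\<forall>v\<in>X.tang x. (\<forall>b\<in>J. v $ b = 0) --> v = 0)" "(\<forall>t. \<exists>v\<in>X.tang x. \<forall>b\<in>J. v $ b = t $ b)"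
    using a(3) x(1,2) by simp_all
   have "vec.dim (X.tang x) = card J"
    by (rule dim_eq_card_coords[OF X.subspace_tang]) ((rule ax(1)[THEN bspec, THEN mp] ax(2)[THEN spec]; assumption?)+)
   then have "P \<in> smooth_points X" unfolding smooth T[OF P x0] using P(1) J by simp
   from van[THEN bspec, OF this] obtain v where v: "v \<in> X.tang x" "v ~= 0" "\<forall>j\<in>J. v $ j = 0"
    unfolding T[OF P x0] by (elim bexE conjE) (rule that)
   then show False using ax(1)[THEN bspec, OF v(1)] by simp
  qed
 next
  assume dep: "\<not> alg_indep (cone_ideal X) J"
  obtain a where a: "a \<in> pf UNIV" "a ~: cone_ideal X"
   "\<forall>x\<in>zeros (cone_ideal X). a x ~= 0 --> (\<exists>v\<in>X.tang x. v ~= 0 \<and> (\<forall>j\<in>J. v $ j = 0))"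
   using X.dependent_tang[OF B _ dep] unfolding cB J by (elim meta_impE[OF _ refl] bexE conjE) (rule that)
  show "\<forall>P\<in>smooth_points X. \<exists>v\<in>tangent_space X P. v ~= 0 \<and> (\<forall>j\<in>J. v $ j = 0)"
  proof (rule ballI, rule ccontr)
   fix P assume P: "P \<in> smooth_points X"
   assume neg: "\<not> (\<exists>v\<in>tangent_space X P. v ~= 0 \<and> (\<forall>j\<in>J. v $ j = 0))"
   have PX: "P \<in> X" using P smooth by blast
   obtain x where x: "x \<in> P" "x ~= 0" using pt[OF PX] by blast
   have inj: "v = 0" if "v \<in> X.tang x" "\<forall>j\<in>J. v $ j = 0" for v
   proof (rule ccontr)
    assume "v ~= 0"
    then have "\<exists>v\<in>X.tang x. v ~= 0 \<and> (\<forall>j\<in>J. v $ j = 0)" using that(2) by (intro bexI[OF _ that(1)]) simp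
    then show False using neg unfolding T[OF PX x] by simp
   qed
   have "\<exists>d>0. \<forall>y. vn (y - x) < d --> (\<forall>v\<in>X.tang y. (\<forall>j\<in>J. v $ j = 0) --> v = 0)"
    by (rule X.tang_generic_injective) (rule inj)
   then obtain d where d: "d > 0" "\<forall>y. vn (y - x) < d --> (\<forall>v\<in>X.tang y. (\<forall>j\<in>J. v $ j = 0) --> v = 0)"
    by (elim exE conjE) (rule that)
   have xz: "x \<in> zeros (cone_ideal X)" using zer PX x(1) by blast
   obtain y where y: "y \<in> zeros (cone_ideal X)" "a y ~= 0" "vn (x - y) < d"
    using X.cone_density[OF xz a(1,2) d(1)] by (elim bexE conjE) (rule that)
   have "vn (y - x) < d" using y(3) vn_minus_commute[of x y] by simp
   note inj_y = d(2)[THEN spec, THEN mp, OF this]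
   from a(3)[THEN bspec, OF y(1), THEN mp, OF y(2)]
   obtain v where v: "v \<in> X.tang y" "v ~= 0" "\<forall>j\<in>J. v $ j = 0" by (elim bexE conjE) (rule that)
   then show False using inj_y[THEN bspec, OF v(1)] by simp
  qed
 qed
 finally show ?thesis .
qed

end

section \<open>Tropical points\<close>

text \<open>In a largest set of coordinates containing \<open>J\<close> with surjective projection,
  the projection is also injective: a kernel vector would allow one more coordinate. The dimension
  then forces this set to be \<open>J\<close>.\<close>

lemma coords_surj_inj:
 fixes W :: "('k::field ^ 'v::finite) set"
 assumes W: "vec.subspace W" and surj: "!!t. \<exists>v\<in>W. \<forall>j\<in>J. v $ j = t $ j" and J: "card J = vec.dim W"
  and v: "v \<in> W" "\<forall>j\<in>J. v $ j = 0"
 shows "v = 0"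
proof -
 define P where "P K \<longleftrightarrow> J \<subseteq> K \<and> (\<forall>t. \<exists>v\<in>W. \<forall>j\<in>K. v $ j = t $ j)" for K
 have "P J" unfolding P_def by (intro conjI allI surj subset_refl)
 moreover have "\<forall>K. P K --> card K < Suc (card (UNIV :: 'v set))" by (simp add: card_mono less_Suc_eq_le)
 ultimately obtain K where K: "P K" "!!K'. P K' ==> card K' <= card K"
  using ex_has_greatest_nat[of P J card "Suc (card (UNIV :: 'v set))"] by blast
 have inj: "u = 0" if u: "u \<in> W" "\<forall>j\<in>K. u $ j = 0" for u
 proof (rule ccontr)
  assume "u ~= 0"
  then obtain i where i: "u $ i ~= 0" by (auto simp: cart_eq_iff)
  then have iK: "i ~: K" using u(2) by blast
  have "\<exists>v\<in>W. \<forall>j\<in>insert i K. v $ j = t $ j" for t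
  proof -
   obtain w where w: "w \<in> W" "\<forall>j\<in>K. w $ j = t $ j" using K(1) unfolding P_def by blast
   have "w + ((t $ i - w $ i) / u $ i) *s u \<in> W"
    by (intro vec.subspace_add[OF W] vec.subspace_scale[OF W] w u)
   then show ?thesis using w(2) u(2) i by (intro bexI[of _ "w + ((t $ i - w $ i) / u $ i) *s u"]) auto
  qed
  then have "P (insert i K)" using K(1) unfolding P_def by blast
  then have "card (insert i K) <= card K" by (rule K(2))
  then show False using iK by simp
 qed
 have "vec.dim W = card K"
 proof (rule dim_eq_card_coords[OF W])
  show "\<exists>v\<in>W. \<forall>b\<in>K. v $ b = t $ b" for t using K(1) unfolding P_def by simp
 qed (rule inj)
 then have "J = K" using J K(1) unfolding P_def by (intro card_subset_eq) auto
 then show ?thesis using inj v by simp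
qed

lemma vec_subspace_real: "subspace L ==> vec.subspace L" for L :: "(real ^ 'v::finite) set"
 unfolding vec.subspace_def
 by (intro conjI ballI allI) (simp_all only: scalar_mult_eq_scaleR subspace_0 subspace_add subspace_scale)

text \<open>Vectors with the powers \<open>T ^ e i\<close> as entries avoid finitely many given
  hyperplanes for suitable \<open>T\<close>, as each hyperplane meets this curve in finitely many
  points.\<close>

lemma ex_generic_power:
 fixes A :: "(real ^ 'v::finite) set" and e :: "'v => nat"
 assumes A: "finite A" "0 ~: A" and e: "inj e"
 shows "\<exists>T::nat. \<forall>et\<in>A. (\<Sum>i\<in>UNIV. et $ i * real T ^ e i) ~= 0"
proof -
 define q where "q et = (\<Sum>i\<in>UNIV. monom (et $ i) (e i))" for et :: "real ^ 'v"
 have pq: "poly (q et) t = (\<Sum>i\<in>UNIV. et $ i * t ^ e i)" for et t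
  unfolding q_def by (simp add: poly_sum poly_monom)
 have q0: "q et ~= 0" if et: "et \<in> A" for et
 proof -
  have "et ~= 0" using et A(2) by blast
  then obtain k where k: "et $ k ~= 0" by (auto simp: cart_eq_iff)
  have "coeff (q et) (e k) = (\<Sum>i\<in>UNIV. if i = k then et $ k else 0)"
   unfolding q_def coeff_sum coeff_monom by (intro sum.cong refl) (auto dest: injD[OF e])
  then have "coeff (q et) (e k) ~= 0" using k by simp
  then show ?thesis by auto
 qed
 have "finite (\<Union>et\<in>A. {t. poly (q et) t = 0})" using A(1) poly_roots_finite[OF q0] by blast
 then have "finite (real -` (\<Union>et\<in>A. {t. poly (q et) t = 0}))" by (rule finite_vimageI) (simp add: inj_def)
 then obtain T where "T ~: real -` (\<Union>et\<in>A. {t. poly (q et) t = 0})" using ex_new_if_finite[OF infinite_UNIV_nat] by blast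
 then show ?thesis unfolding pq[symmetric] by (intro exI[of _ T]) auto
qed

lemma ex_inj_nat: "\<exists>e :: 'v::finite => nat. inj e"
 using finite_imp_inj_to_nat_seg[OF finite[of "UNIV :: 'v set"]] by blast

lemma pf_mv_eval_support:
 assumes "f \<in> pf S"
 shows "\<exists>p. f = mv_eval p \<and> (\<forall>a\<in>Poly_Mapping.keys p. \<forall>i. i ~: S --> Poly_Mapping.lookup a i = 0)"
 using assms
proof (induction rule: pf.induct)
 case (pf_const c)
 show ?case by (rule exI[of _ "Poly_Mapping.single 0 c"]) (simp add: fun_eq_iff mv_eval_single mon_0)
next
 case (pf_coord i)
 then show ?case
  by (intro exI[of _ "Poly_Mapping.single (Poly_Mapping.single i 1) 1"])
   (auto simp add: fun_eq_iff mv_eval_single mon_single lookup_single when_def)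
next
 case (pf_add f g)
 from pf_add.IH obtain p q where pq: "f = mv_eval p" "g = mv_eval q"
  and s: "\<forall>a\<in>Poly_Mapping.keys p. \<forall>i. i ~: S --> Poly_Mapping.lookup a i = 0"
   "\<forall>a\<in>Poly_Mapping.keys q. \<forall>i. i ~: S --> Poly_Mapping.lookup a i = 0" by (elim exE conjE) (rule that)
 have "Poly_Mapping.keys (p + q) \<subseteq> Poly_Mapping.keys p \<union> Poly_Mapping.keys q" by (rule keys_add)
 then show ?case using s by (intro exI[of _ "p + q"] conjI) (auto simp only: mv_eval_add pq)
next
 case (pf_mult f g)
 from pf_mult.IH obtain p q where pq: "f = mv_eval p" "g = mv_eval q"
  and s: "\<forall>a\<in>Poly_Mapping.keys p. \<forall>i. i ~: S --> Poly_Mapping.lookup a i = 0"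
   "\<forall>a\<in>Poly_Mapping.keys q. \<forall>i. i ~: S --> Poly_Mapping.lookup a i = 0" by (elim exE conjE) (rule that)
 have "\<forall>a\<in>Poly_Mapping.keys (p * q). \<forall>i. i ~: S --> Poly_Mapping.lookup a i = 0"
 proof (intro ballI allI impI)
  fix a i assume a: "a \<in> Poly_Mapping.keys (p * q)" and i: "i ~: S"
  from subsetD[OF keys_mult a] obtain b c where "a = b + c" "b \<in> Poly_Mapping.keys p" "c \<in> Poly_Mapping.keys q" by blast
  then show "Poly_Mapping.lookup a i = 0" using s i by (simp add: lookup_add)
 qed
 then show ?case by (intro exI[of _ "p * q"]) (simp only: mv_eval_mult pq)
qed

context na_abs
begin

lemma nrm_sum_less: "r > 0 ==> (!!i. i \<in> A ==> nrm (f i) < r) ==> nrm (sum f A) < r"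
 by (induction A rule: infinite_finite_induct) (simp_all add: nrm_add_less)

lemma sum_distinct_nonzero:
 assumes A: "finite A" "A ~= {}" and nz: "!!a. a \<in> A ==> f a ~= 0"
  and d: "!!a b. a \<in> A ==> b \<in> A ==> nrm (f a) = nrm (f b) ==> a = b"
 shows "sum f A ~= 0"
proof -
 have "Max ((\<lambda>a. nrm (f a)) ` A) \<in> (\<lambda>a. nrm (f a)) ` A" using A by (intro Max_in) auto
 then obtain a where a: "a \<in> A" "nrm (f a) = Max ((\<lambda>a. nrm (f a)) ` A)" by auto
 have le: "nrm (f b) <= nrm (f a)" if "b \<in> A" for b unfolding a(2) using A that by (intro Max_ge) auto
 have pos: "nrm (f a) > 0" using nz[OF a(1)] by simp
 have "nrm (sum f (A - {a})) < nrm (f a)"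
 proof (rule nrm_sum_less[OF pos])
  fix b assume "b \<in> A - {a}"
  then show "nrm (f b) < nrm (f a)" using le[of b] d[of b a] a(1) by force
 qed
 then have "nrm (f a + sum f (A - {a})) = nrm (f a)" by (rule nrm_add_eq)
 then have "nrm (sum f A) = nrm (f a)" using sum.remove[OF A(1) a(1), of f] by simp
 then show ?thesis using pos by auto
qed

definition trop :: "'k ^ 'v::finite => real ^ 'v" where
 "trop x = (\<chi> i. - ln (nrm (x $ i)))"

lemma trop_nth [simp]: "trop x $ i = - ln (nrm (x $ i))"
 by (simp add: trop_def)

lemma nrm_mon:
 assumes "!!i. x $ i ~= 0"
 shows "nrm (mon a x) = exp (- (\<Sum>i\<in>UNIV. real (Poly_Mapping.lookup a i) * trop x $ i))"
proof -
 have "nrm (mon a x) = (\<Prod>i\<in>UNIV. exp (real (Poly_Mapping.lookup a i) * ln (nrm (x $ i))))"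
  unfolding mon_def nrm_prod nrm_power by (intro prod.cong refl) (simp add: assms exp_of_nat_mult)
 then show ?thesis by (simp add: exp_sum sum_negf)
qed

end

context na_prime
begin

definition trop_points :: "(real ^ 'v) set" where
 "trop_points = {trop x | x. x \<in> zeros I \<and> (\<forall>i. x $ i ~= 0)}"

text \<open>A small perturbation of \<open>t\<close> keeps its norms on \<open>J\<close> and reaches
  values over which the fibre is nonempty and contained in the torus.\<close>

lemma lift_valuations:
 assumes J: "tr_basis I J" and x0: "x0 \<in> zeros I" "!!i. x0 $ i ~= 0" and t: "!!j. j \<in> J ==> t $ j ~= 0"
 shows "\<exists>p\<in>trop_points. \<forall>j\<in>J. p $ j = - ln (nrm (t $ j))"
proof -
 have ind: "alg_indep I J" using J by (simp add: tr_basis_def)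
 obtain a where a: "a \<in> pf J" "a ~= 0" "\<forall>y. a y ~= 0 --> finite (fiber J y) \<and> fiber J y ~= {}"
  using fiber_near[OF J] by (elim bexE conjE) (rule that)
 obtain b where b: "b \<in> pf J" "b ~= 0" "\<forall>y\<in>zeros I. b y ~= 0 --> (\<Prod>i\<in>UNIV. y $ i) ~= 0"
  using nonvanishing_over_basis[OF J coord_prod_pf coord_prod_notin[OF x0]] by (elim bexE conjE) (rule that)
 have ab: "a * b \<in> pf J" "a * b ~= 0" using pf_mult[OF a(1) b(1)] indep_domain[OF ind a(1) b(1)] a(2) b(2) by blast+
 define r where "r = Min (insert 1 ((\<lambda>j. nrm (t $ j)) ` J))"
 have r: "r > 0" "!!j. j \<in> J ==> r <= nrm (t $ j)" unfolding r_def using t by auto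
 obtain y where y: "vn (y - t) < r" "(a * b) y ~= 0" using pf_nonzero_near[OF ab r(1)] by blast
 have eq: "nrm (y $ j) = nrm (t $ j)" if "j \<in> J" for j
 proof (rule nrm_eqI)
  show "nrm (y $ j - t $ j) < nrm (t $ j)" using y(1) nrm_le_vn[of "y - t" j] r(2)[OF that] by simp
 qed
 have "a y ~= 0" "b y ~= 0" using y(2) by auto
 then obtain z where z: "z \<in> fiber J y" using a(3) by blast
 then have zz: "z \<in> zeros I" "!!j. j \<in> J ==> z $ j = y $ j" unfolding fiber_def by auto
 have "b z = b y" by (rule pf_cong_coords[OF b(1)]) (rule zz(2))
 then have "(\<Prod>i\<in>UNIV. z $ i) ~= 0" using b(3) zz(1) \<open>b y ~= 0\<close> by simp
 then have "\<forall>i. z $ i ~= 0" by simp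
 then have "trop z \<in> trop_points" unfolding trop_points_def using zz(1) by blast
 then show ?thesis using eq zz(2) by (intro bexI[of _ "trop z"]) simp_all
qed

text \<open>If the coordinates in \<open>S\<close> are free on \<open>L\<close>, then along a generic line in \<open>L\<close> the terms of a
 polynomial in these coordinates have distinct valuations.\<close>

lemma trop_free_indep:
 assumes L: "subspace L" and de: "de > 0"
  and dense: "!!l. l \<in> L ==> norm l < de ==> w0 + l \<in> closure trop_points"
  and free: "!!u. \<exists>l\<in>L. \<forall>i\<in>S. l $ i = u $ i"
 shows "alg_indep I S"
 unfolding alg_indep_def
proof (intro subsetI, rule ccontr)
 fix f assume f: "f \<in> pf S \<inter> I" and "f ~: {0}"
 then have f0: "f ~= 0" by simp
 obtain p where p: "f = mv_eval p" "\<forall>a\<in>Poly_Mapping.keys p. \<forall>i. i ~: S --> Poly_Mapping.lookup a i = 0"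
  using pf_mv_eval_support f by blast
 define K where "K = Poly_Mapping.keys p"
 have K: "finite K" "K ~= {}" unfolding K_def using f0 p(1) mv_eval_0 by auto
 \<comment> \<open>The valuation of the term with exponent \<open>a\<close> at a point with
   valuations \<open>w\<close>.\<close>
 define T where "T a w = - ln (nrm (Poly_Mapping.lookup p a)) + (\<Sum>i\<in>UNIV. real (Poly_Mapping.lookup a i) * w $ i)" for a and w :: "real ^ 'v"
 define D where "D a b = (\<chi> i. real (Poly_Mapping.lookup a i) - real (Poly_Mapping.lookup b i))" for a b :: "'v \<Rightarrow>\<^sub>0 nat"
 define A where "A = {D a b | a b. a \<in> K \<and> b \<in> K \<and> a ~= b}"
 have "A \<subseteq> (\<lambda>(a, b). D a b) ` (K \<times> K)" unfolding A_def by auto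
 then have Afin: "finite A" using K(1) finite_subset by blast
 have D0: "D a b ~= 0" if "a ~= b" for a b
 proof
  assume "D a b = 0"
  then have "Poly_Mapping.lookup a i = Poly_Mapping.lookup b i" for i
   by (simp add: D_def cart_eq_iff)
  then show False using that poly_mapping_eqI by blast
 qed
 then have "0 ~: A" unfolding A_def by force
 obtain e :: "'v => nat" where e: "inj e" using ex_inj_nat by blast
 obtain R :: nat where R: "\<forall>et\<in>A. (\<Sum>i\<in>UNIV. et $ i * real R ^ e i) ~= 0" using ex_generic_power[OF Afin \<open>0 ~: A\<close> e] by blast
 obtain xi where xi: "xi \<in> L" "\<forall>i\<in>S. xi $ i = (\<chi> i. real R ^ e i) $ i" using free by blast
 have Dxi: "(\<Sum>i\<in>UNIV. D a b $ i * xi $ i) ~= 0" if ab: "a \<in> K" "b \<in> K" "a ~= b" for a b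
 proof -
  have "D a b \<in> A" unfolding A_def using ab by blast
  moreover have "(\<Sum>i\<in>UNIV. D a b $ i * xi $ i) = (\<Sum>i\<in>UNIV. D a b $ i * real R ^ e i)"
  proof (rule sum.cong[OF refl])
   fix i
   show "D a b $ i * xi $ i = D a b $ i * real R ^ e i"
   proof (cases "i \<in> S")
    case True
    then show ?thesis using xi(2) by simp
   next
    case False
    then show ?thesis using p(2) ab unfolding D_def K_def by simp
   qed
  qed
  ultimately show ?thesis using R by simp
 qed
 have Tdiff: "T a (w0 + ta *\<^sub>R xi) - T b (w0 + ta *\<^sub>R xi) = (T a w0 - T b w0) + ta * (\<Sum>i\<in>UNIV. D a b $ i * xi $ i)" for a b ta
  unfolding T_def D_def by (simp add: algebra_simps sum.distrib sum_subtractf sum_distrib_left)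
 define bad where "bad = (\<lambda>(a, b). (T b w0 - T a w0) / (\<Sum>i\<in>UNIV. D a b $ i * xi $ i)) ` (K \<times> K)"
 have "finite bad" unfolding bad_def using K(1) by simp
 have rh: "0 < de / (1 + norm xi)" using de by (simp add: add_pos_nonneg)
 then have "infinite ({0<..<de / (1 + norm xi)} - bad)" using \<open>finite bad\<close> infinite_Ioo by (intro Diff_infinite_finite) auto
 then obtain ta where ta: "ta \<in> {0<..<de / (1 + norm xi)}" "ta ~: bad" using infinite_imp_nonempty by blast
 have "ta * (1 + norm xi) < de" using ta(1) by (simp add: pos_less_divide_eq add_pos_nonneg)
 then have "norm (ta *\<^sub>R xi) < de" using ta(1) by (simp add: algebra_simps)
 then have w1: "w0 + ta *\<^sub>R xi \<in> closure trop_points" by (intro dense subspace_scale[OF L xi(1)])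
 \<comment> \<open>Distinctness of the valuations of all terms is an open condition, so it passes
   from a point of the closure to the valuations of an actual point of the cone.\<close>
 define U where "U = (\<Inter>(a, b)\<in>{(a, b). a \<in> K \<and> b \<in> K \<and> a ~= b}. {w. T a w ~= T b w})"
 have "finite {(a, b). a \<in> K \<and> b \<in> K \<and> a ~= b}" by (rule finite_subset[of _ "K \<times> K"]) (use K(1) in auto)
 moreover have "open {w. T a w ~= T b w}" for a b unfolding T_def by (intro open_Collect_neq continuous_intros)
 ultimately have "open U" unfolding U_def by (intro open_INT) auto
 have "w0 + ta *\<^sub>R xi \<in> U"
 proof -
  have "T a (w0 + ta *\<^sub>R xi) ~= T b (w0 + ta *\<^sub>R xi)" if ab: "a \<in> K" "b \<in> K" "a ~= b" for a b
  proof
   assume "T a (w0 + ta *\<^sub>R xi) = T b (w0 + ta *\<^sub>R xi)"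
   then have "ta = (T b w0 - T a w0) / (\<Sum>i\<in>UNIV. D a b $ i * xi $ i)"
    using Tdiff[of a ta b] Dxi[OF ab] by (simp add: field_simps)
   then show False using ta(2) ab unfolding bad_def by auto
  qed
  then show ?thesis unfolding U_def by auto
 qed
 then have "U \<inter> trop_points ~= {}" using w1 open_Int_closure_eq_empty[OF \<open>open U\<close>, of trop_points] by blast
 then obtain y where y: "y \<in> zeros I" "!!i. y $ i ~= 0" "trop y \<in> U" unfolding trop_points_def by blast
 have nt: "nrm (Poly_Mapping.lookup p a * mon a y) = exp (- T a (trop y))" if a: "a \<in> K" for a
 proof -
  have "Poly_Mapping.lookup p a ~= 0" using a unfolding K_def by (simp add: in_keys_iff)
  then have "nrm (Poly_Mapping.lookup p a) > 0" by simp
  moreover have "c * exp (- u) = exp (- (- ln c + u))" if "c > 0" for c u :: real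
   using that by (simp add: exp_diff exp_minus divide_inverse)
  ultimately show ?thesis unfolding nrm_mult nrm_mon[OF y(2)] T_def by blast
 qed
 have "(\<Sum>a\<in>K. Poly_Mapping.lookup p a * mon a y) ~= 0"
 proof (rule sum_distinct_nonzero[OF K])
  fix a assume "a \<in> K"
  from nt[OF this] show "Poly_Mapping.lookup p a * mon a y ~= 0" by (metis exp_not_eq_zero nrm_0)
  fix b assume "b \<in> K" "nrm (Poly_Mapping.lookup p a * mon a y) = nrm (Poly_Mapping.lookup p b * mon b y)"
  then have "T a (trop y) = T b (trop y)" using nt \<open>a \<in> K\<close> by simp
  then show "a = b" using y(3) \<open>a \<in> K\<close> \<open>b \<in> K\<close> unfolding U_def by auto
 qed
 then have "f y ~= 0" unfolding p(1) mv_eval_mon K_def .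
 then show False using zerosD[OF y(1)] f by blast
qed

end

context na_cone
begin

lemma trop_local_dim:
 assumes L: "subspace L" and de: "de > 0" and w0: "w0 \<in> trop_points"
  and near: "!!p. p \<in> trop_points ==> norm (p - w0) < de ==> p - w0 \<in> L"
  and dense: "!!l. l \<in> L ==> norm l < de ==> w0 + l \<in> closure trop_points"
  and B: "tr_basis I B"
 shows "vec.dim L = card B"
proof -
 obtain S where S: "card S = vec.dim L" "!!v. v \<in> L ==> \<forall>j\<in>S. v $ j = 0 ==> v = 0"
  "!!t. \<exists>v\<in>L. \<forall>j\<in>S. v $ j = t $ j"
  by (rule ex_coords[OF vec_subspace_real[OF L]]) (rule that)
 have "alg_indep I S" by (rule trop_free_indep[OF L de dense S(3)])
 from extend_tr_basis[OF this] obtain B' where B': "S \<subseteq> B'" "tr_basis I B'" by (elim exE conjE) (rule that)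
 obtain x0 where x0: "x0 \<in> zeros I" "!!i. x0 $ i ~= 0" "w0 = trop x0" using w0 unfolding trop_points_def by blast
 define n where "n = real CARD('v)"
 \<comment> \<open>With \<open>n + 1\<close> in the denominator, the sum of \<open>n\<close>
   coordinatewise deviations of logarithms stays below \<open>de\<close>.\<close>
 define ep where "ep = exp (de / (n + 1))"
 have n: "n >= 0" unfolding n_def by simp
 have ep: "ep > 1" unfolding ep_def using de n by simp
 have "S = B'"
 proof (rule ccontr)
  assume "S ~= B'"
  then obtain k where k: "k \<in> B'" "k ~: S" using B'(1) by blast
  show False
  proof (rule no_isolated_valuation[OF x0(1,2) B'(2,1) k ep])
   fix y i assume y: "y \<in> zeros I" "!!i. y $ i ~= 0" "!!i. nrm (y $ i / x0 $ i) < ep" "!!i. nrm (x0 $ i / y $ i) < ep"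
    "!!i. i \<in> S ==> nrm (y $ i) = nrm (x0 $ i)"
   have comp: "\<bar>(trop y - w0) $ i\<bar> <= de / (n + 1)" for i
   proof -
    have "ln (nrm (y $ i / x0 $ i)) < ln ep" "ln (nrm (x0 $ i / y $ i)) < ln ep"
     using y(2-4) x0(2) ep by (auto simp: ln_less_cancel_iff)
    then have "ln (nrm (y $ i)) - ln (nrm (x0 $ i)) < de / (n + 1)" "ln (nrm (x0 $ i)) - ln (nrm (y $ i)) < de / (n + 1)"
     using y(2) x0(2) by (simp_all add: nrm_divide ln_div ep_def)
    then show ?thesis unfolding x0(3) by simp
   qed
   have "norm (trop y - w0) <= (\<Sum>i\<in>UNIV. \<bar>(trop y - w0) $ i\<bar>)" by (rule norm_le_l1_cart)
   also have "\<dots> <= (\<Sum>i\<in>(UNIV :: 'v set). de / (n + 1))" by (intro sum_mono comp)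
   also have "\<dots> = n * (de / (n + 1))" by (simp add: n_def)
   also have "\<dots> < de" using de n by (simp add: field_simps)
   finally have nl: "norm (trop y - w0) < de" .
   have "trop y \<in> trop_points" unfolding trop_points_def using y(1,2) by blast
   from near[OF this nl] have "trop y - w0 \<in> L" .
   moreover have "\<forall>j\<in>S. (trop y - w0) $ j = 0" using y(5) unfolding x0(3) by simp
   ultimately have "trop y - w0 = 0" by (rule S(2))
   then have "(trop y - w0) $ i = 0" by simp
   then have "ln (nrm (y $ i)) = ln (nrm (x0 $ i))" unfolding x0(3) by simp
   then show "nrm (y $ i) = nrm (x0 $ i)" using y(2) x0(2) by (simp add: ln_inj_iff)
  qed
 qed
 then show ?thesis using S(1) tr_basis_card[OF B B'(2)] by simp
qed

text \<open>Scaling a point of the cone shifts its valuations by the valuation of the scalar. The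
  value group is only dense, so arbitrary real shifts are available in the closure.\<close>

lemma trop_points_shift:
 assumes p: "p \<in> closure trop_points"
 shows "p + c *\<^sub>R 1 \<in> closure trop_points"
 unfolding closure_approachable
proof (intro allI impI)
 fix e :: real assume e: "e > 0"
 obtain q where q: "q \<in> trop_points" "dist q p < e / 2" using p e unfolding closure_approachable by (meson half_gt_zero)
 obtain x where x: "x \<in> zeros I" "\<forall>i. x $ i ~= 0" "q = trop x" using q(1) unfolding trop_points_def by blast
 define et where "et = e / (2 * (norm (1 :: real ^ 'v) + 1))"
 have et: "et > 0" unfolding et_def using e by (simp add: add_nonneg_pos)
 obtain s where s: "exp (- c - et) < nrm s" "nrm s < exp (- c + et)" using nrm_dense[of "exp (- c - et)" "exp (- c + et)"] et by auto
 have s0: "s ~= 0" using s(1) exp_gt_zero[of "- c - et"] by (auto simp del: exp_gt_zero)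
 have "ln (exp (- c - et)) < ln (nrm s)" "ln (nrm s) < ln (exp (- c + et))"
  using s s0 by (subst ln_less_cancel_iff; simp)+
 then have ls: "\<bar>- ln (nrm s) - c\<bar> < et" by simp
 have eq: "trop (s *s x) = q + (- ln (nrm s)) *\<^sub>R 1"
  unfolding x(3) using x(2) s0 by (simp add: cart_eq_iff nrm_mult ln_mult)
 have mem: "trop (s *s x) \<in> trop_points"
  unfolding trop_points_def using zeros_scale[OF x(1), of s] x(2) s0 by (intro CollectI exI[of _ "s *s x"]) simp
 have "trop (s *s x) - (p + c *\<^sub>R 1) = (q - p) + (- ln (nrm s) - c) *\<^sub>R 1"
  unfolding eq by (simp add: algebra_simps)
 then have "dist (trop (s *s x)) (p + c *\<^sub>R 1) <= norm (q - p) + \<bar>- ln (nrm s) - c\<bar> * norm (1 :: real ^ 'v)"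
  unfolding dist_norm by (metis norm_triangle_ineq norm_scaleR)
 also have "\<dots> <= norm (q - p) + et * (norm (1 :: real ^ 'v) + 1)"
  using ls by (intro add_left_mono mult_mono) auto
 also have "et * (norm (1 :: real ^ 'v) + 1) = e / 2" unfolding et_def
  using norm_ge_zero[of "1 :: real ^ 'v"] by (simp add: field_simps add_nonneg_eq_0_iff)
 also have "norm (q - p) + e / 2 < e" using q(2) by (simp add: dist_norm)
 finally show "\<exists>y\<in>trop_points. dist y (p + c *\<^sub>R 1) < e" using mem by blast
qed

text \<open>A cone satisfying a relation between two coordinates allows only finitely many ratios of
  these coordinates in the torus. By primality a single ratio occurs, and its valuation is the
  constant.\<close>

lemma dependent_pair:
 assumes x0: "x0 \<in> zeros I" "!!i. x0 $ i ~= 0" and dep: "\<not> alg_indep I {j, k}" and jk: "j ~= k"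
 shows "\<exists>c. \<forall>p\<in>trop_points. p $ j - p $ k = c"
proof -
 obtain f where f: "f \<in> pf {j, k}" "f \<in> I" "f ~= 0" using dep unfolding alg_indep_def by blast
 have "(\<lambda>x::'k^'v. x $ k) ~= 0"
 proof
  assume "(\<lambda>x::'k^'v. x $ k) = 0"
  from fun_cong[OF this, of 1] show False by simp
 qed
 from pf_domain[OF f(1) pf_coord[of k "{j, k}"] f(3) this] obtain u where u: "f u ~= 0" "u $ k ~= 0" by auto
 obtain q :: "'k poly" where q: "!!s. f (u + s *s axis j 1) = poly q s" using pf_line_poly[OF f(1)] by blast
 have "poly q 0 = f u" using q[of 0] by simp
 then have q0: "q ~= 0" using u(1) by auto
 define R where "R = (\<lambda>s. (s + u $ j) / u $ k) ` {s. poly q s = 0}"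
 have R: "finite R" unfolding R_def using poly_roots_finite[OF q0] by simp
 have ratio: "y $ j / y $ k \<in> R" if y: "y \<in> zeros I" "y $ k ~= 0" for y
 proof -
  \<comment> \<open>The point is rescaled to have the same coordinate \<open>k\<close> as
    \<open>u\<close>; on the coordinates \<open>j\<close> and \<open>k\<close> it then lies on the
    line on which the relation is the nonzero polynomial \<open>q\<close>.\<close>
  define l where "l = u $ k / y $ k"
  define s where "s = l * y $ j - u $ j"
  have "f (u + s *s axis j 1) = f (l *s y)"
   by (rule pf_cong_coords[OF f(1)]) (use jk y(2) in \<open>auto simp: s_def l_def axis_def\<close>)
  also have "\<dots> = 0" by (rule zerosD[OF zeros_scale[OF y(1)] f(2)])
  finally have "poly q s = 0" unfolding q .
  moreover have "y $ j / y $ k = (s + u $ j) / u $ k" unfolding s_def l_def using u(2) y(2) by simp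
  ultimately show ?thesis unfolding R_def by blast
 qed
 define h where "h rh = (\<lambda>x::'k^'v. x $ j - rh * x $ k)" for rh
 have hpf: "h rh \<in> pf UNIV" for rh unfolding h_def by (intro pf_lambda pf_const pf_coord) simp_all
 have "(\<Prod>rh\<in>R. h rh) * (\<lambda>y. \<Prod>i\<in>UNIV. y $ i) \<in> I"
 proof (rule vanishing_in_ideal)
  show "(\<Prod>rh\<in>R. h rh) * (\<lambda>y. \<Prod>i\<in>UNIV. y $ i) \<in> pf UNIV" by (intro pf_mult pf_prod hpf coord_prod_pf)
  fix y assume y: "y \<in> zeros I"
  show "((\<Prod>rh\<in>R. h rh) * (\<lambda>y. \<Prod>i\<in>UNIV. y $ i)) y = 0"
  proof (cases "y $ k = 0")
   case True
   then have "(\<Prod>i\<in>UNIV. y $ i) = 0" by (intro prod_zero) auto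
   then show ?thesis by simp
  next
   case False
   have "h (y $ j / y $ k) y = 0" unfolding h_def using False by simp
   then have "(\<Prod>rh\<in>R. h rh y) = 0" using ratio[OF y False] R by (intro prod_zero) auto
   then show ?thesis by simp
  qed
 qed
 moreover have "(\<Prod>rh\<in>R. h rh) \<in> pf UNIV" by (intro pf_prod hpf)
 ultimately have "(\<Prod>rh\<in>R. h rh) \<in> I" using ideal_prime[OF _ coord_prod_pf] coord_prod_notin[OF x0] by blast
 then obtain rh where rh: "h rh \<in> I" using ideal_prime_prod[of R h] hpf by blast
 have rel: "y $ j = rh * y $ k" if "y \<in> zeros I" for y using zerosD[OF that rh] by (simp add: h_def)
 have rh0: "rh ~= 0" using rel[OF x0(1)] x0(2)[of j] by auto
 have "p $ j - p $ k = - ln (nrm rh)" if p: "p \<in> trop_points" for p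
 proof -
  obtain y where y: "y \<in> zeros I" "\<forall>i. y $ i ~= 0" "p = trop y" using p unfolding trop_points_def by blast
  show ?thesis unfolding y(3) using rel[OF y(1)] y(2) rh0 by (simp add: nrm_mult ln_mult)
 qed
 then show ?thesis by blast
qed

end

section \<open>Cells of the tropicalization\<close>

lemma to_ttorus_eq_iff: "to_ttorus x = to_ttorus y \<longleftrightarrow> (\<exists>c. x - y = c *\<^sub>R 1)"
 by (simp add: ttorus.abs_eq_iff ttorus_rel_def)

lemma linear_to_ttorus: "linear to_ttorus"
 by (rule linearI) (simp_all add: plus_ttorus.abs_eq scaleR_ttorus.abs_eq)

lemma ex_to_ttorus: "\<exists>x. q = to_ttorus x"
 using Quotient3_abs_rep[OF Quotient3_ttorus, of q] by metis

lemma to_ttorus_0: "to_ttorus 0 = 0"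
 by (rule linear_0[OF linear_to_ttorus])

lemma to_ttorus_eq_0_iff: "to_ttorus x = 0 \<longleftrightarrow> (\<exists>c. x = c *\<^sub>R 1)"
 using to_ttorus_eq_iff[of x 0] unfolding to_ttorus_0 by simp

lemma coord_span_eq: "coord_span (- J) = to_ttorus ` {u. \<forall>j\<in>J. u $ j = 0}"
proof -
 have "span ((\<lambda>i. axis i 1) ` (- J)) = {u :: real ^ 'a. \<forall>j\<in>J. u $ j = 0}"
 proof (intro antisym span_minimal subsetI)
  show "subspace {u :: real ^ 'a. \<forall>j\<in>J. u $ j = 0}" by (auto simp: subspace_def)
  fix u :: "real ^ 'a" assume u: "u \<in> {u. \<forall>j\<in>J. u $ j = 0}"
  have "u = (\<Sum>i\<in>- J. (u $ i) *\<^sub>R axis i 1)"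
  proof -
   have "(\<Sum>i\<in>- J. (u $ i) *\<^sub>R axis i 1) $ k = (\<Sum>i\<in>- J. if i = k then u $ k else 0)" for k
    unfolding sum_component by (intro sum.cong refl) (auto simp: axis_def)
   then show ?thesis using u by (auto simp: cart_eq_iff)
  qed
  also have "\<dots> \<in> span ((\<lambda>i. axis i 1) ` (- J))" by (intro span_sum span_scale span_base) auto
  finally show "u \<in> span ((\<lambda>i. axis i 1) ` (- J))" .
 qed (auto simp: axis_def)
 then show ?thesis unfolding coord_span_def
  using linear_span_image[OF linear_to_ttorus, of "(\<lambda>i. axis i 1) ` (- J)"] by (simp add: image_image)
qed

text \<open>A common vector has a lift in \<open>L\<close> and a lift vanishing on \<open>J\<close>,
  which differ by a multiple of 1. As 1 lies in \<open>L\<close>, the second lift is in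
  \<open>L\<close> as well; conversely, a multiple of 1 vanishing on the nonempty set
  \<open>J\<close> is 0.\<close>

lemma coord_span_Int:
 assumes L: "subspace L" "1 \<in> L" and J: "J ~= {}"
 shows "to_ttorus ` L \<inter> coord_span (- J) ~= {0} \<longleftrightarrow> (\<exists>l\<in>L. l ~= 0 \<and> (\<forall>j\<in>J. l $ j = 0))"
proof
 have "0 = to_ttorus 0" using linear_0[OF linear_to_ttorus] by simp
 then have z: "0 \<in> to_ttorus ` L \<inter> coord_span (- J)" unfolding coord_span_eq using subspace_0[OF L(1)] by force
 assume "to_ttorus ` L \<inter> coord_span (- J) ~= {0}"
 then obtain q where q: "q \<in> to_ttorus ` L" "q \<in> coord_span (- J)" "q ~= 0" using z by blast
 obtain l where l: "l \<in> L" "q = to_ttorus l" using q(1) by blast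
 obtain u where u: "q = to_ttorus u" "\<forall>j\<in>J. u $ j = 0" using q(2) unfolding coord_span_eq by blast
 obtain c where c: "l - u = c *\<^sub>R 1" using l(2) u(1) to_ttorus_eq_iff by metis
 have "u = l - c *\<^sub>R 1" using c by (simp add: algebra_simps)
 then have "u \<in> L" using subspace_diff[OF L(1) l(1) subspace_scale[OF L]] by simp
 moreover have "u ~= 0" using u(1) q(3) linear_0[OF linear_to_ttorus] by auto
 ultimately show "\<exists>l\<in>L. l ~= 0 \<and> (\<forall>j\<in>J. l $ j = 0)" using u(2) by blast
next
 assume "\<exists>l\<in>L. l ~= 0 \<and> (\<forall>j\<in>J. l $ j = 0)"
 then obtain l where l: "l \<in> L" "l ~= 0" "\<forall>j\<in>J. l $ j = 0" by blast
 have "to_ttorus l ~= 0"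
 proof
  assume "to_ttorus l = 0"
  then obtain c where c: "l = c *\<^sub>R 1" using to_ttorus_eq_0_iff by blast
  obtain j where "j \<in> J" using J by blast
  then have "(c *\<^sub>R (1 :: real ^ 'a)) $ j = 0" using l(3) unfolding c by blast
  then have "c = 0" by simp
  then show False using c l(2) by simp
 qed
 moreover have "to_ttorus l \<in> to_ttorus ` L \<inter> coord_span (- J)" unfolding coord_span_eq using l by blast
 ultimately show "to_ttorus ` L \<inter> coord_span (- J) ~= {0}" by blast
qed

text \<open>The inequalities are pulled back to \<open>real ^ 'n\<close>, where a norm is at hand;
  forms that come from the quotient vanish at 1.\<close>

lemma polyhedron_inequalities:
 fixes E :: "'n::finite ttorus set"
 assumes "is_polyhedron E"
 obtains H f b where "finite (H :: 'n ttorus set set)" "!!h. h \<in> H ==> linear (f h :: real ^ 'n => real)"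
  "!!h. h \<in> H ==> f h 1 = 0" "!!x. to_ttorus x \<in> E \<longleftrightarrow> (\<forall>h\<in>H. f h x <= b h)"
proof -
 obtain H where H: "finite H" "E = \<Inter>H" "\<forall>h\<in>H. \<exists>(l :: 'n ttorus => real) b. linear l \<and> h = {x. l x <= b}"
  using assms unfolding is_polyhedron_def by blast
 from bchoice[OF H(3)] obtain l where "\<forall>h\<in>H. \<exists>b. linear (l h :: 'n ttorus => real) \<and> h = {x. l h x <= b}" by blast
 from bchoice[OF this] obtain b where lb: "\<forall>h\<in>H. linear (l h) \<and> h = {x. l h x <= b h}" by blast
 have one: "to_ttorus 1 = 0" unfolding to_ttorus_eq_0_iff by (intro exI[of _ 1]) simp
 show ?thesis
 proof (rule that[of H "\<lambda>h x. l h (to_ttorus x)" b])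
  show "finite H" by (rule H(1))
  fix h assume h: "h \<in> H"
  then show "linear (\<lambda>x. l h (to_ttorus x))"
   using linear_compose[OF linear_to_ttorus, of "l h"] lb by (simp add: o_def)
  show "l h (to_ttorus 1) = 0" using h lb one linear_0 by metis
 next
  fix x
  show "to_ttorus x \<in> E \<longleftrightarrow> (\<forall>h\<in>H. l h (to_ttorus x) <= b h)" unfolding H(2) Inter_iff using lb by blast
 qed
qed

lemma closed_halfspace_linear:
 fixes f :: "real ^ 'n::finite => real"
 assumes "linear f"
 shows "closed {x. f x <= b}"
 using assms by (intro closed_Collect_le linear_continuous_on continuous_on_const) (simp add: linear_conv_bounded_linear)

lemma open_halfspace_linear:
 fixes f :: "real ^ 'n::finite => real"
 assumes "linear f"
 shows "open {x. f x < b}"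
 using assms by (intro open_Collect_less linear_continuous_on continuous_on_const) (simp add: linear_conv_bounded_linear)

lemma closed_cell:
 fixes E :: "'n::finite ttorus set"
 assumes "is_polyhedron E"
 shows "closed (to_ttorus -` E)"
proof -
 obtain H f b where H: "finite (H :: 'n ttorus set set)" "!!h. h \<in> H ==> linear (f h :: real ^ 'n => real)"
  "!!h. h \<in> H ==> f h 1 = 0" "!!x. to_ttorus x \<in> E \<longleftrightarrow> (\<forall>h\<in>H. f h x <= b h)"
  by (rule polyhedron_inequalities[OF assms]) (rule that)
 have "to_ttorus -` E = (\<Inter>h\<in>H. {x. f h x <= b h})" using H(4) by auto
 also have "closed \<dots>" by (intro closed_INT ballI closed_halfspace_linear H(2))
 finally show ?thesis .
qed

text \<open>The point \<open>w\<close> lies in the relative interior of \<open>E\<close>, hence in no other cell.\<close>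

lemma maximal_cell_structure:
 fixes C :: "'n::finite ttorus set set"
 assumes C: "polyhedral_complex C" and E: "E \<in> maximal_cells C" "E ~= {}"
 obtains L w de where "subspace L" "1 \<in> L" "de > 0" "to_ttorus w \<in> E" "diff_span E = to_ttorus ` L"
  "!!l. l \<in> L ==> norm l < de ==> to_ttorus (w + l) \<in> E"
  "!!p. to_ttorus p \<in> \<Union>C ==> norm (p - w) < de ==> to_ttorus p \<in> E"
  "!!p. to_ttorus p \<in> E ==> p - w \<in> L"
proof -
 have EC: "E \<in> C" and max: "!!F. F \<in> C ==> E \<subseteq> F ==> F = E" using E(1) unfolding maximal_cells_def by auto
 have fin: "finite C" and poly: "!!F. F \<in> C ==> is_polyhedron F"
  and face: "!!F. F \<in> C ==> (E \<inter> F) face_of E" using C EC unfolding polyhedral_complex_def by auto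
 obtain H f b where H: "finite (H :: 'n ttorus set set)" "!!h. h \<in> H ==> linear (f h :: real ^ 'n => real)"
  "!!h. h \<in> H ==> f h 1 = 0" "!!x. to_ttorus x \<in> E \<longleftrightarrow> (\<forall>h\<in>H. f h x <= b h)"
  by (rule polyhedron_inequalities[OF poly[OF EC]]) (rule that)
 \<comment> \<open>The inequalities that are equalities on all of \<open>E\<close>. The remaining
   ones become strict simultaneously at a suitable point, by repeated midpoints.\<close>
 define H0 where "H0 = {h \<in> H. \<forall>x. to_ttorus x \<in> E --> f h x = b h}"
 have "F \<subseteq> H - H0 --> (\<exists>w. to_ttorus w \<in> E \<and> (\<forall>h\<in>F. f h w < b h))" if "finite F" for F
  using that
 proof (induction F)
  case empty
  obtain q where "q \<in> E" using E(2) by blast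
  then show ?case using ex_to_ttorus[of q] by auto
 next
  case (insert h F)
  show ?case
  proof
   assume sub: "insert h F \<subseteq> H - H0"
   then obtain w where w: "to_ttorus w \<in> E" "\<forall>h\<in>F. f h w < b h" using insert.IH by blast
   obtain x where x: "to_ttorus x \<in> E" "f h x ~= b h" using sub unfolding H0_def by blast
   define y where "y = (1/2) *\<^sub>R (w + x)"
   have fy: "f g y = (f g w + f g x) / 2" if "g \<in> H" for g
    using H(2)[OF that] unfolding y_def by (simp add: linear_add linear_scale)
   have le: "f g w <= b g" "f g x <= b g" if "g \<in> H" for g using H(4) w(1) x(1) that by blast+
   have yE: "to_ttorus y \<in> E"
    unfolding H(4)
   proof
    fix g assume "g \<in> H"
    then show "f g y <= b g" using fy[of g] le[of g] by simp
   qed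
   have "f g y < b g" if "g \<in> insert h F" for g
   proof -
    have "g \<in> H" using that sub by blast
    moreover have "f g w < b g \<or> f g x < b g" using that w(2) x(2) le[OF \<open>g \<in> H\<close>] by force
    ultimately show ?thesis using fy[of g] le[of g] by auto
   qed
   then show "\<exists>w. to_ttorus w \<in> E \<and> (\<forall>h\<in>insert h F. f h w < b h)" using yE by blast
  qed
 qed
 from this[of "H - H0"] obtain w where w: "to_ttorus w \<in> E" "\<forall>h\<in>H - H0. f h w < b h" using H(1) by blast
 define L where "L = {v. \<forall>h\<in>H0. f h v = 0}"
 have H0: "!!h. h \<in> H0 ==> h \<in> H" "!!h x. h \<in> H0 ==> to_ttorus x \<in> E ==> f h x = b h" unfolding H0_def by auto
 have L: "subspace L" unfolding L_def subspace_def using H(2) H0(1) by (auto simp: linear_0 linear_add linear_scale)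
 have L1: "1 \<in> L" unfolding L_def using H(3) H0(1) by simp
 have EL: "p - w \<in> L" if "to_ttorus p \<in> E" for p
  unfolding L_def using H0(2)[OF _ that] H0(2)[OF _ w(1)] H(2)[OF H0(1)] by (auto simp: linear_diff)
 have "open (\<Inter>h\<in>H - H0. {x. f h x < b h})" using H(1,2) by (intro open_INT ballI open_halfspace_linear) auto
 moreover have "w \<in> (\<Inter>h\<in>H - H0. {x. f h x < b h})" using w(2) by blast
 ultimately have "\<exists>e>0. ball w e \<subseteq> (\<Inter>h\<in>H - H0. {x. f h x < b h})"
  by (rule open_contains_ball[THEN iffD1, THEN bspec])
 then obtain d1 where d1: "d1 > 0" "ball w d1 \<subseteq> (\<Inter>h\<in>H - H0. {x. f h x < b h})" by (elim exE conjE) (rule that)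
 have LE: "to_ttorus (w + l) \<in> E" if l: "l \<in> L" "norm l < d1" for l
  unfolding H(4)
 proof
  fix h assume h: "h \<in> H"
  show "f h (w + l) <= b h"
  proof (cases "h \<in> H0")
   case True
   then have "f h (w + l) = b h" using H0(2)[OF True w(1)] l(1) H(2)[OF h] unfolding L_def by (simp add: linear_add)
   then show ?thesis by simp
  next
   case False
   have "w + l \<in> ball w d1" using l(2) by (simp add: dist_norm)
   then have "w + l \<in> {x. f h x < b h}" using d1(2) h False by blast
   then show ?thesis by simp
  qed
 qed
 \<comment> \<open>A segment of \<open>E\<close> starting at any \<open>x\<close> can be prolonged
   beyond \<open>w\<close> inside \<open>E\<close>. If \<open>w\<close> were in \<open>F\<close>,
   the face \<open>E \<inter> F\<close> of \<open>E\<close> would contain \<open>x\<close>, so that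
   \<open>E\<close> would be contained in \<open>F\<close>.\<close>
 have other: "to_ttorus w ~: F" if F: "F \<in> C" "F ~= E" for F
 proof
  assume wF: "to_ttorus w \<in> F"
  have "E \<subseteq> F"
  proof
   fix q assume q: "q \<in> E"
   obtain x where x: "q = to_ttorus x" using ex_to_ttorus by blast
   define ta where "ta = d1 / (2 * (norm (w - x) + 1))"
   have ta: "ta > 0" unfolding ta_def using d1(1) by (simp add: add_nonneg_pos)
   define z where "z = w + ta *\<^sub>R (w - x)"
   have "w - x \<in> L" using subspace_neg[OF L EL[of x]] q x by simp
   moreover have "norm (ta *\<^sub>R (w - x)) < d1"
   proof -
    have "norm (ta *\<^sub>R (w - x)) = ta * norm (w - x)" using ta by simp
    also have "\<dots> <= ta * (norm (w - x) + 1)" using ta by (intro mult_left_mono) auto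
    also have "\<dots> = d1 / 2" unfolding ta_def using norm_ge_zero[of "w - x"] by (simp add: field_simps add_nonneg_eq_0_iff)
    also have "\<dots> < d1" using d1(1) by simp
    finally show ?thesis .
   qed
   ultimately have zE: "to_ttorus z \<in> E" unfolding z_def by (intro LE subspace_scale[OF L])
   define u where "u = 1 / (1 + ta)"
   have u: "0 < u" "u < 1" unfolding u_def using ta by auto
   have weq: "w = (1 - u) *\<^sub>R x + u *\<^sub>R z"
   proof -
    have "(1 + ta) *\<^sub>R w = ta *\<^sub>R x + z" unfolding z_def by (simp add: algebra_simps)
    then have "u *\<^sub>R ((1 + ta) *\<^sub>R w) = u *\<^sub>R (ta *\<^sub>R x + z)" by simp
    moreover have "u * (1 + ta) = 1" "u * ta = 1 - u" unfolding u_def using ta by (auto simp: field_simps)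
    ultimately show ?thesis by (simp add: scaleR_add_right)
   qed
   have eq: "to_ttorus w = (1 - u) *\<^sub>R to_ttorus x + u *\<^sub>R to_ttorus z"
    unfolding arg_cong[OF weq, of to_ttorus]
    by (simp only: linear_add[OF linear_to_ttorus] linear_scale[OF linear_to_ttorus])
   \<comment> \<open>The definition of a face speaks about open segments, whose endpoints must be
     distinct in the quotient; if they coincide, \<open>x\<close> and \<open>w\<close> have the same
     image.\<close>
   show "q \<in> F"
   proof (cases "to_ttorus x = to_ttorus z")
    case True
    then have "to_ttorus w = to_ttorus x" using eq by (simp add: scaleR_add_left[symmetric])
    then show ?thesis using wF x by simp
   next
    case False
    then have seg: "to_ttorus w \<in> open_segment (to_ttorus x) (to_ttorus z)"
     unfolding in_segment using eq u by (intro conjI exI[of _ u]) simp_all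
    have "to_ttorus w \<in> E \<inter> F" using w(1) wF by simp
    from face_ofD[OF face[OF F(1)] seg q[unfolded x] zE this] show ?thesis using x by simp
   qed
  qed
  then show False using max[OF F(1)] F(2) by blast
 qed
 have "closed (\<Union>F\<in>C - {E}. to_ttorus -` F)"
 proof (intro closed_UN ballI closed_cell)
  show "finite (C - {E})" using fin by simp
  fix F assume "F \<in> C - {E}"
  then show "is_polyhedron F" using poly by simp
 qed
 then have "open (- (\<Union>F\<in>C - {E}. to_ttorus -` F))" by (simp add: open_closed)
 moreover have "w \<in> - (\<Union>F\<in>C - {E}. to_ttorus -` F)" using other by auto
 ultimately have "\<exists>e>0. ball w e \<subseteq> - (\<Union>F\<in>C - {E}. to_ttorus -` F)"
  by (rule open_contains_ball[THEN iffD1, THEN bspec])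
 then obtain d2 where d2: "d2 > 0" "ball w d2 \<subseteq> - (\<Union>F\<in>C - {E}. to_ttorus -` F)" by (elim exE conjE) (rule that)
 have near: "to_ttorus p \<in> E" if p: "to_ttorus p \<in> \<Union>C" "norm (p - w) < d2" for p
 proof -
  have "p \<in> ball w d2" using p(2) by (simp add: dist_norm norm_minus_commute)
  then have "p \<in> - (\<Union>F\<in>C - {E}. to_ttorus -` F)" using d2(2) by blast
  then show ?thesis using p(1) by blast
 qed
 have span: "diff_span E = to_ttorus ` L"
  unfolding diff_span_def
 proof (intro antisym span_minimal)
  show "subspace (to_ttorus ` L)" by (rule linear_subspace_image[OF linear_to_ttorus L])
  show "{x - y |x y. x \<in> E \<and> y \<in> E} \<subseteq> to_ttorus ` L"
  proof clarify
   fix q r assume q: "q \<in> E" "r \<in> E"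
   obtain x y where xy: "q = to_ttorus x" "r = to_ttorus y" using ex_to_ttorus by metis
   have "q - r = to_ttorus ((x - w) - (y - w))" unfolding xy by (simp add: linear_diff[OF linear_to_ttorus])
   then show "q - r \<in> to_ttorus ` L" using subspace_diff[OF L EL EL] q xy by blast
  qed
  show "to_ttorus ` L \<subseteq> span {x - y |x y. x \<in> E \<and> y \<in> E}"
  proof (rule image_subsetI)
   fix l assume l: "l \<in> L"
   define ta where "ta = d1 / (2 * (norm l + 1))"
   have ta: "ta > 0" unfolding ta_def using d1(1) by (simp add: add_nonneg_pos)
   have "norm (ta *\<^sub>R l) <= ta * (norm l + 1)" using ta by simp
   also have "\<dots> = d1 / 2" unfolding ta_def using norm_ge_zero[of l] by (simp add: field_simps add_nonneg_eq_0_iff)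
   also have "\<dots> < d1" using d1(1) by simp
   finally have "to_ttorus (w + ta *\<^sub>R l) \<in> E" by (intro LE subspace_scale[OF L l])
   then have "to_ttorus (w + ta *\<^sub>R l) - to_ttorus w \<in> span {x - y |x y. x \<in> E \<and> y \<in> E}"
    using w(1) by (intro span_base) blast
   then have "ta *\<^sub>R to_ttorus l \<in> span {x - y |x y. x \<in> E \<and> y \<in> E}"
    by (simp add: linear_add[OF linear_to_ttorus] linear_scale[OF linear_to_ttorus])
   then have "(1 / ta) *\<^sub>R (ta *\<^sub>R to_ttorus l) \<in> span {x - y |x y. x \<in> E \<and> y \<in> E}" by (rule span_scale)
   then show "to_ttorus l \<in> span {x - y |x y. x \<in> E \<and> y \<in> E}" using ta by simp
  qed
 qed
 show ?thesis
 proof (rule that[OF L L1 _ w(1) span])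
  show "min d1 d2 > 0" using d1(1) d2(1) by simp
  show "to_ttorus (w + l) \<in> E" if "l \<in> L" "norm l < min d1 d2" for l using that by (intro LE) simp_all
  show "to_ttorus p \<in> E" if "to_ttorus p \<in> \<Union>C" "norm (p - w) < min d1 d2" for p using that by (intro near) simp_all
  show "p - w \<in> L" if "to_ttorus p \<in> E" for p using that by (rule EL)
 qed
qed

lemma cell_below_maximal:
 assumes "finite C" "F \<in> C"
 shows "\<exists>E\<in>maximal_cells C. F \<subseteq> E"
proof -
 obtain E where "E \<in> C" "F \<subseteq> E" "!!G. G \<in> C ==> E \<subseteq> G ==> G = E"
  using finite_has_maximal2[OF assms] by blast
 then show ?thesis unfolding maximal_cells_def by blast
qed

context na_cone
begin

definition trop_variety :: "'v ttorus set" where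
 "trop_variety = closure (to_ttorus ` trop_points)"

text \<open>The closure upstairs is invariant under multiples of 1, hence the full preimage of its
  image, which is therefore closed in the quotient topology.\<close>

lemma trop_variety_preimage: "to_ttorus x \<in> trop_variety \<longleftrightarrow> x \<in> closure trop_points"
proof
 have sat: "to_ttorus -` (to_ttorus ` closure trop_points) = closure trop_points"
 proof (intro antisym subsetI)
  fix y assume "y \<in> to_ttorus -` (to_ttorus ` closure trop_points)"
  then obtain z where z: "z \<in> closure trop_points" "to_ttorus y = to_ttorus z" by auto
  obtain c where "y - z = c *\<^sub>R 1" using z(2) to_ttorus_eq_iff by blast
  then have "y = z + c *\<^sub>R 1" by (simp add: algebra_simps)
  then show "y \<in> closure trop_points" using trop_points_shift[OF z(1)] by simp
 qed blast
 have "to_ttorus -` (- (to_ttorus ` closure trop_points)) = - closure trop_points"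
  unfolding vimage_Compl sat ..
 then have "open (- (to_ttorus ` closure trop_points))"
  unfolding open_ttorus_def by (simp only: open_Compl closed_closure)
 then have "closed (to_ttorus ` closure trop_points)" by (simp only: closed_def)
 then have "trop_variety \<subseteq> to_ttorus ` closure trop_points" unfolding trop_variety_def
  by (intro closure_minimal image_mono closure_subset)
 then show "x \<in> closure trop_points" if "to_ttorus x \<in> trop_variety" using that sat by blast
 have "open (- trop_variety)" unfolding trop_variety_def by (rule open_Compl[OF closed_closure])
 then have "open (- (to_ttorus -` trop_variety))" unfolding open_ttorus_def vimage_Compl .
 then have cl: "closed (to_ttorus -` trop_variety)" by (simp add: closed_def)
 have "to_ttorus ` trop_points \<subseteq> trop_variety" unfolding trop_variety_def by (rule closure_subset)
 then have "trop_points \<subseteq> to_ttorus -` trop_variety" by blast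
 then have "closure trop_points \<subseteq> to_ttorus -` trop_variety" using cl by (rule closure_minimal)
 then show "to_ttorus x \<in> trop_variety" if "x \<in> closure trop_points" using that by blast
qed

text \<open>The centre \<open>w\<close> of the cell may be only a limit of valuations, whereas the
  local argument needs the valuations of an actual point. Such a point \<open>w0\<close> is found
  within half the radius, and the remaining half is kept around it.\<close>

lemma trop_cell:
 assumes C: "polyhedral_complex C" "\<Union>C = trop_variety" and E: "E \<in> maximal_cells C" "E ~= {}"
  and B: "tr_basis I B"
 obtains L w where "subspace L" "1 \<in> L" "diff_span E = to_ttorus ` L" "vec.dim L = card B"
  "\<forall>S. (\<forall>u. \<exists>l\<in>L. \<forall>i\<in>S. l $ i = u $ i) --> alg_indep I S"
  "!!p. to_ttorus p \<in> E ==> p - w \<in> L"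
proof -
 obtain L w de where L: "subspace L" "1 \<in> L" "de > 0" "to_ttorus w \<in> E" "diff_span E = to_ttorus ` L"
  "!!l. l \<in> L ==> norm l < de ==> to_ttorus (w + l) \<in> E"
  "!!p. to_ttorus p \<in> \<Union>C ==> norm (p - w) < de ==> to_ttorus p \<in> E"
  "!!p. to_ttorus p \<in> E ==> p - w \<in> L"
  by (rule maximal_cell_structure[OF C(1) E]) (rule that)
 have EC: "E \<subseteq> trop_variety" using E(1) C(2) unfolding maximal_cells_def by blast
 have cl: "x \<in> closure trop_points" if "to_ttorus x \<in> E" for x using that EC trop_variety_preimage by blast
 obtain w0 where w0: "w0 \<in> trop_points" "dist w0 w < de / 2"
  using cl[OF L(4)] L(3) unfolding closure_approachable by (meson half_gt_zero)
 have tp: "to_ttorus p \<in> \<Union>C" if "p \<in> trop_points" for p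
  unfolding C(2) trop_variety_preimage using that closure_subset by blast
 have d: "norm (w0 - w) < de / 2" using w0(2) by (simp add: dist_norm)
 have "to_ttorus w0 \<in> E" using L(7)[OF tp[OF w0(1)]] d L(3) by simp
 then have w0L: "w0 - w \<in> L" by (rule L(8))
 have near: "p - w0 \<in> L" if p: "p \<in> trop_points" "norm (p - w0) < de / 2" for p
 proof -
  have "norm (p - w) <= norm (p - w0) + norm (w0 - w)" using norm_triangle_ineq[of "p - w0" "w0 - w"] by simp
  then have "norm (p - w) < de" using p(2) d by linarith
  then have "p - w \<in> L" using L(7)[OF tp[OF p(1)]] L(8) by blast
  then have "(p - w) - (w0 - w) \<in> L" by (rule subspace_diff[OF L(1) _ w0L])
  then show ?thesis by simp
 qed
 have dense: "w0 + l \<in> closure trop_points" if l: "l \<in> L" "norm l < de / 2" for l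
 proof -
  have "norm ((w0 - w) + l) < de" using norm_triangle_ineq[of "w0 - w" l] d l(2) by linarith
  then have "to_ttorus (w + ((w0 - w) + l)) \<in> E" by (intro L(6) subspace_add[OF L(1)] w0L l(1))
  then show ?thesis using cl by simp
 qed
 have de: "de / 2 > 0" using L(3) by simp
 show ?thesis
 proof (rule that[OF L(1,2,5)])
  show "vec.dim L = card B" by (rule trop_local_dim[OF L(1) de w0(1) near dense B])
  show "\<forall>S. (\<forall>u. \<exists>l\<in>L. \<forall>i\<in>S. l $ i = u $ i) --> alg_indep I S"
  proof (intro allI impI)
   fix S assume "\<forall>u. \<exists>l\<in>L. \<forall>i\<in>S. l $ i = u $ i"
   then show "alg_indep I S" by (intro trop_free_indep[OF L(1) de dense]) simp_all
  qed
  show "p - w \<in> L" if "to_ttorus p \<in> E" for p by (rule L(8)[OF that])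
 qed
qed

text \<open>Basis coordinates of the form \<open>s ^ (n * T ^ e i)\<close> have valuations
  proportional to \<open>n\<close>. A generic \<open>T\<close> makes each linear form take the value
  \<open>n\<close> times a nonzero constant \<open>D a\<close>, so finitely many \<open>n\<close>
  are excluded.\<close>

lemma trop_points_generic:
 fixes et :: "'i => real ^ 'v" and c :: "'i => real"
 assumes J: "tr_basis I J" and x0: "x0 \<in> zeros I" "!!i. x0 $ i ~= 0"
  and A: "finite A" "!!a. a \<in> A ==> et a ~= 0" "!!a i. a \<in> A ==> i ~: J ==> et a $ i = 0"
 shows "\<exists>p\<in>trop_points. \<forall>a\<in>A. (\<Sum>i\<in>UNIV. p $ i * et a $ i) ~= c a"
proof -
 obtain e :: "'v => nat" where e: "inj e" using ex_inj_nat by blast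
 obtain T :: nat where T: "\<forall>te\<in>et ` A. (\<Sum>i\<in>UNIV. te $ i * real T ^ e i) ~= 0"
  using ex_generic_power[of "et ` A", OF finite_imageI[OF A(1)] _ e] A(2) by force
 obtain s where s: "s ~= 0" "nrm s ~= 1" using nrm_nontrivial by blast
 define si where "si = - ln (nrm s)"
 have si: "si ~= 0" unfolding si_def using s by (simp add: ln_eq_zero_iff)
 define D where "D a = si * (\<Sum>i\<in>UNIV. et a $ i * real T ^ e i)" for a
 have D: "D a ~= 0" if "a \<in> A" for a unfolding D_def using T si that by simp
 have "finite (real -` ((\<lambda>a. c a / D a) ` A))" by (rule finite_vimageI) (use A(1) in \<open>auto simp: inj_def\<close>)
 then obtain n where n: "n ~: real -` ((\<lambda>a. c a / D a) ` A)" using ex_new_if_finite[OF infinite_UNIV_nat] by blast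
 define t where "t = (\<chi> i. s ^ (n * T ^ e i))"
 have "t $ j ~= 0" for j unfolding t_def using s(1) by simp
 then obtain p where p: "p \<in> trop_points" "\<forall>j\<in>J. p $ j = - ln (nrm (t $ j))"
  using lift_valuations[OF J x0, of t] by blast
 have pj: "p $ j = real n * si * real T ^ e j" if "j \<in> J" for j
  using p(2) that s(1) unfolding t_def si_def by (simp add: nrm_power ln_realpow)
 have "(\<Sum>i\<in>UNIV. p $ i * et a $ i) ~= c a" if a: "a \<in> A" for a
 proof
  assume eq: "(\<Sum>i\<in>UNIV. p $ i * et a $ i) = c a"
  have "(\<Sum>i\<in>UNIV. p $ i * et a $ i) = (\<Sum>i\<in>UNIV. real n * (si * (et a $ i * real T ^ e i)))"
  proof (rule sum.cong[OF refl])
   fix i show "p $ i * et a $ i = real n * (si * (et a $ i * real T ^ e i))"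
    using pj[of i] A(3)[OF a, of i] by (cases "i \<in> J") (simp_all add: mult_ac)
  qed
  then have "c a = real n * D a" using eq unfolding D_def by (simp add: sum_distrib_left)
  then have "real n = c a / D a" using D[OF a] by simp
  then show False using n a by auto
 qed
 then show ?thesis using p(1) by blast
qed

lemma maximal_cells_nonempty:
 assumes "\<Union>C = trop_variety" "x0 \<in> zeros I" "!!i. x0 $ i ~= 0" "E \<in> maximal_cells C"
 shows "E ~= {}"
proof
 assume E: "E = {}"
 have "trop x0 \<in> trop_points" unfolding trop_points_def using assms(2,3) by blast
 then have "to_ttorus (trop x0) \<in> \<Union>C" unfolding assms(1) trop_variety_preimage using closure_subset by blast
 then obtain F where "F \<in> C" "F ~= {}" by blast
 then show False using assms(4) E unfolding maximal_cells_def by blast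
qed

theorem cells_criterion:
 assumes x0: "x0 \<in> zeros I" "!!i. x0 $ i ~= 0" and B: "tr_basis I B" and J: "card J = card B" "J ~= {}"
  and C: "polyhedral_complex C" "\<Union>C = trop_variety"
 shows "(\<forall>E\<in>maximal_cells C. diff_span E \<inter> coord_span (- J) ~= {0}) \<longleftrightarrow> \<not> alg_indep I J"
proof
 assume dep: "\<not> alg_indep I J"
 show "\<forall>E\<in>maximal_cells C. diff_span E \<inter> coord_span (- J) ~= {0}"
 proof
  fix E assume E: "E \<in> maximal_cells C"
  have E0: "E ~= {}" by (rule maximal_cells_nonempty[OF C(2) x0 E])
  obtain L w where L: "subspace L" "1 \<in> L" "diff_span E = to_ttorus ` L" "vec.dim L = card B"
   "\<forall>S. (\<forall>u. \<exists>l\<in>L. \<forall>i\<in>S. l $ i = u $ i) --> alg_indep I S"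
   "!!p. to_ttorus p \<in> E ==> p - w \<in> L"
   by (rule trop_cell[OF C E E0 B]) (rule that)
  have "\<exists>l\<in>L. l ~= 0 \<and> (\<forall>j\<in>J. l $ j = 0)"
  proof (rule ccontr)
   assume "\<not> ?thesis"
   then have inj: "v = 0" if "v \<in> L" "\<forall>j\<in>J. v $ j = 0" for v using that by blast
   have "\<exists>v\<in>L. \<forall>j\<in>J. v $ j = t $ j" for t
    by (rule coords_surj[OF vec_subspace_real[OF L(1)] inj]) (simp_all add: J(1) L(4))
   then show False using L(5) dep by blast
  qed
  then show "diff_span E \<inter> coord_span (- J) ~= {0}" unfolding L(3) coord_span_Int[OF L(1,2) J(2)] .
 qed
next
 assume all: "\<forall>E\<in>maximal_cells C. diff_span E \<inter> coord_span (- J) ~= {0}"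
 show "\<not> alg_indep I J"
 proof
  assume ind: "alg_indep I J"
  obtain B' where B': "J \<subseteq> B'" "tr_basis I B'" using extend_tr_basis[OF ind] by (elim exE conjE) (rule that)
  have "J = B'" using B'(1) J(1) tr_basis_card[OF B B'(2)] by (intro card_subset_eq) auto
  then have JB: "tr_basis I J" using B'(2) by simp
  have "\<forall>E\<in>maximal_cells C. \<exists>et c. et ~= 0 \<and> (\<forall>i. i ~: J --> et $ i = 0) \<and> (\<forall>p. to_ttorus p \<in> E --> (\<Sum>i\<in>UNIV. p $ i * et $ i) = c)"
  proof
   fix E assume E: "E \<in> maximal_cells C"
   have E0: "E ~= {}" by (rule maximal_cells_nonempty[OF C(2) x0 E])
   obtain L w where L: "subspace L" "1 \<in> L" "diff_span E = to_ttorus ` L" "vec.dim L = card B"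
    "\<forall>S. (\<forall>u. \<exists>l\<in>L. \<forall>i\<in>S. l $ i = u $ i) --> alg_indep I S"
    "!!p. to_ttorus p \<in> E ==> p - w \<in> L"
    by (rule trop_cell[OF C E E0 B]) (rule that)
   have L': "vec.subspace L" by (rule vec_subspace_real[OF L(1)])
   \<comment> \<open>All vectors that agree on \<open>J\<close> with an element of \<open>L\<close>.
     The other coordinates are unconstrained, so a functional vanishing on \<open>W\<close> involves
     only the coordinates in \<open>J\<close>; it is constant on the cell.\<close>
   define W where "W = {u. \<exists>l\<in>L. \<forall>j\<in>J. u $ j = l $ j}"
   have W: "vec.subspace W"
    unfolding vec.subspace_def W_def
   proof (intro conjI ballI allI CollectI)
    show "\<exists>l\<in>L. \<forall>j\<in>J. (0::real^'v) $ j = l $ j" using subspace_0[OF L(1)] by blast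
    fix x assume "x \<in> {u. \<exists>l\<in>L. \<forall>j\<in>J. u $ j = l $ j}"
    then obtain l where l: "l \<in> L" "\<forall>j\<in>J. x $ j = l $ j" by blast
    { fix y assume "y \<in> {u. \<exists>l\<in>L. \<forall>j\<in>J. u $ j = l $ j}"
     then obtain k where k: "k \<in> L" "\<forall>j\<in>J. y $ j = k $ j" by blast
     show "\<exists>l\<in>L. \<forall>j\<in>J. (x + y) $ j = l $ j"
      by (rule bexI[OF _ subspace_add[OF L(1) l(1) k(1)]]) (simp add: l(2) k(2)) }
    { fix c show "\<exists>l\<in>L. \<forall>j\<in>J. (c *s x) $ j = l $ j"
      by (rule bexI[OF _ subspace_scale[OF L(1) l(1), of c]]) (simp add: l(2)) }
   qed
   have "W ~= UNIV"
   proof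
    assume "W = UNIV"
    then have surj: "\<exists>v\<in>L. \<forall>j\<in>J. v $ j = t $ j" for t
    proof -
     have "t \<in> W" using \<open>W = UNIV\<close> by simp
     then obtain l where "l \<in> L" "\<forall>j\<in>J. t $ j = l $ j" unfolding W_def by blast
     then show ?thesis by (intro bexI[of _ l]) simp_all
    qed
    have "v = 0" if "v \<in> L" "\<forall>j\<in>J. v $ j = 0" for v
     by (rule coords_surj_inj[OF L' surj _ that]) (simp add: J(1) L(4))
    moreover have "\<exists>l\<in>L. l ~= 0 \<and> (\<forall>j\<in>J. l $ j = 0)"
     using all[THEN bspec, OF E] unfolding L(3) coord_span_Int[OF L(1,2) J(2)] .
    ultimately show False by blast
   qed
   from annihilator_nonzero[OF W this] obtain et where et: "et ~= 0" "\<forall>u\<in>W. (\<Sum>i\<in>UNIV. u $ i * et $ i) = 0"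
    by (elim exE conjE) (rule that)
   have "et $ i = 0" if i: "i ~: J" for i
   proof -
    have "axis i 1 \<in> W" unfolding W_def using i subspace_0[OF L(1)] by (auto simp: axis_def intro!: bexI[of _ 0])
    then have "(\<Sum>k\<in>UNIV. axis i 1 $ k * et $ k) = 0" using et(2) by blast
    then show ?thesis by (simp add: axis_def if_distrib[of "\<lambda>c. c * _"] cong: if_cong)
   qed
   moreover have "(\<Sum>i\<in>UNIV. p $ i * et $ i) = (\<Sum>i\<in>UNIV. w $ i * et $ i)" if p: "to_ttorus p \<in> E" for p
   proof -
    have "p - w \<in> W" unfolding W_def using L(6)[OF p] by blast
    then have "(\<Sum>i\<in>UNIV. (p - w) $ i * et $ i) = 0" using et(2) by blast
    then show ?thesis by (simp add: algebra_simps sum_subtractf)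
   qed
   ultimately show "\<exists>et c. et ~= 0 \<and> (\<forall>i. i ~: J --> et $ i = 0) \<and> (\<forall>p. to_ttorus p \<in> E --> (\<Sum>i\<in>UNIV. p $ i * et $ i) = c)"
    using et(1) by (intro exI[of _ et] exI[of _ "\<Sum>i\<in>UNIV. w $ i * et $ i"]) simp
  qed
  from bchoice[OF this] obtain et where "\<forall>E\<in>maximal_cells C. \<exists>c. et E ~= 0 \<and> (\<forall>i. i ~: J --> et E $ i = 0) \<and> (\<forall>p. to_ttorus p \<in> E --> (\<Sum>i\<in>UNIV. p $ i * et E $ i) = c)"
   by (elim exE)
  from bchoice[OF this] obtain c where et: "\<forall>E\<in>maximal_cells C. et E ~= 0 \<and> (\<forall>i. i ~: J --> et E $ i = 0) \<and> (\<forall>p. to_ttorus p \<in> E --> (\<Sum>i\<in>UNIV. p $ i * et E $ i) = c E)"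
   by (elim exE)
  have finC: "finite C" using C(1) unfolding polyhedral_complex_def by simp
  then have finM: "finite (maximal_cells C)" unfolding maximal_cells_def by simp
  \<comment> \<open>If \<open>J\<close> is a basis, valuations on it can be chosen off the finitely
    many hyperplanes containing the cells, although every tropical point lies in a maximal
    cell.\<close>
  have "\<exists>p\<in>trop_points. \<forall>E\<in>maximal_cells C. (\<Sum>i\<in>UNIV. p $ i * et E $ i) ~= c E"
   by (rule trop_points_generic[OF JB x0 finM]) (use et in blast)+
  then obtain p where p: "p \<in> trop_points" "!!E. E \<in> maximal_cells C ==> (\<Sum>i\<in>UNIV. p $ i * et E $ i) ~= c E" by blast
  have "to_ttorus p \<in> \<Union>C" unfolding C(2) trop_variety_preimage using p(1) closure_subset by blast
  then obtain F where F: "F \<in> C" "to_ttorus p \<in> F" by blast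
  obtain E where E: "E \<in> maximal_cells C" "F \<subseteq> E" using cell_below_maximal[OF finC F(1)] by blast
  then show False using et p(2)[OF E(1)] F(2) by blast
 qed
qed

end

section \<open>Comparison of the Gauss map and the tropicalization\<close>

context na_cone
begin

text \<open>With two coordinates in \<open>J\<close>, membership in \<open>coord_span (- J)\<close>
  is the equality of these coordinates. The span condition thus says that their difference is
  constant on the tropicalization, and no polyhedral structure is involved.\<close>

lemma curve_criterion:
 assumes x0: "x0 \<in> zeros I" "!!i. x0 $ i ~= 0" and B: "tr_basis I B" and J: "card J = card B" "card J = 2"
 shows "diff_span trop_variety \<subseteq> coord_span (- J) \<longleftrightarrow> \<not> alg_indep I J"
proof -
 obtain j k where jk: "J = {j, k}" "j ~= k" using J(2) by (auto simp: card_2_iff)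
 have mem: "to_ttorus u \<in> coord_span (- J) \<longleftrightarrow> u $ j = u $ k" for u
 proof
  assume "to_ttorus u \<in> coord_span (- J)"
  then obtain v where v: "to_ttorus u = to_ttorus v" "v $ j = 0" "v $ k = 0"
   unfolding coord_span_eq jk(1) by auto
  obtain c where c: "u - v = c *\<^sub>R 1" using v(1) to_ttorus_eq_iff by blast
  have "(u - v) $ j = c" "(u - v) $ k = c" unfolding c by simp_all
  then show "u $ j = u $ k" using v(2,3) by simp
 next
  assume eq: "u $ j = u $ k"
  have "to_ttorus u = to_ttorus (u - (u $ j) *\<^sub>R 1)"
   unfolding to_ttorus_eq_iff by (intro exI[of _ "u $ j"]) simp
  moreover have "u - (u $ j) *\<^sub>R 1 \<in> {u. \<forall>i\<in>J. u $ i = 0}" unfolding jk(1) using eq by simp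
  ultimately show "to_ttorus u \<in> coord_span (- J)" unfolding coord_span_eq by (rule image_eqI)
 qed
 have trop_in: "to_ttorus p \<in> trop_variety" if "p \<in> trop_points" for p
  unfolding trop_variety_preimage using that closure_subset by blast
 show ?thesis
 proof
  assume dep: "\<not> alg_indep I J"
  obtain c where c: "\<forall>p\<in>trop_points. p $ j - p $ k = c" using dependent_pair[OF x0 dep[unfolded jk(1)] jk(2)] by (elim exE)
  have "closed {p :: real ^ 'v. p $ j - p $ k = c}" by (intro closed_Collect_eq continuous_intros)
  then have "closure trop_points \<subseteq> {p. p $ j - p $ k = c}" using c by (intro closure_minimal) auto
  then have cl: "p $ j - p $ k = c" if "p \<in> closure trop_points" for p using that by blast
  show "diff_span trop_variety \<subseteq> coord_span (- J)"
   unfolding diff_span_def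
  proof (rule span_minimal)
   show "subspace (coord_span (- J))" unfolding coord_span_def by (rule subspace_span)
   show "{x - y |x y. x \<in> trop_variety \<and> y \<in> trop_variety} \<subseteq> coord_span (- J)"
   proof clarify
    fix q r assume qr: "q \<in> trop_variety" "r \<in> trop_variety"
    obtain x where x: "q = to_ttorus x" using ex_to_ttorus by blast
    obtain y where y: "r = to_ttorus y" using ex_to_ttorus by blast
    have "x $ j - x $ k = c" "y $ j - y $ k = c" using qr unfolding x y trop_variety_preimage by (simp_all add: cl)
    then have "(x - y) $ j = (x - y) $ k" by simp
    then have "to_ttorus (x - y) \<in> coord_span (- J)" unfolding mem .
    then show "q - r \<in> coord_span (- J)" unfolding x y by (simp only: linear_diff[OF linear_to_ttorus])
   qed
  qed
 next
  assume sub: "diff_span trop_variety \<subseteq> coord_span (- J)"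
  show "\<not> alg_indep I J"
  proof
   assume ind: "alg_indep I J"
   obtain B' where B': "J \<subseteq> B'" "tr_basis I B'" using extend_tr_basis[OF ind] by (elim exE conjE) (rule that)
   have "J = B'" using B'(1) J(1) tr_basis_card[OF B B'(2)] by (intro card_subset_eq) auto
   then have JB: "tr_basis I J" using B'(2) by simp
   obtain s where s: "s ~= 0" "nrm s ~= 1" using nrm_nontrivial by blast
   obtain p where p: "p \<in> trop_points" "\<forall>i\<in>J. p $ i = - ln (nrm ((1 :: 'k ^ 'v) $ i))"
    using lift_valuations[OF JB x0, of 1] by auto
   \<comment> \<open>Compared with the first lift, only the prescribed valuation of the coordinate
     \<open>j\<close> changes, which makes the difference of the two coordinates vary.\<close>
   have t: "(\<chi> i. if i = j then s else 1) $ i ~= (0 :: 'k)" for i using s(1) by simp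
   obtain q where q: "q \<in> trop_points" "\<forall>i\<in>J. q $ i = - ln (nrm ((\<chi> i. if i = j then s else 1) $ i))"
    using lift_valuations[OF JB x0 t] by (elim bexE) (rule that)
   have "to_ttorus q - to_ttorus p \<in> diff_span trop_variety"
    unfolding diff_span_def using trop_in[OF p(1)] trop_in[OF q(1)] by (intro span_base) blast
   then have "to_ttorus (q - p) \<in> coord_span (- J)" using sub by (auto simp: linear_diff[OF linear_to_ttorus])
   then have "(q - p) $ j = (q - p) $ k" unfolding mem .
   then have "ln (nrm s) = 0" using p(2) q(2) jk by simp
   then show False using s by (simp add: ln_eq_zero_iff)
  qed
 qed
qed

end

text \<open>The value at 0 is set separately because \<open>real_of_ereal\<close> sends the infinite
  valuation to 0, which would give norm 1.\<close>

definition val_norm :: "('k::field => ereal) => 'k => real" where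
 "val_norm val x = (if x = 0 then 0 else exp (- real_of_ereal (val x)))"

lemma na_abs_val_norm:
 fixes val :: "'k::{alg_closed_field, field_char_0} => ereal"
 assumes v: "nonarch_valuation val" and nt: "nontrivial_valuation val"
  and int: "!!z::int. z ~= 0 ==> val (of_int z) = 0"
 shows "na_abs (val_norm val)"
proof
 have fin: "\<exists>r. val x = ereal r" if "x ~= 0" for x
  using v that unfolding nonarch_valuation_def by (cases "val x") auto
 have mult: "val (x * y) = val x + val y" and add: "min (val x) (val y) <= val (x + y)" for x y
  using v unfolding nonarch_valuation_def by auto
 fix x y :: 'k
 show "val_norm val x >= 0" "val_norm val x = 0 \<longleftrightarrow> x = 0" by (simp_all add: val_norm_def)
 show "val_norm val (x * y) = val_norm val x * val_norm val y"
 proof (cases "x = 0 \<or> y = 0")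
  case False
  then obtain r s where "val x = ereal r" "val y = ereal s" using fin by meson
  then show ?thesis using False mult[of x y] by (simp add: val_norm_def exp_add[symmetric])
 qed (auto simp: val_norm_def)
 show "val_norm val (x + y) <= max (val_norm val x) (val_norm val y)"
 proof (cases "x = 0 \<or> y = 0 \<or> x + y = 0")
  case False
  then obtain r s t where "val x = ereal r" "val y = ereal s" "val (x + y) = ereal t" using fin by meson
  then show ?thesis using False add[of x y] by (auto simp: val_norm_def min_def max_def split: if_splits)
 qed (auto simp: val_norm_def le_max_iff_disj)
 show "val_norm val (of_int z) = 1" if "z ~= 0" for z using int[OF that] that by (simp add: val_norm_def)
 obtain u where u: "u ~= 0" "val u ~= 0" using nt unfolding nontrivial_valuation_def by blast
 obtain r where "val u = ereal r" using fin u(1) by blast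
 then show "\<exists>x. x ~= 0 \<and> val_norm val x ~= 1" using u by (intro exI[of _ u]) (simp add: val_norm_def zero_ereal_def)
qed

lemma dense_torus_iff:
 assumes "P \<in> proj_space" "x \<in> P" "x ~= 0"
 shows "P \<in> dense_torus \<longleftrightarrow> (\<forall>i. x $ i ~= 0)"
proof
 show "\<forall>i. x $ i ~= 0" if "P \<in> dense_torus" using that assms(2,3) unfolding dense_torus_def by blast
 assume x: "\<forall>i. x $ i ~= 0"
 have "y $ i ~= 0" if y: "y \<in> P" "y ~= 0" for y i
 proof -
  have "y \<in> vec.span {x}" using proj_space_eq_span[OF assms] y(1) by simp
  then obtain s where s: "y = s *s x" using span_single by blast
  then have "s ~= 0" using y(2) by auto
  then show ?thesis using s x by simp
 qed
 then show "P \<in> dense_torus" unfolding dense_torus_def using assms(1) by simp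
qed

theorem theorem2p7p1:
  fixes val :: "'k::{alg_closed_field, field_char_0} \<Rightarrow> ereal"
    and X :: "('k ^ 'n::{finite, linorder}) set set"
    and J :: "'n set"
    and m :: nat
  assumes "nonarch_valuation val"
    and "nontrivial_valuation val"
    and "\<And>z::int. z \<noteq> 0 \<Longrightarrow> val (of_int z) = 0"
    and "proj_variety X"
    and "proj_dim X = enat m"
    and "X \<inter> dense_torus \<noteq> {}"
    and "card J = m + 1"
  shows "(\<forall>C. polyhedral_complex C \<and> \<Union>C = Trop val X \<longrightarrow>
           (pluecker_vanishes_on (m + 1) J (gauss_image m X) \<longleftrightarrow>
             (\<forall>E\<in>maximal_cells C. diff_span E \<inter> coord_span (- J) \<noteq> {0})))
       \<and> (m = 1 \<longrightarrow>
           (pluecker_vanishes_on (m + 1) J (gauss_image m X) \<longleftrightarrow>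
             diff_span (Trop val X) \<subseteq> coord_span (- J)))"
proof -
 interpret na_abs "val_norm val" by (rule na_abs_val_norm) (rule assms)+
 interpret X: na_cone "cone_ideal X" "val_norm val" by (rule na_cone_variety[OF assms(4)])
 have sub: "X \<subseteq> proj_space" using assms(4) proj_closed_subset unfolding proj_variety_def by blast
 have zer: "zeros (cone_ideal X) = \<Union>X" by (rule zeros_variety[OF assms(4)])
 obtain B where B: "tr_basis (cone_ideal X) B" using X.ex_tr_basis by (elim exE)
 have cJ: "card J = card B" using proj_dim_eq[OF assms(4) B] assms(5,7) by (simp add: one_enat_def)
 have J0: "J ~= {}" using assms(7) by auto
 have point: "\<exists>x. x \<in> P \<and> x ~= 0" if P: "P \<in> X" for P
 proof -
  obtain x where "x ~= 0" "P = vec.span {x}" using subsetD[OF sub P] proj_space_iff by blast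
  then show ?thesis by (auto intro: vec.span_base)
 qed
 have torus: "P \<in> X \<inter> dense_torus \<and> x \<in> P - {0} \<longleftrightarrow> P \<in> X \<and> x \<in> P \<and> (\<forall>i. x $ i ~= 0)" for P x
 proof (cases "P \<in> X \<and> x \<in> P \<and> x ~= 0")
  case True
  then have "P \<in> proj_space" using subsetD[OF sub] by simp
  then show ?thesis using dense_torus_iff[of P x] True by simp
 next
  case False
  then show ?thesis by auto
 qed
 have trop: "(\<chi> i. real_of_ereal (val (x $ i))) = trop x" if "\<forall>i. x $ i ~= 0" for x :: "'k ^ 'n::{finite,linorder}"
  using that by (simp add: cart_eq_iff val_norm_def)
 have "{to_ttorus (\<chi> i. real_of_ereal (val (x $ i))) | x P. P \<in> X \<inter> dense_torus \<and> x \<in> P - {0}} =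
  to_ttorus ` X.trop_points"
  unfolding torus
 proof (intro antisym subsetI)
  fix q assume "q \<in> {to_ttorus (\<chi> i. real_of_ereal (val (x $ i))) | x P. P \<in> X \<and> x \<in> P \<and> (\<forall>i. x $ i ~= 0)}"
  then obtain x P where x: "q = to_ttorus (\<chi> i. real_of_ereal (val (x $ i)))" "P \<in> X" "x \<in> P" "\<forall>i. x $ i ~= 0"
   unfolding mem_Collect_eq by (elim exE conjE) (rule that)
  have "trop x \<in> X.trop_points" unfolding X.trop_points_def zer using x(2-4) by (intro CollectI exI[of _ x]) auto
  then show "q \<in> to_ttorus ` X.trop_points" unfolding x(1) trop[OF x(4)] by (rule imageI)
 next
  fix q assume "q \<in> to_ttorus ` X.trop_points"
  then obtain x where x: "q = to_ttorus (trop x)" "x \<in> \<Union>X" "\<forall>i. x $ i ~= 0"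
   unfolding X.trop_points_def zer by auto
  obtain P where P: "P \<in> X" "x \<in> P" using x(2) by (elim UnionE) (rule that)
  show "q \<in> {to_ttorus (\<chi> i. real_of_ereal (val (x $ i))) | x P. P \<in> X \<and> x \<in> P \<and> (\<forall>i. x $ i ~= 0)}"
   unfolding x(1) trop[OF x(3), symmetric] using P x(3) by (intro CollectI exI[of _ x] exI[of _ P] conjI refl)
 qed
 then have Trop: "Trop val X = X.trop_variety" unfolding Trop_def X.trop_variety_def by simp
 obtain P where P: "P \<in> X" "P \<in> dense_torus" using assms(6) by blast
 obtain x0 where "x0 \<in> P" "x0 ~= 0" using point[OF P(1)] by blast
 then have "\<forall>i. x0 $ i ~= 0" using P torus[of P x0] by simp
 then have x0: "x0 \<in> zeros (cone_ideal X)" "!!i. x0 $ i ~= 0" unfolding zer using P(1) \<open>x0 \<in> P\<close> by auto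
 have gauss: "pluecker_vanishes_on (m + 1) J (gauss_image m X) \<longleftrightarrow> \<not> alg_indep (cone_ideal X) J"
  by (rule gauss_vanishing[OF assms(4,5,7)])
 show ?thesis unfolding gauss Trop
 proof (intro conjI allI impI)
  fix C assume "polyhedral_complex C \<and> \<Union>C = X.trop_variety"
  then show "\<not> alg_indep (cone_ideal X) J \<longleftrightarrow> (\<forall>E\<in>maximal_cells C. diff_span E \<inter> coord_span (- J) ~= {0})"
   by (intro X.cells_criterion[OF x0 B cJ J0, symmetric]) simp_all
 next
  assume "m = 1"
  then have "card J = 2" using assms(7) by simp
  then show "\<not> alg_indep (cone_ideal X) J \<longleftrightarrow> diff_span X.trop_variety \<subseteq> coord_span (- J)"
   by (rule X.curve_criterion[OF x0 B cJ, symmetric])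
 qed
qed

end
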